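(* Let $\mathcal{S}$ be a straight-line program (SLP) of size $n$ representing a string $S$ of length $N$. Let $f$ denote the current position of the finger in $S$, and for a position $i$ let $D = |f - i|$. Using $O(n)$ space one can support either: (i) $\mathsf{setfinger}(f)$ in $O(\log N)$ time and $\mathsf{access}(i)$ in $O(\log D)$ time; or (ii) $\mathsf{setfinger}(f)$ in $O(\log N)$ time, and $\mathsf{movefinger}(i)$ and $\mathsf{access}(i)$ both in $O(\log D + \log\log N)$ time.
   Context: A straight-line program (SLP) is a context-free grammar in which every rule has exactly one variable on the left-hand side and on the right-hand side either exactly two variables or exactly one terminal symbol; it is acyclic and each variable derives exactly one string. Its size $n$ is the number of rules. The SLP is viewed as a DAG whose nodes are the rules, with ordered edges to the variables on the right-hand side; the string $S$ is the string derived by the root (start) variable. The operations are: $\mathsf{access}(i)$ returns the character $S[i]$; $\mathsf{setfinger}(f)$ places the finger at position $f$ of $S$ (its cost must not depend on the previous finger position); $\mathsf{movefinger}(f)$ moves the finger to position $f$ of $S$. Space is measured in machine words (word-RAM model). *)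

theory Defs
  imports Complex_Main
begin

section \<open>Straight-line programs\<close>

text \<open>Variables are named by natural numbers. A terminal symbol is a natural number as well, namely
  the machine word that encodes it.\<close>

datatype rhs = Bin nat nat | Ter nat

record slp =
  rules :: "(nat \<times> rhs) set"
  start :: nat

fun rhs_vars :: "rhs \<Rightarrow> nat set" where
  "rhs_vars (Bin B C) = {B, C}"
| "rhs_vars (Ter a) = {}"

definition slp_edges :: "slp \<Rightarrow> (nat \<times> nat) set" where
  "slp_edges G = {(A, B). \<exists>r. (A, r) \<in> rules G \<and> B \<in> rhs_vars r}"

definition slp_vars :: "slp \<Rightarrow> nat set" where
  "slp_vars G = insert (start G) (\<Union>(A, r) \<in> rules G. insert A (rhs_vars r))"

inductive derives :: "slp \<Rightarrow> nat \<Rightarrow> nat list \<Rightarrow> bool" for G where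
  derives_Ter: "(A, Ter a) \<in> rules G \<Longrightarrow> derives G A [a]"
| derives_Bin: "(A, Bin B C) \<in> rules G \<Longrightarrow> derives G B u \<Longrightarrow> derives G C v \<Longrightarrow> derives G A (u @ v)"

definition is_slp :: "slp \<Rightarrow> bool" where
  "is_slp G \<longleftrightarrow> finite (rules G) \<and> acyclic (slp_edges G) \<and>
     (\<forall>A \<in> slp_vars G. \<exists>!s. derives G A s)"

definition slp_size :: "slp \<Rightarrow> nat" where
  "slp_size G = card (rules G)"

definition represents :: "slp \<Rightarrow> nat list \<Rightarrow> bool" where
  "represents G S \<longleftrightarrow> is_slp G \<and> derives G (start G) S"


section \<open>The word RAM\<close>

text \<open>Words of \<open>w\<close> bits are the natural numbers below \<open>2 ^ w\<close>. The operands of a binary operation are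
  words; \<open>Div\<close> and \<open>Mod\<close> by zero follow the library convention.\<close>

datatype binop = Add | Sub | Mul | Div | Mod | And | Or | Xor | Shl | Shr | Less | Equal

fun binop_sem :: "nat \<Rightarrow> binop \<Rightarrow> nat \<Rightarrow> nat \<Rightarrow> nat" where
  "binop_sem w Add x y = (x + y) mod 2 ^ w"
| "binop_sem w Sub x y = (x + 2 ^ w - y) mod 2 ^ w"
| "binop_sem w Mul x y = (x * y) mod 2 ^ w"
| "binop_sem w Div x y = x div y"
| "binop_sem w Mod x y = x mod y"
| "binop_sem w And x y = semiring_bit_operations_class.and x y"
| "binop_sem w Or x y = semiring_bit_operations_class.or x y"
| "binop_sem w Xor x y = semiring_bit_operations_class.xor x y"
| "binop_sem w Shl x y = push_bit y x mod 2 ^ w"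
| "binop_sem w Shr x y = drop_bit y x"
| "binop_sem w Less x y = (if x < y then 1 else 0)"
| "binop_sem w Equal x y = (if x = y then 1 else 0)"

text \<open>A program mentions only finitely many registers, so the register file contributes \<open>O(1)\<close> words.
  The remaining storage is a memory whose cells are addressed by \<open>0, ..., length M - 1\<close>.\<close>

type_synonym ram_state = "(nat \<Rightarrow> nat) \<times> nat list"

datatype instr =
    Const nat nat             \<comment> \<open>register, constant\<close>
  | Binop binop nat nat nat   \<comment> \<open>operation, destination register, operand registers\<close>
  | Load nat nat              \<comment> \<open>destination register, register holding the address\<close>
  | Store nat nat             \<comment> \<open>register holding the address, source register\<close>
  | Jump_zero nat nat         \<comment> \<open>tested register, jump target\<close>

text \<open>Accessing a cell outside the memory yields \<open>None\<close>: the machine gets stuck. A halting run thus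
  stays within the given space.\<close>

fun exec_instr :: "nat \<Rightarrow> instr \<Rightarrow> nat \<times> ram_state \<Rightarrow> (nat \<times> ram_state) option" where
  "exec_instr w (Const r k) (pc, R, M) = Some (pc + 1, R(r := k mod 2 ^ w), M)"
| "exec_instr w (Binop b d x y) (pc, R, M) = Some (pc + 1, R(d := binop_sem w b (R x) (R y)), M)"
| "exec_instr w (Load d a) (pc, R, M) =
     (if R a < length M then Some (pc + 1, R(d := M ! R a), M) else None)"
| "exec_instr w (Store a s) (pc, R, M) =
     (if R a < length M then Some (pc + 1, R, M[R a := R s]) else None)"
| "exec_instr w (Jump_zero r l) (pc, R, M) = Some (if R r = 0 then l else pc + 1, R, M)"

text \<open>\<open>run w P c t s\<close>: from configuration \<open>c\<close> the program \<open>P\<close> halts in state \<open>s\<close> after exactly \<open>t\<close>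
  instructions. It halts when the program counter leaves the program.\<close>

inductive run :: "nat \<Rightarrow> instr list \<Rightarrow> nat \<times> ram_state \<Rightarrow> nat \<Rightarrow> ram_state \<Rightarrow> bool" for w P where
  run_halt: "length P \<le> pc \<Longrightarrow> run w P (pc, s) 0 s"
| run_step: "pc < length P \<Longrightarrow> exec_instr w (P ! pc) (pc, s) = Some c \<Longrightarrow> run w P c t s'
    \<Longrightarrow> run w P (pc, s) (Suc t) s'"

lemma run_deterministic:
  "run w P c t s \<Longrightarrow> run w P c t' s' \<Longrightarrow> t = t' \<and> s = s'"
proof (induction arbitrary: t' s' rule: run.induct)
  case (run_halt pc s)
  from run_halt.prems show ?case
    by (rule run.cases) (use run_halt.hyps in simp_all)
next
  case (run_step pc s c t s1)
  from run_step.prems obtain c2 t2 where "exec_instr w (P ! pc) (pc, s) = Some c2"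
      and "run w P c2 t2 s'" and t': "t' = Suc t2"
    by (rule run.cases) (use run_step.hyps(1) in simp_all)
  then have "run w P c t2 s'" using run_step.hyps(2) by simp
  then show ?case using run_step.IH t' by blast
qed

text \<open>The argument of a call is passed in register 0, where the result is expected as well. The other
  registers and the memory keep their contents from one call to the next.\<close>

definition call :: "nat \<Rightarrow> instr list \<Rightarrow> nat \<Rightarrow> ram_state \<Rightarrow> nat \<Rightarrow> ram_state \<Rightarrow> bool" where
  "call w P x s t s' \<longleftrightarrow> run w P (0, (fst s)(0 := x), snd s) t s'"

definition result :: "ram_state \<Rightarrow> nat" where
  "result s = fst s 0"


section \<open>Finger search data structures\<close>

datatype finger_op = Setfinger | Movefinger | Access

text \<open>Positions are counted from 0. The finger is \<open>None\<close> until it is first placed, which only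
  \<open>Setfinger\<close> can do.\<close>

fun enabled :: "finger_op \<Rightarrow> nat option \<Rightarrow> bool" where
  "enabled Setfinger p = True"
| "enabled Movefinger p = (p \<noteq> None)"
| "enabled Access p = (p \<noteq> None)"

fun new_finger :: "finger_op \<Rightarrow> nat \<Rightarrow> nat option \<Rightarrow> nat option" where
  "new_finger Setfinger i p = Some i"
| "new_finger Movefinger i p = Some i"
| "new_finger Access i p = p"

text \<open>The value for \<open>None\<close> is irrelevant: it only arises for \<open>Setfinger\<close>, whose time bounds do not
  depend on the distance.\<close>

fun finger_dist :: "nat option \<Rightarrow> nat \<Rightarrow> nat" where
  "finger_dist (Some f) i = nat \<bar>int f - int i\<bar>"
| "finger_dist None i = 0"

text \<open>The machine states, with the corresponding finger, that can arise from the initial memory \<open>M\<close> by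
  an arbitrary sequence of operations from \<open>Ops\<close> on a string of length \<open>N\<close>.\<close>

inductive reachable ::
  "nat \<Rightarrow> finger_op set \<Rightarrow> (finger_op \<Rightarrow> instr list) \<Rightarrow> nat \<Rightarrow> nat list \<Rightarrow> ram_state \<Rightarrow> nat option \<Rightarrow> bool"
  for w Ops P N M where
  reachable_init: "reachable w Ops P N M (\<lambda>_. 0, M) None"
| reachable_op: "reachable w Ops P N M s p \<Longrightarrow> op \<in> Ops \<Longrightarrow> enabled op p \<Longrightarrow> i < N
    \<Longrightarrow> call w (P op) i s t s' \<Longrightarrow> reachable w Ops P N M s' (new_finger op i p)"

definition supports ::
  "nat \<Rightarrow> finger_op set \<Rightarrow> (finger_op \<Rightarrow> instr list) \<Rightarrow> nat list \<Rightarrow> nat list \<Rightarrow>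
   (finger_op \<Rightarrow> nat \<Rightarrow> real) \<Rightarrow> bool" where
  "supports w Ops P S M T \<longleftrightarrow>
     (\<forall>s p op i. reachable w Ops P (length S) M s p \<and> op \<in> Ops \<and> enabled op p \<and> i < length S \<longrightarrow>
        (\<exists>t s'. call w (P op) i s t s' \<and> real t \<le> T op (finger_dist p i) \<and>
           (op = Access \<longrightarrow> result s' = S ! i)))"

text \<open>The programs and the constant \<open>c\<close> are fixed before the grammar, the string and the word length;
  only the initial memory depends on these. The word length is arbitrary as long as the length of the
  string and its characters fit into a word. \<open>T op N D\<close> is the time bound up to a constant factor.\<close>

definition linear_space_solution :: "finger_op set \<Rightarrow> (finger_op \<Rightarrow> nat \<Rightarrow> nat \<Rightarrow> real) \<Rightarrow> bool" where
  "linear_space_solution Ops T \<longleftrightarrow>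
     (\<exists>(P :: finger_op \<Rightarrow> instr list) (c :: nat). \<forall>G S w.
        represents G S \<and> length S < 2 ^ w \<and> (\<forall>a \<in> set S. a < 2 ^ w) \<longrightarrow>
        (\<exists>M. length M \<le> c * slp_size G \<and> (\<forall>x \<in> set M. x < 2 ^ w) \<and>
           supports w Ops P S M (\<lambda>op D. real c * T op (length S) D)))"

text \<open>Logarithms are shifted by 2 in the argument so that the bounds are at least a positive constant
  also for \<open>D \<le> 1\<close> and for very short strings.\<close>

definition lg :: "nat \<Rightarrow> real" where
  "lg x = log 2 (real x + 2)"

definition lglg :: "nat \<Rightarrow> real" where
  "lglg x = log 2 (lg x)"

fun static_time :: "finger_op \<Rightarrow> nat \<Rightarrow> nat \<Rightarrow> real" where
  "static_time Setfinger N D = lg N"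
| "static_time Access N D = lg D"
| "static_time Movefinger N D = 0"   \<comment> \<open>not an operation of this variant\<close>

fun dynamic_time :: "finger_op \<Rightarrow> nat \<Rightarrow> nat \<Rightarrow> real" where
  "dynamic_time Setfinger N D = lg N"
| "dynamic_time Movefinger N D = lg D + lglg N"
| "dynamic_time Access N D = lg D + lglg N"

end

theory Submission imports Defs "HOL-Library.Discrete_Functions" begin

text \<open>The grammar is first balanced: its parse DAG is rebuilt into a binary tree with \<open>O(n)\<close> distinct
  subtrees in which every subtree of size \<open>m\<close> has depth \<open>O(log m)\<close>. Only the distinct subtrees are stored.
  (If \<open>N = O(n)\<close>, the string itself is stored; otherwise addresses fit into words of \<open>log N\<close> bits.)

  Static variant. \<open>setfinger\<close> cuts the text on either side of \<open>f\<close> into \<open>O(log N)\<close> subtrees such that a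
  subtree at distance \<open>\<delta>\<close> from the finger has depth \<open>O(log \<delta>)\<close>; a subtree that is too deep for its distance
  is split into its children. \<open>access\<close> finds the right subtree by binary search in the first \<open>D + 1\<close>
  entries and descends in it.

  Dynamic variant. The finger is kept as the path from the root to its leaf, in which stretches of
  precomputed paths are single entries. For either direction the tree is covered by paths which continue
  in the far child of a node if the near child is smaller than the square root of the far child, and in
  the near child otherwise. Let \<open>\<theta> = max D (log N)\<close>. Suppose position \<open>i\<close> is at distance at most \<open>\<theta>\<close> from
  the near end of a node. If the search path of \<open>i\<close> leaves the precomputed path towards a subtree larger
  than \<open>\<theta>\<^sup>2\<close>, then it does so at the first node whose near child is larger than \<open>\<theta>\<close>, and the size drops to
  its square root; so this happens \<open>O(log log N)\<close> times. Such a node is found by pointers that lead to the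
  next near child larger than the square of the current one. Otherwise the exit is found once by skew
  binary jump pointers in \<open>O(log log N)\<close> time, and the remaining subtree of size at most \<open>\<theta>\<^sup>2\<close> is searched in
  \<open>O(log \<theta>)\<close> time. To move the finger, binary search over the stored path finds the lowest ancestor of \<open>f\<close>
  that contains \<open>i\<close>; its child towards \<open>i\<close> has \<open>i\<close> within distance \<open>D\<close> of its near end.\<close>

section \<open>A structured language over the word RAM\<close>

text \<open>Balancing follows heavy paths: the light subtrees on either side of a path form two
  sequences, which grow at the root end. Adding a subtree should create O(1) new nodes and yet keep
  heavy entries shallow. The obstacle is sharing: paths of a DAG have common lower ends, so one
  state has many extensions, and an amortized merge would be paid for again in each of them. A merge
  is therefore refused if it costs more than the number of pending subtrees or than the height of
  what still extends the path. A refusal certifies that the pending subtrees are exponentially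
  light, so they may lie deep.

  In the dynamic variant, log log N rounds of log log \<theta> pointer steps each would give a
  product of iterated logarithms. The pointers ignore everything below \<open>T0\<close>, about log
  N, so a round takes only log log \<theta> - log log \<open>T0\<close> steps. The inequality p (log
  q - log p) \<le> 2 q with p = log \<open>T0\<close> and q = log \<theta> turns the product into
  O(log \<theta>).\<close>

datatype eop = EAdd | ESub | EMul | EDiv | ELt

datatype exp = V nat | C nat | Op eop exp exp | Ld exp

abbreviation eAdd (infixl "\<^bold>+" 65) where "x \<^bold>+ y \<equiv> Op EAdd x y"
abbreviation eSub (infixl "\<^bold>-" 65) where "x \<^bold>- y \<equiv> Op ESub x y"
abbreviation eMul (infixl "\<^bold>*" 70) where "x \<^bold>* y \<equiv> Op EMul x y"
abbreviation eDiv (infixl "\<^bold>'/" 70) where "x \<^bold>/ y \<equiv> Op EDiv x y"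
abbreviation eLt (infix "\<^bold><" 50) where "x \<^bold>< y \<equiv> Op ELt x y"

datatype cmd = Skip | Asg nat exp | St exp exp | Sq cmd cmd (infixr ";;" 40)
  | IfC exp cmd cmd | Wh exp cmd

abbreviation Asg_syntax (infix "::=" 45) where "r ::= e \<equiv> Asg r e"

fun opval :: "eop \<Rightarrow> nat \<Rightarrow> nat \<Rightarrow> nat" where
  "opval EAdd x y = x + y"
| "opval ESub x y = x - y"
| "opval EMul x y = x * y"
| "opval EDiv x y = x div y"
| "opval ELt x y = (if x < y then 1 else 0)"

fun opdef :: "nat \<Rightarrow> eop \<Rightarrow> nat \<Rightarrow> nat \<Rightarrow> bool" where
  "opdef w EAdd x y = (x + y < 2 ^ w)"
| "opdef w ESub x y = (y \<le> x \<and> x < 2 ^ w)"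
| "opdef w EMul x y = (x * y < 2 ^ w)"
| "opdef w _ x y = True"

fun opinstr :: "eop \<Rightarrow> binop" where
  "opinstr EAdd = Add" | "opinstr ESub = Sub" | "opinstr EMul = Mul"
| "opinstr EDiv = Div" | "opinstr ELt = Less"

fun val :: "exp \<Rightarrow> ram_state \<Rightarrow> nat" where
  "val (V r) s = fst s r"
| "val (C k) s = k"
| "val (Op b x y) s = opval b (val x s) (val y s)"
| "val (Ld e) s = snd s ! val e s"

text \<open>Overflow, negative differences and addresses outside the memory count as undefined, so that
  values of expressions are those of ordinary arithmetic.\<close>

fun dfd :: "nat \<Rightarrow> exp \<Rightarrow> ram_state \<Rightarrow> bool" where
  "dfd w (V r) s = True"
| "dfd w (C k) s = (k < 2 ^ w)"
| "dfd w (Op b x y) s = (dfd w x s \<and> dfd w y s \<and> opdef w b (val x s) (val y s))"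
| "dfd w (Ld e) s = (dfd w e s \<and> val e s < length (snd s))"

fun cost :: "exp \<Rightarrow> nat" where
  "cost (V r) = 1" | "cost (C k) = 1" | "cost (Op b x y) = cost x + cost y + 1"
| "cost (Ld e) = cost e + 1"

text \<open>Undefined expressions have no rule, so an execution never overflows or leaves the
  memory. The time counts machine instructions of the compiled code exactly, including the jumps of
  \<open>IfC\<close> and \<open>Wh\<close>.\<close>

inductive ex :: "nat \<Rightarrow> cmd \<Rightarrow> ram_state \<Rightarrow> nat \<Rightarrow> ram_state \<Rightarrow> bool" for w where
  ex_Skip: "ex w Skip s 0 s"
| ex_Asg: "dfd w e (R, M) \<Longrightarrow> ex w (Asg r e) (R, M) (cost e + 1) (R(r := val e (R, M)), M)"
| ex_St: "dfd w a (R, M) \<Longrightarrow> dfd w e (R, M) \<Longrightarrow> val a (R, M) < length M \<Longrightarrow>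
    ex w (St a e) (R, M) (cost a + cost e + 1) (R, M[val a (R, M) := val e (R, M)])"
| ex_Sq: "ex w c1 s t1 s1 \<Longrightarrow> ex w c2 s1 t2 s2 \<Longrightarrow> ex w (c1 ;; c2) s (t1 + t2) s2"
| ex_IfT: "dfd w e s \<Longrightarrow> val e s \<noteq> 0 \<Longrightarrow> ex w c1 s t s' \<Longrightarrow> ex w (IfC e c1 c2) s (t + (cost e + 2)) s'"
| ex_IfF: "dfd w e s \<Longrightarrow> val e s = 0 \<Longrightarrow> ex w c2 s t s' \<Longrightarrow> ex w (IfC e c1 c2) s (t + (cost e + 1)) s'"
| ex_WhF: "dfd w e s \<Longrightarrow> val e s = 0 \<Longrightarrow> ex w (Wh e c) s (cost e + 1) s"
| ex_WhT: "dfd w e s \<Longrightarrow> val e s \<noteq> 0 \<Longrightarrow> ex w c s t1 s1 \<Longrightarrow> ex w (Wh e c) s1 t2 s2 \<Longrightarrow>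
    ex w (Wh e c) s (cost e + 2 + t1 + t2) s2"

text \<open>Registers below 32 belong to the structured program. Register 32 is always 0 and serves for
  unconditional jumps; the registers from 33 on hold intermediate values.\<close>

fun compE :: "exp \<Rightarrow> nat \<Rightarrow> instr list" where
  "compE (V r) k = [Binop Or (33 + k) r r]"
| "compE (C n) k = [Const (33 + k) n]"
| "compE (Op b x y) k = compE x k @ compE y (Suc k) @ [Binop (opinstr b) (33 + k) (33 + k) (34 + k)]"
| "compE (Ld e) k = compE e k @ [Load (33 + k) (33 + k)]"

fun compC :: "cmd \<Rightarrow> nat \<Rightarrow> instr list" where
  "compC Skip o' = []"
| "compC (Asg r e) o' = compE e 0 @ [Binop Or r 33 33]"
| "compC (St a e) o' = compE a 0 @ compE e 1 @ [Store 33 34]"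
| "compC (c1 ;; c2) o' = compC c1 o' @ compC c2 (o' + length (compC c1 o'))"
| "compC (IfC e c1 c2) o' =
    (let q = compE e 0; p1 = compC c1 (o' + length q + 1);
         m = o' + length q + length p1 + 2; p2 = compC c2 m
     in q @ [Jump_zero 33 m] @ p1 @ [Jump_zero 32 (m + length p2)] @ p2)"
| "compC (Wh e c) o' =
    (let q = compE e 0; p = compC c (o' + length q + 1)
     in q @ [Jump_zero 33 (o' + length q + length p + 2)] @ p @ [Jump_zero 32 o'])"

fun okE :: "exp \<Rightarrow> bool" where
  "okE (V r) = (r < 32)" | "okE (C k) = True" | "okE (Op b x y) = (okE x \<and> okE y)"
| "okE (Ld e) = okE e"

fun okC :: "cmd \<Rightarrow> bool" where
  "okC Skip = True" | "okC (Asg r e) = (r < 32 \<and> okE e)" | "okC (St a e) = (okE a \<and> okE e)"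
| "okC (c1 ;; c2) = (okC c1 \<and> okC c2)" | "okC (IfC e c1 c2) = (okE e \<and> okC c1 \<and> okC c2)"
| "okC (Wh e c) = (okE e \<and> okC c)"

section \<open>Correctness of the compiler\<close>

definition sim :: "ram_state \<Rightarrow> ram_state \<Rightarrow> bool" where
  "sim s u \<longleftrightarrow> (\<forall>r<32. fst u r = fst s r) \<and> fst u 32 = 0 \<and> snd u = snd s"

text \<open>In contrast to \<open>run\<close>, an execution may stop inside the program, so that
  executions of fragments can be composed.\<close>

inductive steps :: "nat \<Rightarrow> instr list \<Rightarrow> nat \<times> ram_state \<Rightarrow> nat \<Rightarrow> nat \<times> ram_state \<Rightarrow> bool" for w P where
  steps_refl: "steps w P c 0 c"
| steps_step: "pc < length P \<Longrightarrow> exec_instr w (P ! pc) (pc, s) = Some c \<Longrightarrow> steps w P c t c'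
    \<Longrightarrow> steps w P (pc, s) (Suc t) c'"

lemma steps_trans: "steps w P a t b \<Longrightarrow> steps w P b t' c \<Longrightarrow> steps w P a (t + t') c"
  by (induction rule: steps.induct) (auto intro: steps.intros)

lemma steps_one: "pc < length P \<Longrightarrow> exec_instr w (P ! pc) (pc, s) = Some c \<Longrightarrow> steps w P (pc, s) 1 c"
  unfolding One_nat_def by (rule steps_step[OF _ _ steps_refl])

lemma steps_run: "steps w P c t c' \<Longrightarrow> length P \<le> fst c' \<Longrightarrow> run w P c t (snd c')"
proof (induction rule: steps.induct)
  case (steps_refl c)
  then show ?case by (cases c) (auto intro: run_halt)
qed (auto intro: run_step)

definition located :: "instr list \<Rightarrow> nat \<Rightarrow> instr list \<Rightarrow> bool" where
  "located P n q \<longleftrightarrow> (\<exists>a b. P = a @ q @ b \<and> length a = n)"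

lemma located_append: "located P n (q @ r) \<longleftrightarrow> located P n q \<and> located P (n + length q) r"
proof
  assume "located P n (q @ r)"
  then obtain a b where P: "P = a @ (q @ r) @ b" "length a = n" unfolding located_def by blast
  have "P = a @ q @ (r @ b)" "P = (a @ q) @ r @ b" "length (a @ q) = n + length q" using P by auto
  then show "located P n q \<and> located P (n + length q) r" unfolding located_def using P(2) by blast
next
  assume "located P n q \<and> located P (n + length q) r"
  then obtain a b a' b' where "P = a @ q @ b" "length a = n"
    and P': "P = a' @ r @ b'" "length a' = n + length q" unfolding located_def by blast
  then have "a' = a @ q" by (metis append_assoc append_eq_append_conv length_append)
  then show "located P n (q @ r)" unfolding located_def using P' \<open>length a = n\<close> by auto
qed

lemma located_Cons: "located P n (x # r) \<longleftrightarrow> n < length P \<and> P ! n = x \<and> located P (Suc n) r"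
proof -
  have "located P n [x] \<longleftrightarrow> n < length P \<and> P ! n = x"
  proof
    assume "n < length P \<and> P ! n = x"
    then have "P = take n P @ [x] @ drop (Suc n) P" "length (take n P) = n"
      using id_take_nth_drop[of n P] by auto
    then show "located P n [x]" unfolding located_def by blast
  qed (auto simp: located_def nth_append)
  then show ?thesis using located_append[of P n "[x]" r] by simp
qed

lemma length_compE: "length (compE e k) = cost e"
  by (induction e arbitrary: k) auto

text \<open>The registers from 33 on form a stack of intermediate values. Evaluation at height
  \<open>k\<close> leaves the lower ones intact, which protects the first operand while the second
  is computed.\<close>

lemma compE_steps:
  "okE e \<Longrightarrow> sim s u \<Longrightarrow> dfd w e s \<Longrightarrow> located P n (compE e k) \<Longrightarrow>
   \<exists>u'. steps w P (n, u) (cost e) (n + cost e, u') \<and> sim s u' \<and> fst u' (33 + k) = val e s \<and>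
     (\<forall>j<k. fst u' (33 + j) = fst u (33 + j))"
proof (induction e arbitrary: k n u)
  case (V r)
  obtain R M where u: "u = (R, M)" by fastforce
  have "steps w P (n, u) 1 (n + 1, R(33 + k := R r), M)"
    using V by (intro steps_one) (auto simp: located_Cons u)
  then show ?case using V by (intro exI[of _ "(R(33 + k := R r), M)"]) (auto simp: sim_def u)
next
  case (C m)
  obtain R M where u: "u = (R, M)" by fastforce
  have "steps w P (n, u) 1 (n + 1, R(33 + k := m), M)"
    using C by (intro steps_one) (auto simp: located_Cons u)
  then show ?case using C by (intro exI[of _ "(R(33 + k := m), M)"]) (auto simp: sim_def u)
next
  case (Op b x y)
  from Op.IH(1)[of u n k] Op.prems obtain u1 where u1: "steps w P (n, u) (cost x) (n + cost x, u1)"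
    "sim s u1" "fst u1 (33 + k) = val x s" "\<forall>j<k. fst u1 (33 + j) = fst u (33 + j)"
    by (auto simp: located_append)
  from Op.IH(2)[OF _ u1(2), of "n + cost x" "Suc k"] Op.prems obtain u2 where
    u2: "steps w P (n + cost x, u1) (cost y) (n + cost x + cost y, u2)"
    "sim s u2" "fst u2 (33 + Suc k) = val y s" "\<forall>j<Suc k. fst u2 (33 + j) = fst u1 (33 + j)"
    by (auto simp: located_append length_compE)
  obtain R M where u: "u2 = (R, M)" by fastforce
  let ?R = "R(33 + k := opval b (val x s) (val y s))"
  have sem: "binop_sem w (opinstr b) (val x s) (val y s) = opval b (val x s) (val y s)"
    using Op.prems(3) by (cases b) (auto simp: mod_if)
  have "steps w P (n + cost x + cost y, u2) 1 (n + cost x + cost y + 1, ?R, M)"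
    using Op.prems u u1(3) u2(3,4) sem
    by (intro steps_one) (auto simp: located_append located_Cons length_compE add.assoc)
  from steps_trans[OF steps_trans[OF u1(1) u2(1)] this]
  show ?case using u1 u2 u by (intro exI[of _ "(?R, M)"]) (auto simp: sim_def add.assoc)
next
  case (Ld e)
  from Ld.IH[of u n k] Ld.prems obtain u1 where u1: "steps w P (n, u) (cost e) (n + cost e, u1)"
    "sim s u1" "fst u1 (33 + k) = val e s" "\<forall>j<k. fst u1 (33 + j) = fst u (33 + j)"
    by (auto simp: located_append)
  obtain R M where u: "u1 = (R, M)" by fastforce
  let ?R = "R(33 + k := M ! val e s)"
  have "steps w P (n + cost e, u1) 1 (n + cost e + 1, ?R, M)"
    using Ld.prems u u1(2,3)
    by (intro steps_one) (auto simp: located_append located_Cons length_compE sim_def)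
  from steps_trans[OF u1(1) this]
  show ?case using u1 u by (intro exI[of _ "(?R, M)"]) (auto simp: sim_def)
qed

lemma sim_jump0: "sim s u \<Longrightarrow> located P n (Jump_zero 32 l # r) \<Longrightarrow> steps w P (n, u) 1 (l, u)"
  using steps_one[of n P w u "(l, u)"] by (cases u) (auto simp: located_Cons sim_def)

lemma located_If:
  assumes "located P n (compC (IfC e c1 c2) n)"
    and "p1 = compC c1 (n + cost e + 1)" "m = n + cost e + 1 + length p1 + 1" "p2 = compC c2 m"
  shows "located P n (compE e 0)" "located P (n + cost e) [Jump_zero 33 m]" "located P (n + cost e + 1) p1"
    "located P (n + cost e + 1 + length p1) [Jump_zero 32 (m + length p2)]" "located P m p2"
    "n + length (compC (IfC e c1 c2) n) = m + length p2"
proof -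
  have m: "n + cost e + length p1 + 2 = m" using assms(3) by simp
  have c: "compC (IfC e c1 c2) n = compE e 0 @ [Jump_zero 33 m] @ p1 @ [Jump_zero 32 (m + length p2)] @ p2"
    unfolding compC.simps Let_def length_compE assms(2)[symmetric] m assms(4)[symmetric] ..
  have l: "located P n (compE e 0 @ [Jump_zero 33 m] @ p1 @ [Jump_zero 32 (m + length p2)] @ p2)"
    using assms(1) unfolding c .
  show "located P n (compE e 0)" "located P (n + cost e) [Jump_zero 33 m]" "located P (n + cost e + 1) p1"
    "located P (n + cost e + 1 + length p1) [Jump_zero 32 (m + length p2)]" "located P m p2"
    using l unfolding located_append length_compE assms(3) by simp_all
  show "n + length (compC (IfC e c1 c2) n) = m + length p2" unfolding c using m by (simp add: length_compE)
qed

lemma located_Wh: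
  assumes "located P n (compC (Wh e c) n)" and "p = compC c (n + cost e + 1)" "m = n + cost e + 1 + length p + 1"
  shows "located P n (compE e 0)" "located P (n + cost e) [Jump_zero 33 m]" "located P (n + cost e + 1) p"
    "located P (n + cost e + 1 + length p) [Jump_zero 32 n]" "n + length (compC (Wh e c) n) = m"
proof -
  have m: "n + cost e + length p + 2 = m" using assms(3) by simp
  have c: "compC (Wh e c) n = compE e 0 @ [Jump_zero 33 m] @ p @ [Jump_zero 32 n]"
    unfolding compC.simps Let_def length_compE assms(2)[symmetric] m ..
  have l: "located P n (compE e 0 @ [Jump_zero 33 m] @ p @ [Jump_zero 32 n])"
    using assms(1) unfolding c .
  show "located P n (compE e 0)" "located P (n + cost e) [Jump_zero 33 m]" "located P (n + cost e + 1) p"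
    "located P (n + cost e + 1 + length p) [Jump_zero 32 n]"
    using l unfolding located_append length_compE assms(3) by simp_all
  show "n + length (compC (Wh e c) n) = m" unfolding c using m by (simp add: length_compE)
qed

lemma jump33:
  assumes "located P n [Jump_zero 33 m]"
  shows "steps w P (n, u) 1 (if fst u 33 = 0 then m else n + 1, u)"
  using assms steps_one[of n P w u] by (cases u) (simp add: located_Cons)

text \<open>Induction on the execution rather than on the program, because a loop enters the same
  code repeatedly. Jump targets are absolute, hence the offset passed to \<open>compC\<close> must
  agree with the location of the code.\<close>

lemma compC_steps:
  "ex w c s t s' \<Longrightarrow> okC c \<Longrightarrow> sim s u \<Longrightarrow> located P n (compC c n) \<Longrightarrow>
   \<exists>u'. steps w P (n, u) t (n + length (compC c n), u') \<and> sim s' u'"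
proof (induction arbitrary: n u rule: ex.induct)
  case (ex_Skip s)
  then show ?case using steps_refl by (intro exI[of _ u]) simp
next
  case (ex_Asg e R M r)
  obtain u1 where u1: "steps w P (n, u) (cost e) (n + cost e, u1)" "sim (R, M) u1"
    "fst u1 33 = val e (R, M)"
    using compE_steps[of e "(R, M)" u w P n 0] ex_Asg by (auto simp: located_append)
  obtain R1 M1 where u: "u1 = (R1, M1)" by fastforce
  have "steps w P (n + cost e, u1) 1 (n + cost e + 1, R1(r := R1 33), M1)"
    using ex_Asg u by (intro steps_one) (auto simp: located_append located_Cons length_compE)
  from steps_trans[OF u1(1) this] show ?case using u1 u ex_Asg
    by (intro exI[of _ "(R1(r := R1 33), M1)"]) (auto simp: sim_def length_compE)
next
  case (ex_St a R M e)
  obtain u1 where u1: "steps w P (n, u) (cost a) (n + cost a, u1)" "sim (R, M) u1"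
    "fst u1 33 = val a (R, M)"
    using compE_steps[of a "(R, M)" u w P n 0] ex_St by (auto simp: located_append)
  obtain u2 where u2: "steps w P (n + cost a, u1) (cost e) (n + cost a + cost e, u2)" "sim (R, M) u2"
    "fst u2 34 = val e (R, M)" "fst u2 33 = val a (R, M)"
    using compE_steps[of e "(R, M)" u1 w P "n + cost a" 1] ex_St u1 
    by (auto simp: located_append length_compE)
  obtain R1 M1 where u: "u2 = (R1, M1)" by fastforce
  have "steps w P (n + cost a + cost e, u2) 1
      (n + cost a + cost e + 1, R1, M1[val a (R, M) := val e (R, M)])"
    using ex_St u u2 by (intro steps_one) (auto simp: located_append located_Cons length_compE sim_def add.assoc)
  from steps_trans[OF steps_trans[OF u1(1) u2(1)] this] show ?case using u1 u2 u ex_St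
    by (intro exI[of _ "(R1, M1[val a (R, M) := val e (R, M)])"])
       (auto simp: sim_def length_compE add.assoc)
next
  case (ex_Sq c1 s t1 s1 c2 t2 s2)
  obtain u1 where u1: "steps w P (n, u) t1 (n + length (compC c1 n), u1)" "sim s1 u1"
    using ex_Sq.IH(1)[of u n] ex_Sq.prems by (auto simp: located_append)
  obtain u2 where "steps w P (n + length (compC c1 n), u1) t2
      (n + length (compC c1 n) + length (compC c2 (n + length (compC c1 n))), u2)" "sim s2 u2"
    using ex_Sq.IH(2)[OF _ u1(2), of "n + length (compC c1 n)"] ex_Sq.prems by (auto simp: located_append)
  then show ?case using steps_trans[OF u1(1)] by (intro exI[of _ u2]) (simp add: add.assoc)
next
  case (ex_IfT e s c1 t s' c2)
  define p1 where "p1 = compC c1 (n + cost e + 1)"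
  define m where "m = n + cost e + 1 + length p1 + 1"
  define p2 where "p2 = compC c2 m"
  note loc = located_If[OF ex_IfT.prems(3) p1_def m_def p2_def]
  obtain u1 where u1: "steps w P (n, u) (cost e) (n + cost e, u1)" "sim s u1" "fst u1 33 = val e s"
    using compE_steps[of e s u w P n 0] ex_IfT loc(1) by auto
  have j: "steps w P (n + cost e, u1) 1 (n + cost e + 1, u1)"
    using jump33[OF loc(2), of w u1] u1(3) ex_IfT.hyps(2) by simp
  obtain u2 where u2: "steps w P (n + cost e + 1, u1) t (n + cost e + 1 + length p1, u2)" "sim s' u2"
    using ex_IfT.IH[OF _ u1(2), of "n + cost e + 1"] ex_IfT.prems(1) loc(3) unfolding p1_def by auto
  from steps_trans[OF steps_trans[OF steps_trans[OF u1(1) j] u2(1)] sim_jump0[OF u2(2) loc(4)]]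
  have "steps w P (n, u) (t + (cost e + 2)) (m + length p2, u2)" by (simp add: algebra_simps)
  then show ?case unfolding loc(6) using u2(2) by blast
next
  case (ex_IfF e s c2 t s' c1)
  define p1 where "p1 = compC c1 (n + cost e + 1)"
  define m where "m = n + cost e + 1 + length p1 + 1"
  define p2 where "p2 = compC c2 m"
  note loc = located_If[OF ex_IfF.prems(3) p1_def m_def p2_def]
  obtain u1 where u1: "steps w P (n, u) (cost e) (n + cost e, u1)" "sim s u1" "fst u1 33 = val e s"
    using compE_steps[of e s u w P n 0] ex_IfF loc(1) by auto
  have j: "steps w P (n + cost e, u1) 1 (m, u1)"
    using jump33[OF loc(2), of w u1] u1(3) ex_IfF.hyps(2) by simp
  obtain u2 where u2: "steps w P (m, u1) t (m + length p2, u2)" "sim s' u2"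
    using ex_IfF.IH[OF _ u1(2), of m] ex_IfF.prems(1) loc(5) unfolding p2_def by auto
  from steps_trans[OF steps_trans[OF u1(1) j] u2(1)]
  have "steps w P (n, u) (t + (cost e + 1)) (m + length p2, u2)" by (simp add: algebra_simps)
  then show ?case unfolding loc(6) using u2(2) by blast
next
  case (ex_WhF e s c)
  define p where "p = compC c (n + cost e + 1)"
  define m where "m = n + cost e + 1 + length p + 1"
  note loc = located_Wh[OF ex_WhF.prems(3) p_def m_def]
  obtain u1 where u1: "steps w P (n, u) (cost e) (n + cost e, u1)" "sim s u1" "fst u1 33 = val e s"
    using compE_steps[of e s u w P n 0] ex_WhF loc(1) by auto
  have j: "steps w P (n + cost e, u1) 1 (m, u1)"
    using jump33[OF loc(2), of w u1] u1(3) ex_WhF.hyps(2) by simp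
  show ?case unfolding loc(5) using steps_trans[OF u1(1) j] u1(2) by blast
next
  case (ex_WhT e s c t1 s1 t2 s2)
  define p where "p = compC c (n + cost e + 1)"
  define m where "m = n + cost e + 1 + length p + 1"
  note loc = located_Wh[OF ex_WhT.prems(3) p_def m_def]
  obtain u1 where u1: "steps w P (n, u) (cost e) (n + cost e, u1)" "sim s u1" "fst u1 33 = val e s"
    using compE_steps[of e s u w P n 0] ex_WhT loc(1) by auto
  have j: "steps w P (n + cost e, u1) 1 (n + cost e + 1, u1)"
    using jump33[OF loc(2), of w u1] u1(3) ex_WhT.hyps(2) by simp
  obtain u2 where u2: "steps w P (n + cost e + 1, u1) t1 (n + cost e + 1 + length p, u2)" "sim s1 u2"
    using ex_WhT.IH(1)[OF _ u1(2), of "n + cost e + 1"] ex_WhT.prems(1) loc(3) unfolding p_def by auto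
  obtain u3 where u3: "steps w P (n, u2) t2 (m, u3)" "sim s2 u3"
    using ex_WhT.IH(2)[OF ex_WhT.prems(1) u2(2) ex_WhT.prems(3)] unfolding loc(5) by auto
  from steps_trans[OF steps_trans[OF steps_trans[OF steps_trans[OF u1(1) j] u2(1)] sim_jump0[OF u2(2) loc(4)]] u3(1)]
  have "steps w P (n, u) (cost e + 2 + t1 + t2) (m, u3)" by (simp add: algebra_simps)
  then show ?case unfolding loc(5) using u3(2) by blast
qed

lemma ex_call:
  assumes "ex w c (R(0 := x), M) t s'" "okC c" "sim (R, M) u"
  shows "\<exists>u'. call w (compC c 0) x u t u' \<and> sim s' u'"
proof -
  have "sim (R(0 := x), M) ((fst u)(0 := x), snd u)" using assms(3) by (auto simp: sim_def)
  moreover have "located (compC c 0) 0 (compC c 0)" unfolding located_def by (intro exI[of _ "[]"]) auto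
  ultimately obtain u' where "steps w (compC c 0) (0, (fst u)(0 := x), snd u) t (length (compC c 0), u')" "sim s' u'"
    using compC_steps[OF assms(1,2)] by fastforce
  then show ?thesis using steps_run unfolding call_def by fastforce
qed

section \<open>Weakest preconditions with running time\<close>

definition wp :: "nat \<Rightarrow> cmd \<Rightarrow> (nat \<Rightarrow> ram_state \<Rightarrow> bool) \<Rightarrow> ram_state \<Rightarrow> bool" where
  "wp w c Q s \<longleftrightarrow> (\<exists>t s'. ex w c s t s' \<and> Q t s')"

inductive_cases ex_SkipE: "ex w Skip s t s'"
inductive_cases ex_AsgE: "ex w (Asg r e) s t s'"
inductive_cases ex_StE: "ex w (St a e) s t s'"
inductive_cases ex_SqE: "ex w (c1 ;; c2) s t s'"
inductive_cases ex_IfE: "ex w (IfC e c1 c2) s t s'"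

lemma wp_Skip [simp]: "wp w Skip Q s \<longleftrightarrow> Q 0 s"
  unfolding wp_def by (blast intro: ex_Skip elim: ex_SkipE)

lemma wp_Asg [simp]:
  "wp w (Asg r e) Q (R, M) \<longleftrightarrow> dfd w e (R, M) \<and> Q (cost e + 1) (R(r := val e (R, M)), M)"
  unfolding wp_def
proof (intro iffI)
  assume "\<exists>t s'. ex w (Asg r e) (R, M) t s' \<and> Q t s'"
  then show "dfd w e (R, M) \<and> Q (cost e + 1) (R(r := val e (R, M)), M)" by (auto elim!: ex_AsgE)
qed (blast intro: ex_Asg)

lemma wp_St [simp]:
  "wp w (St a e) Q (R, M) \<longleftrightarrow> dfd w a (R, M) \<and> dfd w e (R, M) \<and> val a (R, M) < length M \<and>
     Q (cost a + cost e + 1) (R, M[val a (R, M) := val e (R, M)])"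
  unfolding wp_def
proof (intro iffI)
  assume "\<exists>t s'. ex w (St a e) (R, M) t s' \<and> Q t s'"
  then show "dfd w a (R, M) \<and> dfd w e (R, M) \<and> val a (R, M) < length M \<and>
     Q (cost a + cost e + 1) (R, M[val a (R, M) := val e (R, M)])" by (auto elim!: ex_StE)
qed (blast intro: ex_St)

lemma wp_Sq [simp]: "wp w (c1 ;; c2) Q s \<longleftrightarrow> wp w c1 (\<lambda>t1 s1. wp w c2 (\<lambda>t2. Q (t1 + t2)) s1) s"
  unfolding wp_def by (blast intro: ex_Sq elim: ex_SqE)

lemma wp_If [simp]:
  "wp w (IfC e c1 c2) Q s \<longleftrightarrow> dfd w e s \<and>
     (if val e s \<noteq> 0 then wp w c1 (\<lambda>t. Q (t + (cost e + 2))) s else wp w c2 (\<lambda>t. Q (t + (cost e + 1))) s)"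
  unfolding wp_def
proof (intro iffI)
  assume "\<exists>t s'. ex w (IfC e c1 c2) s t s' \<and> Q t s'"
  then obtain t s' where "ex w (IfC e c1 c2) s t s'" "Q t s'" by blast
  then show "dfd w e s \<and> (if val e s \<noteq> 0 then \<exists>t s'. ex w c1 s t s' \<and> Q (t + (cost e + 2)) s'
      else \<exists>t s'. ex w c2 s t s' \<and> Q (t + (cost e + 1)) s')"
    by (elim ex_IfE) (simp_all del: split_paired_Ex, blast+)
next
  assume "dfd w e s \<and> (if val e s \<noteq> 0 then \<exists>t s'. ex w c1 s t s' \<and> Q (t + (cost e + 2)) s'
      else \<exists>t s'. ex w c2 s t s' \<and> Q (t + (cost e + 1)) s')"
  then show "\<exists>t s'. ex w (IfC e c1 c2) s t s' \<and> Q t s'"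
    using ex_IfT[of w e s c1 _ _ c2] ex_IfF[of w e s c2 _ _ c1] by (cases "val e s = 0") (simp_all del: split_paired_Ex, blast+)
qed

lemma wp_mono: "wp w c Q s \<Longrightarrow> (\<And>t s'. Q t s' \<Longrightarrow> Q' t s') \<Longrightarrow> wp w c Q' s"
  unfolding wp_def by blast

text \<open>The ghost value \<open>x\<close> describes the state of the loop mathematically, and
  \<open>pot\<close> bounds the time still to be spent. The drop of \<open>pot\<close> in one
  iteration pays for the body, the test and two jumps, which yields termination and the time bound
  at once.\<close>

lemma wp_While:
  fixes I :: "'g \<Rightarrow> ram_state \<Rightarrow> bool" and pot :: "'g \<Rightarrow> nat"
  assumes "I x (R, M)"
    and df: "\<And>x R M. I x (R, M) \<Longrightarrow> dfd w e (R, M)"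
    and body: "\<And>x R M. I x (R, M) \<Longrightarrow> val e (R, M) \<noteq> 0 \<Longrightarrow>
      wp w c (\<lambda>t s'. \<exists>y. I y s' \<and> t + cost e + 2 + pot y \<le> pot x) (R, M)"
    and post: "\<And>t y R M. I y (R, M) \<Longrightarrow> val e (R, M) = 0 \<Longrightarrow> t + pot y \<le> pot x + cost e + 1 \<Longrightarrow> Q t (R, M)"
  shows "wp w (Wh e c) Q (R, M)"
proof -
  have "\<exists>t s' y. ex w (Wh e c) s t s' \<and> I y s' \<and> val e s' = 0 \<and> t + pot y \<le> pot x + cost e + 1"
    if "I x s" for x s
    using that
  proof (induction "pot x" arbitrary: x s rule: less_induct)
    case less
    have d: "dfd w e s" using df[of x "fst s" "snd s"] less.prems by simp
    show ?case
    proof (cases "val e s = 0")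
      case True
      then show ?thesis using less.prems d
        by (intro exI[of _ "cost e + 1"] exI[of _ s] exI[of _ x] conjI ex_WhF) auto
    next
      case False
      then obtain t1 s1 y where 1: "ex w c s t1 s1" "I y s1" "t1 + cost e + 2 + pot y \<le> pot x"
        using body[of x "fst s" "snd s"] less.prems unfolding wp_def by auto
      then obtain t2 s2 z where 2: "ex w (Wh e c) s1 t2 s2" "I z s2" "val e s2 = 0"
        "t2 + pot z \<le> pot y + cost e + 1" using less.hyps[of y s1] by auto
      have "ex w (Wh e c) s (cost e + 2 + t1 + t2) s2" using ex_WhT[OF d False 1(1) 2(1)] .
      then show ?thesis using 1 2 by (intro exI conjI) auto
    qed
  qed
  from this[OF assms(1)] show ?thesis unfolding wp_def using post by (metis prod.collapse)
qed

fun mods :: "cmd \<Rightarrow> nat set" where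
  "mods Skip = {}" | "mods (Asg r e) = {r}" | "mods (St a e) = {}"
| "mods (c1 ;; c2) = mods c1 \<union> mods c2" | "mods (IfC e c1 c2) = mods c1 \<union> mods c2"
| "mods (Wh e c) = mods c"

fun nostore :: "cmd \<Rightarrow> bool" where
  "nostore (St a e) = False" | "nostore (c1 ;; c2) = (nostore c1 \<and> nostore c2)"
| "nostore (IfC e c1 c2) = (nostore c1 \<and> nostore c2)" | "nostore (Wh e c) = nostore c"
| "nostore _ = True"

lemma ex_frame: "ex w c s t s' \<Longrightarrow> r \<notin> mods c \<Longrightarrow> fst s' r = fst s r"
  by (induction rule: ex.induct) auto

lemma ex_nostore: "ex w c s t s' \<Longrightarrow> nostore c \<Longrightarrow> snd s' = snd s"
  by (induction rule: ex.induct) auto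

text \<open>Preservation of registers and memory is read off the program text, so that the
  specifications of fragments need not list what they leave alone.\<close>

lemma wp_frame:
  "wp w c Q s \<Longrightarrow> wp w c (\<lambda>t s'. Q t s' \<and> (\<forall>r. r \<notin> mods c \<longrightarrow> fst s' r = fst s r) \<and>
     (nostore c \<longrightarrow> snd s' = snd s)) s"
  unfolding wp_def using ex_frame ex_nostore by meson

section \<open>From invariants to data structures\<close>

definition solve_inv :: "(nat option \<Rightarrow> ram_state \<Rightarrow> bool) \<Rightarrow> nat option \<Rightarrow> ram_state \<Rightarrow> bool" where
  "solve_inv I p u \<longleftrightarrow> (\<exists>s. sim s u \<and> I p s)"

text \<open>\<open>solve_inv\<close> closes the invariant under arbitrary contents of the scratch
  registers, which differ between calls. As runs are deterministic, the run found by
  \<open>wp\<close> is the one that \<open>reachable\<close> follows.\<close>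

lemma supports_by_invariant:
  assumes init: "I None (\<lambda>_. 0, M)"
    and ok: "\<And>op. op \<in> Ops \<Longrightarrow> okC (Pc op)"
    and op: "\<And>R M' p op i. I p (R, M') \<Longrightarrow> op \<in> Ops \<Longrightarrow> enabled op p \<Longrightarrow> i < length S \<Longrightarrow>
      wp w (Pc op) (\<lambda>t s'. real t \<le> T op (finger_dist p i) \<and> (op = Access \<longrightarrow> fst s' 0 = S ! i) \<and>
        I (new_finger op i p) s') (R(0 := i), M')"
  shows "supports w Ops (\<lambda>op. compC (Pc op) 0) S M T"
proof -
  have *: "\<exists>t u'. call w (compC (Pc op) 0) i u t u' \<and> real t \<le> T op (finger_dist p i) \<and>
      (op = Access \<longrightarrow> result u' = S ! i) \<and> solve_inv I (new_finger op i p) u'"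
    if h: "solve_inv I p u" "op \<in> Ops" "enabled op p" "i < length S" for u p op i
  proof -
    obtain R M' where s: "sim (R, M') u" "I p (R, M')"
      using h(1) unfolding solve_inv_def by (metis prod.collapse)
    obtain t s' where e: "ex w (Pc op) (R(0 := i), M') t s'" "real t \<le> T op (finger_dist p i)"
      "op = Access \<longrightarrow> fst s' 0 = S ! i" "I (new_finger op i p) s'"
      using op[OF s(2) h(2-4)] unfolding wp_def by blast
    obtain u' where u': "call w (compC (Pc op) 0) i u t u'" "sim s' u'"
      using ex_call[OF e(1) ok[OF h(2)] s(1)] by blast
    have "result u' = fst s' 0" using u'(2) by (auto simp: result_def sim_def)
    then show ?thesis using u' e unfolding solve_inv_def by metis
  qed
  have reach: "solve_inv I p u" if "reachable w Ops (\<lambda>op. compC (Pc op) 0) (length S) M u p" for u p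
    using that
  proof (induction rule: reachable.induct)
    case reachable_init
    have "sim (\<lambda>_. 0, M) (\<lambda>_. 0, M)" by (auto simp: sim_def)
    then show ?case using init unfolding solve_inv_def by blast
  next
    case (reachable_op s p op i t s')
    then show ?case using *[of p s op i] run_deterministic unfolding call_def by blast
  qed
  show ?thesis unfolding supports_def using * reach by blast
qed

section \<open>Balancing\<close>

datatype tree = Lf nat | Nd tree tree

primrec sz :: "tree \<Rightarrow> nat" where
  "sz (Lf a) = 1" | "sz (Nd l r) = sz l + sz r"

primrec yl :: "tree \<Rightarrow> nat list" where
  "yl (Lf a) = [a]" | "yl (Nd l r) = yl l @ yl r"

primrec dep :: "tree \<Rightarrow> nat" where
  "dep (Lf a) = 0" | "dep (Nd l r) = Suc (max (dep l) (dep r))"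

primrec subs :: "tree \<Rightarrow> tree set" where
  "subs (Lf a) = {Lf a}" | "subs (Nd l r) = insert (Nd l r) (subs l \<union> subs r)"

lemma sz_pos [simp]: "0 < sz t" by (induction t) auto
lemma sz_ge1: "1 \<le> sz t" using sz_pos[of t] by linarith
lemma sz_not0 [simp]: "sz t \<noteq> 0" using sz_pos[of t] by linarith
lemma length_yl: "length (yl t) = sz t" by (induction t) auto
lemma subs_refl [simp]: "t \<in> subs t" by (cases t) auto
lemma finite_subs [simp]: "finite (subs t)" by (induction t) auto
lemma subs_trans: "u \<in> subs t \<Longrightarrow> subs u \<subseteq> subs t" by (induction t) auto
lemma sz_subs: "u \<in> subs t \<Longrightarrow> sz u \<le> sz t" by (induction t) auto
lemma dep_subs: "u \<in> subs t \<Longrightarrow> dep u \<le> dep t" by (induction t) auto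

text \<open>The subtrees along a longest branch are pairwise distinct, because their sizes
  decrease.\<close>

lemma dep_card: "dep t < card (subs t)"
proof (induction t)
  case (Nd l r)
  have "card (subs u) < card (subs (Nd l r))" if "u = l \<or> u = r" for u
  proof (rule psubset_card_mono)
    have "Nd l r \<notin> subs u" using that sz_subs[of "Nd l r" u] sz_pos[of l] sz_pos[of r] by (auto simp del: sz_pos)
    then show "subs u \<subset> subs (Nd l r)" using that by auto
  qed auto
  from this[of l] this[of r] Nd show ?case by auto
qed auto

lemma sz_le_dep: "sz t \<le> 2 ^ dep t"
proof (induction t)
  case (Nd l r)
  have "(2::nat) ^ dep l \<le> 2 ^ max (dep l) (dep r)" "(2::nat) ^ dep r \<le> 2 ^ max (dep l) (dep r)"
    by (simp_all add: power_increasing del: power_increasing_iff)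
  then have "sz l + sz r \<le> 2 * 2 ^ max (dep l) (dep r)" using Nd by linarith
  then show ?case by simp
qed auto

abbreviation lg2 :: "nat \<Rightarrow> real" where "lg2 n \<equiv> log 2 (real n)"

lemma lg2_mono: "0 < a \<Longrightarrow> a \<le> b \<Longrightarrow> lg2 a \<le> lg2 b" by simp
lemma lg2_nonneg: "0 < a \<Longrightarrow> 0 \<le> lg2 a" by simp

lemma lg2_double: "0 < a \<Longrightarrow> 2 * a \<le> b \<Longrightarrow> lg2 a + 1 \<le> lg2 b"
proof -
  assume a: "0 < a" "2 * a \<le> b"
  have "lg2 (2 * a) \<le> lg2 b" using a by (intro lg2_mono) auto
  moreover have "lg2 (2 * a) = 1 + lg2 a" using a by (simp add: log_mult)
  ultimately show ?thesis by simp
qed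

text \<open>The square of 3/2 exceeds 2, so squaring both sides turns the factor 3/2 into a full
  unit of the logarithm.\<close>

lemma lg2_three_halves: "0 < a \<Longrightarrow> 3 * a \<le> 2 * b \<Longrightarrow> lg2 a + 1 / 2 \<le> lg2 b"
proof -
  assume a: "0 < a" "3 * a \<le> 2 * b"
  have "2 * a * a \<le> b * b"
  proof -
    have "(3 * a) * (3 * a) \<le> (2 * b) * (2 * b)" using mult_le_mono[OF a(2) a(2)] .
    then show ?thesis by (simp add: algebra_simps)
  qed
  then have "lg2 (2 * a * a) \<le> lg2 (b * b)" using a by (intro lg2_mono) auto
  moreover have "0 < real a" "0 < real b" using a by auto
  then have "lg2 (2 * a * a) = 1 + lg2 a + lg2 a" "lg2 (b * b) = lg2 b + lg2 b"
    by (auto simp: log_mult)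
  ultimately show ?thesis by simp
qed

lemma lg2_pow: "0 < a \<Longrightarrow> 2 ^ q * a \<le> b \<Longrightarrow> real q + lg2 a \<le> lg2 b"
proof -
  assume a: "0 < a" "2 ^ q * a \<le> b"
  have "lg2 (2 ^ q * a) \<le> lg2 b" using a by (intro lg2_mono) auto
  moreover have "lg2 (2 ^ q * a) = real q + lg2 a" using a by (simp add: log_mult log_nat_power)
  ultimately show ?thesis by simp
qed

text \<open>The flag \<open>f\<close> selects one of two mirror images, so that the parts to the left and to the right of a
  heavy path are handled by one construction.\<close>

definition nd :: "bool \<Rightarrow> tree \<Rightarrow> tree \<Rightarrow> tree" where
  "nd f a b = (if f then Nd b a else Nd a b)"

definition cc :: "bool \<Rightarrow> nat list \<Rightarrow> nat list \<Rightarrow> nat list" where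
  "cc f xs ys = (if f then ys @ xs else xs @ ys)"

lemma nd_simps [simp]:
  "sz (nd f a b) = sz a + sz b" "dep (nd f a b) = Suc (max (dep a) (dep b))"
  "yl (nd f a b) = cc f (yl a) (yl b)" "subs (nd f a b) = insert (nd f a b) (subs a \<union> subs b)"
  by (auto simp: nd_def cc_def)

lemma cc_simps [simp]: "cc f xs [] = xs" "cc f [] xs = xs" "cc f (cc f xs ys) zs = cc f xs (cc f ys zs)"
  "length (cc f xs ys) = length xs + length ys"
  by (auto simp: cc_def)

primrec cw :: "bool \<Rightarrow> tree list \<Rightarrow> nat list" where
  "cw f [] = []" | "cw f (t # ts) = cc f (yl t) (cw f ts)"

lemma cw_append [simp]: "cw f (as @ bs) = cc f (cw f as) (cw f bs)"
  by (induction as) auto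

abbreviation wsum :: "tree list \<Rightarrow> nat" where "wsum ts \<equiv> sum_list (map sz ts)"

lemma length_cw: "length (cw f ts) = wsum ts"
  by (induction ts) (auto simp: length_yl)

lemma wsum_mem: "t \<in> set ts \<Longrightarrow> sz t \<le> wsum ts"
  by (induction ts) auto

lemma length_le_wsum: "length ts \<le> wsum ts"
proof (induction ts)
  case (Cons t ts) then show ?case using sz_ge1[of t] by simp
qed simp

subsection \<open>Skew binary lists of trees\<close>

text \<open>Cons of the skew binary random-access lists of Okasaki: two leading blocks of equal rank
  are joined below the new element, which creates only two nodes.\<close>

fun consF :: "bool \<Rightarrow> tree \<Rightarrow> (nat \<times> tree) list \<Rightarrow> (nat \<times> tree) list" where
  "consF f a ((i, x) # (j, y) # L) =
    (if i = j then (Suc i, nd f a (nd f x y)) # L else (0, a) # (i, x) # (j, y) # L)"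
| "consF f a [] = [(0, a)]"
| "consF f a [p] = [(0, a), p]"

definition skew :: "bool \<Rightarrow> tree list \<Rightarrow> (nat \<times> tree) list" where
  "skew f as = foldr (consF f) as []"

lemma skew_simps [simp]: "skew f [] = []" "skew f (a # as) = consF f a (skew f as)"
  by (auto simp: skew_def)

fun ft :: "bool \<Rightarrow> (nat \<times> tree) list \<Rightarrow> tree" where
  "ft f [] = Lf 0"
| "ft f [p] = snd p"
| "ft f (p # q # L) = nd f (snd p) (ft f (q # L))"

text \<open>A block of rank \<open>i\<close> stores the preorder of a complete binary tree with
  2^(i+1) - 1 elements.\<close>

inductive blk :: "bool \<Rightarrow> nat \<Rightarrow> tree \<Rightarrow> tree list \<Rightarrow> bool" for f where
  blk0: "blk f 0 a [a]"
| blkS: "blk f i x xs \<Longrightarrow> blk f i y ys \<Longrightarrow> blk f (Suc i) (nd f a (nd f x y)) (a # xs @ ys)"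

inductive blks :: "bool \<Rightarrow> (nat \<times> tree) list \<Rightarrow> tree list \<Rightarrow> bool" for f where
  blks_Nil: "blks f [] []"
| blks_Cons: "blk f i x xs \<Longrightarrow> blks f L ys \<Longrightarrow> blks f ((i, x) # L) (xs @ ys)"

inductive_cases blks_ConsE: "blks f ((i, x) # L) as"
inductive_cases blks_NilE: "blks f [] as"

lemma consF_blks: "blks f L as \<Longrightarrow> blks f (consF f a L) (a # as)"
proof (cases "(f, a, L)" rule: consF.cases)
  case (1 f' a' i x j y L')
  assume "blks f L as"
  with 1 obtain xs ys zs where *: "as = xs @ ys @ zs" "blk f i x xs" "blk f j y ys" "blks f L' zs"
    by (auto elim!: blks_ConsE)
  show ?thesis
  proof (cases "i = j")
    case True
    then show ?thesis using * 1 blks_Cons[OF blkS[of f i x xs y ys a], of L' zs] by simp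
  next
    case False
    then show ?thesis using 1 \<open>blks f L as\<close> blks_Cons[OF blk0, of f L as a] by simp
  qed
qed (use blks_Cons[OF blk0, of f L as a] in auto)

lemma skew_blks: "blks f (skew f as) as"
  by (induction as) (auto intro: blks_Nil consF_blks)

lemma blk_length: "blk f i x as \<Longrightarrow> length as + 1 = 2 ^ Suc i"
  by (induction rule: blk.induct) auto

lemma blk_yl: "blk f i x as \<Longrightarrow> yl x = cw f as"
  by (induction rule: blk.induct) auto

lemma ft_yl: "blks f L as \<Longrightarrow> L \<noteq> [] \<Longrightarrow> yl (ft f L) = cw f as"
proof (induction rule: blks.induct)
  case (blks_Cons i x xs L ys)
  then show ?case by (cases L) (auto simp: blk_yl elim: blks_NilE)
qed simp

lemma skew_ne [simp]: "skew f as = [] \<longleftrightarrow> as = []"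
proof (cases as)
  case (Cons a bs)
  have "consF f a L \<noteq> []" for L by (cases "(f, a, L)" rule: consF.cases) auto
  then show ?thesis using Cons by simp
qed simp

lemma ft_skew_yl: "as \<noteq> [] \<Longrightarrow> yl (ft f (skew f as)) = cw f as"
  using ft_yl[OF skew_blks] by simp

lemma ft_skew_sz: "as \<noteq> [] \<Longrightarrow> sz (ft f (skew f as)) = wsum as"
  using ft_skew_yl[of as f] length_cw length_yl by metis

text \<open>The two levels that a block adds above its halves are paid for by the element in front
  of them; hence an element at index \<open>y\<close> is only O(y) deep.\<close>

lemma blk_dep_front:
  "blk f i x as \<Longrightarrow> (\<And>y. y < length as \<Longrightarrow> real (dep (as ! y)) + 2 * real y + 1 \<le> B) \<Longrightarrow> real (dep x) \<le> B"
proof (induction arbitrary: B rule: blk.induct)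
  case (blk0 a) then show ?case using blk0[of 0] by simp
next
  case (blkS i x xs y ys a)
  have "real (dep x) \<le> B - 2"
  proof (intro blkS.IH)
    fix j assume "j < length xs"
    then show "real (dep (xs ! j)) + 2 * real j + 1 \<le> B - 2"
      using blkS.prems[of "Suc j"] by (simp add: nth_append)
  qed
  moreover have "real (dep y) \<le> B - 2"
  proof (intro blkS.IH)
    fix j assume "j < length ys"
    then show "real (dep (ys ! j)) + 2 * real j + 1 \<le> B - 2"
      using blkS.prems[of "Suc (length xs + j)"] by (simp add: nth_append)
  qed
  ultimately show ?case using blkS.prems[of 0] by simp
qed

lemma ft_dep_front:
  "blks f L as \<Longrightarrow> L \<noteq> [] \<Longrightarrow> (\<And>y. y < length as \<Longrightarrow> real (dep (as ! y)) + 2 * real y + 2 \<le> B)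
   \<Longrightarrow> real (dep (ft f L)) \<le> B"
proof (induction arbitrary: B rule: blks.induct)
  case (blks_Cons i x xs L ys)
  have "real (dep x) \<le> B - 1"
  proof (intro blk_dep_front[OF blks_Cons.hyps(1)])
    fix y assume "y < length xs"
    then show "real (dep (xs ! y)) + 2 * real y + 1 \<le> B - 1"
      using blks_Cons.prems(2)[of y] by (simp add: nth_append)
  qed
  moreover have "real (dep (ft f L)) \<le> B - 1" if "L \<noteq> []"
  proof (intro blks_Cons.IH that)
    fix y assume "y < length ys"
    moreover have "1 \<le> real (length xs)" using blk_length[OF blks_Cons.hyps(1)] by (cases xs) auto
    ultimately show "real (dep (ys ! y)) + 2 * real y + 2 \<le> B - 1"
      using blks_Cons.prems(2)[of "length xs + y"] by (simp add: nth_append)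
  qed
  ultimately show ?case by (cases L) auto
qed simp

text \<open>Canonical numerals of the skew binary system: the ranks increase strictly, except that
  the first two may coincide.\<close>

definition sk :: "(nat \<times> tree) list \<Rightarrow> bool" where
  "sk L \<longleftrightarrow> sorted_wrt (<) (map fst (tl L)) \<and> (case L of p # q # _ \<Rightarrow> fst p \<le> fst q | _ \<Rightarrow> True)"

lemma sk_consF: "sk L \<Longrightarrow> sk (consF f a L)"
proof (cases "(f, a, L)" rule: consF.cases)
  case (1 f' a' i x j y L')
  assume "sk L"
  with 1 show ?thesis by (cases L') (auto simp: sk_def)
qed (auto simp: sk_def)

lemma sk_skew: "sk (skew f as)"
proof (induction as)
  case Nil then show ?case by (simp add: sk_def)
qed (auto intro: sk_consF)

lemma sk_tl: "sk (p # L) \<Longrightarrow> sk L"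
  by (cases L; cases "tl L") (auto simp: sk_def)

lemma sorted_length: "sorted_wrt (<) (xs :: nat list) \<Longrightarrow> x \<in> set xs \<Longrightarrow> (\<forall>y\<in>set xs. y \<le> B) \<Longrightarrow> length xs \<le> Suc B"
proof -
  assume a: "sorted_wrt (<) xs" "\<forall>y\<in>set xs. y \<le> B"
  then have "distinct xs" by (simp add: strict_sorted_iff)
  then have "length xs = card (set xs)" by (simp add: distinct_card)
  also have "\<dots> \<le> card {..B}" using a(2) by (intro card_mono) auto
  finally show ?thesis by simp
qed

lemma blk_dep: "blk f i x as \<Longrightarrow> (\<forall>a\<in>set as. dep a \<le> m) \<Longrightarrow> dep x \<le> m + 2 * i"
  by (induction rule: blk.induct) auto

lemma blks_mem: "blks f L as \<Longrightarrow> (i, x) \<in> set L \<Longrightarrow> \<exists>xs. blk f i x xs \<and> set xs \<subseteq> set as \<and> length xs \<le> length as"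
  by (induction rule: blks.induct) fastforce+

lemma ft_dep_length: "L \<noteq> [] \<Longrightarrow> (\<forall>p\<in>set L. dep (snd p) \<le> B) \<Longrightarrow> dep (ft f L) \<le> B + length L"
proof (induction L)
  case (Cons p L) then show ?case by (cases L) auto
qed simp

text \<open>With \<open>r\<close> the largest rank, blocks contribute at most \<open>2 * r\<close>
  levels, and there are at most \<open>r + 2\<close> blocks since their ranks are distinct after the
  first.\<close>

lemma ft_dep_local:
  assumes "blks f L as" "sk L" "L \<noteq> []" "\<forall>a\<in>set as. dep a \<le> m"
  shows "\<exists>r. dep (ft f L) \<le> m + 3 * r + 2 \<and> 2 ^ r \<le> length as"
proof -
  define r where "r = Max (fst ` set L)"
  have r: "\<forall>p\<in>set L. fst p \<le> r" unfolding r_def by auto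
  have "r \<in> fst ` set L" unfolding r_def using assms(3) by (intro Max_in) auto
  then obtain x where x: "(r, x) \<in> set L" by auto
  obtain xs where xs: "blk f r x xs" "length xs \<le> length as" using blks_mem[OF assms(1) x] by blast
  have "length xs + 1 = 2 ^ r + 2 ^ r" using blk_length[OF xs(1)] by simp
  moreover have "(1::nat) \<le> 2 ^ r" by simp
  ultimately have "2 ^ r \<le> length as" using xs(2) by linarith
  moreover have "dep (ft f L) \<le> (m + 2 * r) + length L"
  proof (intro ft_dep_length assms(3) ballI)
    fix p assume p: "p \<in> set L"
    obtain i y where [simp]: "p = (i, y)" by fastforce
    obtain ys where "blk f i y ys" "set ys \<subseteq> set as" using blks_mem[OF assms(1), of i y] p by auto
    then have "dep y \<le> m + 2 * i" using assms(4) by (intro blk_dep[of f i y ys m]) auto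
    then show "dep (snd p) \<le> m + 2 * r" using r p by fastforce
  qed
  moreover have "length (tl L) \<le> Suc r"
  proof (cases "tl L = []")
    case False
    then obtain q where "q \<in> set (tl L)" by (cases "tl L") auto
    moreover have "set (tl L) \<subseteq> set L" by (cases L) auto
    then have "\<forall>y\<in>set (map fst (tl L)). y \<le> r" using r by fastforce
    ultimately show ?thesis using sorted_length[of "map fst (tl L)" "fst q" r] assms(2) by (auto simp: sk_def)
  qed simp
  ultimately show ?thesis using assms(3) by (intro exI[of _ r]) (cases L, auto)
qed

subsection \<open>Combs\<close>

text \<open>Under \<open>cinv\<close> the head is the heaviest tree and hangs directly below the
  root. The entries towards the growing end stand at the end of the list; they lie deeper but weigh
  geometrically less.\<close>

fun nest :: "bool \<Rightarrow> tree list \<Rightarrow> tree" where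
  "nest f [] = Lf 0"
| "nest f [D] = D"
| "nest f (D # E # Ds) = nd f (nest f (E # Ds)) D"

text \<open>\<open>X\<close> passes an entry as long as the doubling of weights survives its
  arrival. At the first failure everything from there on is fused with \<open>X\<close> into one
  entry.\<close>

fun push :: "bool \<Rightarrow> tree \<Rightarrow> tree list \<Rightarrow> tree list" where
  "push f X [] = [X]"
| "push f X (D # Ds) = (if 2 * (sz X + wsum Ds) \<le> sz D then D # push f X Ds else [nd f X (nest f (D # Ds))])"

fun plen :: "tree \<Rightarrow> tree list \<Rightarrow> nat" where
  "plen X [] = 0"
| "plen X (D # Ds) = (if 2 * (sz X + wsum Ds) \<le> sz D then Suc (plen X Ds) else 0)"

fun cinv :: "tree list \<Rightarrow> bool" where
  "cinv [] = True"
| "cinv (D # Ds) = (2 * wsum Ds \<le> sz D \<and> cinv Ds)"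

lemma nest_Cons: "Ds \<noteq> [] \<Longrightarrow> nest f (D # Ds) = nd f (nest f Ds) D"
  by (cases Ds) auto

lemma nest_yl: "Ds \<noteq> [] \<Longrightarrow> yl (nest f Ds) = cw f (rev Ds)"
proof (induction Ds)
  case (Cons D Ds) then show ?case by (cases "Ds = []") (auto simp: nest_Cons)
qed simp

lemma nest_sz: "Ds \<noteq> [] \<Longrightarrow> sz (nest f Ds) = wsum Ds"
proof (induction Ds)
  case (Cons D Ds) then show ?case by (cases "Ds = []") (auto simp: nest_Cons)
qed simp

lemma push_ne [simp]: "push f X Ds \<noteq> []" by (cases Ds) auto

lemma push_cw: "cw f (rev (push f X Ds)) = cc f (yl X) (cw f (rev Ds))"
  by (induction Ds) (auto simp: nest_yl)

lemma push_wsum: "wsum (push f X Ds) = sz X + wsum Ds"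
  by (induction Ds) (auto simp: nest_sz)

lemma push_cinv: "cinv Ds \<Longrightarrow> cinv (push f X Ds)"
  by (induction Ds) (auto simp: push_wsum)

text \<open>Each entry passed weighs at least twice all that follows it, \<open>X\<close> included.
  So a long push can only be caused by an exponentially light \<open>X\<close>.\<close>

lemma plen_pow: "2 ^ plen X Ds * sz X \<le> sz X + wsum Ds"
  by (induction Ds) auto

text \<open>The doubling of weights pays for one level per entry. The lemma serves twice: with
  \<open>E = 4\<close> and a \<open>Z\<close> that depends on the total weight for the depth of
  whole trees, and with \<open>E = 20\<close> and \<open>Z = 0\<close> for the depth of each
  part.\<close>

lemma nest_dep:
  assumes "1 \<le> E" "0 \<le> Z"
  shows "cinv Ds \<Longrightarrow> Ds \<noteq> [] \<Longrightarrow> (\<forall>D\<in>set Ds. real (dep D) \<le> E * lg2 (sz D) + Z + 1) \<Longrightarrow>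
    real (dep (nest f Ds)) \<le> E * lg2 (wsum Ds) + Z + 2"
proof (induction Ds)
  case (Cons D Ds)
  have D: "real (dep D) \<le> E * lg2 (sz D) + Z + 1" using Cons.prems by auto
  show ?case
  proof (cases "Ds = []")
    case True then show ?thesis using D by simp
  next
    case False
    then have pos: "0 < wsum Ds" using length_le_wsum[of Ds] by (cases Ds) auto
    have "real (dep (nest f Ds)) \<le> E * lg2 (wsum Ds) + Z + 2" using Cons False by auto
    moreover have "lg2 (wsum Ds) + 1 \<le> lg2 (wsum (D # Ds))" using Cons.prems(1) pos by (intro lg2_double) auto
    then have "E * (lg2 (wsum Ds) + 1) \<le> E * lg2 (wsum (D # Ds))" using assms by (intro mult_left_mono) auto
    then have "E * lg2 (wsum Ds) + 1 \<le> E * lg2 (wsum (D # Ds))" using assms by (simp add: algebra_simps)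
    moreover have "E * lg2 (sz D) \<le> E * lg2 (wsum (D # Ds))"
      using assms by (intro mult_left_mono lg2_mono) auto
    ultimately show ?thesis using D False by (simp add: nest_Cons)
  qed
qed simp

lemma push_dep:
  assumes E: "4 \<le> E" "0 \<le> Z" and X: "real (dep X) \<le> E * lg2 (sz X) + Z"
  shows "cinv Ds \<Longrightarrow> (\<forall>D\<in>set Ds. real (dep D) \<le> E * lg2 (sz D) + Z + 1) \<Longrightarrow>
    \<forall>D\<in>set (push f X Ds). real (dep D) \<le> E * lg2 (sz D) + Z + 1"
proof (induction Ds)
  case Nil then show ?case using X by simp
next
  case (Cons D Ds)
  have D: "real (dep D) \<le> E * lg2 (sz D) + Z + 1" using Cons.prems by auto
  show ?case
  proof (cases "2 * (sz X + wsum Ds) \<le> sz D")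
    case True then show ?thesis using Cons by auto
  next
    case False
    define T where "T = sz X + (sz D + wsum Ds)"
    have TX: "E * lg2 (sz X) \<le> E * lg2 T" unfolding T_def using E by (intro mult_left_mono lg2_mono) auto
    \<comment> \<open>The failed test means that \<open>D\<close> is at most two thirds of the fused
      tree. The logarithm gains one half, which \<open>E \<ge> 4\<close> turns into the two levels
      needed.\<close>
    have "lg2 (sz D) + 1 / 2 \<le> lg2 T" using False unfolding T_def by (intro lg2_three_halves) auto
    then have "E * (lg2 (sz D) + 1 / 2) \<le> E * lg2 T" using E by (intro mult_left_mono) auto
    then have TD: "E * lg2 (sz D) + 2 \<le> E * lg2 T" using E by (simp add: algebra_simps)
    have "real (dep (nest f (D # Ds))) + 1 \<le> E * lg2 T + Z + 1"
    proof (cases "Ds = []")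
      case True then show ?thesis using D TD by simp
    next
      case ne: False
      then have pos: "0 < wsum Ds" using length_le_wsum[of Ds] by (cases Ds) auto
      have "real (dep (nest f Ds)) \<le> E * lg2 (wsum Ds) + Z + 2" using Cons.prems ne E by (intro nest_dep) auto
      moreover have "lg2 (wsum Ds) + 1 \<le> lg2 T" using Cons.prems(1) pos unfolding T_def by (intro lg2_double) auto
      then have "E * (lg2 (wsum Ds) + 1) \<le> E * lg2 T" using E by (intro mult_left_mono) auto
      then have "E * lg2 (wsum Ds) + 3 \<le> E * lg2 T" using E by (simp add: algebra_simps)
      ultimately show ?thesis using D TD ne by (simp add: nest_Cons)
    qed
    then have "real (dep (nd f X (nest f (D # Ds)))) \<le> E * lg2 T + Z + 1" using X TX by simp
    moreover have "sz (nd f X (nest f (D # Ds))) = T" by (simp add: T_def nest_sz)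
    ultimately show ?thesis using False by simp
  qed
qed

subsection \<open>Pushing a symbol\<close>

type_synonym pstate = "tree list \<times> tree list"

text \<open>A merge is charged to the symbols pushed since the last merge and to the heavy forest below the
  current node, whose height is \<open>h\<close>.\<close>

definition merges :: "bool \<Rightarrow> nat \<Rightarrow> tree \<Rightarrow> pstate \<Rightarrow> bool" where
  "merges f h a s \<longleftrightarrow> (let p = plen (ft f (skew f (a # fst s))) (snd s) in p \<le> Suc (length (fst s)) \<and> p \<le> h)"

definition step :: "bool \<Rightarrow> nat \<Rightarrow> tree \<Rightarrow> pstate \<Rightarrow> pstate" where
  "step f h a s = (if merges f h a s then ([], push f (ft f (skew f (a # fst s))) (snd s)) else (a # fst s, snd s))"

text \<open>For each \<open>j\<close>, the memory of the refusal when the \<open>j\<close> oldest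
  pending trees were all there was: a push past \<open>q\<close> entries cost more than those
  \<open>j\<close> trees or than the height at that time. The latter exceeds the present
  \<open>h\<close> by at least the number of trees that arrived since.\<close>

definition win :: "tree list \<Rightarrow> nat \<Rightarrow> nat \<Rightarrow> bool" where
  "win as W h \<longleftrightarrow> (\<forall>j\<in>{1..length as}. \<exists>q. 2 ^ q * wsum (drop (length as - j) as) \<le> W \<and>
     (j < q \<or> h + (length as - j) < q))"

text \<open>The suffix that starts at about \<open>y / 2\<close> contains entry \<open>y\<close>.
  Whichever reason its refusal had, the corresponding \<open>q\<close> exceeds half of
  \<open>y\<close>.\<close>

lemma win_elem:
  assumes "win as W h" "y < length as"
  shows "\<exists>q. 2 ^ q * sz (as ! y) \<le> W \<and> y + 2 \<le> 2 * q"
proof -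
  define d where "d = Suc y div 2"
  have d: "d \<le> y" unfolding d_def by (cases y) auto
  have m: "length as - d \<in> {1..length as}" using d assms(2) by auto
  have dd: "length as - (length as - d) = d" using d assms(2) by auto
  obtain q where q: "2 ^ q * wsum (drop d as) \<le> W" "length as - d < q \<or> h + d < q"
    using bspec[OF assms(1)[unfolded win_def] m] unfolding dd by blast
  have "as ! y = drop d as ! (y - d)" using d assms(2) by simp
  then have "as ! y \<in> set (drop d as)" using d assms(2) nth_mem[of "y - d" "drop d as"] by auto
  then have "sz (as ! y) \<le> wsum (drop d as)" by (rule wsum_mem)
  then have "2 ^ q * sz (as ! y) \<le> W" using q(1) by (meson le_trans mult_le_mono2)
  moreover have "y + 2 \<le> 2 * q" using q(2) assms(2) unfolding d_def by linarith
  ultimately show ?thesis by blast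
qed

lemma win_mono: "win as W h \<Longrightarrow> W \<le> W' \<Longrightarrow> h' \<le> h \<Longrightarrow> win as W' h'"
  unfolding win_def
proof
  fix j assume a: "\<forall>j\<in>{1..length as}. \<exists>q. 2 ^ q * wsum (drop (length as - j) as) \<le> W \<and>
     (j < q \<or> h + (length as - j) < q)" "W \<le> W'" "h' \<le> h" and "j \<in> {1..length as}"
  then obtain q where "2 ^ q * wsum (drop (length as - j) as) \<le> W" "j < q \<or> h + (length as - j) < q" by blast
  then show "\<exists>q. 2 ^ q * wsum (drop (length as - j) as) \<le> W' \<and> (j < q \<or> h' + (length as - j) < q)"
    using a(2,3) by (intro exI[of _ q]) linarith
qed

lemma win_Cons:
  assumes "win as W h" "Suc h' \<le> h" "W \<le> W'"
    and "2 ^ q * wsum (a # as) \<le> W'" "Suc (length as) < q \<or> h' < q"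
  shows "win (a # as) W' h'"
  unfolding win_def
proof
  fix j assume j: "j \<in> {1..length (a # as)}"
  show "\<exists>q. 2 ^ q * wsum (drop (length (a # as) - j) (a # as)) \<le> W' \<and>
      (j < q \<or> h' + (length (a # as) - j) < q)"
  proof (cases "j = Suc (length as)")
    case True then show ?thesis using assms(4,5) by auto
  next
    case False
    then have j': "j \<in> {1..length as}" using j by auto
    then obtain q where "2 ^ q * wsum (drop (length as - j) as) \<le> W" "j < q \<or> h + (length as - j) < q"
      using assms(1) unfolding win_def by blast
    moreover have "length (a # as) - j = Suc (length as - j)" using j' by auto
    ultimately show ?thesis using assms(2,3) by (intro exI[of _ q]) auto
  qed
qed

text \<open>Of the eight logarithms of an entry's weight, four are estimated by the weight of the
  list and four by log \<open>W\<close> - q. The gain of \<open>4 * q\<close> pays for the position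
  \<open>y\<close> of the entry in the skew list, which costs about \<open>2 * y\<close>
  levels.\<close>

lemma F_dep:
  assumes "\<And>y. y < length as \<Longrightarrow> \<exists>q. 2 ^ q * sz (as ! y) \<le> W \<and> y + 1 \<le> 2 * q \<or> y = 0 \<and> sz (as ! y) \<le> W"
    and "as \<noteq> []" "\<forall>b\<in>set as. real (dep b) \<le> 8 * lg2 (sz b) + M"
  shows "real (dep (ft f (skew f as))) \<le> 4 * lg2 (wsum as) + (4 * lg2 W + M + 2)"
proof (intro ft_dep_front[OF skew_blks])
  fix y assume y: "y < length as"
  let ?b = "as ! y"
  have b: "real (dep ?b) \<le> 8 * lg2 (sz ?b) + M" using assms(3) y by simp
  have "sz ?b \<le> wsum as" using y by (intro wsum_mem) auto
  then have l: "lg2 (sz ?b) \<le> lg2 (wsum as)" by (intro lg2_mono) auto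
  show "real (dep ?b) + 2 * real y + 2 \<le> 4 * lg2 (wsum as) + (4 * lg2 W + M + 2)"
  proof (cases "y = 0 \<and> sz ?b \<le> W")
    case True
    then have "lg2 (sz ?b) \<le> lg2 W" by (intro lg2_mono) auto
    then show ?thesis using b l True by simp
  next
    case False
    then obtain q where q: "2 ^ q * sz ?b \<le> W" "y + 1 \<le> 2 * q" using assms(1)[OF y] by blast
    have "real q + lg2 (sz ?b) \<le> lg2 W" using q(1) by (intro lg2_pow) auto
    moreover have "real y + 1 \<le> 2 * real q" using q(2) by linarith
    ultimately show ?thesis using b l by argo
  qed
qed (use assms(2) in auto)

text \<open>\<open>M\<close> is the slack of the balanced light subtrees. The entries of the comb
  are measured partly by the total weight \<open>W\<close>, because a merge brings in pending trees
  that are deep compared with their own weight.\<close>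

definition stinv :: "real \<Rightarrow> nat \<Rightarrow> pstate \<Rightarrow> bool" where
  "stinv M h s \<longleftrightarrow> (let as = fst s; Ds = snd s; W = wsum as + wsum Ds in
     cinv Ds \<and> (as \<noteq> [] \<longrightarrow> Ds \<noteq> []) \<and> win as W h \<and> (\<forall>b\<in>set as. real (dep b) \<le> 8 * lg2 (sz b) + M) \<and>
     (\<forall>D\<in>set Ds. real (dep D) \<le> 4 * lg2 (sz D) + (4 * lg2 W + M + 2) + 1))"

lemma stinv_mono: "stinv M h s \<Longrightarrow> h' \<le> h \<Longrightarrow> stinv M h' s"
  unfolding stinv_def Let_def using win_mono by blast

lemma stinv_step:
  assumes "stinv M h s" "Suc h' \<le> h" "real (dep a) \<le> 8 * lg2 (sz a) + M" "0 \<le> M"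
  shows "stinv M h' (step f h' a s)"
proof -
  obtain as Ds where s: "s = (as, Ds)" by fastforce
  define W where "W = wsum as + wsum Ds"
  define W' where "W' = sz a + W"
  define X where "X = ft f (skew f (a # as))"
  have inv: "cinv Ds" "as \<noteq> [] \<longrightarrow> Ds \<noteq> []" "win as W h" "\<forall>b\<in>set as. real (dep b) \<le> 8 * lg2 (sz b) + M"
    "\<forall>D\<in>set Ds. real (dep D) \<le> 4 * lg2 (sz D) + (4 * lg2 W + M + 2) + 1"
    using assms(1) unfolding stinv_def s W_def Let_def by auto
  have X: "sz X = wsum (a # as)" unfolding X_def by (intro ft_skew_sz) auto
  have W'p: "0 < W'" unfolding W'_def by simp
  have mon: "4 * lg2 W \<le> 4 * lg2 W'" if "Ds \<noteq> []"
  proof -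
    have "0 < wsum Ds" using that length_le_wsum[of Ds] by (cases Ds) auto
    then show ?thesis unfolding W_def W'_def by (intro mult_left_mono lg2_mono) auto
  qed
  have Ds': "\<forall>D\<in>set Ds. real (dep D) \<le> 4 * lg2 (sz D) + (4 * lg2 W' + M + 2) + 1"
    using inv(5) mon by fastforce
  show ?thesis
  proof (cases "merges f h' a s")
    case True
    have "real (dep X) \<le> 4 * lg2 (wsum (a # as)) + (4 * lg2 W' + M + 2)"
      unfolding X_def
    proof (intro F_dep)
      fix y assume "y < length (a # as)"
      show "\<exists>q. 2 ^ q * sz ((a # as) ! y) \<le> W' \<and> y + 1 \<le> 2 * q \<or> y = 0 \<and> sz ((a # as) ! y) \<le> W'"
      proof (cases y)
        case 0 then show ?thesis by (simp add: W'_def)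
      next
        case (Suc z)
        then obtain q where "2 ^ q * sz (as ! z) \<le> W" "z + 2 \<le> 2 * q"
          using win_elem[OF inv(3), of z] \<open>y < length (a # as)\<close> by auto
        then show ?thesis using Suc by (intro exI[of _ q]) (auto simp: W'_def)
      qed
    qed (use inv(4) assms(3) in auto)
    then have dX: "real (dep X) \<le> 4 * lg2 (sz X) + (4 * lg2 W' + M + 2)" using X by simp
    have "\<forall>D\<in>set (push f X Ds). real (dep D) \<le> 4 * lg2 (sz D) + (4 * lg2 W' + M + 2) + 1"
      using W'p assms(4) by (intro push_dep[OF _ _ dX inv(1) Ds']) auto
    moreover have "wsum (push f X Ds) = W'" by (simp add: push_wsum X W'_def W_def)
    moreover have "step f h' a s = ([], push f X Ds)" using True by (simp add: step_def s X_def)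
    ultimately show ?thesis using push_cinv[OF inv(1)] by (simp add: stinv_def Let_def win_def)
  next
    case False
    then have st: "step f h' a s = (a # as, Ds)" by (simp add: step_def s)
    \<comment> \<open>The length of the refused push is the witness that \<open>win\<close> records
      for the new tree.\<close>
    define q where "q = plen X Ds"
    have q: "Suc (length as) < q \<or> h' < q" using False by (auto simp: merges_def Let_def s X_def q_def)
    \<comment> \<open>On an empty comb a push has length 0 and is never refused.\<close>
    then have "Ds \<noteq> []" by (auto simp: q_def)
    have "2 ^ q * wsum (a # as) \<le> W'" using plen_pow[of X Ds] X by (simp add: q_def W'_def W_def)
    then have "win (a # as) W' h'" using q inv(3) assms(2) by (intro win_Cons[of as W h]) (auto simp: W'_def)
    then show ?thesis using inv Ds' assms(3) \<open>Ds \<noteq> []\<close> unfolding st stinv_def Let_def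
      by (simp add: W'_def W_def add.assoc)
  qed
qed

definition stree :: "bool \<Rightarrow> pstate \<Rightarrow> tree option" where
  "stree f s = (if snd s = [] then None else if fst s = [] then Some (nest f (snd s))
     else Some (nd f (ft f (skew f (fst s))) (nest f (snd s))))"

lemma stinv_empty [simp]: "stinv M h ([], [])"
  by (simp add: stinv_def win_def)

lemma stinv_dep:
  assumes "stinv M h s" "0 \<le> M" "stree f s = Some t"
  shows "real (dep t) \<le> 8 * lg2 (wsum (fst s) + wsum (snd s)) + M + 5"
proof -
  obtain as Ds where s: "s = (as, Ds)" by fastforce
  define W where "W = wsum as + wsum Ds"
  have ne: "Ds \<noteq> []" using assms(3) by (auto simp: stree_def s split: if_splits)
  have inv: "cinv Ds" "win as W h" "\<forall>b\<in>set as. real (dep b) \<le> 8 * lg2 (sz b) + M"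
    "\<forall>D\<in>set Ds. real (dep D) \<le> 4 * lg2 (sz D) + (4 * lg2 W + M + 2) + 1"
    using assms(1) unfolding stinv_def s W_def Let_def by auto
  have Dp: "0 < wsum Ds" using ne length_le_wsum[of Ds] by (cases Ds) auto
  then have "0 < W" by (simp add: W_def)
  have "real (dep (nest f Ds)) \<le> 4 * lg2 (wsum Ds) + (4 * lg2 W + M + 2) + 2"
    using \<open>0 < W\<close> assms(2) inv ne by (intro nest_dep) auto
  moreover have "lg2 (wsum Ds) \<le> lg2 W" using Dp by (intro lg2_mono) (auto simp: W_def)
  ultimately have n: "real (dep (nest f Ds)) \<le> 8 * lg2 W + M + 4" by argo
  show ?thesis
  proof (cases "as = []")
    case True
    then show ?thesis using n assms(3) ne by (simp add: stree_def s W_def split: if_splits)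
  next
    case False
    then have "0 < wsum as" using length_le_wsum[of as] by (cases as) auto
    have "real (dep (ft f (skew f as))) \<le> 4 * lg2 (wsum as) + (4 * lg2 W + M + 2)"
    proof (intro F_dep False inv)
      fix y assume "y < length as"
      then obtain q where "2 ^ q * sz (as ! y) \<le> W" "y + 2 \<le> 2 * q" using win_elem[OF inv(2)] by auto
      then show "\<exists>q. 2 ^ q * sz (as ! y) \<le> W \<and> y + 1 \<le> 2 * q \<or> y = 0 \<and> sz (as ! y) \<le> W"
        by (intro exI[of _ q]) auto
    qed
    moreover have "lg2 (wsum as) \<le> lg2 W" using \<open>0 < wsum as\<close> by (intro lg2_mono) (auto simp: W_def)
    ultimately have "real (dep (ft f (skew f as))) \<le> 8 * lg2 W + M + 2" by argo
    moreover have "t = nd f (ft f (skew f as)) (nest f Ds)" using assms(3) False ne by (simp add: stree_def s)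
    ultimately show ?thesis using n by (simp add: W_def s)
  qed
qed

subsection \<open>The balanced tree\<close>

primrec hv :: "tree \<Rightarrow> tree" where
  "hv (Lf a) = Lf a" | "hv (Nd l r) = (if sz l < sz r then r else l)"

primrec lt :: "tree \<Rightarrow> tree" where
  "lt (Lf a) = Lf a" | "lt (Nd l r) = (if sz l < sz r then l else r)"

primrec hl :: "tree \<Rightarrow> nat" where
  "hl (Lf a) = a" | "hl (Nd l r) = (if sz l < sz r then hl r else hl l)"

fun attach :: "bool \<Rightarrow> tree option \<Rightarrow> tree \<Rightarrow> tree" where
  "attach f None t = t" | "attach f (Some s) t = nd f s t"

definition asm :: "tree \<Rightarrow> pstate \<times> pstate \<Rightarrow> tree" where
  "asm T p = attach True (stree True (snd p)) (attach False (stree False (fst p)) (Lf (hl T)))"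

text \<open>The state of a node extends that of its heavy child by the balanced light child. It
  depends on the subtree alone, so equal subtrees share one state; this is what makes counting
  distinct subtrees possible. The height bound \<open>h\<close> is supplied later by the forest of
  heavy edges.\<close>

primrec bal :: "(tree \<Rightarrow> nat) \<Rightarrow> tree \<Rightarrow> pstate \<times> pstate" where
  "bal h (Lf a) = (([], []), ([], []))"
| "bal h (Nd l r) = (if sz l < sz r
     then (step False (h (Nd l r)) (asm l (bal h l)) (fst (bal h r)), snd (bal h r))
     else (fst (bal h l), step True (h (Nd l r)) (asm r (bal h r)) (snd (bal h l))))"

definition st :: "bool \<Rightarrow> (tree \<Rightarrow> nat) \<Rightarrow> tree \<Rightarrow> pstate" where
  "st f h T = (if f then snd (bal h T) else fst (bal h T))"

definition tr :: "(tree \<Rightarrow> nat) \<Rightarrow> tree \<Rightarrow> tree" where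
  "tr h T = asm T (bal h T)"

definition ls :: "bool \<Rightarrow> tree \<Rightarrow> bool" where
  "ls f T \<longleftrightarrow> (\<exists>l r. T = Nd l r \<and> f = (\<not> sz l < sz r))"

lemma st_Lf [simp]: "st f h (Lf a) = ([], [])" by (simp add: st_def)

lemma st_Nd: "st f h (Nd l r) = (if ls f (Nd l r)
   then step f (h (Nd l r)) (tr h (lt (Nd l r))) (st f h (hv (Nd l r))) else st f h (hv (Nd l r)))"
  by (auto simp: st_def ls_def tr_def)

lemma tr_st: "tr h T = attach True (stree True (st True h T)) (attach False (stree False (st False h T)) (Lf (hl T)))"
  by (simp add: tr_def asm_def st_def)

definition sw :: "bool \<Rightarrow> pstate \<Rightarrow> nat list" where
  "sw f s = cc f (cw f (fst s)) (cw f (rev (snd s)))"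

definition swf :: "pstate \<Rightarrow> bool" where
  "swf s \<longleftrightarrow> (fst s \<noteq> [] \<longrightarrow> snd s \<noteq> [])"

lemma step_sw: "sw f (step f h a s) = cc f (yl a) (sw f s)"
  using ft_skew_yl[of "a # fst s" f] by (simp add: step_def sw_def push_cw)

lemma step_swf: "swf s \<Longrightarrow> swf (step f h a s)"
  by (auto simp: swf_def step_def merges_def)

lemma st_swf: "swf (st f h T)"
proof (induction T)
  case (Nd l r) then show ?case by (auto simp: st_Nd step_swf)
qed (simp add: swf_def)

lemma attach_yl: "swf s \<Longrightarrow> yl (attach f (stree f s) t) = cc f (sw f s) (yl t)"
  by (cases "snd s = []"; cases "fst s = []") (auto simp: stree_def sw_def swf_def nest_yl ft_skew_yl)

lemma tr_yl_sw: "yl (tr h T) = sw False (st False h T) @ [hl T] @ sw True (st True h T)"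
  unfolding tr_st attach_yl[OF st_swf] by (simp add: cc_def)

lemma sw_empty [simp]: "sw f ([], []) = []" by (simp add: sw_def)

lemma tr_yl: "yl (tr h T) = yl T"
proof (induction T)
  case (Nd l r)
  show ?case
  proof (cases "sz l < sz r")
    case True
    then have "\<not> ls True (Nd l r)" "ls False (Nd l r)" by (auto simp: ls_def)
    then show ?thesis using True Nd unfolding tr_yl_sw by (simp add: st_Nd step_sw cc_def tr_yl_sw)
  next
    case False
    then have "ls True (Nd l r)" "\<not> ls False (Nd l r)" by (auto simp: ls_def)
    then show ?thesis using False Nd unfolding tr_yl_sw by (simp add: st_Nd step_sw cc_def tr_yl_sw)
  qed
qed (simp add: tr_yl_sw)

lemma tr_sz: "sz (tr h T) = sz T" using tr_yl length_yl by metis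

primrec lights :: "tree \<Rightarrow> tree set" where
  "lights (Lf a) = {}"
| "lights (Nd l r) = (if sz l < sz r then insert l (lights r) else insert r (lights l))"

lemma lights_sz: "U \<in> lights T \<Longrightarrow> 2 * sz U \<le> sz T"
  by (induction T) (auto split: if_splits)

lemma lights_subs: "U \<in> lights T \<Longrightarrow> U \<in> subs T"
  by (induction T) (auto split: if_splits)

definition hok :: "(tree \<Rightarrow> nat) \<Rightarrow> tree \<Rightarrow> bool" where
  "hok h T \<longleftrightarrow> (\<forall>U\<in>subs T. \<forall>l r. U = Nd l r \<longrightarrow> Suc (h U) \<le> h (hv U))"

lemma hok_Nd: "hok h (Nd l r) \<longleftrightarrow> hok h l \<and> hok h r \<and> Suc (h (Nd l r)) \<le> h (hv (Nd l r))"
  unfolding hok_def by auto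

lemma st_stinv:
  "hok h T \<Longrightarrow> 0 \<le> M \<Longrightarrow> (\<forall>U\<in>lights T. real (dep (tr h U)) \<le> 8 * lg2 (sz U) + M) \<Longrightarrow> stinv M (h T) (st f h T)"
proof (induction T)
  case (Nd l r)
  have IH: "stinv M (h (hv (Nd l r))) (st f h (hv (Nd l r)))"
    using Nd by (auto simp: hok_Nd)
  have le: "Suc (h (Nd l r)) \<le> h (hv (Nd l r))" using Nd.prems by (simp only: hok_Nd)
  have "real (dep (tr h (lt (Nd l r)))) \<le> 8 * lg2 (sz (tr h (lt (Nd l r)))) + M"
    using Nd.prems(3) by (auto simp: tr_sz)
  then show ?case using stinv_step[OF IH le _ Nd.prems(2), of "tr h (lt (Nd l r))" f] stinv_mono[OF IH, of "h (Nd l r)"] le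
    unfolding st_Nd by auto
qed auto

lemma st_W: "wsum (fst (st f h T)) + wsum (snd (st f h T)) < sz T"
proof -
  have "length (sw f (st f h T)) < sz T"
    using arg_cong[OF tr_yl_sw[of h T], of length] by (cases f) (auto simp: length_yl tr_sz)
  then show ?thesis by (simp add: sw_def length_cw rev_map[symmetric] sum_list_rev)
qed

lemma attach_dep: "dep (attach f x t) \<le> Suc (max (case x of None \<Rightarrow> 0 | Some s \<Rightarrow> dep s) (dep t))"
  by (cases x) auto

lemma lg2_nd: "1 \<le> lg2 (sz a + sz b)"
proof -
  have "lg2 1 + 1 \<le> lg2 (sz a + sz b)" using sz_ge1[of a] sz_ge1[of b] by (intro lg2_double) auto
  then show ?thesis by simp
qed

text \<open>Light subtrees have at most half the size. In 15 = 8 + 7, eight logarithms are used by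
  the invariant, and the seven units gained by halving pay for the five extra levels of
  \<open>stinv_dep\<close> and the two levels of attaching both sides to the leaf.\<close>

lemma tr_dep: "hok h T \<Longrightarrow> real (dep (tr h T)) \<le> 15 * lg2 (sz T)"
proof (induction "sz T" arbitrary: T rule: less_induct)
  case less
  show ?case
  proof (cases T)
    case (Lf a) then show ?thesis by (simp add: tr_st stree_def)
  next
    case (Nd l r)
    have s2: "2 \<le> sz T" using Nd sz_ge1[of l] sz_ge1[of r] by simp
    define M where "M = 7 * (lg2 (sz T) - 1)"
    have one: "1 \<le> lg2 (sz T)" using lg2_nd[of l r] Nd by simp
    then have M: "0 \<le> M" by (simp add: M_def)
    have "\<forall>U\<in>lights T. real (dep (tr h U)) \<le> 8 * lg2 (sz U) + M"
    proof
      fix U assume U: "U \<in> lights T"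
      have "hok h U" using less.prems subs_trans[OF lights_subs[OF U]] unfolding hok_def by blast
      moreover have u: "2 * sz U \<le> sz T" using lights_sz[OF U] .
      moreover have "0 < sz U" by simp
      ultimately have "real (dep (tr h U)) \<le> 15 * lg2 (sz U)" by (intro less.hyps) linarith
      moreover have "lg2 (sz U) + 1 \<le> lg2 (sz T)" using u by (intro lg2_double) auto
      ultimately show "real (dep (tr h U)) \<le> 8 * lg2 (sz U) + M" unfolding M_def by argo
    qed
    then have inv: "stinv M (h T) (st f h T)" for f using st_stinv[OF less.prems M] by blast
    have d: "real (case stree f (st f h T) of None \<Rightarrow> 0 | Some s \<Rightarrow> dep s) \<le> 15 * lg2 (sz T) - 2" for f
    proof (cases "stree f (st f h T)")
      case None
      have "0 \<le> 15 * lg2 (sz T) - 2" using one by linarith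
      then show ?thesis using None by simp
    next
      case (Some s)
      then have "real (dep s) \<le> 8 * lg2 (wsum (fst (st f h T)) + wsum (snd (st f h T))) + M + 5"
        using stinv_dep[OF inv M] by blast
      moreover have "0 < wsum (fst (st f h T)) + wsum (snd (st f h T))"
        using Some length_le_wsum[of "snd (st f h T)"] by (cases "snd (st f h T)") (auto simp: stree_def)
      then have "lg2 (wsum (fst (st f h T)) + wsum (snd (st f h T))) \<le> lg2 (sz T)"
        using st_W[of f h T] by (intro lg2_mono) auto
      ultimately show ?thesis using Some unfolding M_def by simp
    qed
    have "dep (attach False (stree False (st False h T)) (Lf (hl T))) \<le> Suc (case stree False (st False h T) of None \<Rightarrow> 0 | Some s \<Rightarrow> dep s)"
      using attach_dep[of False "stree False (st False h T)" "Lf (hl T)"] by simp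
    moreover have "dep (tr h T) \<le> Suc (max (case stree True (st True h T) of None \<Rightarrow> 0 | Some s \<Rightarrow> dep s)
        (dep (attach False (stree False (st False h T)) (Lf (hl T)))))"
      unfolding tr_st by (rule attach_dep)
    ultimately have "dep (tr h T) \<le> Suc (max (case stree True (st True h T) of None \<Rightarrow> 0 | Some s \<Rightarrow> dep s)
        (Suc (case stree False (st False h T) of None \<Rightarrow> 0 | Some s \<Rightarrow> dep s)))"
      by linarith
    then have "real (dep (tr h T)) \<le> real (Suc (max (case stree True (st True h T) of None \<Rightarrow> 0 | Some s \<Rightarrow> dep s)
        (Suc (case stree False (st False h T) of None \<Rightarrow> 0 | Some s \<Rightarrow> dep s))))" by (rule of_nat_mono)
    then show ?thesis using d[of True] d[of False] by (auto simp: max_def split: if_splits)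
  qed
qed

subsection \<open>Local depth bounds\<close>

text \<open>\<open>tr_dep\<close> concerns only the trees built for whole subtrees of the parse
  tree. The searches also start in pieces of blocks and combs, so each piece needs a bound in terms
  of its own size.\<close>

definition lcl :: "tree \<Rightarrow> bool" where
  "lcl t \<longleftrightarrow> (\<forall>u\<in>subs t. real (dep u) \<le> 25 * lg2 (sz u))"

lemma lcl_nd: "lcl (nd f a b) \<longleftrightarrow> lcl a \<and> lcl b \<and> real (dep (nd f a b)) \<le> 25 * lg2 (sz a + sz b)"
  unfolding lcl_def by auto

lemma lg2_lenbound: "2 ^ r \<le> length as \<Longrightarrow> real r \<le> lg2 (wsum as)"
  using lg2_pow[of 1 r "wsum as"] length_le_wsum[of as] by simp

lemma elem_dep: "\<forall>a\<in>set as. real (dep a) \<le> 15 * lg2 (sz a) \<Longrightarrow> a \<in> set as \<Longrightarrow> dep a \<le> nat \<lfloor>15 * lg2 (wsum as)\<rfloor>"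
proof -
  assume a: "\<forall>a\<in>set as. real (dep a) \<le> 15 * lg2 (sz a)" "a \<in> set as"
  have "lg2 (sz a) \<le> lg2 (wsum as)" using a(2) by (intro lg2_mono wsum_mem) auto
  then have "real (dep a) \<le> 15 * lg2 (wsum as)" using a by fastforce
  then show ?thesis by linarith
qed

lemma nat_floor_le: "0 \<le> x \<Longrightarrow> real (nat \<lfloor>x\<rfloor>) \<le> x" by linarith

lemma blk_sz: "blk f i x as \<Longrightarrow> sz x = wsum as"
  using blk_yl[of f i x as] length_cw length_yl by metis

lemma blk_bound:
  assumes "blk f i x as" "\<forall>a\<in>set as. real (dep a) \<le> 15 * lg2 (sz a)"
  shows "real (dep x) \<le> 17 * lg2 (sz x)"
proof -
  have ne: "as \<noteq> []" using blk_length[OF assms(1)] by auto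
  have "0 \<le> 15 * lg2 (wsum as)" using ne length_le_wsum[of as] by (cases as) auto
  moreover have "dep x \<le> nat \<lfloor>15 * lg2 (wsum as)\<rfloor> + 2 * i"
    using blk_dep[OF assms(1)] elem_dep[OF assms(2)] by blast
  ultimately have "real (dep x) \<le> 15 * lg2 (wsum as) + 2 * real i" using nat_floor_le by fastforce
  moreover have "length as + 1 = 2 ^ i + 2 ^ i" using blk_length[OF assms(1)] by simp
  moreover have "(1::nat) \<le> 2 ^ i" by simp
  ultimately have "2 ^ i \<le> length as" by linarith
  then have "real i \<le> lg2 (wsum as)" by (rule lg2_lenbound)
  then show ?thesis using \<open>real (dep x) \<le> _\<close> blk_sz[OF assms(1)] by simp
qed

lemma blk_lcl:
  "blk f i x as \<Longrightarrow> (\<forall>a\<in>set as. lcl a \<and> real (dep a) \<le> 15 * lg2 (sz a)) \<Longrightarrow> lcl x"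
proof (induction rule: blk.induct)
  case (blkS i x xs y ys a)
  have x: "real (dep x) \<le> 17 * lg2 (sz x)" and y: "real (dep y) \<le> 17 * lg2 (sz y)"
    using blkS blk_bound by auto
  have all: "real (dep (nd f a (nd f x y))) \<le> 17 * lg2 (sz (nd f a (nd f x y)))"
    using blk_bound[OF blk.blkS[OF blkS.hyps(1,2)], of a] blkS.prems by blast
  have "lg2 (sz x) \<le> lg2 (sz x + sz y)" "lg2 (sz y) \<le> lg2 (sz x + sz y)" by (rule lg2_mono, simp, simp)+
  then have "real (dep (nd f x y)) \<le> 25 * lg2 (sz x + sz y)" using x y lg2_nd[of x y] by (simp add: max_def)
  moreover have "17 * lg2 (sz (nd f a (nd f x y))) \<le> 25 * lg2 (sz a + (sz x + sz y))"
    using lg2_nonneg[of "sz a + (sz x + sz y)"] by simp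
  ultimately show ?case using blkS all by (simp add: lcl_nd)
qed auto

lemma ft_bound:
  assumes "blks f L as" "sk L" "L \<noteq> []" "\<forall>a\<in>set as. real (dep a) \<le> 15 * lg2 (sz a)"
  shows "real (dep (ft f L)) \<le> 20 * lg2 (sz (ft f L))"
proof -
  have szt: "sz (ft f L) = wsum as" using ft_yl[OF assms(1,3)] length_cw length_yl by metis
  have ne: "as \<noteq> []" using szt by auto
  \<comment> \<open>The two additive levels need a logarithm of at least 1, which a single entry
    need not have; in that case the list is one block and has no additive term.\<close>
  show ?thesis
  proof (cases "length as = 1")
    case True
    then obtain a where as: "as = [a]" by (cases as) auto
    obtain i x L' where L: "L = (i, x) # L'" using assms(3) by (cases L) auto
    obtain xs ys where xy: "as = xs @ ys" "blk f i x xs" "blks f L' ys" using assms(1) unfolding L by (auto elim: blks_ConsE)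
    have "xs \<noteq> []" using blk_length[OF xy(2)] by auto
    then have "xs = [a]" "ys = []" using xy(1) as by (cases xs; auto)+
    have "L' = []"
    proof (rule ccontr)
      assume "L' \<noteq> []"
      then obtain j z L'' where "L' = (j, z) # L''" by (cases L') auto
      then obtain us vs where "ys = us @ vs" "blk f j z us" using xy(3) by (auto elim: blks_ConsE)
      then show False using \<open>ys = []\<close> blk_length[of f j z us] by auto
    qed
    then show ?thesis using blk_bound[OF xy(2)] assms(4) xy(1) L lg2_nonneg[of "sz x"] by fastforce
  next
    case False
    obtain r where r: "dep (ft f L) \<le> nat \<lfloor>15 * lg2 (wsum as)\<rfloor> + 3 * r + 2" "2 ^ r \<le> length as"
      using ft_dep_local[OF assms(1-3)] elem_dep[OF assms(4)] by blast
    have "2 \<le> length as" using False ne by (cases as; cases "tl as") auto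
    then have "2 * 1 \<le> wsum as" using length_le_wsum[of as] by linarith
    then have 1: "1 \<le> lg2 (wsum as)" using lg2_double[of 1 "wsum as"] by simp
    then have "real (dep (ft f L)) \<le> 15 * lg2 (wsum as) + 3 * real r + 2" using r(1) nat_floor_le[of "15 * lg2 (wsum as)"] by linarith
    then show ?thesis using lg2_lenbound[OF r(2)] 1 unfolding szt by argo
  qed
qed

lemma ft_lcl:
  "blks f L as \<Longrightarrow> sk L \<Longrightarrow> L \<noteq> [] \<Longrightarrow> (\<forall>a\<in>set as. lcl a \<and> real (dep a) \<le> 15 * lg2 (sz a)) \<Longrightarrow> lcl (ft f L)"
proof (induction rule: blks.induct)
  case (blks_Cons i x xs L ys)
  have x: "lcl x" using blk_lcl[OF blks_Cons.hyps(1)] blks_Cons.prems by auto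
  show ?case
  proof (cases L)
    case Nil then show ?thesis using x by simp
  next
    case (Cons p L')
    have "lcl (ft f L)" using blks_Cons Cons sk_tl by auto
    moreover have "real (dep (ft f ((i, x) # L))) \<le> 20 * lg2 (sz (ft f ((i, x) # L)))"
      using ft_bound[OF blks.blks_Cons[OF blks_Cons.hyps(1,2)]] blks_Cons.prems by auto
    moreover have "20 * lg2 (sz x + sz (ft f L)) \<le> 25 * lg2 (sz x + sz (ft f L))"
      using lg2_nonneg[of "sz x + sz (ft f L)"] by simp
    ultimately show ?thesis using x Cons by (simp add: lcl_nd)
  qed
qed simp

lemma nest_lcl:
  "cinv Ds \<Longrightarrow> Ds \<noteq> [] \<Longrightarrow> (\<forall>D\<in>set Ds. lcl D \<and> real (dep D) \<le> 20 * lg2 (sz D) + 0 + 1) \<Longrightarrow> lcl (nest f Ds)"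
proof (induction Ds)
  case (Cons D Ds)
  show ?case
  proof (cases "Ds = []")
    case True then show ?thesis using Cons by simp
  next
    case False
    then have "lcl (nest f Ds)" using Cons by auto
    moreover have "real (dep (nest f (D # Ds))) \<le> 20 * lg2 (wsum (D # Ds)) + 0 + 2"
      using Cons.prems by (intro nest_dep) auto
    ultimately show ?thesis using Cons.prems False lg2_nd[of "nest f Ds" D] by (simp add: nest_Cons lcl_nd nest_sz add.commute)
  qed
qed simp

lemma push_lcl:
  assumes "lcl X" "real (dep X) \<le> 20 * lg2 (sz X) + 0"
  shows "cinv Ds \<Longrightarrow> (\<forall>D\<in>set Ds. lcl D \<and> real (dep D) \<le> 20 * lg2 (sz D) + 0 + 1) \<Longrightarrow>
    \<forall>D\<in>set (push f X Ds). lcl D"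
proof (induction Ds)
  case Nil then show ?case using assms by simp
next
  case (Cons D Ds)
  show ?case
  proof (cases "2 * (sz X + wsum Ds) \<le> sz D")
    case True then show ?thesis using Cons by auto
  next
    case False
    have "lcl (nest f (D # Ds))" using Cons.prems by (intro nest_lcl) auto
    moreover have "\<forall>E\<in>set (push f X (D # Ds)). real (dep E) \<le> 20 * lg2 (sz E) + 0 + 1"
      using Cons.prems by (intro push_dep[OF _ _ assms(2)]) auto
    then have "real (dep (nd f X (nest f (D # Ds)))) \<le> 20 * lg2 (sz X + sz (nest f (D # Ds))) + 1" using False by simp
    ultimately show ?thesis using False assms(1) lg2_nd[of X "nest f (D # Ds)"] by (simp add: lcl_nd)
  qed
qed

text \<open>A second invariant in which every tree is measured by its own weight only. The bounds of
  \<open>stinv\<close> involve the total weight and say nothing about a light part of a heavy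
  comb.\<close>

definition linv :: "pstate \<Rightarrow> bool" where
  "linv s \<longleftrightarrow> cinv (snd s) \<and> (\<forall>a\<in>set (fst s). lcl a \<and> real (dep a) \<le> 15 * lg2 (sz a)) \<and>
     (\<forall>D\<in>set (snd s). lcl D \<and> real (dep D) \<le> 20 * lg2 (sz D) + 0 + 1)"

lemma linv_ft: "linv s \<Longrightarrow> fst s \<noteq> [] \<Longrightarrow> lcl (ft f (skew f (fst s))) \<and>
    real (dep (ft f (skew f (fst s)))) \<le> 20 * lg2 (sz (ft f (skew f (fst s))))"
  using ft_lcl[OF skew_blks sk_skew, of f "fst s"] ft_bound[OF skew_blks sk_skew, of f "fst s"]
  unfolding linv_def by (auto simp del: ft.simps)

lemma linv_step:
  assumes "linv s" "lcl a" "real (dep a) \<le> 15 * lg2 (sz a)"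
  shows "linv (step f h a s)"
proof -
  have 1: "linv (a # fst s, snd s)" using assms by (auto simp: linv_def)
  define X where "X = ft f (skew f (a # fst s))"
  have X: "lcl X" "real (dep X) \<le> 20 * lg2 (sz X) + 0" using linv_ft[OF 1, of f] by (auto simp: X_def)
  have "linv ([], push f X (snd s))"
    using assms(1) push_lcl[OF X, of "snd s" f] push_dep[OF _ _ X(2), of "snd s" f] push_cinv[of "snd s" f X]
    unfolding linv_def by auto
  then show ?thesis using 1 by (simp add: step_def X_def)
qed

lemma linv_stree: "linv s \<Longrightarrow> stree f s = Some t \<Longrightarrow> lcl t \<and> real (dep t) \<le> 23 * lg2 (sz t)"
proof -
  assume s: "linv s" "stree f s = Some t"
  define n where "n = nest f (snd s)"
  have ne: "snd s \<noteq> []" using s(2) by (auto simp: stree_def split: if_splits)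
  have n: "lcl n" using s(1) ne unfolding linv_def n_def by (intro nest_lcl) auto
  have "real (dep n) \<le> 20 * lg2 (wsum (snd s)) + 0 + 2" using s(1) ne unfolding linv_def n_def by (intro nest_dep) auto
  then have dn0: "real (dep n) \<le> 20 * lg2 (sz n) + 2" using ne by (simp add: n_def nest_sz)
  have dn: "real (dep n) \<le> 22 * lg2 (sz n)"
  proof (cases n)
    case (Nd l r) then show ?thesis using dn0 lg2_nd[of l r] by simp
  qed simp
  show ?thesis
  proof (cases "fst s = []")
    case True
    then have "t = n" using s(2) ne by (simp add: stree_def n_def)
    then show ?thesis using n dn lg2_nonneg[of "sz n"] by simp
  next
    case False
    define F where "F = ft f (skew f (fst s))"
    have t: "t = nd f F n" using s(2) ne False by (simp add: stree_def n_def F_def)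
    have F: "lcl F" "real (dep F) \<le> 20 * lg2 (sz F)" using linv_ft[OF s(1) False, of f] by (auto simp: F_def)
    have "lg2 (sz F) \<le> lg2 (sz F + sz n)" "lg2 (sz n) \<le> lg2 (sz F + sz n)" by (rule lg2_mono, simp, simp)+
    moreover have "real (dep t) = 1 + real (dep F) \<or> real (dep t) = 1 + real (dep n)" by (auto simp: t max_def)
    ultimately have "real (dep t) \<le> 23 * lg2 (sz F + sz n)" using F(2) dn lg2_nd[of F n] lg2_nonneg[OF sz_pos, of F] by linarith
    then have "real (dep t) \<le> 23 * lg2 (sz t)" by (simp add: t)
    then show ?thesis using n F unfolding t by (simp add: lcl_nd)
  qed
qed

lemma lcl_tr: "hok h T \<Longrightarrow> lcl (tr h T) \<and> linv (st f h T)"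
proof (induction T arbitrary: f)
  case (Lf a) then show ?case by (simp add: tr_st stree_def lcl_def linv_def)
next
  case (Nd l r)
  have h: "hok h l" "hok h r" using Nd.prems by (auto simp: hok_Nd)
  have lin: "linv (st f h (Nd l r))" for f
  proof -
    have "linv (st f h (hv (Nd l r)))" using Nd.IH h by simp
    moreover have "lcl (tr h (lt (Nd l r)))" using Nd.IH h by simp
    moreover have "real (dep (tr h (lt (Nd l r)))) \<le> 15 * lg2 (sz (tr h (lt (Nd l r))))"
      using tr_dep h by (simp add: tr_sz)
    ultimately show ?thesis unfolding st_Nd using linv_step by presburger
  qed
  define t1 where "t1 = attach False (stree False (st False h (Nd l r))) (Lf (hl (Nd l r)))"
  have t1: "lcl t1"
  proof (cases "stree False (st False h (Nd l r))")
    case None then show ?thesis by (simp add: t1_def lcl_def)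
  next
    case (Some s)
    have s: "lcl s" "real (dep s) \<le> 23 * lg2 (sz s)" using linv_stree[OF lin Some] by auto
    have "lg2 (sz s) \<le> lg2 (sz s + 1)" by (rule lg2_mono) auto
    then have "real (dep s) + 1 \<le> 25 * lg2 (sz s + 1)" using s lg2_nd[of s "Lf 0", unfolded sz.simps] by linarith
    then show ?thesis using Some s by (simp add: t1_def lcl_nd) (simp add: lcl_def)
  qed
  have tr: "real (dep (tr h (Nd l r))) \<le> 15 * lg2 (sz (tr h (Nd l r)))" using tr_dep[OF Nd.prems] by (simp only: tr_sz)
  have t: "tr h (Nd l r) = attach True (stree True (st True h (Nd l r))) t1" by (simp only: tr_st t1_def)
  have "lcl (tr h (Nd l r))"
  proof (cases "stree True (st True h (Nd l r))")
    case None then show ?thesis unfolding t using t1 by simp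
  next
    case (Some s)
    have "lcl s" using linv_stree[OF lin Some] by auto
    moreover have "15 * lg2 (sz s + sz t1) \<le> 25 * lg2 (sz s + sz t1)" using lg2_nonneg[of "sz s + sz t1"] by simp
    ultimately show ?thesis using tr t1 Some unfolding t by (simp add: lcl_nd)
  qed
  then show ?case using lin by blast
qed

subsection \<open>The number of distinct subtrees\<close>

text \<open>The part of the number of new trees at \<open>T\<close> that is not constant: the comb
  entries above which a merge builds new nodes.\<close>

definition mc :: "bool \<Rightarrow> (tree \<Rightarrow> nat) \<Rightarrow> tree \<Rightarrow> nat" where
  "mc f h T = (if ls f T \<and> merges f (h T) (tr h (lt T)) (st f h (hv T))
     then plen (ft f (skew f (tr h (lt T) # fst (st f h (hv T))))) (snd (st f h (hv T))) else 0)"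

definition kk :: "bool \<Rightarrow> (tree \<Rightarrow> nat) \<Rightarrow> tree \<Rightarrow> nat" where
  "kk f h T = length (fst (st f h T))"

lemma mc_cases:
  assumes "T = Nd l r"
  shows "mc f h T \<le> Suc (kk f h (hv T)) \<and> mc f h T \<le> h T \<and> kk f h T = 0 \<or> mc f h T = 0 \<and> kk f h T \<le> Suc (kk f h (hv T))"
  unfolding assms mc_def kk_def st_Nd[of f h l r] by (auto simp: merges_def step_def Let_def)

primrec hset :: "tree \<Rightarrow> tree set" where
  "hset (Lf a) = {}"
| "hset (Nd l r) = (if sz l < sz r then insert r (hset r) else insert l (hset l))"

lemma hset_sz: "U \<in> hset T \<Longrightarrow> sz U < sz T"
proof (induction T)
  case (Nd l r) then show ?case using sz_pos[of l] sz_pos[of r] by (auto split: if_splits simp del: sz_pos)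
qed simp

lemma hset_chain: "u \<in> insert y (hset y) \<Longrightarrow> v \<in> insert y (hset y) \<Longrightarrow> u = v \<or> u \<in> hset v \<or> v \<in> hset u"
proof (induction y)
  case (Nd l r) then show ?case by (cases "sz l < sz r") auto
qed simp

lemma hset_Lf: "Lf a \<in> hset T \<longleftrightarrow> (\<exists>l r. T = Nd l r) \<and> hl T = a"
proof (induction T)
  case (Nd l r)
  show ?case by (cases "sz l < sz r"; cases l; cases r) (use Nd in auto)
qed simp

locale forest =
  fixes D :: "tree set"
  assumes finD: "finite D" and closed: "\<And>l r. Nd l r \<in> D \<Longrightarrow> l \<in> D \<and> r \<in> D"
begin

text \<open>The forest stands upside down: the children of \<open>x\<close> are the trees whose
  heavy child is \<open>x\<close>, and its roots are the leaves of the parse tree.\<close>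

definition ch :: "tree \<Rightarrow> tree set" where
  "ch x = {y \<in> D. \<exists>l r. y = Nd l r \<and> hv y = x}"

definition desc :: "tree \<Rightarrow> tree set" where
  "desc x = {y \<in> D. x \<in> hset y}"

lemma fin [simp]: "finite (ch x)" "finite (desc x)" using finD by (auto simp: ch_def desc_def)

lemma ch_hset: "y \<in> ch x \<Longrightarrow> y \<in> D \<and> hset y = insert x (hset x)"
  by (auto simp: ch_def)

lemma ch_sz: "y \<in> ch x \<Longrightarrow> sz x < sz y"
  using hset_sz[of x y] ch_hset[of y x] by simp

definition htr :: "(tree \<times> tree) set" where "htr = {(y, x). y \<in> ch x}"

lemma wf_htr: "wf htr"
proof -
  define B where "B = Max (sz ` D)"
  have "htr \<subseteq> measure (\<lambda>x. B - sz x)"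
  proof
    fix p assume "p \<in> htr"
    then obtain y x where p: "p = (y, x)" "y \<in> ch x" unfolding htr_def by auto
    then have "sz y \<le> B" unfolding B_def ch_def using finD by auto
    then show "p \<in> measure (\<lambda>x. B - sz x)" using ch_sz[OF p(2)] p by auto
  qed
  then show ?thesis using wf_subset wf_measure by blast
qed

definition ht :: "tree \<Rightarrow> nat" where
  "ht = wfrec htr (\<lambda>g x. if ch x = {} then 0 else Suc (Max (g ` ch x)))"

lemma ht_rec: "ht x = (if ch x = {} then 0 else Suc (Max (ht ` ch x)))"
proof -
  have "ht x = (if ch x = {} then 0 else Suc (Max (cut ht htr x ` ch x)))"
    unfolding ht_def by (subst wfrec[OF wf_htr]) simp
  moreover have "cut ht htr x ` ch x = ht ` ch x"
    by (intro image_cong) (auto simp: cut_def htr_def)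
  ultimately show ?thesis by simp
qed

lemma ht_ch: "y \<in> ch x \<Longrightarrow> Suc (ht y) \<le> ht x"
  using Max_ge[of "ht ` ch x" "ht y"] by (subst ht_rec[of x]) auto

lemma ht_wit: "ch x \<noteq> {} \<Longrightarrow> \<exists>y\<in>ch x. ht x = Suc (ht y)"
proof -
  assume "ch x \<noteq> {}"
  then have "Max (ht ` ch x) \<in> ht ` ch x" by (intro Max_in) auto
  then obtain y where "y \<in> ch x" "Max (ht ` ch x) = ht y" by auto
  then show ?thesis using \<open>ch x \<noteq> {}\<close> ht_rec[of x] by auto
qed

lemma desc_un: "desc x = (\<Union>c\<in>ch x. insert c (desc c))"
proof
  show "desc x \<subseteq> (\<Union>c\<in>ch x. insert c (desc c))"
  proof
    fix y assume "y \<in> desc x"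
    then have "y \<in> D" "x \<in> hset y" by (auto simp: desc_def)
    then have "\<exists>c\<in>ch x. y = c \<or> c \<in> hset y"
    proof (induction y)
      case (Nd l r)
      show ?case
      proof (cases "hv (Nd l r) = x")
        case True then show ?thesis using Nd.prems by (intro bexI[of _ "Nd l r"]) (auto simp: ch_def simp del: hv.simps)
      next
        case False
        then have "x \<in> hset (hv (Nd l r))" using Nd.prems(2) by auto
        then have "\<exists>c\<in>ch x. hv (Nd l r) = c \<or> c \<in> hset (hv (Nd l r))"
          using Nd.IH closed[OF Nd.prems(1)] by (cases "sz l < sz r") auto
        then show ?thesis by auto
      qed
    qed simp
    then show "y \<in> (\<Union>c\<in>ch x. insert c (desc c))" using \<open>y \<in> D\<close> by (auto simp: desc_def)
  qed
next
  have tr: "x \<in> hset y" if "c \<in> hset y" "x \<in> hset c" for c y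
    using that by (induction y) (auto split: if_splits)
  show "(\<Union>c\<in>ch x. insert c (desc c)) \<subseteq> desc x"
  proof (intro UN_least subsetI)
    fix c y assume c: "c \<in> ch x" and "y \<in> insert c (desc c)"
    then have "x \<in> hset y" "y \<in> D" using tr[of c y] ch_hset[OF c] by (auto simp: desc_def)
    then show "y \<in> desc x" by (simp add: desc_def)
  qed
qed

lemma ch_disj: "c \<in> ch x \<Longrightarrow> c' \<in> ch x \<Longrightarrow> c \<noteq> c' \<Longrightarrow> insert c (desc c) \<inter> insert c' (desc c') = {}"
proof (rule ccontr)
  assume a: "c \<in> ch x" "c' \<in> ch x" "c \<noteq> c'" "insert c (desc c) \<inter> insert c' (desc c') \<noteq> {}"
  then obtain y where "c \<in> insert y (hset y)" "c' \<in> insert y (hset y)" by (auto simp: desc_def)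
  then have "c \<in> hset c' \<or> c' \<in> hset c" using hset_chain[of c y c'] a(3) by blast
  moreover have False if "c \<in> ch x" "c' \<in> ch x" "c \<in> hset c'" for c c'
  proof -
    have "c = x \<or> c \<in> hset x" using that(3) ch_hset[OF that(2)] by simp
    then have "sz c \<le> sz x" using hset_sz[of c x] by auto
    then show False using ch_sz[OF that(1)] by simp
  qed
  ultimately show False using a by blast
qed

lemma desc_sum: "(\<Sum>y\<in>desc x. g y :: nat) = (\<Sum>c\<in>ch x. g c + (\<Sum>y\<in>desc c. g y))"
proof -
  have "(\<Sum>y\<in>desc x. g y) = (\<Sum>c\<in>ch x. \<Sum>y\<in>insert c (desc c). g y)"
    unfolding desc_un[of x]
  proof (intro sum.UNION_disjoint ballI impI)
    fix c c' assume "c \<in> ch x" "c' \<in> ch x" "c \<noteq> c'"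
    then show "insert c (desc c) \<inter> insert c' (desc c') = {}" by (rule ch_disj)
  qed simp_all
  also have "\<dots> = (\<Sum>c\<in>ch x. g c + (\<Sum>y\<in>desc c. g y))"
  proof (intro sum.cong refl)
    fix c have "c \<notin> desc c" using hset_sz[of c c] by (auto simp: desc_def)
    then show "(\<Sum>y\<in>insert c (desc c). g y) = g c + (\<Sum>y\<in>desc c. g y)" by simp
  qed
  finally show ?thesis .
qed

text \<open>Only the child on a longest branch is allowed to spend the pending trees of
  \<open>x\<close>. In every other branch the term \<open>min\<close> is at most the height of that
  branch, which cancels against the height on the left. This is where the second condition of
  \<open>merges\<close> enters: without it each branch would spend the same pending trees
  again.\<close>

lemma amortized: "(\<Sum>y\<in>desc x. mc f ht y) + ht x \<le> 2 * card (desc x) + min (kk f ht x) (ht x)"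
proof (induction "ht x" arbitrary: x rule: less_induct)
  case less
  show ?case
  proof (cases "ch x = {}")
    case True
    then have "desc x = {}" unfolding desc_un[of x] by simp
    then show ?thesis using ht_rec[of x] True by simp
  next
    case False
    define g where "g c = mc f ht c + (\<Sum>y\<in>desc c. mc f ht y)" for c
    have c: "g c + ht c \<le> 2 * card (desc c) + min (Suc (kk f ht x)) (ht c)" if "c \<in> ch x" for c
    proof -
      obtain l r where lr: "c = Nd l r" "hv c = x" using \<open>c \<in> ch x\<close> by (auto simp: ch_def)
      have "(\<Sum>y\<in>desc c. mc f ht y) + ht c \<le> 2 * card (desc c) + min (kk f ht c) (ht c)"
        using less[of c] ht_ch[OF that] by simp
      then show ?thesis using mc_cases[OF lr(1), of f ht] lr(2) unfolding g_def by auto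
    qed
    obtain c0 where c0: "c0 \<in> ch x" "ht x = Suc (ht c0)" using ht_wit[OF False] by blast
    have "(\<Sum>y\<in>desc x. mc f ht y) = (\<Sum>c\<in>ch x. g c)" unfolding g_def by (rule desc_sum)
    also have "\<dots> = g c0 + (\<Sum>c\<in>ch x - {c0}. g c)" using c0 by (intro sum.remove) auto
    finally have s: "(\<Sum>y\<in>desc x. mc f ht y) = g c0 + (\<Sum>c\<in>ch x - {c0}. g c)" .
    have "card (desc x) = (\<Sum>c\<in>ch x. 1 + card (desc c))" using desc_sum[of "\<lambda>_. 1" x] by simp
    also have "\<dots> = (1 + card (desc c0)) + (\<Sum>c\<in>ch x - {c0}. 1 + card (desc c))" using c0 by (intro sum.remove) auto
    finally have k: "card (desc x) = (1 + card (desc c0)) + (\<Sum>c\<in>ch x - {c0}. 1 + card (desc c))" .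
    have "(\<Sum>c\<in>ch x - {c0}. g c) \<le> (\<Sum>c\<in>ch x - {c0}. 2 * (1 + card (desc c)))"
    proof (intro sum_mono)
      fix c assume "c \<in> ch x - {c0}"
      then show "g c \<le> 2 * (1 + card (desc c))" using c[of c] by auto
    qed
    also have "\<dots> = 2 * (\<Sum>c\<in>ch x - {c0}. 1 + card (desc c))" by (rule sum_distrib_left[symmetric])
    finally show ?thesis using c[OF c0(1)] s k c0(2) by auto
  qed
qed

text \<open>Each inner tree belongs to exactly one tree of the forest, the one rooted in the leaf at
  the end of its heavy path; grouping by that leaf reduces the sum to
  \<open>amortized\<close>.\<close>

lemma mc_total: "(\<Sum>y\<in>D. mc f ht y) \<le> 2 * card D"
proof -
  define N where "N = {y \<in> D. \<exists>l r. y = Nd l r}"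
  have finN: "finite N" using finD by (auto simp: N_def)
  have leaf: "Lf (hl y) \<in> D" if "y \<in> D" for y
    using that
  proof (induction y)
    case (Nd l r) then show ?case using closed[OF Nd.prems] by simp
  qed simp
  have fin2: "finite (D - N)" using finD by auto
  have im: "(\<lambda>y. Lf (hl y)) ` N \<subseteq> D - N" using leaf by (auto simp: N_def)
  have ds: "desc x = {y \<in> N. Lf (hl y) = x}" if x: "x \<in> D - N" for x
  proof -
    obtain a where "x = Lf a" using x by (cases x) (auto simp: N_def)
    then show ?thesis using hset_Lf[of a] by (auto simp: desc_def N_def)
  qed
  have z: "mc f ht y = 0" if "y \<in> D - N" for y
    using that by (cases y) (auto simp: N_def mc_def ls_def)
  have "(\<Sum>y\<in>D. mc f ht y) = (\<Sum>y\<in>N. mc f ht y)"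
    using finD z by (intro sum.mono_neutral_right) (auto simp: N_def)
  also have "\<dots> = (\<Sum>x\<in>D - N. \<Sum>y\<in>{y \<in> N. Lf (hl y) = x}. mc f ht y)"
    using sum.group[OF finN fin2 im, of "mc f ht"] by simp
  also have "\<dots> = (\<Sum>x\<in>D - N. \<Sum>y\<in>desc x. mc f ht y)" using ds by (intro sum.cong) auto
  also have "\<dots> \<le> (\<Sum>x\<in>D - N. 2 * card (desc x))"
  proof (intro sum_mono)
    fix x show "(\<Sum>y\<in>desc x. mc f ht y) \<le> 2 * card (desc x)" using amortized[of f x] by auto
  qed
  also have "\<dots> = (\<Sum>x\<in>D - N. \<Sum>y\<in>{y \<in> N. Lf (hl y) = x}. 2)" using ds by (intro sum.cong) auto
  also have "\<dots> = (\<Sum>y\<in>N. 2)" using sum.group[OF finN fin2 im, of "\<lambda>_. 2 :: nat"] by simp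
  also have "\<dots> \<le> 2 * card D" using finD by (simp add: N_def card_mono)
  finally show ?thesis .
qed

end

definition extends :: "tree set \<Rightarrow> tree set \<Rightarrow> nat \<Rightarrow> bool" where
  "extends A B k \<longleftrightarrow> (\<exists>N. finite N \<and> card N \<le> k \<and> A \<subseteq> B \<union> N)"

lemma extendsI: "A \<subseteq> B \<union> N \<Longrightarrow> finite N \<Longrightarrow> card N \<le> k \<Longrightarrow> extends A B k"
  unfolding extends_def by blast

lemma extends_trans: "extends A B k \<Longrightarrow> extends B B' k' \<Longrightarrow> extends A B' (k + k')"
  unfolding extends_def
proof (elim exE conjE)
  fix N N' assume "finite N" "card N \<le> k" "A \<subseteq> B \<union> N" "finite N'" "card N' \<le> k'" "B \<subseteq> B' \<union> N'"
  then show "\<exists>N. finite N \<and> card N \<le> k + k' \<and> A \<subseteq> B' \<union> N"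
    using card_Un_le[of N N'] by (intro exI[of _ "N \<union> N'"]) auto
qed

lemma extends_mono: "extends A B k \<Longrightarrow> A' \<subseteq> A \<Longrightarrow> B \<subseteq> B' \<Longrightarrow> k \<le> k' \<Longrightarrow> extends A' B' k'"
  unfolding extends_def by (meson le_trans subset_trans sup.mono order_refl)

lemma extends_insert: "extends A B k \<Longrightarrow> extends (insert x A) B (Suc k)"
  unfolding extends_def
proof (elim exE conjE)
  fix N assume "finite N" "card N \<le> k" "A \<subseteq> B \<union> N"
  then show "\<exists>N. finite N \<and> card N \<le> Suc k \<and> insert x A \<subseteq> B \<union> N"
    using card_insert_le_m1[of "Suc k" N x] by (intro exI[of _ "insert x N"]) auto
qed

lemma extends_Un: "extends A B k \<Longrightarrow> extends A' B k' \<Longrightarrow> extends (A \<union> A') B (k + k')"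
  unfolding extends_def
proof (elim exE conjE)
  fix N N' assume "finite N" "card N \<le> k" "A \<subseteq> B \<union> N" "finite N'" "card N' \<le> k'" "A' \<subseteq> B \<union> N'"
  then show "\<exists>N. finite N \<and> card N \<le> k + k' \<and> A \<union> A' \<subseteq> B \<union> N"
    using card_Un_le[of N N'] by (intro exI[of _ "N \<union> N'"]) auto
qed

lemma extends_sub: "A \<subseteq> B \<Longrightarrow> extends A B 0"
  by (rule extendsI[of _ _ "{}"]) auto

definition fts :: "bool \<Rightarrow> (nat \<times> tree) list \<Rightarrow> tree set" where
  "fts f L = (if L = [] then {} else subs (ft f L))"

lemma fts_simps: "fts f [] = {}" "fts f [p] = subs (snd p)"
  "L \<noteq> [] \<Longrightarrow> fts f (p # L) = insert (ft f (p # L)) (subs (snd p) \<union> fts f L)"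
  by (auto simp: fts_def neq_Nil_conv)

lemma fts_Cons: "fts f (p # L) \<subseteq> insert (ft f (p # L)) (subs (snd p) \<union> fts f L)"
  "subs (snd p) \<union> fts f L \<subseteq> fts f (p # L)"
  by (cases "L = []"; auto simp: fts_simps)+

text \<open>At most two nodes for a new block and one for the comb over the blocks.\<close>

lemma ft_new: "extends (fts f (consF f a L)) (subs a \<union> fts f L) 3"
proof (cases "(f, a, L)" rule: consF.cases)
  case (1 f' a' i x j y L')
  show ?thesis
  proof (cases "i = j")
    case True
    let ?b = "nd f a (nd f x y)"
    have "fts f ((Suc i, ?b) # L') \<subseteq> insert (ft f ((Suc i, ?b) # L')) (subs ?b \<union> fts f L')"
      using fts_Cons(1)[of f "(Suc i, ?b)" L'] by simp
    moreover have "subs x \<union> (subs y \<union> fts f L') \<subseteq> fts f L"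
      using 1 fts_Cons(2)[of "(i, x)" f "(j, y) # L'"] fts_Cons(2)[of "(j, y)" f L'] by auto
    ultimately have "fts f (consF f a L) \<subseteq> (subs a \<union> fts f L) \<union> {ft f ((Suc i, ?b) # L'), ?b, nd f x y}"
      using 1 True by auto
    then show ?thesis by (rule extendsI) (auto simp: card_insert_if)
  next
    case False
    then show ?thesis using 1 fts_Cons(1)[of f "(0, a)" L]
      by (intro extendsI[of _ _ "{ft f ((0, a) # L)}"]) auto
  qed
next
  case 2
  then show ?thesis by (intro extendsI[of _ _ "{}"]) (auto simp: fts_simps)
next
  case (3 f' a' p)
  then show ?thesis using fts_Cons(1)[of f "(0, a)" L]
    by (intro extendsI[of _ _ "{ft f ((0, a) # L)}"]) auto
qed

definition nsts :: "bool \<Rightarrow> tree list \<Rightarrow> tree set" where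
  "nsts f Ds = (if Ds = [] then {} else subs (nest f Ds))"

lemma nsts_Cons: "subs D \<union> nsts f Ds \<subseteq> nsts f (D # Ds)" "nsts f (D # Ds) \<subseteq> insert (nest f (D # Ds)) (subs D \<union> nsts f Ds)"
  by (cases "Ds = []"; auto simp: nsts_def nest_Cons)+

text \<open>Above each entry passed a node of the comb is rebuilt, and the fused entry is one more;
  what hangs below is shared with the old comb.\<close>

lemma nest_new: "extends (nsts f (push f X Ds)) (subs X \<union> nsts f Ds) (Suc (plen X Ds))"
proof (induction Ds)
  case Nil then show ?case by (intro extendsI[of _ _ "{}"]) (auto simp: nsts_def)
next
  case (Cons D Ds)
  show ?case
  proof (cases "2 * (sz X + wsum Ds) \<le> sz D")
    case True
    have "extends (nsts f (push f X Ds)) (subs X \<union> nsts f (D # Ds)) (Suc (plen X Ds))"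
      using nsts_Cons(1)[of D f Ds] by (intro extends_mono[OF Cons]) auto
    moreover have "extends (subs D) (subs X \<union> nsts f (D # Ds)) 0"
      by (rule extends_sub) (use nsts_Cons(1)[of D f Ds] in blast)
    ultimately have "extends (nsts f (push f X Ds) \<union> subs D) (subs X \<union> nsts f (D # Ds)) (Suc (plen X Ds))"
      using extends_Un by fastforce
    from extends_insert[OF this, of "nest f (D # push f X Ds)"]
    show ?thesis
      by (rule extends_mono) (use True nsts_Cons(2)[of f D "push f X Ds"] in auto)
  next
    case False
    then show ?thesis
      by (intro extendsI[of _ _ "{nd f X (nest f (D # Ds))}"]) (auto simp: nsts_def)
  qed
qed

definition sts :: "bool \<Rightarrow> pstate \<Rightarrow> tree set" where
  "sts f s = fts f (skew f (fst s)) \<union> nsts f (snd s)"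

lemma step_new:
  "extends (sts f (step f h a s)) (subs a \<union> sts f s)
     (4 + (if merges f h a s then plen (ft f (skew f (a # fst s))) (snd s) else 0))"
proof -
  let ?X = "ft f (skew f (a # fst s))"
  have F: "extends (fts f (skew f (a # fst s))) (subs a \<union> sts f s) 3"
    using ft_new[of f a "skew f (fst s)"] by (rule extends_mono) (auto simp: sts_def)
  show ?thesis
  proof (cases "merges f h a s")
    case False
    have "extends (fts f (skew f (a # fst s)) \<union> nsts f (snd s)) (subs a \<union> sts f s) (3 + 0)"
      by (intro extends_Un F extends_sub) (auto simp: sts_def)
    then show ?thesis by (rule extends_mono) (use False in \<open>auto simp: sts_def step_def\<close>)
  next
    case True
    have X: "subs ?X = fts f (skew f (a # fst s))" by (simp add: fts_def skew_ne[of f "a # fst s", simplified])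
    have "extends (subs ?X \<union> nsts f (snd s)) (subs a \<union> sts f s) (3 + 0)"
      unfolding X by (intro extends_Un F extends_sub) (auto simp: sts_def)
    from extends_trans[OF nest_new[of f ?X "snd s"] this]
    show ?thesis by (rule extends_mono) (use True in \<open>auto simp: sts_def step_def fts_simps\<close>)
  qed
qed

lemma stree_new: "stree f s = Some t \<Longrightarrow> subs t \<subseteq> insert t (sts f s)"
  by (auto simp: stree_def sts_def fts_def nsts_def split: if_splits)

lemma attach_new: "extends (subs (attach f (stree f s) t)) (sts f s \<union> subs t) 2"
proof (cases "stree f s")
  case None then show ?thesis by (intro extendsI[of _ _ "{}"]) auto
next
  case (Some u)
  then show ?thesis using stree_new[OF Some] 
    by (intro extendsI[of _ _ "{nd f u t, u}"]) (auto simp: card_insert_if)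
qed

definition full :: "(tree \<Rightarrow> nat) \<Rightarrow> tree \<Rightarrow> tree set" where
  "full h T = subs (tr h T) \<union> (sts False (st False h T) \<union> sts True (st True h T))"

lemma tr_new: "extends (full h T) (sts False (st False h T) \<union> sts True (st True h T)) 5"
proof -
  let ?B = "sts False (st False h T) \<union> sts True (st True h T)"
  let ?t1 = "attach False (stree False (st False h T)) (Lf (hl T))"
  have "extends (sts False (st False h T) \<union> subs (Lf (hl T))) ?B 1"
    by (intro extendsI[of _ _ "{Lf (hl T)}"]) auto
  from extends_trans[OF attach_new this] have t1: "extends (subs ?t1) ?B 3" by (simp add: numeral_eq_Suc)
  have "extends (sts True (st True h T) \<union> subs ?t1) ?B (0 + 3)" by (intro extends_Un t1 extends_sub) auto
  from extends_trans[OF attach_new this] have "extends (subs (tr h T)) ?B 5" unfolding tr_st by (simp add: numeral_eq_Suc)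
  from extends_Un[OF this extends_sub[of ?B]] show ?thesis unfolding full_def by simp
qed

text \<open>The 13 allows four new trees beyond the push for either side and five for joining the
  two sides at the leaf.\<close>

lemma full_Nd: "extends (full h (Nd l r)) (full h l \<union> full h r) (13 + mc False h (Nd l r) + mc True h (Nd l r))"
proof -
  let ?T = "Nd l r"
  have S: "extends (sts f (st f h ?T)) (full h l \<union> full h r) (4 + mc f h ?T)" for f
  proof (cases "ls f ?T")
    case True
    have "subs (tr h (lt ?T)) \<union> sts f (st f h (hv ?T)) \<subseteq> full h l \<union> full h r"
      by (cases f) (auto simp: full_def)
    from extends_mono[OF step_new order_refl this order_refl, of "h ?T"]
    show ?thesis using True unfolding st_Nd mc_def by simp
  next
    case False
    have "sts f (st f h ?T) \<subseteq> full h l \<union> full h r" unfolding st_Nd using False by (cases f) (auto simp: full_def)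
    then show ?thesis by (rule extends_mono[OF extends_sub]) auto
  qed
  from extends_trans[OF tr_new extends_Un[OF S S]] show ?thesis by (rule extends_mono) auto
qed

text \<open>Charging to a family \<open>g\<close> indexed by distinct subtrees, instead of adding up
  along the tree, makes a shared subtree pay only once.\<close>

lemma card_full:
  "\<exists>g. full h T \<subseteq> (\<Union>U\<in>subs T. g U) \<and> (\<forall>U. finite (g U) \<and> card (g U) \<le> 13 + mc False h U + mc True h U)"
proof -
  have "\<forall>U. \<exists>N. finite N \<and> card N \<le> 13 + mc False h U + mc True h U \<and>
      (case U of Lf a \<Rightarrow> full h U \<subseteq> N | Nd l r \<Rightarrow> full h U \<subseteq> full h l \<union> full h r \<union> N)"
  proof
    fix U
    show "\<exists>N. finite N \<and> card N \<le> 13 + mc False h U + mc True h U \<and>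
      (case U of Lf a \<Rightarrow> full h U \<subseteq> N | Nd l r \<Rightarrow> full h U \<subseteq> full h l \<union> full h r \<union> N)"
    proof (cases U)
      case (Lf a)
      have "full h U \<subseteq> {Lf a}" using Lf by (simp add: full_def tr_st stree_def sts_def fts_def nsts_def)
      then show ?thesis using Lf by (intro exI[of _ "{Lf a}"]) auto
    next
      case (Nd l r) then show ?thesis using full_Nd[of h l r] unfolding extends_def by auto
    qed
  qed
  then obtain g where g: "\<forall>U. finite (g U) \<and> card (g U) \<le> 13 + mc False h U + mc True h U \<and>
      (case U of Lf a \<Rightarrow> full h U \<subseteq> g U | Nd l r \<Rightarrow> full h U \<subseteq> full h l \<union> full h r \<union> g U)" by metis
  have "full h T \<subseteq> (\<Union>U\<in>subs T. g U)"
  proof (induction T)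
    case (Lf a) then show ?case using g[rule_format, of "Lf a"] by simp
  next
    case (Nd l r) then show ?case using g[rule_format, of "Nd l r"] by fastforce
  qed
  then show ?thesis using g by blast
qed

theorem balanced_tree:
  "\<exists>t'. yl t' = yl t \<and> card (subs t') \<le> 17 * card (subs t) \<and> (\<forall>u\<in>subs t'. real (dep u) \<le> 25 * lg2 (sz u))"
proof -
  interpret forest "subs t"
  proof
    fix l r assume "Nd l r \<in> subs t"
    from subs_trans[OF this] show "l \<in> subs t \<and> r \<in> subs t" by auto
  qed auto
  have "hok ht t" unfolding hok_def
  proof (intro ballI allI impI)
    fix U l r assume "U \<in> subs t" "U = Nd l r"
    then have "U \<in> ch (hv U)" by (auto simp: ch_def)
    then show "Suc (ht U) \<le> ht (hv U)" by (rule ht_ch)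
  qed
  then have "lcl (tr ht t)" using lcl_tr by blast
  moreover have "card (subs (tr ht t)) \<le> 17 * card (subs t)"
  proof -
    obtain g where g: "full ht t \<subseteq> (\<Union>U\<in>subs t. g U)"
      "\<And>U. finite (g U)" "\<And>U. card (g U) \<le> 13 + mc False ht U + mc True ht U"
      using card_full[of ht t] by blast
    have "card (subs (tr ht t)) \<le> card (\<Union>U\<in>subs t. g U)" using g by (intro card_mono) (auto simp: full_def)
    also have "\<dots> \<le> (\<Sum>U\<in>subs t. card (g U))" by (intro card_UN_le) auto
    also have "\<dots> \<le> (\<Sum>U\<in>subs t. 13 + mc False ht U + mc True ht U)" by (intro sum_mono g)
    also have "\<dots> = 13 * card (subs t) + (\<Sum>U\<in>subs t. mc False ht U) + (\<Sum>U\<in>subs t. mc True ht U)"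
      by (simp add: sum.distrib)
    also have "\<dots> \<le> 17 * card (subs t)" using mc_total[of False] mc_total[of True] by simp
    finally show ?thesis .
  qed
  ultimately show ?thesis using tr_yl unfolding lcl_def by (intro exI[of _ "tr ht t"]) auto
qed

subsection \<open>From grammars to trees\<close>

text \<open>A variable may have several rules that derive the same string. Fixing one of them by
  \<open>\<rho>\<close> assigns a single tree to every variable, so there are no more distinct
  subtrees than rules.\<close>

lemma parse_tree:
  assumes "represents G S"
  shows "\<exists>t. yl t = S \<and> card (subs t) \<le> slp_size G"
proof -
  have fin: "finite (rules G)" and acy: "acyclic (slp_edges G)" and
    uni: "\<And>A. A \<in> slp_vars G \<Longrightarrow> \<exists>!s. derives G A s" and der: "derives G (start G) S"
    using assms unfolding represents_def is_slp_def by auto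
  have "\<forall>A\<in>slp_vars G. \<exists>r. (A, r) \<in> rules G"
  proof
    fix A assume "A \<in> slp_vars G"
    then obtain s where "derives G A s" using uni by blast
    then show "\<exists>r. (A, r) \<in> rules G" by cases auto
  qed
  then obtain \<rho> where \<rho>: "\<And>A. A \<in> slp_vars G \<Longrightarrow> (A, \<rho> A) \<in> rules G" by metis
  define Hf where "Hf g A = (case \<rho> A of Ter a \<Rightarrow> Lf a | Bin B E \<Rightarrow> Nd (g B) (g E))" for g :: "nat \<Rightarrow> tree" and A
  define p where "p = wfrec ((slp_edges G)\<inverse>) Hf"
  have "slp_edges G \<subseteq> (\<Union>(A, r)\<in>rules G. {A} \<times> rhs_vars r)" by (auto simp: slp_edges_def)
  moreover have "finite (rhs_vars r)" for r by (cases r) auto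
  then have "finite (\<Union>(A, r)\<in>rules G. {A} \<times> rhs_vars r)" using fin by (intro finite_UN_I) auto
  ultimately have "finite (slp_edges G)" by (rule finite_subset)
  then have wf: "wf ((slp_edges G)\<inverse>)" using acy by (rule finite_acyclic_wf_converse)
  have bin: "B \<in> slp_vars G" "E \<in> slp_vars G" "(A, B) \<in> slp_edges G" "(A, E) \<in> slp_edges G"
    if "A \<in> slp_vars G" "\<rho> A = Bin B E" for A B E
    using \<rho>[OF that(1)] that(2) by (force simp: slp_vars_def slp_edges_def)+
  have p: "p A = (case \<rho> A of Ter a \<Rightarrow> Lf a | Bin B E \<Rightarrow> Nd (p B) (p E))" if "A \<in> slp_vars G" for A
  proof -
    have "p A = Hf (cut p ((slp_edges G)\<inverse>) A) A" unfolding p_def by (rule wfrec[OF wf])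
    then show ?thesis using bin[OF that] by (auto simp: Hf_def cut_def split: rhs.splits)
  qed
  have main: "A \<in> slp_vars G \<Longrightarrow> derives G A (yl (p A)) \<and> subs (p A) \<subseteq> p ` fst ` rules G" for A
    using wf
  proof (induction A rule: wf_induct_rule)
    case (less A)
    show ?case
    proof (cases "\<rho> A")
      case (Ter a)
      then show ?thesis using p[OF less.prems] \<rho>[OF less.prems] derives_Ter[of A a G] by force
    next
      case (Bin B E)
      have "derives G A (yl (p B) @ yl (p E))"
        using \<rho>[OF less.prems] Bin less.IH bin[OF less.prems Bin] by (intro derives_Bin) auto
      moreover have "p A \<in> p ` fst ` rules G" using \<rho>[OF less.prems] by force
      ultimately show ?thesis using p[OF less.prems] Bin less.IH bin[OF less.prems Bin] by auto
    qed
  qed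
  have st: "start G \<in> slp_vars G" by (simp add: slp_vars_def)
  have "yl (p (start G)) = S" using main[OF st] uni[OF st] der by blast
  moreover have "card (subs (p (start G))) \<le> card (p ` fst ` rules G)" using main[OF st] fin by (intro card_mono) auto
  moreover have "card (p ` fst ` rules G) \<le> card (rules G)"
    using card_image_le[OF fin, of fst] card_image_le[OF finite_imageI[OF fin], of p fst] by linarith
  ultimately show ?thesis unfolding slp_size_def by (intro exI[of _ "p (start G)"]) auto
qed

section \<open>Programs with a time bound\<close>

definition wpb :: "nat \<Rightarrow> cmd \<Rightarrow> nat \<Rightarrow> (ram_state \<Rightarrow> bool) \<Rightarrow> ram_state \<Rightarrow> bool" where
  "wpb w c B P s \<longleftrightarrow> wp w c (\<lambda>k s'. k \<le> B \<and> P s') s"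

lemma wpb_Sq: "wpb w c1 B1 (\<lambda>s1. wpb w c2 B2 P s1) s \<Longrightarrow> wpb w (c1 ;; c2) (B1 + B2) P s"
  unfolding wpb_def wp_Sq by (elim wp_mono conjE) (auto elim!: wp_mono)

lemma wpb_mono: "wpb w c B P s \<Longrightarrow> B \<le> B' \<Longrightarrow> (\<And>s'. P s' \<Longrightarrow> P' s') \<Longrightarrow> wpb w c B' P' s"
  unfolding wpb_def by (elim wp_mono) auto

lemma wpb_Asg [simp]: "wpb w (Asg r e) B P (R, M) \<longleftrightarrow> dfd w e (R, M) \<and> cost e + 1 \<le> B \<and> P (R(r := val e (R, M)), M)"
  by (simp add: wpb_def)

section \<open>The representation in memory\<close>

abbreviation fl :: "nat \<Rightarrow> nat" where "fl \<equiv> floor_log"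

lemma fl_mono: "a \<le> b \<Longrightarrow> fl a \<le> fl b" by (rule floor_log_le_iff)

lemma fl_ge: "2 ^ k \<le> n \<Longrightarrow> k \<le> fl n"
  using fl_mono[of "2 ^ k" n] by simp

text \<open>The least power of 2 whose logarithm, times 50, is at least the depth. It serves to compare
  depths with logarithms of distances in constant time.\<close>

definition thr :: "tree \<Rightarrow> nat" where "thr T = 2 ^ ((dep T + 49) div 50)"

text \<open>The memory has a header of 20 cells, then records of 15 cells for the distinct subtrees,
  and from \<open>bs\<close> on three work areas of \<open>cap\<close> cells each, whose addresses
  are stored in cells 17 to 19. The zero in cell 0 marks the compressed representation.\<close>

locale mem =
  fixes w :: nat and t :: tree and ad :: "tree \<Rightarrow> nat" and M0 :: "nat list" and bs cap :: nat
  assumes len: "length M0 = bs + 3 * cap" and lenw: "bs + 3 * cap < 2 ^ w"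
    and bs35: "35 \<le> bs"
    and ad: "\<And>T. T \<in> subs t \<Longrightarrow> 20 \<le> ad T \<and> ad T + 15 \<le> bs"
    and m_sz: "\<And>T. T \<in> subs t \<Longrightarrow> M0 ! ad T = sz T"
    and m_c0: "\<And>l r. Nd l r \<in> subs t \<Longrightarrow> M0 ! (ad (Nd l r) + 1) = ad l"
    and m_c1: "\<And>l r. Nd l r \<in> subs t \<Longrightarrow> M0 ! (ad (Nd l r) + 2) = ad r"
    and m_lf: "\<And>a. Lf a \<in> subs t \<Longrightarrow> M0 ! (ad (Lf a) + 1) = 0"
    and m_ch: "\<And>a. Lf a \<in> subs t \<Longrightarrow> M0 ! (ad (Lf a) + 3) = a"
    and m_thr: "\<And>T. T \<in> subs t \<Longrightarrow> M0 ! (ad T + 4) = thr T"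
    and hdr: "M0 ! 0 = 0" "M0 ! 15 = ad t" "M0 ! 17 = bs" "M0 ! 18 = bs + cap" "M0 ! 19 = bs + 2 * cap"
    and szw: "sz t < 2 ^ w"
    and dep_le: "\<And>T. T \<in> subs t \<Longrightarrow> dep T \<le> 50 * fl (sz T)"
    and cap: "10 * dep t + 20 \<le> cap"
begin

definition okM :: "nat list \<Rightarrow> bool" where
  "okM M \<longleftrightarrow> length M = bs + 3 * cap \<and> (\<forall>a<bs. M ! a = M0 ! a)"

lemma okM_M0: "okM M0" by (simp add: okM_def len)

lemma okM_len: "okM M \<Longrightarrow> length M = bs + 3 * cap" by (simp add: okM_def)

lemma okM_upd: "okM M \<Longrightarrow> bs \<le> a \<Longrightarrow> okM (M[a := x])" by (simp add: okM_def)

lemma sub_Nd: "Nd l r \<in> subs t \<Longrightarrow> l \<in> subs t \<and> r \<in> subs t"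
  using subs_trans[of "Nd l r" t] by auto

lemma rec_sz: "okM M \<Longrightarrow> T \<in> subs t \<Longrightarrow> M ! ad T = sz T" using ad[of T] m_sz by (simp add: okM_def)
lemma rec_c0: "okM M \<Longrightarrow> Nd l r \<in> subs t \<Longrightarrow> M ! Suc (ad (Nd l r)) = ad l" using ad[of "Nd l r"] m_c0[of l r] by (simp add: okM_def)
lemma rec_c1: "okM M \<Longrightarrow> Nd l r \<in> subs t \<Longrightarrow> M ! Suc (Suc (ad (Nd l r))) = ad r" using ad[of "Nd l r"] m_c1[of l r] by (simp add: okM_def)
lemma rec_lf: "okM M \<Longrightarrow> Lf a \<in> subs t \<Longrightarrow> M ! Suc (ad (Lf a)) = 0" using ad[of "Lf a"] m_lf[of a] by (simp add: okM_def)
lemma rec_ch: "okM M \<Longrightarrow> Lf a \<in> subs t \<Longrightarrow> M ! (ad (Lf a) + 3) = a" using ad[of "Lf a"] m_ch[of a] by (simp add: okM_def)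
lemma rec_thr: "okM M \<Longrightarrow> T \<in> subs t \<Longrightarrow> M ! (ad T + 4) = thr T" using ad[of T] m_thr by (simp add: okM_def)
lemma rec_hdr: "okM M \<Longrightarrow> M ! 15 = ad t \<and> M ! 17 = bs \<and> M ! 18 = bs + cap \<and> M ! 19 = bs + 2 * cap \<and> M ! 0 = 0"
  using hdr bs35 by (simp add: okM_def)

lemma leaf_test: "okM M \<Longrightarrow> T \<in> subs t \<Longrightarrow> M ! Suc (ad T) = 0 \<longleftrightarrow> (\<exists>a. T = Lf a)"
proof (cases T)
  case (Nd l r)
  assume a: "okM M" "T \<in> subs t"
  have "M ! Suc (ad T) = ad l" unfolding Nd using rec_c0[OF a(1) a(2)[unfolded Nd]] .
  moreover have "l \<in> subs t" using sub_Nd[OF a(2)[unfolded Nd]] by blast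
  then have "20 \<le> ad l" using ad[of l] by blast
  ultimately show ?thesis using Nd by simp
qed (simp add: rec_lf)

lemma sz_w: "T \<in> subs t \<Longrightarrow> sz T < 2 ^ w" using sz_subs[of T t] szw by linarith

end

section \<open>The static structure\<close>

definition wd :: "nat \<Rightarrow> tree \<Rightarrow> nat list" where
  "wd d T = (if d = 0 then yl T else rev (yl T))"

abbreviation cat :: "nat \<Rightarrow> tree list \<Rightarrow> nat list" where "cat d Ts \<equiv> concat (map (wd d) Ts)"

text \<open>Both directions include position \<open>f\<close> itself, so that distances from the
  finger start at 0 on either side.\<close>

definition Sd :: "nat \<Rightarrow> nat \<Rightarrow> nat list \<Rightarrow> nat list" where
  "Sd d f S = (if d = 0 then drop f S else rev (take (Suc f) S))"

definition noff :: "nat \<Rightarrow> nat \<Rightarrow> tree \<Rightarrow> nat" where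
  "noff d k T = (if d = 0 then k else sz T - 1 - k)"

lemma length_wd [simp]: "length (wd d T) = sz T" by (simp add: wd_def length_yl)

lemma Sd_wd: "f < sz T \<Longrightarrow> Sd d f (yl T) = drop (noff d f T) (wd d T)"
  by (simp add: Sd_def noff_def wd_def rev_take length_yl)

lemma desc_left: "k < sz l \<Longrightarrow> drop (noff d k (Nd l r)) (wd d (Nd l r)) = drop (noff d k l) (wd d l) @ (if d = 0 then wd d r else [])"
  by (simp add: noff_def wd_def length_yl)

lemma desc_right: "sz l \<le> k \<Longrightarrow> k < sz l + sz r \<Longrightarrow>
   drop (noff d k (Nd l r)) (wd d (Nd l r)) = drop (noff d (k - sz l) r) (wd d r) @ (if d = 0 then [] else wd d l)"
  by (auto simp: noff_def wd_def length_yl add.commute)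

abbreviation (input) "rF \<equiv> 17::nat" abbreviation (input) "rD \<equiv> 2::nat" abbreviation (input) "rA \<equiv> 3::nat" abbreviation (input) "rO \<equiv> 4::nat"
abbreviation (input) "rSp \<equiv> 5::nat" abbreviation (input) "rStk \<equiv> 6::nat" abbreviation (input) "rL \<equiv> 7::nat" abbreviation (input) "rR \<equiv> 8::nat"
abbreviation (input) "rN \<equiv> 9::nat" abbreviation (input) "rB \<equiv> 10::nat" abbreviation (input) "rCnt \<equiv> 11::nat" abbreviation (input) "rDl \<equiv> 12::nat"
abbreviation (input) "rTh \<equiv> 13::nat" abbreviation (input) "rLo \<equiv> 14::nat" abbreviation (input) "rHi \<equiv> 15::nat" abbreviation (input) "rMid \<equiv> 16::nat"

section \<open>Descent to the finger\<close>

definition "sDesc = Wh (C 0 \<^bold>< Ld (V rA \<^bold>+ C 1))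
  (rL ::= Ld (V rA \<^bold>+ C 1) ;; rR ::= Ld (V rA \<^bold>+ C 2) ;; rN ::= Ld (V rL) ;;
   IfC (V rO \<^bold>< V rN)
    (rA ::= V rL ;; IfC (V rD) Skip (St (V rStk \<^bold>+ V rSp) (V rR) ;; rSp ::= V rSp \<^bold>+ C 1))
    (rO ::= V rO \<^bold>- V rN ;; rA ::= V rR ;;
     IfC (V rD) (St (V rStk \<^bold>+ V rSp) (V rL) ;; rSp ::= V rSp \<^bold>+ C 1) Skip))"

context mem begin

definition stk :: "tree list \<Rightarrow> nat list \<Rightarrow> bool" where
  "stk Ys M \<longleftrightarrow> set Ys \<subseteq> subs t \<and> (\<forall>k<length Ys. M ! (bs + k) = ad (Ys ! k))"

lemma stk_push: "stk Ys M \<Longrightarrow> Y \<in> subs t \<Longrightarrow> length M > bs + length Ys \<Longrightarrow> stk (Ys @ [Y]) (M[bs + length Ys := ad Y])"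
  unfolding stk_def by (auto simp: nth_append less_Suc_eq)

text \<open>The stack area below \<open>bs + cap\<close> is exempt, since both directions use it in
  turn.\<close>

definition outside :: "nat \<Rightarrow> nat list \<Rightarrow> nat list \<Rightarrow> bool" where
  "outside d M M' \<longleftrightarrow> (\<forall>a<bs + 3 * cap. bs + cap \<le> a \<longrightarrow> (a < bs + (1 + d) * cap \<or> bs + (2 + d) * cap \<le> a) \<longrightarrow> M' ! a = M ! a)"

lemma outside_refl [simp]: "outside d M M" by (simp add: outside_def)

lemma outside_upd1: "outside d M M' \<Longrightarrow> a < bs + cap \<Longrightarrow> outside d M (M'[a := x])"
  unfolding outside_def by auto

lemma outside_upd2: "outside d M M' \<Longrightarrow> bs + (1 + d) * cap \<le> a \<Longrightarrow> a < bs + (2 + d) * cap \<Longrightarrow> outside d M (M'[a := x])"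
  unfolding outside_def by auto

definition dInv :: "nat \<Rightarrow> nat \<Rightarrow> nat list \<Rightarrow> tree \<times> tree list \<Rightarrow> ram_state \<Rightarrow> bool" where
  "dInv d f M1 x s \<longleftrightarrow> (case x of (T, Ys) \<Rightarrow> case s of (R, M) \<Rightarrow> T \<in> subs t \<and> okM M \<and> R rA = ad T \<and> R rO < sz T \<and> R rSp = length Ys \<and>
     R rD = d \<and> R rStk = bs \<and> R rF = f \<and> stk Ys M \<and> outside d M1 M \<and> length Ys + dep T \<le> dep t \<and>
     Sd d f (yl t) = drop (noff d (R rO) T) (wd d T) @ cat d (rev Ys))"

lemma sDesc_wp:
  assumes "dInv d f M1 (T0, Ys0) (R0, M0')" "d \<le> 1"
    and Q: "\<And>k a Ys R M. dInv d f M1 (Lf a, Ys) (R, M) \<Longrightarrow> k \<le> 70 * dep T0 + 70 \<Longrightarrow> Q k (R, M)"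
  shows "wp w sDesc Q (R0, M0')"
  unfolding sDesc_def
proof (rule wp_While[where I = "dInv d f M1" and pot = "\<lambda>(T, Ys). 60 * dep T", OF assms(1)])
  fix x R M assume I: "dInv d f M1 x (R, M)"
  obtain T Ys where x: "x = (T, Ys)" by fastforce
  have T: "T \<in> subs t" "okM M" "R rA = ad T" "R rO < sz T" "R rSp = length Ys" "R rD = d" "R rStk = bs" "R rF = f"
    "stk Ys M" "outside d M1 M" "length Ys + dep T \<le> dep t" "Sd d f (yl t) = drop (noff d (R rO) T) (wd d T) @ cat d (rev Ys)"
    using I unfolding dInv_def x by auto
  note base = ad[OF T(1)] lenw bs35 okM_len[OF T(2)]
  show "dfd w (C 0 \<^bold>< Ld (V rA \<^bold>+ C 1)) (R, M)" using base by (simp add: T(3))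
  {
    assume "val (C 0 \<^bold>< Ld (V rA \<^bold>+ C 1)) (R, M) \<noteq> 0"
    then obtain l r where lr: "T = Nd l r" using T(1-3) rec_lf by (cases T) (auto split: if_splits)
    have ll: "l \<in> subs t" and rr: "r \<in> subs t" using sub_Nd[OF T(1)[unfolded lr]] by auto
    have c: "M ! Suc (ad T) = ad l" "M ! Suc (Suc (ad T)) = ad r" "M ! ad l = sz l"
      using rec_c0[OF T(2)] rec_c1[OF T(2)] rec_sz[OF T(2)] T(1) ll lr by auto
    have d1: "dep l < dep T" "dep r < dep T" using lr by auto
    note base2 = base ad[OF ll] ad[OF rr] sz_w[OF ll] sz_w[OF T(1)] d1 T(11) cap T(4)
    define y where "y = (if R rO < sz l then (l, if d = 0 then Ys @ [r] else Ys) else (r, if d = 0 then Ys else Ys @ [l]))"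
    have up: "okM (M[bs + length Ys := v])" "outside d M1 (M[bs + length Ys := v])" for v
      using base2 T by (simp_all add: okM_upd outside_upd1)
    have sp: "stk (Ys @ [r]) (M[bs + length Ys := ad r])" "stk (Ys @ [l]) (M[bs + length Ys := ad l])"
      using base2 by (simp_all add: stk_push[OF T(9) ll] stk_push[OF T(9) rr])
    have o: "R rO < 2 ^ w" "\<not> R rO < sz l \<Longrightarrow> R rO - sz l < sz r" using base2 lr by auto
    have up0: "d = 0 \<Longrightarrow> outside 0 M1 (M[bs + length Ys := v])" "d = 0 \<Longrightarrow> outside 0 M1 M" for v
      using up T(10) by auto
    have "wp w (rL ::= Ld (V rA \<^bold>+ C 1) ;; rR ::= Ld (V rA \<^bold>+ C 2) ;; rN ::= Ld (V rL) ;;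
      IfC (V rO \<^bold>< V rN)
      (rA ::= V rL ;; IfC (V rD) Skip (St (V rStk \<^bold>+ V rSp) (V rR) ;; rSp ::= V rSp \<^bold>+ C 1))
      (rO ::= V rO \<^bold>- V rN ;; rA ::= V rR ;;
       IfC (V rD) (St (V rStk \<^bold>+ V rSp) (V rL) ;; rSp ::= V rSp \<^bold>+ C 1) Skip))
      (\<lambda>k s'. dInv d f M1 y s' \<and> k \<le> 45) (R, M)"
      using base2 T(4,11)[unfolded lr]
      by (simp add: dInv_def y_def T(2-10) T(12)[unfolded lr] c up up0 o sp desc_left desc_right ll rr)
    moreover have "(case y of (T, Ys) \<Rightarrow> 60 * dep T) + 60 \<le> 60 * dep T" using d1 by (auto simp: y_def)
    ultimately show "wp w (rL ::= Ld (V rA \<^bold>+ C 1) ;; rR ::= Ld (V rA \<^bold>+ C 2) ;; rN ::= Ld (V rL) ;;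
      IfC (V rO \<^bold>< V rN)
      (rA ::= V rL ;; IfC (V rD) Skip (St (V rStk \<^bold>+ V rSp) (V rR) ;; rSp ::= V rSp \<^bold>+ C 1))
      (rO ::= V rO \<^bold>- V rN ;; rA ::= V rR ;;
       IfC (V rD) (St (V rStk \<^bold>+ V rSp) (V rL) ;; rSp ::= V rSp \<^bold>+ C 1) Skip))
      (\<lambda>k s'. \<exists>y. dInv d f M1 y s' \<and> k + cost (C 0 \<^bold>< Ld (V rA \<^bold>+ C 1)) + 2 + (case y of (T, Ys) \<Rightarrow> 60 * dep T) \<le>
        (case x of (T, Ys) \<Rightarrow> 60 * dep T)) (R, M)"
      by (elim wp_mono) (intro exI[of _ y], simp add: x)
  }
next
  fix k y R M assume I: "dInv d f M1 y (R, M)" "val (C 0 \<^bold>< Ld (V rA \<^bold>+ C 1)) (R, M) = 0"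
    "k + (case y of (T, Ys) \<Rightarrow> 60 * dep T) \<le> (case (T0, Ys0) of (T, Ys) \<Rightarrow> 60 * dep T) + cost (C 0 \<^bold>< Ld (V rA \<^bold>+ C 1)) + 1"
  obtain T Ys where y: "y = (T, Ys)" by fastforce
  have T: "T \<in> subs t" "okM M" "R rA = ad T" using I(1) unfolding dInv_def y by auto
  have "M ! Suc (ad T) = 0" using I(2) T(3) by (simp split: if_split_asm)
  then obtain a where a: "T = Lf a" using leaf_test[OF T(2,1)] by blast
  show "Q k (R, M)" using I(1,3) unfolding y a by (intro Q) auto
qed

end

lemma (in mem) sDesc_wpb:
  assumes "dInv d f M1 (T0, Ys0) (R0, M0')" "d \<le> 1"
  shows "wpb w sDesc (70 * dep T0 + 70) (\<lambda>(R, M). \<exists>a Ys. dInv d f M1 (Lf a, Ys) (R, M)) (R0, M0')"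
  unfolding wpb_def by (rule sDesc_wp[OF assms]) blast

text \<open>Potential of the pending trees, the first of which starts at distance \<open>dl\<close>:
  one unit for its output and two for each level by which it is too deep for its distance.\<close>

fun Fp :: "tree list \<Rightarrow> nat \<Rightarrow> nat" where
  "Fp [] dl = 0"
| "Fp (Y # zs) dl = 1 + 2 * (dep Y - 50 * fl dl) + Fp zs (dl + sz Y)"

lemma Fp_length: "length zs \<le> Fp zs dl"
  by (induction zs dl rule: Fp.induct) auto

text \<open>The excess depths telescope: what lies behind \<open>Y\<close> is at distance at least
  \<open>sz Y\<close>, and there a depth of \<open>dep Y\<close> is already permitted.\<close>

lemma Fp_init:
  "(\<forall>Y\<in>set zs. dep Y \<le> mx \<and> dep Y \<le> 50 * fl (sz Y)) \<Longrightarrow> Fp zs dl \<le> length zs + 2 * (mx - 50 * fl dl)"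
proof (induction zs dl rule: Fp.induct)
  case (2 Y zs dl)
  have "Fp zs (dl + sz Y) \<le> length zs + 2 * (mx - 50 * fl (dl + sz Y))" using 2 by auto
  moreover have "fl dl \<le> fl (dl + sz Y)" "fl (sz Y) \<le> fl (dl + sz Y)" by (auto intro: fl_mono)
  moreover have "dep Y \<le> mx" "dep Y \<le> 50 * fl (sz Y)" using 2 by auto
  ultimately show ?case by simp
qed simp

text \<open>A split loses one level, worth two units: one is for the additional tree, the other for
  the work of splitting. The excesses of the two parts do not add up, again because the far part
  starts behind the near one.\<close>

lemma Fp_expand:
  assumes "dep n < dep Y" "dep m < dep Y" "dep n \<le> 50 * fl (sz n)" "50 * fl dl < dep Y" "sz Y = sz n + sz m"
  shows "Suc (Fp (n # m # zs) dl) \<le> Fp (Y # zs) dl"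
proof -
  have "fl dl \<le> fl (dl + sz n)" "fl (sz n) \<le> fl (dl + sz n)" by (auto intro: fl_mono)
  then show ?thesis using assms by (simp add: add.assoc)
qed

lemma thr_less: "1 \<le> dl \<Longrightarrow> dl < thr T \<longleftrightarrow> 50 * fl dl < dep T"
proof -
  assume dl: "1 \<le> dl"
  have "thr T \<le> dl \<longleftrightarrow> (dep T + 49) div 50 \<le> fl dl"
  proof
    assume "(dep T + 49) div 50 \<le> fl dl"
    then have "thr T \<le> 2 ^ fl dl" unfolding thr_def by (intro power_increasing) auto
    then show "thr T \<le> dl" using floor_log_exp2_le[of dl] dl by simp
  qed (auto simp: thr_def intro: fl_ge)
  then show ?thesis by (auto simp: not_le[symmetric])
qed

definition esum :: "(nat \<times> tree) list \<Rightarrow> nat" where "esum es = sum_list (map (sz \<circ> snd) es)"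

text \<open>Since \<open>fl 0 = 0\<close>, the first entry must have depth 0: it is the leaf at the
  finger.\<close>

definition good :: "(nat \<times> tree) list \<Rightarrow> bool" where
  "good es \<longleftrightarrow> (\<forall>k<length es. fst (es ! k) = esum (take k es) \<and> dep (snd (es ! k)) \<le> 50 * fl (fst (es ! k)))"

lemma esum_append [simp]: "esum (es @ es') = esum es + esum es'" by (simp add: esum_def)
lemma esum_single [simp]: "esum [p] = sz (snd p)" "esum [] = 0" by (simp_all add: esum_def)

lemma good_append: "good es \<Longrightarrow> dep Y \<le> 50 * fl (esum es) \<Longrightarrow> good (es @ [(esum es, Y)])"
  unfolding good_def by (auto simp: nth_append less_Suc_eq)

definition near :: "nat \<Rightarrow> tree \<Rightarrow> tree \<Rightarrow> tree" where "near d l r = (if d = 0 then l else r)"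
definition far :: "nat \<Rightarrow> tree \<Rightarrow> tree \<Rightarrow> tree" where "far d l r = (if d = 0 then r else l)"

lemma wd_nf: "wd d (Nd l r) = wd d (near d l r) @ wd d (far d l r)" by (simp add: wd_def near_def far_def)
lemma sz_nf: "sz (Nd l r) = sz (near d l r) + sz (far d l r)" by (simp add: near_def far_def)
lemma dep_nf: "dep (near d l r) < dep (Nd l r)" "dep (far d l r) < dep (Nd l r)" by (auto simp: near_def far_def)

definition "sGBody =
  (rSp ::= V rSp \<^bold>- C 1 ;; rA ::= Ld (V rStk \<^bold>+ V rSp) ;; rTh ::= Ld (V rA \<^bold>+ C 4) ;;
   IfC (V rDl \<^bold>< V rTh)
    (rL ::= Ld (V rA \<^bold>+ C 2 \<^bold>- V rD) ;; rR ::= Ld (V rA \<^bold>+ C 1 \<^bold>+ V rD) ;;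
     St (V rStk \<^bold>+ V rSp) (V rL) ;; rSp ::= V rSp \<^bold>+ C 1 ;; St (V rStk \<^bold>+ V rSp) (V rR) ;; rSp ::= V rSp \<^bold>+ C 1)
    (rN ::= Ld (V rA) ;; St (V rB \<^bold>+ C 1 \<^bold>+ V rCnt \<^bold>+ V rCnt) (V rDl) ;;
     St (V rB \<^bold>+ C 2 \<^bold>+ V rCnt \<^bold>+ V rCnt) (V rA) ;; rCnt ::= V rCnt \<^bold>+ C 1 ;; rDl ::= V rDl \<^bold>+ V rN))"

definition "sGreedy = Wh (C 0 \<^bold>< V rSp) sGBody"

context mem begin

text \<open>The addresses of the two children lie in adjacent cells, so the direction enters as an
  offset and one program handles both sides.\<close>

lemma near_far: 
  assumes "okM M" "Nd l r \<in> subs t" "d \<le> 1"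
  shows "M ! (Suc (Suc (ad (Nd l r))) - d) = ad (far d l r)" "M ! (Suc (ad (Nd l r) + d)) = ad (near d l r)"
    "near d l r \<in> subs t" "far d l r \<in> subs t"
proof -
  have d: "d = 0 \<or> d = 1" using assms(3) by linarith
  note * = rec_c0[OF assms(1,2)] rec_c1[OF assms(1,2)]
  show "M ! (Suc (Suc (ad (Nd l r))) - d) = ad (far d l r)" "M ! (Suc (ad (Nd l r) + d)) = ad (near d l r)"
    using d by (rule disjE; simp add: near_def far_def *)+
  show "near d l r \<in> subs t" "far d l r \<in> subs t"
    using sub_Nd[OF assms(2)] by (simp_all add: near_def far_def)
qed

definition ent :: "nat \<Rightarrow> (nat \<times> tree) list \<Rightarrow> nat list \<Rightarrow> bool" where
  "ent b es M \<longleftrightarrow> snd ` set es \<subseteq> subs t \<and>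
     (\<forall>k<length es. M ! Suc (b + k + k) = fst (es ! k) \<and> M ! Suc (Suc (b + k + k)) = ad (snd (es ! k)))"

lemma ent_append: "ent b es M \<Longrightarrow> Y \<in> subs t \<Longrightarrow> Suc (Suc (b + length es + length es)) < length M \<Longrightarrow>
   ent b (es @ [(v, Y)]) (M[Suc (b + length es + length es) := v, Suc (Suc (b + length es + length es)) := ad Y])"
  unfolding ent_def by (auto simp: nth_append nth_list_update less_Suc_eq)

lemma ent_upd: "ent b es M \<Longrightarrow> a \<le> b \<Longrightarrow> ent b es (M[a := x])"
  unfolding ent_def by auto

lemma stk_upd: "stk Ys M \<Longrightarrow> bs + length Ys \<le> a \<Longrightarrow> stk Ys (M[a := x])"
  unfolding stk_def by auto

lemma stk_pop: "stk (rev (Y # zs)) M \<Longrightarrow> stk (rev zs) M \<and> M ! (bs + length zs) = ad Y \<and> Y \<in> subs t"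
  unfolding stk_def by (auto simp: nth_append less_Suc_eq)

definition gInv :: "nat \<Rightarrow> nat \<Rightarrow> nat \<Rightarrow> nat list \<Rightarrow> tree list \<times> (nat \<times> tree) list \<Rightarrow> ram_state \<Rightarrow> bool" where
  "gInv d f b M1 x s \<longleftrightarrow> (case x of (zs, es) \<Rightarrow> case s of (R, M) \<Rightarrow> okM M \<and> R rSp = length zs \<and> R rD = d \<and> R rStk = bs \<and>
     R rF = f \<and> R rB = b \<and> R rCnt = length es \<and> R rDl = esum es \<and> stk (rev zs) M \<and> outside d M1 M \<and> ent b es M \<and> good es \<and>
     1 \<le> esum es \<and> Sd d f (yl t) = cat d (map snd es) @ cat d zs \<and> length es + Fp zs (esum es) \<le> 3 * dep t + 1)"

lemma sGreedy_wp:
  assumes "gInv d f b M1 (zs0, es0) (R0, M0')" "d \<le> 1" and b: "b = bs + (1 + d) * cap" and f: "f < sz t"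
    and Q: "\<And>k es R M. gInv d f b M1 ([], es) (R, M) \<Longrightarrow> k \<le> 80 * Fp zs0 (esum es0) + 10 \<Longrightarrow> Q k (R, M)"
  shows "wp w sGreedy Q (R0, M0')"
  unfolding sGreedy_def
proof (rule wp_While[where I = "gInv d f b M1" and pot = "\<lambda>(zs, es). 80 * Fp zs (esum es)", OF assms(1)])
  fix x R M assume I: "gInv d f b M1 x (R, M)"
  show "dfd w (C 0 \<^bold>< V rSp) (R, M)" by simp
  assume "val (C 0 \<^bold>< V rSp) (R, M) \<noteq> 0"
  then obtain Y zs es where x: "x = (Y # zs, es)" using I by (cases x; cases "fst x") (auto simp: gInv_def)
  have T: "okM M" "R rSp = Suc (length zs)" "R rD = d" "R rStk = bs" "R rF = f" "R rB = b" "R rCnt = length es"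
    "R rDl = esum es" "stk (rev (Y # zs)) M" "outside d M1 M" "ent b es M" "good es" "1 \<le> esum es"
    "Sd d f (yl t) = cat d (map snd es) @ cat d (Y # zs)" "length es + Fp (Y # zs) (esum es) \<le> 3 * dep t + 1"
    using I unfolding gInv_def x by auto
  have Y: "Y \<in> subs t" "stk (rev zs) M" "M ! (bs + length zs) = ad Y" using stk_pop[OF T(9)] by auto
  have lb: "bs + cap \<le> b" "b + cap \<le> bs + 3 * cap" using b assms(2) by (cases d; simp)+
  have ln: "length es + length (Y # zs) \<le> 3 * dep t + 1" using Fp_length[of "Y # zs" "esum es"] T(15) by linarith
  have lenS: "length (Sd d f (yl t)) \<le> sz t" using f by (auto simp: Sd_def length_yl)
  have lcat: "length (cat d (map snd es)) = esum es" for es by (induction es) (auto simp: esum_def)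
  have es1: "esum es + sz Y < 2 ^ w" using lenS T(14) lcat[of es] szw by auto
  note base = ad[OF Y(1)] lenw bs35 okM_len[OF T(1)] lb ln cap es1 rec_sz[OF T(1) Y(1)] rec_thr[OF T(1) Y(1)] assms(2)
  define m where "m = bs + length zs"
  have up: "okM (M[m := u, Suc m := v])" "outside d M1 (M[m := u, Suc m := v])" "ent b es (M[m := u, Suc m := v])" for u v
    using base T(1,10,11) by (simp_all add: m_def okM_upd outside_upd1 ent_upd)
  have mm: "M ! m = ad Y" "Suc m < bs + 3 * cap" using Y(3) base by (simp_all add: m_def)
  define q where "q = b + length es + length es"
  have qq: "Suc (Suc q) < bs + 3 * cap" using base by (simp add: q_def)
  have up2: "okM (M[Suc q := u, Suc (Suc q) := v])" "outside d M1 (M[Suc q := u, Suc (Suc q) := v])"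
      "stk (rev zs) (M[Suc q := u, Suc (Suc q) := v])" for u v
    using base T(1,10) Y b by (simp_all add: q_def okM_upd outside_upd2 stk_upd)
  have en: "ent b (es @ [(esum es, Y)]) (M[Suc q := esum es, Suc (Suc q) := ad Y])"
    using ent_append[OF T(11) Y(1)] base by (simp add: q_def)
  have tl: "esum es < thr Y \<longleftrightarrow> 50 * fl (esum es) < dep Y" using thr_less[OF T(13)] .
  show "wp w sGBody (\<lambda>k s'. \<exists>y. gInv d f b M1 y s' \<and> k + cost (C 0 \<^bold>< V rSp) + 2 + (case y of (zs, es) \<Rightarrow> 80 * Fp zs (esum es)) \<le>
        (case x of (zs, es) \<Rightarrow> 80 * Fp zs (esum es))) (R, M)"
  proof (cases "esum es < thr Y")
    case True
    then obtain l r where lr: "Y = Nd l r" using tl by (cases Y) auto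
    define n where "n = near d l r"
    define p where "p = far d l r"
    have nf: "M ! (Suc (Suc (ad Y)) - d) = ad p" "M ! (Suc (ad Y + d)) = ad n" "n \<in> subs t" "p \<in> subs t"
      using near_far[OF T(1) Y(1)[unfolded lr] assms(2)] by (simp_all add: n_def p_def lr)
    \<comment> \<open>The far part goes below the near one on the stack, as the near one must be
      treated next.\<close>
    have sx: "stk (rev (n # p # zs)) (M[m := ad p, Suc m := ad n])"
      using stk_push[OF stk_push[OF Y(2) nf(4)] nf(3)] base by (simp add: m_def)
    have ex: "Suc (Fp (n # p # zs) (esum es)) \<le> Fp (Y # zs) (esum es)"
      using dep_nf[of d l r] dep_le[OF nf(3)] True tl sz_nf[of l r d] lr by (intro Fp_expand) (auto simp: n_def p_def)
    have w: "wd d Y = wd d n @ wd d p" unfolding lr n_def p_def by (rule wd_nf)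
    have aux: "Suc (Suc (ad Y)) - d < bs + 3 * cap" using base by linarith
    have "wp w sGBody (\<lambda>k s'. gInv d f b M1 (n # p # zs, es) s' \<and> k \<le> 60) (R, M)"
      unfolding sGBody_def using base ex T(13,15) mm(2)
      by (simp add: gInv_def T(1-12) T(14) Y(1,2) mm(1) m_def[symmetric] nf True aux up sx w del: rev.simps Fp.simps)
    then show ?thesis by (rule wp_mono) (rule exI[of _ "(n # p # zs, es)"], use ex in \<open>simp add: x del: Fp.simps\<close>)
  next
    case False
    have gd: "good (es @ [(esum es, Y)])" using good_append[OF T(12)] False tl by simp
    have "wp w sGBody (\<lambda>k s'. gInv d f b M1 (zs, es @ [(esum es, Y)]) s' \<and> k \<le> 60) (R, M)"
      unfolding sGBody_def using base T(13) T(15) qq mm(2)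
      by (simp add: gInv_def T(1-12) T(14) Y(1,2) mm(1) m_def[symmetric] q_def[symmetric] False up2 en gd)
    then show ?thesis by (rule wp_mono) (rule exI[of _ "(zs, es @ [(esum es, Y)])"], simp add: x)
  qed
next
  fix k y R M assume I: "gInv d f b M1 y (R, M)" "val (C 0 \<^bold>< V rSp) (R, M) = 0"
    "k + (case y of (zs, es) \<Rightarrow> 80 * Fp zs (esum es)) \<le> (case (zs0, es0) of (zs, es) \<Rightarrow> 80 * Fp zs (esum es)) + cost (C 0 \<^bold>< V rSp) + 1"
  then obtain es where "y = ([], es)" by (cases y; cases "fst y") (auto simp: gInv_def split: if_splits)
  then show "Q k (R, M)" using I(1,3) by (intro Q) auto
qed

end

definition "sPre = (rA ::= Ld (C 15) ;; rO ::= V rF ;; rSp ::= C 0 ;; rStk ::= Ld (C 17))"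
definition "sMid = (rB ::= Ld (C 18 \<^bold>+ V rD) ;; St (V rB \<^bold>+ C 1) (C 0) ;; St (V rB \<^bold>+ C 2) (V rA) ;; rCnt ::= C 1 ;; rDl ::= C 1)"
definition "sHalf = (sPre ;; sDesc ;; sMid ;; sGreedy ;; St (V rB) (V rCnt))"

definition "sSet = (rF ::= V 0 ;; rD ::= C 0 ;; sHalf ;; rD ::= C 1 ;; sHalf)"

context mem begin

definition lv :: "nat \<Rightarrow> nat \<Rightarrow> nat list \<Rightarrow> bool" where
  "lv d f M \<longleftrightarrow> (\<exists>es. M ! (bs + (1 + d) * cap) = length es \<and> ent (bs + (1 + d) * cap) es M \<and> good es \<and> es \<noteq> [] \<and>
     Sd d f (yl t) = cat d (map snd es) \<and> 2 * length es + 3 \<le> cap)"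

text \<open>The second half of \<open>sSet\<close> runs when the first list is already in place; the
  lists lie in different areas, each of at most \<open>cap\<close> cells.\<close>

lemma lv_outside:
  assumes "lv d f M" "outside d' M M'" "d \<le> 1" "d' \<le> 1" "d \<noteq> d'"
  shows "lv d f M'"
proof -
  obtain es where es: "M ! (bs + (1 + d) * cap) = length es" "ent (bs + (1 + d) * cap) es M" "good es" "es \<noteq> []"
     "Sd d f (yl t) = cat d (map snd es)" "2 * length es + 3 \<le> cap" using assms(1) unfolding lv_def by blast
  define b where "b = bs + (1 + d) * cap"
  have cases: "d = 0 \<and> d' = 1 \<or> d = 1 \<and> d' = 0" using assms by auto
  have eq: "M' ! (b + k) = M ! (b + k)" if "k < cap" for k
  proof -
    have "b + k < bs + 3 * cap" "bs + cap \<le> b + k" "b + k < bs + (1 + d') * cap \<or> bs + (2 + d') * cap \<le> b + k"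
      using cases that by (auto simp: b_def)
    then show ?thesis using assms(2) unfolding outside_def by blast
  qed
  have "M' ! b = length es" using eq[of 0] es(1,6) by (simp add: b_def)
  moreover have "ent b es M'" unfolding ent_def
  proof (intro conjI allI impI)
    show "snd ` set es \<subseteq> subs t" using es(2) unfolding ent_def by blast
    fix k assume k: "k < length es"
    have "M ! Suc (b + k + k) = fst (es ! k)" "M ! Suc (Suc (b + k + k)) = ad (snd (es ! k))"
      using es(2) k unfolding ent_def b_def by blast+
    moreover have "Suc (k + k) < cap" "Suc (Suc (k + k)) < cap" using k es(6) by auto
    ultimately show "M' ! Suc (b + k + k) = fst (es ! k)" "M' ! Suc (Suc (b + k + k)) = ad (snd (es ! k))"
      using eq[of "Suc (k + k)"] eq[of "Suc (Suc (k + k))"] by (simp_all add: add.assoc)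
  qed
  ultimately show ?thesis using es unfolding lv_def b_def by blast
qed

lemma sGreedy_wpb:
  assumes "gInv d f b M1 (zs0, es0) (R0, M0')" "d \<le> 1" "b = bs + (1 + d) * cap" "f < sz t"
  shows "wpb w sGreedy (80 * Fp zs0 (esum es0) + 10) (\<lambda>(R, M). \<exists>es. gInv d f b M1 ([], es) (R, M)) (R0, M0')"
  unfolding wpb_def by (rule sGreedy_wp[OF assms]) blast

lemma sHalf_wpb:
  assumes M: "okM M" "R rD = d" "R rF = f" "d \<le> 1" "f < sz t"
  shows "wpb w sHalf (400 * dep t + 400) (\<lambda>(R', M'). okM M' \<and> outside d M M' \<and> lv d f M' \<and> R' rF = f) (R, M)"
    (is "wpb w sHalf _ ?P _")
proof -
  define b where "b = bs + (1 + d) * cap"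
  have lb: "bs + cap \<le> b" "b + cap \<le> bs + 3 * cap" using b_def M(4) by (cases d; simp)+
  have hd: "M ! 15 = ad t" "M ! 17 = bs" using rec_hdr[OF M(1)] by auto
  have b18: "M' ! (18 + d) = b" if "okM M'" for M'
  proof -
    have "d = 0 \<or> d = 1" using M(4) by auto
    then show ?thesis using rec_hdr[OF that] by (auto simp: b_def)
  qed
  have tt: "t \<in> subs t" by simp
  note base = lenw bs35 okM_len[OF M(1)] ad[OF tt] lb cap
  have fin: "wpb w (St (V rB) (V rCnt)) 10 ?P (R4, M4)" if I4: "gInv d f b M ([], es) (R4, M4)" for es R4 M4
  proof -
    have T4: "okM M4" "R4 rD = d" "R4 rF = f" "R4 rB = b" "R4 rCnt = length es" "outside d M M4" "ent b es M4" "good es" "1 \<le> esum es"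
      "Sd d f (yl t) = cat d (map snd es)" "length es \<le> 3 * dep t + 1" using I4 unfolding gInv_def by auto
    have "lv d f (M4[b := length es])" unfolding lv_def b_def[symmetric]
      using T4(7-11) base okM_len[OF T4(1)] by (intro exI[of _ es]) (auto intro: ent_upd)
    moreover have "okM (M4[b := length es])" "outside d M (M4[b := length es])"
      using T4(1,6) lb base by (auto simp: okM_upd outside_upd2 b_def)
    ultimately show ?thesis using base okM_len[OF T4(1)] unfolding wpb_def by (simp add: T4(2-5))
  qed
  have mid: "wpb w (sMid ;; sGreedy ;; St (V rB) (V rCnt)) (240 * dep t + 60) ?P (R2, M2)"
    if I: "dInv d f M (Lf a, Ys) (R2, M2)" for a Ys R2 M2
  proof -
    have T: "Lf a \<in> subs t" "okM M2" "R2 rA = ad (Lf a)" "R2 rO < 1" "R2 rSp = length Ys" "R2 rD = d" "R2 rStk = bs" "R2 rF = f"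
      "stk Ys M2" "outside d M M2" "length Ys \<le> dep t" "Sd d f (yl t) = drop (noff d (R2 rO) (Lf a)) (wd d (Lf a)) @ cat d (rev Ys)"
      using I unfolding dInv_def by auto
    define M3 where "M3 = M2[Suc b := 0, Suc (Suc b) := ad (Lf a)]"
    \<comment> \<open>The leaf at the finger is entered by hand and the greedy phase starts at
      distance 1, because the comparison with \<open>thr\<close> is meaningful only for positive
      distances.\<close>
    have "Fp (rev Ys) 1 \<le> length (rev Ys) + 2 * (dep t - 50 * fl 1)"
      using T(9) dep_subs dep_le unfolding stk_def by (intro Fp_init) auto
    then have F: "Fp (rev Ys) (esum [(0, Lf a)]) \<le> 3 * dep t" using T(11) by simp
    have "okM M3" using T(2) lb by (simp add: M3_def okM_upd)
    moreover have "stk Ys M3" using T(9,11) base by (simp add: M3_def stk_upd)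
    moreover have "outside d M M3" using T(10) base by (simp add: M3_def outside_upd2 b_def)
    moreover have "ent b [(0, Lf a)] M3" using T(1) base okM_len[OF T(2)] by (simp add: ent_def M3_def)
    moreover have "good [(0, Lf a)]" by (simp add: good_def)
    moreover have "Sd d f (yl t) = wd d (Lf a) @ cat d (rev Ys)" using T(12,4) by (simp add: noff_def)
    ultimately have "wpb w sMid 40 (gInv d f b M (rev Ys, [(0, Lf a)])) (R2, M2)"
      unfolding wpb_def sMid_def using base okM_len[OF T(2)] M(4) F[simplified]
      by (simp add: gInv_def T(3-8) b18[OF T(2)] M3_def)
    then have "wpb w sMid 40 (\<lambda>s. wpb w (sGreedy ;; St (V rB) (V rCnt)) ((240 * dep t + 10) + 10) ?P s) (R2, M2)"
    proof (rule wpb_mono)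
      fix s assume "gInv d f b M (rev Ys, [(0, Lf a)]) s"
      then have "wpb w sGreedy (80 * Fp (rev Ys) (esum [(0, Lf a)]) + 10) (\<lambda>(R, M'). \<exists>es. gInv d f b M ([], es) (R, M')) s"
        using sGreedy_wpb[OF _ M(4) b_def M(5)] by (cases s) blast
      then show "wpb w (sGreedy ;; St (V rB) (V rCnt)) ((240 * dep t + 10) + 10) ?P s"
        by (intro wpb_Sq, elim wpb_mono) (use F fin in auto)
    qed simp
    from wpb_mono[OF wpb_Sq[OF this]] show ?thesis by simp
  qed
  have "wpb w sPre 30 (dInv d f M (t, [])) (R, M)"
    unfolding wpb_def sPre_def using base M(1,5) by (simp add: dInv_def stk_def hd M(2,3) Sd_wd)
  then have "wpb w sPre 30 (\<lambda>s. wpb w (sDesc ;; sMid ;; sGreedy ;; St (V rB) (V rCnt)) ((70 * dep t + 70) + (240 * dep t + 60)) ?P s) (R, M)"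
  proof (rule wpb_mono)
    fix s assume "dInv d f M (t, []) s"
    then have "wpb w sDesc (70 * dep t + 70) (\<lambda>(R, M'). \<exists>a Ys. dInv d f M (Lf a, Ys) (R, M')) s"
      using sDesc_wpb[OF _ M(4)] by (cases s) blast
    then show "wpb w (sDesc ;; sMid ;; sGreedy ;; St (V rB) (V rCnt)) ((70 * dep t + 70) + (240 * dep t + 60)) ?P s"
      by (intro wpb_Sq, elim wpb_mono) (use mid in auto)
  qed simp
  from wpb_mono[OF wpb_Sq[OF this]] show ?thesis unfolding sHalf_def by simp
qed

lemma sSet_wpb:
  assumes "okM M" "i < sz t"
  shows "wpb w sSet (1000 * dep t + 1000) (\<lambda>(R', M'). okM M' \<and> lv 0 i M' \<and> lv 1 i M' \<and> R' rF = i) (R(0 := i), M)"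
    (is "wpb w sSet _ ?P _")
proof -
  note base = lenw bs35
  have 2: "wpb w (rD ::= C 1 ;; sHalf) (10 + (400 * dep t + 400)) ?P s2"
    if a0: "case s2 of (R', M') \<Rightarrow> okM M' \<and> outside 0 M M' \<and> lv 0 i M' \<and> R' rF = i" for s2
  proof (rule wpb_Sq)
    obtain R2 M2 where s2: "s2 = (R2, M2)" by fastforce
    have a: "okM M2 \<and> outside 0 M M2 \<and> lv 0 i M2 \<and> R2 rF = i" using a0 by (simp add: s2)
    have "wpb w sHalf (400 * dep t + 400) ?P (R2(rD := 1), M2)"
      using a by (intro wpb_mono[OF sHalf_wpb[OF _ _ _ _ assms(2), of M2 "R2(rD := 1)" 1]]) (auto intro: lv_outside)
    then show "wpb w (rD ::= C 1) 10 (\<lambda>s1. wpb w sHalf (400 * dep t + 400) ?P s1) s2"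
      unfolding s2 using base by simp
  qed
  have "wpb w sHalf (400 * dep t + 400) (\<lambda>s. wpb w (rD ::= C 1 ;; sHalf) (10 + (400 * dep t + 400)) ?P s) (R(0 := i, rF := i, rD := 0), M)"
    by (rule wpb_mono[OF sHalf_wpb[OF assms(1) _ _ _ assms(2)] order_refl 2]) simp_all
  then have 1: "wpb w (sHalf ;; rD ::= C 1 ;; sHalf) (400 * dep t + 400 + (10 + (400 * dep t + 400))) ?P (R(0 := i, rF := i, rD := 0), M)"
    by (rule wpb_Sq)
  then have "wpb w (rD ::= C 0) 10 (\<lambda>s. wpb w (sHalf ;; rD ::= C 1 ;; sHalf) (400 * dep t + 400 + (10 + (400 * dep t + 400))) ?P s) (R(0 := i, rF := i), M)"
    using base by simp
  from wpb_Sq[OF this] have "wpb w (rF ::= V 0) 10 (\<lambda>s. wpb w (rD ::= C 0 ;; sHalf ;; rD ::= C 1 ;; sHalf) (10 + (400 * dep t + 400 + (10 + (400 * dep t + 400)))) ?P s) (R(0 := i), M)"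
    by simp
  from wpb_mono[OF wpb_Sq[OF this]] show ?thesis unfolding sSet_def by simp
qed

end

section \<open>Access by binary search\<close>

definition its :: "nat \<Rightarrow> nat" where "its n = (if n \<le> 1 then 0 else Suc (fl (n - 1)))"

lemma its_half: "2 \<le> n \<Longrightarrow> m \<le> (n + 1) div 2 \<Longrightarrow> Suc (its m) \<le> its n"
proof (cases "m \<le> 1")
  case False
  assume n: "2 \<le> n" "m \<le> (n + 1) div 2"
  then have "m - 1 \<le> (n - 1) div 2" "2 \<le> n - 1" using False by linarith+
  then have "fl (m - 1) \<le> fl ((n - 1) div 2)" "fl (n - 1) = Suc (fl ((n - 1) div 2))"
    using floor_log_rec[of "n - 1"] by (auto intro: fl_mono simp del: floor_log_half)
  then show ?thesis using False n by (simp add: its_def del: floor_log_half)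
qed (simp add: its_def)

lemma its_le: "its n \<le> Suc (fl n)" by (auto simp: its_def intro: fl_mono)

definition "sBin = Wh (V rLo \<^bold>+ C 1 \<^bold>< V rHi)
  (rMid ::= (V rLo \<^bold>+ V rHi) \<^bold>/ C 2 ;;
   IfC (V rO \<^bold>< Ld (V rB \<^bold>+ C 1 \<^bold>+ V rMid \<^bold>+ V rMid)) (rHi ::= V rMid) (rLo ::= V rMid))"

definition "sWalk = Wh (C 0 \<^bold>< Ld (V rA \<^bold>+ C 1))
  (rL ::= Ld (V rA \<^bold>+ C 1 \<^bold>+ V rD) ;; rN ::= Ld (V rL) ;;
   IfC (V rO \<^bold>< V rN) (rA ::= V rL) (rO ::= V rO \<^bold>- V rN ;; rA ::= Ld (V rA \<^bold>+ C 2 \<^bold>- V rD)))"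

definition "sAcc1 = (IfC (V 0 \<^bold>< V rF) (rD ::= C 1 ;; rO ::= V rF \<^bold>- V 0) (rD ::= C 0 ;; rO ::= V 0 \<^bold>- V rF) ;;
  rB ::= Ld (C 18 \<^bold>+ V rD) ;; rLo ::= C 0 ;; rHi ::= Ld (V rB) ;;
  IfC (V rO \<^bold>+ C 1 \<^bold>< V rHi) (rHi ::= V rO \<^bold>+ C 1) Skip)"

definition "sAcc2 = (rA ::= Ld (V rB \<^bold>+ C 2 \<^bold>+ V rLo \<^bold>+ V rLo) ;;
  rO ::= V rO \<^bold>- Ld (V rB \<^bold>+ C 1 \<^bold>+ V rLo \<^bold>+ V rLo))"

definition "sAcc = (sAcc1 ;; sBin ;; sAcc2 ;; sWalk ;; 0 ::= Ld (V rA \<^bold>+ C 3))"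

text \<open>Trees are nonempty, so entry \<open>D + 1\<close> starts beyond distance
  \<open>D\<close>. The search can thus be confined to the first \<open>D + 1\<close> entries, which
  makes it logarithmic in \<open>D\<close> and not in the length of the list.\<close>

lemma good_ge: "good es \<Longrightarrow> k < length es \<Longrightarrow> k \<le> fst (es ! k)"
proof -
  assume a: "good es" "k < length es"
  have "length xs \<le> esum xs" for xs :: "(nat \<times> tree) list"
  proof (induction xs)
    case (Cons p xs) then show ?case using sz_ge1[of "snd p"] by (simp add: esum_def)
  qed simp
  from this[of "take k es"] show ?thesis using a by (auto simp: good_def)
qed

lemma length_cat: "length (cat d (map snd es)) = esum es" by (induction es) (auto simp: esum_def)

lemma good_find:
  assumes "good es" "lo < length es" "fst (es ! lo) \<le> D" "D < esum es" "Suc lo < length es \<longrightarrow> D < fst (es ! Suc lo)"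
  shows "cat d (map snd es) ! D = wd d (snd (es ! lo)) ! (D - fst (es ! lo))" "D - fst (es ! lo) < sz (snd (es ! lo))"
proof -
  define e where "e = es ! lo"
  have es: "es = take lo es @ e # drop (Suc lo) es" unfolding e_def using assms(2) by (rule id_take_nth_drop)
  have fe: "fst e = esum (take lo es)" using assms(1,2) by (simp add: good_def e_def)
  have "D < fst e + sz (snd e)"
  proof (cases "Suc lo < length es")
    case True
    then have "fst (es ! Suc lo) = esum (take (Suc lo) es)" using assms(1) by (simp add: good_def)
    also have "\<dots> = fst e + sz (snd e)" using assms(2) fe by (simp add: take_Suc_conv_app_nth e_def)
    finally show ?thesis using assms(5) True by simp
  next
    case False
    then have "drop (Suc lo) es = []" by simp
    then have "esum es = fst e + sz (snd e)" using arg_cong[OF es, of esum] fe by simp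
    then show ?thesis using assms(4) by simp
  qed
  then show 2: "D - fst (es ! lo) < sz (snd (es ! lo))" using assms(3) by (simp add: e_def)
  have c: "cat d (map snd es) = cat d (map snd (take lo es)) @ wd d (snd e) @ cat d (map snd (drop (Suc lo) es))"
    by (subst es) simp
  show "cat d (map snd es) ! D = wd d (snd (es ! lo)) ! (D - fst (es ! lo))"
  proof -
    define u where "u = cat d (map snd (take lo es))"
    have "length u = fst e" unfolding u_def length_cat fe ..
    then show ?thesis unfolding c u_def[symmetric] using assms(3) 2 by (simp add: nth_append e_def[symmetric])
  qed
qed

lemma Sd_nth: "f < length S \<Longrightarrow> d = 0 \<longrightarrow> f + D < length S \<Longrightarrow> d \<noteq> 0 \<longrightarrow> D \<le> f \<Longrightarrow>
   D < length (Sd d f S) \<and> Sd d f S ! D = S ! (if d = 0 then f + D else f - D)"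
  by (auto simp: Sd_def rev_nth)

context mem begin

lemma sBin_wpb:
  assumes "ent b es M" "good es" "R rLo = 0" "R rHi = min (length es) (D + 1)" "R rO = D" "R rB = b" "R rD = d"
    and es: "es \<noteq> []" "okM M" "b + cap \<le> bs + 3 * cap" "2 * length es + 3 \<le> cap" and R0: "R rF = f"
  shows "wpb w sBin (40 * fl (D + 1) + 60) (\<lambda>(R', M'). M' = M \<and> (\<exists>lo<length es. R' rLo = lo \<and> fst (es ! lo) \<le> D \<and>
     (Suc lo < length es \<longrightarrow> D < fst (es ! Suc lo))) \<and> R' rO = D \<and> R' rB = b \<and> R' rD = d \<and> R' rF = f) (R, M)"
  unfolding wpb_def sBin_def
proof (rule wp_While[where x = "(0, min (length es) (D + 1))" and pot = "\<lambda>(lo, hi). 40 * its (hi - lo)" and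
    I = "\<lambda>(lo, hi) (R', M'). M' = M \<and> R' rLo = lo \<and> R' rHi = hi \<and> lo < hi \<and> hi \<le> length es \<and> fst (es ! lo) \<le> D \<and>
      (hi < length es \<longrightarrow> D < fst (es ! hi)) \<and> R' rO = D \<and> R' rB = b \<and> R' rD = d \<and> R' rF = f"], goal_cases)
  case 1
  have "D < fst (es ! min (length es) (D + 1))" if "min (length es) (D + 1) < length es"
    using good_ge[OF assms(2), of "D + 1"] that by (simp add: min_def split: if_splits)
  then show ?case using assms by (auto simp: good_def)
next
  case (2 x R M)
  then show ?case using lenw bs35 es by (cases x) auto
next
  case (3 x R M')
  obtain lo hi where x: "x = (lo, hi)" by fastforce
  have T: "M' = M" "R rLo = lo" "R rHi = hi" "lo < hi" "hi \<le> length es" "fst (es ! lo) \<le> D" "hi < length es \<longrightarrow> D < fst (es ! hi)"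
    "R rO = D" "R rB = b" "R rD = d" "R rF = f" "Suc lo < hi" using 3 by (auto simp: x split: if_splits)
  define mid where "mid = (lo + hi) div 2"
  have mid: "lo < mid" "mid < hi" "hi - mid \<le> (hi - lo + 1) div 2" "mid - lo \<le> (hi - lo + 1) div 2" using T(12) unfolding mid_def by linarith+
  have m: "M ! Suc (b + mid + mid) = fst (es ! mid)" using assms(1) mid T(5) unfolding ent_def by auto
  have p: "Suc (its (hi - mid)) \<le> its (hi - lo)" "Suc (its (mid - lo)) \<le> its (hi - lo)" using mid T(12) by (auto intro!: its_half)
  define y where "y = (if D < fst (es ! mid) then (lo, mid) else (mid, hi))"
  have y: "(case y of (lo, hi) \<Rightarrow> 40 * its (hi - lo)) + 40 \<le> 40 * its (hi - lo)" using p by (auto simp: y_def)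
  show ?case using lenw bs35 okM_len[OF es(2)] es(3,4) T(4,5,12) mid(1,2) y unfolding x
    by (simp add: T(1-3) T(8-11) mid_def[symmetric] m) (auto intro!: exI[of _ y] simp: y_def T(6,7))
next
  case (4 k y R M)
  obtain lo hi where y: "y = (lo, hi)" by fastforce
  have "its (min (length es) (D + 1)) \<le> its (D + 1)" by (auto simp: its_def intro: fl_mono)
  then have "its (min (length es) (D + 1)) \<le> Suc (fl (D + 1))" using its_le[of "D + 1"] by linarith
  moreover have "hi = Suc lo" using 4 by (auto simp: y split: if_splits)
  ultimately show ?case using 4 by (auto simp: y)
qed

lemma sWalk_wpb:
  assumes "T \<in> subs t" "okM M" "R rA = ad T" "R rO < sz T" "R rD = d" "d \<le> 1" "wd d T ! R rO = a" "R rF = f"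
  shows "wpb w sWalk (50 * dep T + 50) (\<lambda>(R', M'). M' = M \<and> Lf a \<in> subs t \<and> R' rA = ad (Lf a) \<and> R' rF = f) (R, M)"
  unfolding wpb_def sWalk_def
proof (rule wp_While[where x = T and pot = "\<lambda>T. 50 * dep T" and
    I = "\<lambda>T (R', M'). M' = M \<and> T \<in> subs t \<and> R' rA = ad T \<and> R' rO < sz T \<and> R' rD = d \<and> wd d T ! R' rO = a \<and> R' rF = f"], goal_cases)
  case 1 then show ?case using assms by simp
next
  case (2 T R M')
  then show ?case using lenw bs35 ad[of T] okM_len[OF assms(2)] by auto
next
  case (3 Y R M')
  have T: "M' = M" "Y \<in> subs t" "R rA = ad Y" "R rO < sz Y" "R rD = d" "wd d Y ! R rO = a" "R rF = f" using 3 by auto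
  have "M ! Suc (ad Y) \<noteq> 0" using 3(2) T by (auto split: if_splits)
  then obtain l r where lr: "Y = Nd l r" using leaf_test[OF assms(2) T(2)] by (cases Y) auto
  define n where "n = near d l r"
  define p where "p = far d l r"
  have nf: "M ! (Suc (Suc (ad Y)) - d) = ad p" "M ! (Suc (ad Y + d)) = ad n" "n \<in> subs t" "p \<in> subs t"
    using near_far[OF assms(2) T(2)[unfolded lr] assms(6)] by (simp_all add: n_def p_def lr)
  have w: "wd d Y = wd d n @ wd d p" "sz Y = sz n + sz p" "dep n < dep Y" "dep p < dep Y"
    unfolding lr n_def p_def by (rule wd_nf sz_nf dep_nf)+
  define y where "y = (if R rO < sz n then n else p)"
  have aux: "Suc (Suc (ad Y)) - d < bs + 3 * cap" "R rO < 2 ^ w" "\<not> R rO < sz n \<Longrightarrow> R rO - sz n < sz p"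
    "R rO < sz n \<Longrightarrow> wd d n ! R rO = a" "\<not> R rO < sz n \<Longrightarrow> wd d p ! (R rO - sz n) = a"
    using ad[OF T(2)] sz_w[OF T(2)] T(4) w T(6) by (auto simp: nth_append split: if_splits)
  show ?case using lenw bs35 okM_len[OF assms(2)] ad[OF T(2)] ad[OF nf(3)] assms(6) w(3,4)
    by (simp add: T(1,3,5,7) nf rec_sz[OF assms(2) nf(3)] aux) (auto intro!: exI[of _ y] simp: y_def nf aux)
next
  case (4 k y R M')
  have T: "M' = M" "y \<in> subs t" "R rA = ad y" "R rO < sz y" "R rD = d" "wd d y ! R rO = a" "R rF = f" using 4 by auto
  have "M ! Suc (ad y) = 0" using 4(2) T by (auto split: if_splits)
  then obtain b where b: "y = Lf b" using leaf_test[OF assms(2) T(2)] by blast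
  then have "b = a" using T(4,6) by (auto simp: wd_def)
  then show ?case using T b 4(3) by auto
qed

definition sI :: "nat option \<Rightarrow> ram_state \<Rightarrow> bool" where
  "sI p s \<longleftrightarrow> (case s of (R, M) \<Rightarrow> okM M \<and> (case p of None \<Rightarrow> True | Some f \<Rightarrow> f < sz t \<and> R rF = f \<and> lv 0 f M \<and> lv 1 f M))"

lemma static_set: "sI p (R, M) \<Longrightarrow> i < sz t \<Longrightarrow> wpb w sSet (1000 * dep t + 1000) (sI (Some i)) (R(0 := i), M)"
  by (rule wpb_mono[OF sSet_wpb]) (auto simp: sI_def)

lemma static_access:
  assumes "sI (Some f) (R, M)" "i < sz t"
  shows "wpb w sAcc (2600 * fl (finger_dist (Some f) i + 1) + 300) (\<lambda>s'. sI (Some f) s' \<and> fst s' 0 = yl t ! i) (R(0 := i), M)"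
proof -
  have A: "okM M" "f < sz t" "R rF = f" "lv 0 f M" "lv 1 f M" using assms(1) by (auto simp: sI_def)
  define d :: nat where "d = (if i < f then 1 else 0)"
  define D where "D = finger_dist (Some f) i"
  have D: "D = (if i < f then f - i else i - f)" by (auto simp: D_def)
  have d1: "d \<le> 1" by (simp add: d_def)
  have "lv d f M" using A by (auto simp: d_def)
  define b where "b = bs + (1 + d) * cap"
  obtain es where es: "M ! b = length es" "ent b es M" "good es" "es \<noteq> []"
     "Sd d f (yl t) = cat d (map snd es)" "2 * length es + 3 \<le> cap" using \<open>lv d f M\<close> unfolding lv_def b_def by blast
  have lb: "b + cap \<le> bs + 3 * cap" by (auto simp: b_def d_def)
  have b18: "M ! (18 + d) = b" using rec_hdr[OF A(1)] by (auto simp: b_def d_def)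
  have sd: "D < esum es" "cat d (map snd es) ! D = yl t ! i"
    using Sd_nth[of f "yl t" d D] A(2) assms(2) es(5) length_cat[of d es] by (auto simp: length_yl D d_def split: if_splits)
  note base = lenw bs35 okM_len[OF A(1)] lb es(6) szw assms(2) A(2)
  let ?R1 = "R(0 := i, rD := d, rO := D, rB := b, rLo := 0, rHi := min (length es) (D + 1))"
  have 1: "wpb w sAcc1 70 (\<lambda>s. s = (?R1, M)) (R(0 := i), M)"
  proof -
    have "M ! 18 = b" if "\<not> i < f" using b18 that by (simp add: d_def)
    moreover have "M ! 19 = b" if "i < f" using b18 that by (simp add: d_def)
    moreover have "i < f \<Longrightarrow> Suc (f - i) < 2 ^ w" "\<not> i < f \<Longrightarrow> Suc (i - f) < 2 ^ w" using base by linarith+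
    ultimately show ?thesis unfolding wpb_def sAcc1_def using base
      by (cases "i < f") (simp_all add: A(3) D d_def es(1) min_def fun_eq_iff)
  qed
  let ?P = "\<lambda>s'. sI (Some f) s' \<and> fst s' 0 = yl t ! i"
  have 4: "wpb w (0 ::= Ld (V rA \<^bold>+ C 3)) 10 ?P (R', M)" if "Lf (yl t ! i) \<in> subs t" "R' rA = ad (Lf (yl t ! i))" "R' rF = f" for R'
    unfolding wpb_def using base ad[OF that(1)] assms(1) by (simp add: that rec_ch[OF A(1) that(1)] sI_def)
  have 3: "wpb w (sAcc2 ;; sWalk ;; 0 ::= Ld (V rA \<^bold>+ C 3)) (40 + ((2500 * fl (D + 1) + 50) + 10)) ?P (R', M)"
    if a: "lo < length es" "R' rLo = lo" "fst (es ! lo) \<le> D" "Suc lo < length es \<longrightarrow> D < fst (es ! Suc lo)" "R' rO = D" "R' rB = b" "R' rD = d" "R' rF = f" for R' lo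
  proof (rule wpb_Sq)
    define Y where "Y = snd (es ! lo)"
    have e: "M ! Suc (b + lo + lo) = fst (es ! lo)" "M ! Suc (Suc (b + lo + lo)) = ad Y" using es(2) a(1) unfolding ent_def Y_def by blast+
    have Y: "Y \<in> subs t" using es(2) a(1) unfolding ent_def Y_def by auto
    note gf = good_find(1)[OF es(3) a(1,3) sd(1) a(4), of d, folded Y_def] good_find(2)[OF es(3) a(1,3) sd(1) a(4), folded Y_def]
    \<comment> \<open>The tree found starts at a distance of at most \<open>D\<close>, and its depth
      was limited by the logarithm of that distance.\<close>
    have dY: "dep Y \<le> 50 * fl (D + 1)"
    proof -
      have "dep Y \<le> 50 * fl (fst (es ! lo))" using es(3) a(1) unfolding good_def Y_def by blast
      also have "\<dots> \<le> 50 * fl (D + 1)" using a(3) by (intro mult_le_mono2 fl_mono) simp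
      finally show ?thesis .
    qed
    let ?R2 = "R'(rA := ad Y, rO := D - fst (es ! lo))"
    have wk: "wpb w (sWalk ;; 0 ::= Ld (V rA \<^bold>+ C 3)) ((2500 * fl (D + 1) + 50) + 10) ?P (?R2, M)"
    proof (rule wpb_Sq)
      have "wpb w sWalk (50 * dep Y + 50) (\<lambda>(R', M'). M' = M \<and> Lf (yl t ! i) \<in> subs t \<and> R' rA = ad (Lf (yl t ! i)) \<and> R' rF = f) (?R2, M)"
        using gf sd a d1 by (intro sWalk_wpb[OF Y A(1)]) simp_all
      then show "wpb w sWalk (2500 * fl (D + 1) + 50) (wpb w (0 ::= Ld (V rA \<^bold>+ C 3)) 10 ?P) (?R2, M)"
        by (rule wpb_mono) (use dY 4 in \<open>auto simp del: wpb_Asg\<close>)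
    qed
    have "D < 2 ^ w" using base D by (simp split: if_splits)
    then have "wpb w sAcc2 40 (\<lambda>s. s = (?R2, M)) (R', M)" unfolding wpb_def sAcc2_def using base a(1,3)
      by (simp add: a(2,5-8) e)
    then show "wpb w sAcc2 40 (wpb w (sWalk ;; 0 ::= Ld (V rA \<^bold>+ C 3)) ((2500 * fl (D + 1) + 50) + 10) ?P) (R', M)"
      by (rule wpb_mono) (simp, simp only: wk)
  qed
  have 2: "wpb w sBin (40 * fl (D + 1) + 60) (wpb w (sAcc2 ;; sWalk ;; 0 ::= Ld (V rA \<^bold>+ C 3)) (40 + ((2500 * fl (D + 1) + 50) + 10)) ?P) (?R1, M)"
    by (rule wpb_mono[OF sBin_wpb[OF es(2,3) _ _ _ _ _ es(4) A(1) lb es(6), of ?R1 D d f]]) (use 3 A(3) in auto)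
  have "wpb w sAcc1 70 (wpb w (sBin ;; sAcc2 ;; sWalk ;; 0 ::= Ld (V rA \<^bold>+ C 3)) ((40 * fl (D + 1) + 60) + (40 + ((2500 * fl (D + 1) + 50) + 10))) ?P) (R(0 := i), M)"
    by (rule wpb_mono[OF 1]) (simp, simp only: wpb_Sq[OF 2])
  from wpb_mono[OF wpb_Sq[OF this]] show ?thesis unfolding sAcc_def D_def[symmetric] by simp
qed

end

section \<open>Jump pointers\<close>

text \<open>Skew binary jump pointers on depths: with parent and jump pointers, a monotone predicate on the
  ancestors of a node at depth \<open>p\<close> can be searched in \<open>O(log p)\<close> steps.\<close>

function jm :: "nat \<Rightarrow> nat" where
  "jm p = (let m = 2 ^ fl (p + 1) - 1 in if p \<le> m then 0 else m + jm (p - m))"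
  by auto

lemma fl_pos: "2 \<le> n \<Longrightarrow> 1 \<le> fl n" using fl_ge[of 1 n] by simp

termination
proof (relation "measure id")
  fix p m :: nat assume m: "m = 2 ^ fl (p + 1) - 1" "\<not> p \<le> m"
  then have "1 \<le> fl (p + 1)" by (intro fl_pos) simp
  then have "(2::nat) ^ 1 \<le> 2 ^ fl (p + 1)" by (intro power_increasing) auto
  then show "(p - m, p) \<in> measure id" using m by simp
qed simp

declare jm.simps [simp del]

lemma fl_eqI: "2 ^ k \<le> n \<Longrightarrow> n < 2 * 2 ^ k \<Longrightarrow> fl n = k"
  by (rule floor_log_eqI) (auto intro: Nat.gr0I)

lemma jm_top: "jm (2 ^ k - 1) = 0"
  by (subst jm.simps) (simp add: Let_def)

text \<open>Beyond a full pattern of length 2^k - 1 the pointers repeat the pattern from the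
  beginning.\<close>

lemma jm_shift:
  assumes "m = 2 ^ k - 1" "0 < q" "q \<le> m"
  shows "jm (m + q) = m + jm q"
proof -
  have "(1::nat) \<le> 2 ^ k" by simp
  then have "fl (m + q + 1) = k" using assms by (intro fl_eqI) auto
  then show ?thesis using assms by (subst jm.simps) (simp add: Let_def)
qed

lemma dec_pow: "1 \<le> p \<Longrightarrow> \<exists>k m q. m = 2 ^ k - 1 \<and> 1 \<le> k \<and> 1 \<le> m \<and> p = m + q \<and> q \<le> m \<and> k = fl (p + 1)"
proof -
  assume p: "1 \<le> p"
  define k where "k = fl (p + 1)"
  have k: "2 ^ k \<le> p + 1" "p + 1 < 2 * 2 ^ k" unfolding k_def using floor_log_exp2_le[of "p + 1"] floor_log_exp2_gt[of "p + 1"] by auto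
  have "1 \<le> k" unfolding k_def using p by (intro fl_pos) simp
  then have "(2::nat) ^ 1 \<le> 2 ^ k" by (intro power_increasing) auto
  then show ?thesis using k \<open>1 \<le> k\<close> k_def by (intro exI[of _ k] exI[of _ "2 ^ k - 1"] exI[of _ "p - (2 ^ k - 1)"]) auto
qed

lemma jm_less: "0 < p \<Longrightarrow> jm p < p"
proof (induction p rule: less_induct)
  case (less p)
  obtain k m q where d: "m = 2 ^ k - 1" "1 \<le> m" "p = m + q" "q \<le> m" using dec_pow[of p] less.prems by auto
  show ?case
  proof (cases "q = 0")
    case True then show ?thesis using d jm_top[of k] less.prems by simp
  next
    case False
    then show ?thesis using jm_shift[OF d(1) _ d(4)] less.IH[of q] d(2,3) by simp
  qed
qed

text \<open>The length of the greedy walk from depth \<open>p\<close> to depth \<open>u\<close>: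
  jump unless the jump overshoots, otherwise go to the parent.\<close>

function cnt :: "nat \<Rightarrow> nat \<Rightarrow> nat" where
  "cnt p u = (if p \<le> u then 0 else if u \<le> jm p then Suc (cnt (jm p) u) else Suc (cnt (p - 1) u))"
  by auto
termination by (relation "measure fst") (auto intro: jm_less)

declare cnt.simps [simp del]

lemma cnt_le [simp]: "p \<le> u \<Longrightarrow> cnt p u = 0" by (subst cnt.simps) simp
lemma cnt_jump: "u < p \<Longrightarrow> u \<le> jm p \<Longrightarrow> cnt p u = Suc (cnt (jm p) u)" by (subst cnt.simps) simp
lemma cnt_parent: "u < p \<Longrightarrow> jm p < u \<Longrightarrow> cnt p u = Suc (cnt (p - 1) u)" by (subst cnt.simps) simp

lemma cnt_shift:
  assumes "m = 2 ^ k - 1"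
  shows "q \<le> m \<Longrightarrow> cnt (m + q) (m + u) = cnt q u"
proof (induction q rule: less_induct)
  case (less q)
  show ?case
  proof (cases "q \<le> u")
    case False
    then have j: "jm (m + q) = m + jm q" using less.prems by (intro jm_shift[OF assms]) auto
    have l: "jm q < q" using False by (intro jm_less) simp
    show ?thesis
    proof (cases "u \<le> jm q")
      case True then show ?thesis using False j l less by (simp add: cnt_jump)
    next
      case c: False
      then have "cnt (m + q) (m + u) = Suc (cnt (m + q - 1) (m + u))" using False j by (intro cnt_parent) auto
      also have "cnt (m + q - 1) (m + u) = cnt (q - 1) u"
      proof -
        have "m + q - 1 = m + (q - 1)" using False by linarith
        then show ?thesis using less.IH[of "q - 1"] less.prems False by (metis (no_types) diff_le_self diff_less gr0I le0 le_trans less_numeral_extra(1))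
      qed
      also have "Suc (cnt (q - 1) u) = cnt q u" using c False by (simp add: cnt_parent)
      finally show ?thesis .
    qed
  qed simp
qed

text \<open>Jumps from above \<open>m\<close> never go below \<open>m\<close>, so all of them are
  taken. The walk passes through \<open>m\<close> and until then looks like a walk from
  \<open>q\<close> to 0.\<close>

lemma cnt_low:
  assumes "m = 2 ^ k - 1" "u \<le> m"
  shows "q \<le> m \<Longrightarrow> cnt (m + q) u = cnt q 0 + cnt m u"
proof (induction q rule: less_induct)
  case (less q)
  show ?case
  proof (cases "q = 0")
    case False
    then have j: "jm (m + q) = m + jm q" "jm q < q" using less.prems by (auto intro: jm_shift[OF assms(1)] jm_less)
    then have "cnt (m + q) u = Suc (cnt (m + jm q) u)" using assms(2) False by (subst cnt_jump) auto
    also have "\<dots> = Suc (cnt (jm q) 0 + cnt m u)" using less j by simp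
    also have "\<dots> = cnt q 0 + cnt m u" using False by (subst cnt_jump[of 0 q]) auto
    finally show ?thesis .
  qed simp
qed

lemma cnt_top0: "cnt (2 ^ k - 1) 0 \<le> 1"
proof (cases "2 ^ k - (1::nat) = 0")
  case False
  then have "cnt (2 ^ k - 1) 0 = Suc (cnt (jm (2 ^ k - 1)) 0)" by (intro cnt_jump) auto
  then show ?thesis unfolding jm_top by simp
qed simp

lemma cnt_zero: "cnt p 0 \<le> fl (p + 1) + 1"
proof (induction p rule: less_induct)
  case (less p)
  show ?case
  proof (cases "p = 0")
    case False
    obtain k m q where d: "m = 2 ^ k - 1" "1 \<le> k" "1 \<le> m" "p = m + q" "q \<le> m" "k = fl (p + 1)"
      using dec_pow[of p] False by (metis One_nat_def Suc_leI neq0_conv)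
    have c: "cnt p 0 \<le> cnt q 0 + 1" using cnt_low[OF d(1) _ d(5), of 0] cnt_top0[of k, folded d(1)] d(4) by simp
    show ?thesis
    proof (cases "q = m")
      case True then show ?thesis using c d(2,6) cnt_top0[of k, folded d(1)] by simp
    next
      case False
      have "q + 1 < 2 ^ k" using False d(1,3,5) by auto
      moreover have "2 ^ fl (q + 1) \<le> q + 1" by (rule floor_log_exp2_le) simp
      ultimately have "(2::nat) ^ fl (q + 1) < 2 ^ k" by linarith
      then have "fl (q + 1) < k" by (rule power_less_imp_less_exp[rotated]) simp
      moreover have "cnt q 0 \<le> fl (q + 1) + 1" using less[of q] d(3,4) by simp
      ultimately show ?thesis using c d(6) by linarith
    qed
  qed simp
qed

text \<open>The jump from the end of a full pattern leads to 0. If that overshoots, a parent step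
  and at most one jump reach the end of the half-size pattern in which \<open>u\<close>
  lies.\<close>

lemma cnt_top: "cnt (2 ^ k - 1) u \<le> 2 * k"
proof (induction k arbitrary: u)
  case (Suc k)
  define m where "m = 2 ^ k - (1::nat)"
  have one: "(1::nat) \<le> 2 ^ k" by simp
  then have p: "2 ^ Suc k - 1 = Suc (m + m)" unfolding m_def power_Suc by linarith
  have j: "jm (Suc (m + m)) = 0" using jm_top[of "Suc k"] p by simp
  show ?case
  proof (cases "u = 0")
    case True show ?thesis unfolding True by (rule order_trans[OF cnt_top0]) simp
  next
    case u: False
    show ?thesis
    proof (cases "u < Suc (m + m)")
      case True
      then have c: "cnt (Suc (m + m)) u = Suc (cnt (m + m) u)" using u j cnt_parent[of u "Suc (m + m)"] by simp
      have "cnt (m + m) u \<le> Suc (2 * k)"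
      proof (cases "m \<le> u")
        case True
        then obtain v where "u = m + v" using le_Suc_ex by blast
        then show ?thesis using cnt_shift[OF m_def, of m v] Suc[of v] by (simp add: m_def)
      next
        case False
        then show ?thesis using cnt_low[OF m_def, of u m] Suc[of u] cnt_top0[of k] by (simp add: m_def)
      qed
      then show ?thesis unfolding p using c by simp
    next
      case False then show ?thesis unfolding p by simp
    qed
  qed
qed simp

text \<open>As long as \<open>u\<close> lies at or beyond \<open>m\<close>, \<open>cnt_shift\<close>
  removes a full pattern. After that the walk consists of the way to \<open>m\<close>, bounded by
  \<open>cnt_zero\<close>, and a walk inside a full pattern, bounded by
  \<open>cnt_top\<close>.\<close>

lemma cnt_bound: "cnt p u \<le> 3 * fl (p + 1) + 1"
proof (induction p arbitrary: u rule: less_induct)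
  case (less p)
  show ?case
  proof (cases "p = 0")
    case False
    obtain k m q where d: "m = 2 ^ k - 1" "1 \<le> k" "1 \<le> m" "p = m + q" "q \<le> m" "k = fl (p + 1)"
      using dec_pow[of p] False by (metis One_nat_def Suc_leI neq0_conv)
    show ?thesis
    proof (cases "m \<le> u")
      case True
      then obtain v where "u = m + v" using le_Suc_ex by blast
      then have "cnt p u = cnt q v" using cnt_shift[OF d(1,5)] d(4) by simp
      also have "\<dots> \<le> 3 * fl (q + 1) + 1" using less[of q v] d(3,4) by simp
      also have "\<dots> \<le> 3 * fl (p + 1) + 1" using d(4) by (intro add_le_mono1 mult_le_mono2 fl_mono) simp
      finally show ?thesis .
    next
      case False
      then have "cnt p u = cnt q 0 + cnt m u" using cnt_low[OF d(1) _ d(5), of u] d(4) by simp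
      moreover have "cnt q 0 \<le> fl (q + 1) + 1" by (rule cnt_zero)
      moreover have "fl (q + 1) \<le> k" unfolding d(6) using d(4) by (intro fl_mono) simp
      moreover have "cnt m u \<le> 2 * k" using cnt_top d(1) by simp
      ultimately show ?thesis using d(6) by linarith
    qed
  qed simp
qed

section \<open>The forest of fringe paths\<close>

text \<open>\<open>hR\<close> tells whether the path of direction \<open>d\<close> continues to the right, \<open>bv\<close> is the size of the near child
  where the path continues in the far one, and \<open>Off\<close> is the offset of the last leaf of the path.\<close>

definition hR :: "nat \<Rightarrow> tree \<Rightarrow> tree \<Rightarrow> bool" where
  "hR d l r = (if sz (near d l r) * sz (near d l r) < sz (far d l r) then d = 0 else d \<noteq> 0)"

fun hc :: "nat \<Rightarrow> tree \<Rightarrow> tree" where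
  "hc d (Lf a) = Lf a" | "hc d (Nd l r) = (if hR d l r then r else l)"

fun oc :: "nat \<Rightarrow> tree \<Rightarrow> tree" where
  "oc d (Lf a) = Lf a" | "oc d (Nd l r) = (if hR d l r then l else r)"

fun bv :: "nat \<Rightarrow> tree \<Rightarrow> nat" where
  "bv d (Lf a) = 0"
| "bv d (Nd l r) = (if sz (near d l r) * sz (near d l r) < sz (far d l r) then sz (near d l r) else 0)"

primrec Off :: "nat \<Rightarrow> tree \<Rightarrow> nat" where
  "Off d (Lf a) = 0" | "Off d (Nd l r) = (if hR d l r then sz l + Off d r else Off d l)"

primrec hD :: "nat \<Rightarrow> tree \<Rightarrow> nat" where
  "hD d (Lf a) = 0" | "hD d (Nd l r) = Suc (if hR d l r then hD d r else hD d l)"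

abbreviation hn :: "nat \<Rightarrow> nat \<Rightarrow> tree \<Rightarrow> tree" where "hn d k \<equiv> (hc d ^^ k)"

lemma hn_Suc: "hn d (Suc k) T = hc d (hn d k T)" by simp

lemma hD_hn: "k \<le> hD d T \<Longrightarrow> hD d (hn d k T) = hD d T - k"
proof (induction k)
  case (Suc k)
  then have "hD d (hn d k T) = hD d T - k" by simp
  moreover have "hD d (hc d U) = hD d U - 1" for U by (cases U) auto
  ultimately show ?case by simp
qed simp

lemma hn_subs: "hn d k T \<in> subs T"
proof (induction k)
  case (Suc k)
  have "hc d U \<in> subs U" for U by (cases U) auto
  then show ?case using subs_trans[OF Suc] by (auto simp: hn_Suc)
qed simp

lemma hn_dep: "k \<le> hD d T \<Longrightarrow> dep (hn d k T) + k \<le> dep T"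
proof (induction k)
  case (Suc k)
  have "hD d (hn d k T) \<noteq> 0" using Suc.prems hD_hn[of k d T] by simp
  then obtain l r where "hn d k T = Nd l r" by (cases "hn d k T") auto
  then show ?case using Suc by (auto simp: hn_Suc)
qed simp

lemma hD_dep: "hD d T \<le> dep T" by (induction T) auto

lemma hn_sz: "0 < k \<Longrightarrow> k \<le> hD d T \<Longrightarrow> sz (hn d k T) < sz T"
proof (induction k)
  case (Suc k)
  have "hD d (hn d k T) \<noteq> 0" using Suc.prems hD_hn[of k d T] by simp
  then obtain l r where "hn d k T = Nd l r" by (cases "hn d k T") auto
  then have "sz (hn d (Suc k) T) < sz (hn d k T)" by auto
  moreover have "sz (hn d k T) \<le> sz T" using hn_subs sz_subs by blast
  ultimately show ?case by simp
qed simp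

lemma Off_less: "Off d T < sz T" by (induction T) auto

text \<open>\<open>z\<close> is the position of the leaf in which the path ends, so that the node \<open>X\<close> of the path starts at
  position \<open>z - Off d X\<close>.\<close>

definition holds :: "nat \<Rightarrow> nat \<Rightarrow> nat \<Rightarrow> tree \<Rightarrow> bool" where
  "holds d z i X \<longleftrightarrow> z - Off d X \<le> i \<and> i < z - Off d X + sz X"

lemma Off_hc: "Off d X \<le> z \<Longrightarrow> Off d (hc d X) \<le> Off d X \<and> z - Off d X \<le> z - Off d (hc d X) \<and>
   z - Off d (hc d X) + sz (hc d X) \<le> z - Off d X + sz X"
  by (cases X) auto

lemma hn_range: "Off d T \<le> z \<Longrightarrow> j \<le> k \<Longrightarrow> Off d (hn d k T) \<le> Off d (hn d j T) \<and> z - Off d (hn d j T) \<le> z - Off d (hn d k T) \<and>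
   z - Off d (hn d k T) + sz (hn d k T) \<le> z - Off d (hn d j T) + sz (hn d j T)"
proof (induction k)
  case (Suc k)
  have all: "Off d (hn d j T) \<le> z" for j
  proof (induction j)
    case (Suc j) then show ?case using Off_hc[OF Suc.IH] by (simp add: hn_Suc)
  qed (simp add: Suc.prems)
  show ?case
  proof (cases "j = Suc k")
    case False
    then show ?thesis using Suc Off_hc[OF all[of k]] by (auto simp: hn_Suc)
  qed simp
qed simp

text \<open>The nodes of a path cover nested intervals. This makes \<open>holds\<close> a monotone
  predicate, as the search by jump pointers requires.\<close>

lemma holds_mono: "Off d T \<le> z \<Longrightarrow> j \<le> k \<Longrightarrow> holds d z i (hn d k T) \<Longrightarrow> holds d z i (hn d j T)"
  using hn_range[of d T z j k] unfolding holds_def by linarith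

text \<open>Squaring makes the number of pointer steps doubly logarithmic. Raising the value to at
  least \<open>T0\<close> skips the steps below it, which is decisive for the total time.\<close>

definition glim :: "nat \<Rightarrow> nat \<Rightarrow> tree \<Rightarrow> nat" where
  "glim T0 d T = (max T0 (bv d T))\<^sup>2"

definition gset :: "nat \<Rightarrow> nat \<Rightarrow> tree \<Rightarrow> nat set" where
  "gset T0 d T = {k. 0 < k \<and> k \<le> hD d T \<and> glim T0 d T < bv d (hn d k T)}"

text \<open>These are the two ways to leave a path: towards a near child smaller than the square
  root of the node, or towards a far child at most the square of its sibling.\<close>

lemma bv_cases:
  assumes "X = Nd l r"
  shows "bv d X \<noteq> 0 \<and> oc d X = near d l r \<and> hc d X = far d l r \<and> sz (oc d X) = bv d X \<and> bv d X * bv d X < sz X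
    \<or> bv d X = 0 \<and> oc d X = far d l r \<and> hc d X = near d l r \<and> sz (oc d X) \<le> sz (hc d X) * sz (hc d X)"
  using assms by (auto simp: hR_def near_def far_def not_less)

text \<open>Distance from \<open>i\<close> to the end of \<open>A\<close> that faces the finger, which lies to the left for \<open>d = 0\<close>.\<close>

definition noffs :: "nat \<Rightarrow> nat \<Rightarrow> nat \<Rightarrow> tree \<Rightarrow> nat" where
  "noffs d i s A = (if d = 0 then i - s else s + sz A - 1 - i)"

text \<open>A passage to the square root lowers the iterated logarithm by one. This counts both the
  rounds of the descent and the pointer steps within a round.\<close>

lemma fl_sq: "2 \<le> a \<Longrightarrow> a * a < b \<Longrightarrow> Suc (fl (fl a)) \<le> fl (fl b)"
proof -
  assume a: "2 \<le> a" "a * a < b"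
  have "2 ^ (2 * fl a) \<le> b"
  proof -
    have "2 ^ fl a * 2 ^ fl a \<le> a * a" using a floor_log_exp2_le[of a] by (intro mult_le_mono) auto
    then show ?thesis using a by (simp add: mult_2 power_add)
  qed
  then have "2 * fl a \<le> fl b" by (rule fl_ge)
  then have "fl (2 * fl a) \<le> fl (fl b)" by (rule fl_mono)
  moreover have "1 \<le> fl a" using a(1) by (rule fl_pos)
  then have "fl (2 * fl a) = Suc (fl (fl a))" by simp
  ultimately show ?thesis by simp
qed

text \<open>Up to rounding, log (q / p) is at most q / p. With the logarithms of \<open>T0\<close>
  and of the threshold in the roles of \<open>p\<close> and \<open>q\<close>, this bounds the number
  of rounds times the steps per round.\<close>

lemma fl_diff: "1 \<le> p \<Longrightarrow> p \<le> q \<Longrightarrow> p * (fl q - fl p) \<le> 2 * q"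
proof -
  assume a: "1 \<le> p" "p \<le> q"
  define e where "e = fl q - fl p"
  have "fl p \<le> fl q" using a by (intro fl_mono)
  then have "2 ^ fl q = 2 ^ fl p * (2::nat) ^ e" unfolding e_def by (simp flip: power_add)
  moreover have "2 ^ fl q \<le> q" using a by (intro floor_log_exp2_le) simp
  moreover have "p < 2 * 2 ^ fl p" by (rule floor_log_exp2_gt)
  moreover have "e < 2 ^ e" by simp
  ultimately have "p * e \<le> (2 * 2 ^ fl p) * 2 ^ e" by (intro mult_le_mono) auto
  then show ?thesis using \<open>2 ^ fl q = _\<close> \<open>2 ^ fl q \<le> q\<close> unfolding e_def[symmetric] by simp
qed

lemma fl_mult_le: "fl (a * b) \<le> fl a + fl b + 1"
proof (cases "a * b = 0")
  case False
  have "a * b < (2 * 2 ^ fl a) * (2 * 2 ^ fl b)"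
    using floor_log_exp2_gt[of a] floor_log_exp2_gt[of b] by (intro mult_strict_mono) auto
  then have "a * b < 2 ^ (fl a + fl b + 2)" by (simp add: power_add)
  moreover have "2 ^ fl (a * b) \<le> a * b" using False by (intro floor_log_exp2_le) simp
  ultimately have "(2::nat) ^ fl (a * b) < 2 ^ (fl a + fl b + 2)" by linarith
  then have "fl (a * b) < fl a + fl b + 2" by (rule power_less_imp_less_exp[rotated]) simp
  then show ?thesis by simp
qed auto

section \<open>The dynamic structure\<close>

text \<open>\<open>wp\<close> asserts the existence of one run, so the witness in its final state
  can be fixed before reasoning about what follows; bounds and case distinctions may then depend on
  it.\<close>

lemma wpb_ex: "wpb w c B (\<lambda>s. \<exists>k. P k s) s \<Longrightarrow> \<exists>k. wpb w c B (P k) s"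
  unfolding wpb_def wp_def by blast

lemma wpb_pure: "wpb w c B (\<lambda>s. p \<and> P s) s \<Longrightarrow> p \<and> wpb w c B P s"
  unfolding wpb_def wp_def by blast

lemma wpb_frame: "wpb w c B P s \<Longrightarrow> wpb w c B (\<lambda>s'. P s' \<and> (\<forall>r. r \<notin> mods c \<longrightarrow> fst s' r = fst s r) \<and>
    (nostore c \<longrightarrow> snd s' = snd s)) s"
  unfolding wpb_def by (drule wp_frame) (elim wp_mono, blast)

section \<open>Programs of the dynamic structure\<close>

abbreviation (input) "rS \<equiv> 4::nat" abbreviation (input) "rWp \<equiv> 6::nat" abbreviation (input) "rX \<equiv> 10::nat"
abbreviation (input) "rZ \<equiv> 11::nat" abbreviation (input) "rJ \<equiv> 12::nat" abbreviation (input) "rSs \<equiv> 13::nat"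
abbreviation (input) "rFl \<equiv> 18::nat" abbreviation (input) "rTt \<equiv> 19::nat" abbreviation (input) "rCur \<equiv> 20::nat"
abbreviation (input) "rBv \<equiv> 21::nat" abbreviation (input) "rG \<equiv> 22::nat" abbreviation (input) "rI \<equiv> 23::nat"
abbreviation (input) "rBase \<equiv> 24::nat"

text \<open>Conjunction as a product of truth values: \<open>rI\<close> lies in the interval that
  starts at the value of \<open>s\<close> and whose length is stored at address
  \<open>p\<close>.\<close>

definition "eIn s p = ((V rI \<^bold>< V s \<^bold>+ Ld p) \<^bold>* (C 1 \<^bold>- (V rI \<^bold>< V s)))"

definition "dSBody =
  (rJ ::= Ld (V rX \<^bold>+ C 9 \<^bold>+ V rD) ;; rSs ::= V rZ \<^bold>- Ld (V rJ \<^bold>+ C 5 \<^bold>+ V rD) ;;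
   IfC (eIn rSs (V rJ)) (rX ::= V rJ)
    (rJ ::= Ld (V rX \<^bold>+ C 7 \<^bold>+ V rD) ;; rSs ::= V rZ \<^bold>- Ld (V rJ \<^bold>+ C 5 \<^bold>+ V rD) ;;
     IfC (eIn rSs (V rJ)) (rX ::= V rJ) (rFl ::= C 0)))"

definition "dSearch = (rFl ::= C 1 ;; Wh (V rFl) dSBody)"

definition "dHBody = (rCur ::= V rG ;; rBv ::= Ld (V rCur \<^bold>+ C 13 \<^bold>+ V rD) ;; rG ::= Ld (V rCur \<^bold>+ C 11 \<^bold>+ V rD))"
definition "dHop = Wh ((C 0 \<^bold>< V rG) \<^bold>* (C 1 \<^bold>- (V rTt \<^bold>< V rBv))) dHBody"

definition "dPush e = (St (V rWp) (V rA) ;; St (V rWp \<^bold>+ C 1) (V rS) ;; St (V rWp \<^bold>+ C 2) e ;; rWp ::= V rWp \<^bold>+ C 3)"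

definition "dStep = (rL ::= Ld (V rA \<^bold>+ C 1) ;; rR ::= Ld (V rA \<^bold>+ C 2) ;; rN ::= V rS \<^bold>+ Ld (V rL) ;; dPush (C 2) ;;
  IfC (V rI \<^bold>< V rN) (rA ::= V rL) (rA ::= V rR ;; rS ::= V rN))"

definition "dB0 = (rZ ::= V rS \<^bold>+ Ld (V rA \<^bold>+ C 5 \<^bold>+ V rD) ;; rCur ::= V rA ;;
  rBv ::= Ld (V rA \<^bold>+ C 13 \<^bold>+ V rD) ;; rG ::= Ld (V rA \<^bold>+ C 11 \<^bold>+ V rD))"
definition "dB2 = (rSs ::= V rZ \<^bold>- Ld (V rCur \<^bold>+ C 5 \<^bold>+ V rD) ;;
  IfC ((V rTt \<^bold>< V rBv) \<^bold>* eIn rSs (V rCur)) (rX ::= V rCur) (rX ::= V rA ;; dSearch))"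
definition "dB3 = (rN ::= V rZ \<^bold>- Ld (V rX \<^bold>+ C 5 \<^bold>+ V rD) ;; IfC (Ld (V rX) \<^bold>< Ld (V rA)) (dPush (V rD)) Skip ;;
  rA ::= V rX ;; rS ::= V rN)"

definition "dStep' = IfC (C 0 \<^bold>< Ld (V rA \<^bold>+ C 1)) dStep Skip"

text \<open>The quotient is compared instead of the square of the threshold, which need not fit into
  a word.\<close>

definition "dFBody = (IfC (V rTt \<^bold>< Ld (V rA) \<^bold>/ V rTt) (dB0 ;; dHop ;; dB2 ;; dB3) Skip ;; dStep')"
definition "dFringe = Wh (C 0 \<^bold>< Ld (V rA \<^bold>+ C 1)) dFBody"

lemma hn_add: "hn d k (hn d j T) = hn d (k + j) T" by (simp add: funpow_add)

text \<open>Pointers beyond the end of a path are 0. As cells 0, 5 and 6 contain 0, address 0 acts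
  as the record of an empty tree with offset 0, which contains no position; the search therefore
  needs no test for null pointers.\<close>

locale dmem = mem +
  fixes T0 :: nat
  assumes T0: "T0 = fl (sz t) + 2" "T0 < sz t" "M0 ! 16 = T0"
    and m_off: "\<And>T d. T \<in> subs t \<Longrightarrow> d \<le> 1 \<Longrightarrow> M0 ! (ad T + 5 + d) = Off d T"
    and m_h: "\<And>T d. T \<in> subs t \<Longrightarrow> d \<le> 1 \<Longrightarrow> M0 ! (ad T + 7 + d) = (if hD d T = 0 then 0 else ad (hc d T))"
    and m_j: "\<And>T d. T \<in> subs t \<Longrightarrow> d \<le> 1 \<Longrightarrow> M0 ! (ad T + 9 + d) = (if hD d T = 0 then 0 else ad (hn d (hD d T - jm (hD d T)) T))"
    and m_g: "\<And>T d. T \<in> subs t \<Longrightarrow> d \<le> 1 \<Longrightarrow> M0 ! (ad T + 11 + d) = (if gset T0 d T = {} then 0 else ad (hn d (Min (gset T0 d T)) T))"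
    and m_b: "\<And>T d. T \<in> subs t \<Longrightarrow> d \<le> 1 \<Longrightarrow> M0 ! (ad T + 13 + d) = bv d T"
    and m_null: "M0 ! 5 = 0" "M0 ! 6 = 0"
begin

lemma recs:
  assumes "okM M" "T \<in> subs t" "d \<le> 1"
  shows "M ! (ad T + 5 + d) = Off d T" "M ! (ad T + 7 + d) = (if hD d T = 0 then 0 else ad (hc d T))"
    "M ! (ad T + 9 + d) = (if hD d T = 0 then 0 else ad (hn d (hD d T - jm (hD d T)) T))"
    "M ! (ad T + 11 + d) = (if gset T0 d T = {} then 0 else ad (hn d (Min (gset T0 d T)) T))"
    "M ! (ad T + 13 + d) = bv d T" "M ! (5 + d) = 0" "M ! 0 = 0" "M ! 16 = T0"
proof -
  have a: "ad T + 15 \<le> bs" using ad[OF assms(2)] by simp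
  have *: "M ! x = M0 ! x" if "x < bs" for x using assms(1) that by (simp add: okM_def)
  show "M ! (ad T + 5 + d) = Off d T" "M ! (ad T + 7 + d) = (if hD d T = 0 then 0 else ad (hc d T))"
    "M ! (ad T + 9 + d) = (if hD d T = 0 then 0 else ad (hn d (hD d T - jm (hD d T)) T))"
    "M ! (ad T + 11 + d) = (if gset T0 d T = {} then 0 else ad (hn d (Min (gset T0 d T)) T))"
    "M ! (ad T + 13 + d) = bv d T"
    using a assms(3) by (simp_all only: * m_off[OF assms(2,3)] m_h[OF assms(2,3)] m_j[OF assms(2,3)] m_g[OF assms(2,3)] m_b[OF assms(2,3)])
  have "d = 0 \<or> d = 1" using assms(3) by linarith
  then show "M ! (5 + d) = 0" using m_null bs35 * by auto
  show "M ! 0 = 0" "M ! 16 = T0" using * hdr(1) T0(3) bs35 by simp_all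
qed

lemma hn_sub: "T \<in> subs t \<Longrightarrow> hn d k T \<in> subs t" using hn_subs subs_trans by blast

text \<open>\<open>km\<close> numbers the last node of the path that contains \<open>i\<close>.
  Depths for the jump pointers are counted from the end of the path, so the remaining walk leads
  from \<open>hD d A - k\<close> to \<open>hD d A - km\<close>.\<close>

lemma search_step:
  assumes "okM M" "d \<le> 1" "A \<in> subs t" "z = s + Off d A" "s + sz A \<le> sz t" "k \<le> hD d A" "i < sz t"
    and R: "R rX = ad (hn d k A)" "R rZ = z" "R rD = d" "R rI = i"
    and km: "km \<le> hD d A" "\<And>k'. k' \<le> hD d A \<Longrightarrow> holds d z i (hn d k' A) \<longleftrightarrow> k' \<le> km" and kk: "k \<le> km"
  shows "wpb w dSBody 80 (\<lambda>(R', M'). M' = M \<and> R' rZ = z \<and> R' rD = d \<and> R' rI = i \<and>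
    (R' rFl = R rFl \<and> (\<exists>k'. k < k' \<and> k' \<le> km \<and> R' rX = ad (hn d k' A) \<and> Suc (cnt (hD d A - k') (hD d A - km)) \<le> cnt (hD d A - k) (hD d A - km))
     \<or> R' rFl = 0 \<and> km \<le> k \<and> R' rX = ad (hn d k A))) (R, M)"
proof -
  define X where "X = hn d k A"
  have X: "X \<in> subs t" using hn_sub[OF assms(3)] by (simp add: X_def)
  have hX: "hD d X = hD d A - k" using hD_hn[OF assms(6)] by (simp add: X_def)
  have zt: "z < sz t" using assms(4,5) Off_less[of d A] by linarith
  have Oz: "Off d A \<le> z" using assms(4) by simp
  have rng: "Off d (hn d j A) \<le> z \<and> z - Off d (hn d j A) + sz (hn d j A) \<le> sz t" for j
  proof -
    have "z - Off d A = s" using assms(4) by simp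
    moreover have "Off d (hn d j A) \<le> Off d A" "z - Off d (hn d j A) + sz (hn d j A) \<le> z - Off d A + sz A"
      using hn_range[OF Oz, of 0 j] by (simp_all only: funpow_0 le0 simp_thms)
    ultimately show ?thesis using Oz assms(5) by linarith
  qed
  note base = lenw bs35 okM_len[OF assms(1)] ad[OF X] assms(2,7) szw zt
  have p: "(1::nat) < 2 ^ w" "ad X + 9 + d < 2 ^ w" "ad X + 7 + d < 2 ^ w" "ad X + 9 + d < bs + 3 * cap" "ad X + 7 + d < bs + 3 * cap"
    "z < 2 ^ w" "5 + d < 2 ^ w" "5 + d < bs + 3 * cap" "ad X + 9 < 2 ^ w" "ad X + 7 < 2 ^ w" "(9::nat) < 2 ^ w" "(7::nat) < 2 ^ w" "(5::nat) < 2 ^ w" "0 < bs + 3 * cap"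
    using base by linarith+
  have q: "ad U + 5 < 2 ^ w" "ad U + 5 + d < 2 ^ w" "ad U + 5 + d < bs + 3 * cap" "ad U < bs + 3 * cap" if "U \<in> subs t" for U
    using ad[OF that] base by linarith+
  show ?thesis
  proof (cases "hD d X = 0")
    case True
    then have km': "km \<le> k" using hX kk km(1) assms(6) by linarith
    have j: "M ! (ad X + 9 + d) = 0" "M ! (ad X + 7 + d) = 0" using recs(2,3)[OF assms(1) X assms(2)] True by simp_all
    show ?thesis unfolding wpb_def dSBody_def eIn_def using p okM_len[OF assms(1)] km'
      by (simp add: R X_def[symmetric] j recs(6,7)[OF assms(1) X assms(2)])
  next
    case False
    define pj where "pj = jm (hD d X)"
    define kj where "kj = hD d A - pj"
    have pj: "pj < hD d X" unfolding pj_def using False by (intro jm_less) simp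
    have kj: "k < kj" "kj \<le> hD d A" using pj hX by (auto simp: kj_def)
    have J: "hn d (hD d X - jm (hD d X)) X = hn d kj A"
      unfolding X_def hn_add using hX pj assms(6) by (simp add: kj_def pj_def X_def)
    have H: "hc d X = hn d (Suc k) A" by (simp add: X_def)
    have Js: "hn d kj A \<in> subs t" "hn d (Suc k) A \<in> subs t" using hn_sub[OF assms(3)] by blast+
    have j: "M ! (ad X + 9 + d) = ad (hn d kj A)" "M ! (ad X + 7 + d) = ad (hn d (Suc k) A)"
      using recs(2,3)[OF assms(1) X assms(2)] False J H by simp_all
    define OJ where "OJ = Off d (hn d kj A)"
    define OH where "OH = Off d (hn d (Suc k) A)"
    define SJ where "SJ = sz (hn d kj A)"
    define SH where "SH = sz (hn d (Suc k) A)"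
    note rj = recs(1)[OF assms(1) Js(1) assms(2), folded OJ_def] recs(1)[OF assms(1) Js(2) assms(2), folded OH_def]
      rec_sz[OF assms(1) Js(1), folded SJ_def] rec_sz[OF assms(1) Js(2), folded SH_def]
    define zJ where "zJ = z - OJ"
    define zH where "zH = z - OH"
    note zz = zJ_def[symmetric] zH_def[symmetric]
    have "OJ \<le> z \<and> z - OJ + SJ \<le> sz t" "OH \<le> z \<and> z - OH + SH \<le> sz t"
      using rng[of kj] rng[of "Suc k"] unfolding OJ_def SJ_def OH_def SH_def by blast+
    then have rr: "OJ \<le> z" "zJ + SJ < 2 ^ w" "OH \<le> z" "zH + SH < 2 ^ w" unfolding zz using szw by linarith+
    have hJ: "holds d z i (hn d kj A) \<longleftrightarrow> kj \<le> km" using km(2)[OF kj(2)] .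
    have hJ': "(i < zJ + SJ \<and> \<not> i < zJ) \<longleftrightarrow> kj \<le> km" using hJ unfolding holds_def OJ_def[symmetric] SJ_def[symmetric] zz by linarith
    have sk: "Suc k \<le> hD d A" using kj by linarith
    have hH: "(i < zH + SH \<and> \<not> i < zH) \<longleftrightarrow> Suc k \<le> km" using km(2)[OF sk] unfolding holds_def OH_def[symmetric] SH_def[symmetric] zz by linarith
    define pm where "pm = hD d A - km"
    define pk where "pk = hD d A - k"
    have pkX: "hD d X = pk" using hX by (simp add: pk_def)
    show ?thesis
    proof (cases "kj \<le> km")
      case True
      have "Suc (cnt (hD d A - kj) pm) \<le> cnt pk pm"
      proof -
        have "pm < pk" "pm \<le> jm pk" using True kj pj pkX km(1) by (auto simp: pm_def pk_def pj_def kj_def)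
        moreover have "hD d A - kj = jm pk" using pj hX pkX unfolding kj_def pj_def by simp
        ultimately show ?thesis using cnt_jump[of pm pk] by simp
      qed
      then have ex: "\<exists>k'>k. k' \<le> km \<and> ad (hn d kj A) = ad (hn d k' A) \<and> Suc (cnt (hD d A - k') (hD d A - km)) \<le> cnt (hD d A - k) (hD d A - km)"
        using kj True unfolding pm_def pk_def by blast
      have c: "i < zJ + SJ" "\<not> i < zJ" using hJ' True by auto
      show ?thesis unfolding wpb_def dSBody_def eIn_def using p q[OF Js(1)] rr okM_len[OF assms(1)] ex
        by (simp add: R X_def[symmetric] j rj zz c)
    next
      case nj: False
      then have nc: "\<not> (i < zJ + SJ \<and> \<not> i < zJ)" using hJ' by blast
      show ?thesis
      proof (cases "Suc k \<le> km")
        case True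
        have "Suc (cnt (hD d A - Suc k) pm) \<le> cnt pk pm"
        proof -
          have "pm < pk" using True sk km(1) by (auto simp: pm_def pk_def)
          moreover have "pj = jm pk" by (simp add: pj_def pkX)
          then have "jm pk < pm" using nj km(1) unfolding pm_def kj_def by linarith
          moreover have "hD d A - Suc k = pk - 1" by (simp add: pk_def)
          ultimately show ?thesis using cnt_parent[of pm pk] by simp
        qed
        then have ex: "\<exists>k'>k. k' \<le> km \<and> ad (hn d (Suc k) A) = ad (hn d k' A) \<and> Suc (cnt (hD d A - k') (hD d A - km)) \<le> cnt (hD d A - k) (hD d A - km)"
          using True unfolding pm_def pk_def by blast
        have c: "i < zH + SH" "\<not> i < zH" using hH True by auto
        show ?thesis unfolding wpb_def dSBody_def eIn_def using p q[OF Js(1)] q[OF Js(2)] rr okM_len[OF assms(1)] ex nc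
          by (simp add: R X_def[symmetric] j rj zz c del: funpow.simps)
      next
        case False
        then have c: "\<not> (i < zH + SH \<and> \<not> i < zH)" using hH by blast
        have "km \<le> k" using False by simp
        then show ?thesis unfolding wpb_def dSBody_def eIn_def using p q[OF Js(1)] q[OF Js(2)] rr okM_len[OF assms(1)] nc c
          by (simp add: R X_def[symmetric] j rj zz del: funpow.simps)
      qed
    qed
  qed
qed

lemma holds_max:
  assumes "holds d z i A" "Off d A \<le> z"
  shows "\<exists>km\<le>hD d A. \<forall>k'\<le>hD d A. holds d z i (hn d k' A) \<longleftrightarrow> k' \<le> km"
proof -
  define K where "K = {k. k \<le> hD d A \<and> holds d z i (hn d k A)}"
  have f: "finite K" "K \<noteq> {}" using assms(1) by (auto simp: K_def intro!: exI[of _ 0])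
  have m: "Max K \<in> K" using f by (rule Max_in)
  have "holds d z i (hn d k' A) \<longleftrightarrow> k' \<le> Max K" if "k' \<le> hD d A" for k'
  proof
    assume "holds d z i (hn d k' A)" then show "k' \<le> Max K" using f(1) that by (intro Max_ge) (auto simp: K_def)
  next
    assume "k' \<le> Max K"
    moreover have "holds d z i (hn d (Max K) A)" using m by (simp add: K_def)
    ultimately show "holds d z i (hn d k' A)" by (rule holds_mono[OF assms(2)])
  qed
  then show ?thesis using m by (intro exI[of _ "Max K"]) (auto simp: K_def)
qed

text \<open>The time of a search by jump pointers. Paths have length at most \<open>dep t\<close>,
  which is O(log N), so this is O(log log N).\<close>

definition "KS = 300 * fl (dep t + 1) + 400"

lemma dSearch_wpb:
  assumes "okM M" "d \<le> 1" "A \<in> subs t" "z = s + Off d A" "s + sz A \<le> sz t" "i < sz t" "holds d z i A"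
    and R: "R rX = ad A" "R rZ = z" "R rD = d" "R rI = i"
  shows "wpb w dSearch KS (\<lambda>s'. (\<exists>k\<le>hD d A. fst s' rX = ad (hn d k A) \<and> holds d z i (hn d k A) \<and> (k < hD d A \<longrightarrow> \<not> holds d z i (hn d (Suc k) A))) \<and>
    (\<forall>r. r \<notin> {rX, rJ, rSs, rFl} \<longrightarrow> fst s' r = R r) \<and> snd s' = M) (R, M)"
proof -
  have Oz: "Off d A \<le> z" using assms(4) by simp
  obtain km where km: "km \<le> hD d A" "\<And>k'. k' \<le> hD d A \<Longrightarrow> holds d z i (hn d k' A) \<longleftrightarrow> k' \<le> km"
    using holds_max[OF assms(7) Oz] by blast
  let ?pot = "\<lambda>(k, b). if b then 90 * (cnt (hD d A - k) (hD d A - km) + 1) else (0::nat)"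
  have W: "wpb w (Wh (V rFl) dSBody) (90 * (cnt (hD d A) (hD d A - km) + 1) + 10) (\<lambda>s'. fst s' rX = ad (hn d km A)) (R(rFl := 1), M)"
    unfolding wpb_def
  proof (rule wp_While[where x = "(0, True)" and pot = ?pot and
      I = "\<lambda>(k, b) (R', M'). M' = M \<and> R' rZ = z \<and> R' rD = d \<and> R' rI = i \<and> k \<le> km \<and> R' rX = ad (hn d k A) \<and>
        R' rFl = (if b then 1 else 0) \<and> (\<not> b \<longrightarrow> k = km)"], goal_cases)
    case 1 show ?case using R by simp
  next
    case 2 show ?case by simp
  next
    case (3 x R' M')
    obtain k b where x: "x = (k, b)" by fastforce
    have T: "M' = M" "R' rZ = z" "R' rD = d" "R' rI = i" "k \<le> km" "R' rX = ad (hn d k A)" "R' rFl = 1" "b"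
      using 3 by (auto simp: x split: if_splits)
    have kA: "k \<le> hD d A" using T(5) km(1) by simp
    have "wpb w dSBody 80 (\<lambda>(R', M'). M' = M \<and> R' rZ = z \<and> R' rD = d \<and> R' rI = i \<and>
      (R' rFl = 1 \<and> (\<exists>k'. k < k' \<and> k' \<le> km \<and> R' rX = ad (hn d k' A) \<and> Suc (cnt (hD d A - k') (hD d A - km)) \<le> cnt (hD d A - k) (hD d A - km))
       \<or> R' rFl = 0 \<and> km \<le> k \<and> R' rX = ad (hn d k A))) (R', M)"
      using search_step[OF assms(1-5) kA assms(6) T(6,2,3,4) km T(5)] T(7) by simp
    then show ?case unfolding T(1) wpb_def
    proof (rule wp_mono)
      fix q :: nat and s' assume q: "q \<le> 80 \<and> (case s' of (R', M') \<Rightarrow> M' = M \<and> R' rZ = z \<and> R' rD = d \<and> R' rI = i \<and>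
        (R' rFl = 1 \<and> (\<exists>k'. k < k' \<and> k' \<le> km \<and> R' rX = ad (hn d k' A) \<and> Suc (cnt (hD d A - k') (hD d A - km)) \<le> cnt (hD d A - k) (hD d A - km))
       \<or> R' rFl = 0 \<and> km \<le> k \<and> R' rX = ad (hn d k A)))"
      obtain R2 M2 where s': "s' = (R2, M2)" by fastforce
      show "\<exists>y. (case y of (k, b) \<Rightarrow> \<lambda>(R', M'). M' = M \<and> R' rZ = z \<and> R' rD = d \<and> R' rI = i \<and> k \<le> km \<and> R' rX = ad (hn d k A) \<and>
        R' rFl = (if b then 1 else 0) \<and> (\<not> b \<longrightarrow> k = km)) s' \<and> q + cost (V rFl) + 2 + ?pot y \<le> ?pot x"
      proof (cases "R2 rFl = 1")
        case True
        then obtain k' where "k < k'" "k' \<le> km" "R2 rX = ad (hn d k' A)" "Suc (cnt (hD d A - k') (hD d A - km)) \<le> cnt (hD d A - k) (hD d A - km)"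
          using q unfolding s' by auto
        then show ?thesis using q True T(8) unfolding s' x by (intro exI[of _ "(k', True)"]) simp
      next
        case False
        then have "R2 rFl = 0" "km \<le> k" "R2 rX = ad (hn d k A)" using q unfolding s' by auto
        then show ?thesis using q T(5,8) unfolding s' x by (intro exI[of _ "(k, False)"]) simp
      qed
    qed
  next
    case (4 q y R' M')
    then show ?case by (cases y) (auto split: if_splits)
  qed
  have c: "cnt (hD d A) (hD d A - km) \<le> 3 * fl (dep t + 1) + 1"
  proof -
    have "hD d A \<le> dep t" using hD_dep[of d A] dep_subs[OF assms(3)] by linarith
    then have "fl (hD d A + 1) \<le> fl (dep t + 1)" by (intro fl_mono) simp
    then show ?thesis using cnt_bound[of "hD d A" "hD d A - km"] by linarith
  qed
  have P: "\<exists>k\<le>hD d A. ad (hn d km A) = ad (hn d k A) \<and> holds d z i (hn d k A) \<and> (k < hD d A \<longrightarrow> \<not> holds d z i (hn d (Suc k) A))"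
  proof (intro exI[of _ km] conjI impI km(1) refl)
    show "holds d z i (hn d km A)" using km(2)[OF km(1)] by blast
    assume "km < hD d A" then show "\<not> holds d z i (hn d (Suc km) A)" using km(2)[of "Suc km"] by (simp del: funpow.simps)
  qed
  have "wpb w dSearch (2 + (90 * (cnt (hD d A) (hD d A - km) + 1) + 10)) (\<lambda>s'. fst s' rX = ad (hn d km A)) (R, M)"
    unfolding dSearch_def by (rule wpb_Sq) (use W lenw bs35 in simp)
  from wpb_mono[OF wpb_frame[OF this]] show ?thesis
    using c P by (simp add: KS_def dSearch_def dSBody_def)
qed

text \<open>A shared subtree has no position of its own. A visit to it is tied to a place in the
  text by the string found there.\<close>

definition occ :: "tree \<Rightarrow> nat \<Rightarrow> bool" where
  "occ T s \<longleftrightarrow> T \<in> subs t \<and> s + sz T \<le> sz t \<and> take (sz T) (drop s (yl t)) = yl T"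

lemma occ_Nd: "occ (Nd l r) s \<Longrightarrow> occ l s \<and> occ r (s + sz l)"
proof -
  assume o: "occ (Nd l r) s"
  have "take (sz l) (drop s (yl t)) @ take (sz r) (drop (s + sz l) (yl t)) = yl l @ yl r"
    using o by (simp add: occ_def take_add add.commute)
  moreover have "s + (sz l + sz r) \<le> sz t" using o by (simp add: occ_def)
  then have "sz l \<le> sz t - s" by linarith
  then have "length (take (sz l) (drop s (yl t))) = length (yl l)" by (simp add: length_yl)
  ultimately have "take (sz l) (drop s (yl t)) = yl l" "take (sz r) (drop (s + sz l) (yl t)) = yl r" by simp_all
  moreover have "l \<in> subs t \<and> r \<in> subs t" using o sub_Nd unfolding occ_def by blast
  ultimately show ?thesis using o by (simp add: occ_def)
qed

lemma occ_hn: "occ T s \<Longrightarrow> occ (hn d k T) (s + Off d T - Off d (hn d k T)) \<and> Off d (hn d k T) \<le> s + Off d T"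
proof (induction k)
  case (Suc k)
  define X where "X = hn d k T"
  define z where "z = s + Off d T"
  have o: "occ X (z - Off d X)" "Off d X \<le> z" using Suc by (auto simp: X_def z_def)
  have "occ (hc d X) (z - Off d (hc d X)) \<and> Off d (hc d X) \<le> z"
  proof (cases X)
    case (Nd l r)
    show ?thesis using occ_Nd[of l r "z - Off d X"] o Nd by (auto simp: diff_add_eq_diff_diff_swap[symmetric])
  qed (use o in simp)
  then show ?case by (simp add: X_def z_def)
qed simp

text \<open>Entries of the finger path. A type \<open>\<tau> < 2\<close> means that the next entry lies further down on the
  precomputed path of direction \<open>\<tau>\<close>, type 2 that it is a child.\<close>

fun lnk :: "tree \<times> nat \<times> nat \<Rightarrow> tree \<Rightarrow> nat \<Rightarrow> bool" where
  "lnk (T, s, \<tau>) X sX \<longleftrightarrow> \<tau> < 2 \<and> (\<exists>k. 0 < k \<and> k \<le> hD \<tau> T \<and> X = hn \<tau> k T \<and> sX = s + Off \<tau> T - Off \<tau> X) \<or>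
     \<tau> = 2 \<and> (\<exists>l r. T = Nd l r \<and> (X = l \<and> sX = s \<or> X = r \<and> sX = s + sz l))"

definition okp :: "bool \<Rightarrow> (tree \<times> nat \<times> nat) list \<Rightarrow> tree \<Rightarrow> nat \<Rightarrow> bool" where
  "okp rt es A s \<longleftrightarrow> (\<forall>k. Suc k < length es \<longrightarrow> lnk (es ! k) (fst (es ! Suc k)) (fst (snd (es ! Suc k)))) \<and>
     (es \<noteq> [] \<longrightarrow> lnk (last es) A s) \<and>
     (rt \<longrightarrow> (if es = [] then A = t \<and> s = 0 else fst (es ! 0) = t \<and> fst (snd (es ! 0)) = 0))"

lemma okp_append: "okp rt es A s \<Longrightarrow> lnk (A, s, \<tau>) X sX \<Longrightarrow> okp rt (es @ [(A, s, \<tau>)]) X sX"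
  unfolding okp_def
proof (intro conjI allI impI)
  fix k assume a: "(\<forall>k. Suc k < length es \<longrightarrow> lnk (es ! k) (fst (es ! Suc k)) (fst (snd (es ! Suc k)))) \<and>
     (es \<noteq> [] \<longrightarrow> lnk (last es) A s) \<and> (rt \<longrightarrow> (if es = [] then A = t \<and> s = 0 else fst (es ! 0) = t \<and> fst (snd (es ! 0)) = 0))"
    and k: "Suc k < length (es @ [(A, s, \<tau>)])"
  show "lnk ((es @ [(A, s, \<tau>)]) ! k) (fst ((es @ [(A, s, \<tau>)]) ! Suc k)) (fst (snd ((es @ [(A, s, \<tau>)]) ! Suc k)))"
  proof (cases "Suc k = length es")
    case True
    then have ne: "es \<noteq> []" and "k = length es - 1" by auto
    then have "last es = es ! k" by (simp add: last_conv_nth)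
    then show ?thesis using a True ne by (simp add: nth_append del: lnk.simps)
  next
    case False
    then show ?thesis using a k by (simp add: nth_append del: lnk.simps)
  qed
qed (auto simp: nth_append simp del: lnk.simps split: if_splits)

definition pst :: "nat \<Rightarrow> (tree \<times> nat \<times> nat) list \<Rightarrow> nat list \<Rightarrow> bool" where
  "pst wb es M \<longleftrightarrow> (\<forall>k<length es. M ! (wb + 3 * k) = ad (fst (es ! k)) \<and> M ! Suc (wb + 3 * k) = fst (snd (es ! k)) \<and>
     M ! Suc (Suc (wb + 3 * k)) = snd (snd (es ! k)))"

lemma pst_append: "pst wb es M \<Longrightarrow> q = wb + 3 * length es \<Longrightarrow> Suc (Suc q) < length M \<Longrightarrow>
   pst wb (es @ [(T, s, \<tau>)]) (M[q := ad T, Suc q := s, Suc (Suc q) := \<tau>])"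
  unfolding pst_def by (auto simp: nth_append nth_list_update less_Suc_eq)

definition outs :: "nat \<Rightarrow> nat list \<Rightarrow> nat list \<Rightarrow> bool" where
  "outs wb M1 M \<longleftrightarrow> (\<forall>a<bs + 3 * cap. a < wb \<or> wb + cap \<le> a \<longrightarrow> M ! a = M1 ! a)"

lemma outs_upd: "outs wb M1 M \<Longrightarrow> wb \<le> a \<Longrightarrow> a < wb + cap \<Longrightarrow> outs wb M1 (M[a := x])"
  unfolding outs_def by auto

text \<open>The path is written from address \<open>wb\<close> on. For \<open>access\<close> this is a scratch area, where the path need
  not start at the root (\<open>rt\<close> is false) and the path of the finger is preserved (\<open>outs\<close>).\<close>

definition fI0 :: "bool \<Rightarrow> nat \<Rightarrow> nat \<Rightarrow> nat \<Rightarrow> nat \<Rightarrow> nat list \<Rightarrow> tree \<times> nat \<times> (tree \<times> nat \<times> nat) list \<Rightarrow> ram_state \<Rightarrow> bool" where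
  "fI0 rt wb i th d M1 x S \<longleftrightarrow> (case x of (A, s, es) \<Rightarrow> case S of (R, M) \<Rightarrow>
     okM M \<and> occ A s \<and> s \<le> i \<and> i < s + sz A \<and> R rA = ad A \<and> R rS = s \<and> R rI = i \<and> R rTt = th \<and> R rD = d \<and>
     R rWp = wb + 3 * length es \<and> pst wb es M \<and> okp rt es A s \<and> length es + dep A \<le> dep t \<and> outs wb M1 M)"

lemma fI0_frame: "fI0 rt wb i th d M1 x S \<Longrightarrow> (\<forall>r\<in>{2, 3, 4, 6, 19, 23}. fst S' r = fst S r) \<Longrightarrow> snd S' = snd S \<Longrightarrow> fI0 rt wb i th d M1 x S'"
  unfolding fI0_def by (cases x; cases S; cases S') auto

lemma fI0D:
  assumes "fI0 rt wb i th d M1 (A, s, es) (R, M)"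
  shows "okM M" "occ A s" "s \<le> i" "i < s + sz A" "R rA = ad A" "R rS = s" "R rI = i" "R rTt = th" "R rD = d"
     "R rWp = wb + 3 * length es" "pst wb es M" "okp rt es A s" "length es + dep A \<le> dep t" "outs wb M1 M" "A \<in> subs t" "s + sz A \<le> sz t"
  using assms unfolding fI0_def occ_def by auto

lemma push_mem:
  assumes "fI0 rt wb i th d M1 (A, s, es) (R, M)" "bs \<le> wb" "wb + cap \<le> bs + 3 * cap" "q = wb + 3 * length es"
  shows "okM (M[q := a, Suc q := b, Suc (Suc q) := c])" "outs wb M1 (M[q := a, Suc q := b, Suc (Suc q) := c])"
    "pst wb (es @ [(A, s, \<tau>)]) (M[q := ad A, Suc q := s, Suc (Suc q) := \<tau>])" "Suc (Suc q) < bs + 3 * cap" "Suc (Suc (Suc q)) < 2 ^ w"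
proof -
  note D = fI0D[OF assms(1)]
  have q: "Suc (Suc q) < wb + cap" using D(13) cap assms(4) by linarith
  show "Suc (Suc q) < bs + 3 * cap" "Suc (Suc (Suc q)) < 2 ^ w" using q assms(3) lenw by linarith+
  show "okM (M[q := a, Suc q := b, Suc (Suc q) := c])" using D(1) assms(2,4) by (simp add: okM_upd)
  show "outs wb M1 (M[q := a, Suc q := b, Suc (Suc q) := c])" using D(14) q assms(2,4) by (simp add: outs_upd)
  show "pst wb (es @ [(A, s, \<tau>)]) (M[q := ad A, Suc q := s, Suc (Suc q) := \<tau>])"
    using pst_append[OF D(11) assms(4)] q assms(3) okM_len[OF D(1)] by simp
qed

definition chd :: "nat \<Rightarrow> tree \<times> nat \<times> (tree \<times> nat \<times> nat) list \<Rightarrow> tree \<times> nat \<times> (tree \<times> nat \<times> nat) list" where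
  "chd i x = (case x of (A, s, es) \<Rightarrow> case A of Lf a \<Rightarrow> x | Nd l r \<Rightarrow>
     if i < s + sz l then (l, s, es @ [(A, s, 2)]) else (r, s + sz l, es @ [(A, s, 2)]))"

lemma dStep'_wpb:
  assumes I: "fI0 rt wb i th d M1 (A, s, es) (R, M)" and wb: "bs \<le> wb" "wb + cap \<le> bs + 3 * cap"
  shows "wpb w dStep' 90 (fI0 rt wb i th d M1 (chd i (A, s, es))) (R, M)"
proof -
  note D = fI0D[OF I]
  note base = lenw bs35 okM_len[OF D(1)] ad[OF D(15)]
  show ?thesis
  proof (cases A)
    case (Lf a)
    have "M ! Suc (ad A) = 0" using leaf_test[OF D(1,15)] Lf by blast
    then show ?thesis unfolding wpb_def dStep'_def using base I by (simp add: D(5) Lf chd_def)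
  next
    case (Nd l r)
    define q where "q = wb + 3 * length es"
    note m = push_mem[OF I wb q_def]
    have lr: "l \<in> subs t" "r \<in> subs t" using sub_Nd[OF D(15)[unfolded Nd]] by auto
    have c: "M ! Suc (ad A) = ad l" "M ! Suc (Suc (ad A)) = ad r" "M ! ad l = sz l" "ad l \<noteq> 0"
      using rec_c0[OF D(1) D(15)[unfolded Nd]] rec_c1[OF D(1) D(15)[unfolded Nd]] rec_sz[OF D(1) lr(1)] ad[OF lr(1)] Nd by auto
    have o: "occ l s" "occ r (s + sz l)" using occ_Nd[OF D(2)[unfolded Nd]] by auto
    have k: "okp rt (es @ [(A, s, 2)]) l s" "okp rt (es @ [(A, s, 2)]) r (s + sz l)"
      by (rule okp_append[OF D(12)], simp add: Nd)+
    have aux: "s + sz l < 2 ^ w" "wb + (3 + 3 * length es) = 3 + q" "i < s + (sz l + sz r)" "Suc (length es + dep l) \<le> dep t" "Suc (length es + dep r) \<le> dep t" "3 + q < 2 ^ w"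
      using D(4,13,16) szw m(5) Nd by (auto simp: q_def)
    show ?thesis unfolding wpb_def dStep'_def dStep_def dPush_def using base ad[OF lr(1)] m(4,5) D(3) aux
      by (simp add: fI0_def chd_def Nd D(7-10) D(5,6)[unfolded Nd] c[unfolded Nd] q_def[symmetric] m(1-3)[unfolded Nd] o k[unfolded Nd])
  qed
qed

end

text \<open>Along a path the intervals shrink inwards while they still contain \<open>i\<close>, so
  the near end only comes closer.\<close>

lemma noffs_hn:
  assumes "holds d (s + Off d A) i (hn d k A)" "s \<le> i"
  shows "noffs d i (s + Off d A - Off d (hn d k A)) (hn d k A) \<le> noffs d i s A"
  using hn_range[of d A "s + Off d A" 0 k] unfolding noffs_def by auto

context dmem begin

text \<open>A position within \<open>th\<close> of the near end cannot lie beyond a near child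
  larger than \<open>th\<close>. If a path that follows near children is left towards a far child,
  then the near child has size at most \<open>th\<close>, and the far one at most its
  square.\<close>

lemma child_cases:
  assumes X: "X = Nd l r" and z: "Off d X \<le> z" and sX: "sX = z - Off d X" and h: "holds d z i X" and n: "noffs d i sX X \<le> th"
    and Y: "chd i (X, sX, es) = (Y, sY, es')"
  shows "th < bv d X \<Longrightarrow> sz Y = bv d X \<and> noffs d i sY Y \<le> th"
    and "\<not> holds d z i (hc d X) \<Longrightarrow> bv d X \<le> th * th \<Longrightarrow> sz Y \<le> th * th"
proof -
  have i: "sX \<le> i" "i < sX + (sz l + sz r)" using h unfolding holds_def sX X by simp_all
  have Yc: "(Y = l \<and> sY = sX \<and> i < sX + sz l) \<or> (Y = r \<and> sY = sX + sz l \<and> \<not> i < sX + sz l)"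
    using Y by (auto simp: chd_def X split: if_splits)
  show "sz Y = bv d X \<and> noffs d i sY Y \<le> th" if b: "th < bv d X"
    using Yc i n b unfolding X noffs_def by (cases "d = 0") (auto simp: near_def split: if_splits)
  assume nh: "\<not> holds d z i (hc d X)" and b: "bv d X \<le> th * th"
  have hs: "(\<not> hR d l r \<and> hc d X = l \<and> z - Off d l = sX) \<or> (hR d l r \<and> hc d X = r \<and> z - Off d r = sX + sz l)"
    using z unfolding sX X by (auto split: if_splits)
  have Yo: "(\<not> hR d l r \<and> Y = r \<and> \<not> i < sX + sz l) \<or> (hR d l r \<and> Y = l \<and> i < sX + sz l)"
    using Yc hs nh i unfolding holds_def by auto
  have sq: "sz Y \<le> th * th" if "sz H \<le> th" "sz Y \<le> sz H * sz H" for H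
    using that mult_le_mono[OF that(1) that(1)] by linarith
  show "sz Y \<le> th * th"
  proof (cases "sz (near d l r) * sz (near d l r) < sz (far d l r)")
    case True
    have "bv d X = sz (near d l r)" using True by (simp add: X)
    moreover have "sz Y = sz (near d l r)" using Yo True by (auto simp: near_def hR_def split: if_splits)
    ultimately show ?thesis using b by simp
  next
    case False
    have Yf: "sz Y = sz (far d l r)" using Yo False by (auto simp: far_def hR_def split: if_splits)
    have "hR d l r \<longleftrightarrow> d \<noteq> 0" using False by (simp add: hR_def)
    then have "sz (near d l r) \<le> th" using Yo n i unfolding X noffs_def by (cases "d = 0") (auto simp: near_def)
    then show ?thesis using sq[of "near d l r"] False Yf by simp
  qed
qed

definition gp :: "nat \<Rightarrow> tree \<Rightarrow> nat" where
  "gp d X = (if gset T0 d X = {} then 0 else ad (hn d (Min (gset T0 d X)) X))"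

text \<open>An upper bound for the remaining pointer steps: each one raises the iterated logarithm
  of \<open>max T0 b\<close> until \<open>b\<close> exceeds the threshold.\<close>

definition hp :: "nat \<Rightarrow> nat \<Rightarrow> nat" where
  "hp th b = (if th < b then 0 else fl (fl th) - fl (fl (max T0 b)) + 1)"

lemma hp_le: "hp th b \<le> fl (fl th) - fl (fl T0) + 1"
proof -
  have "fl (fl T0) \<le> fl (fl (max T0 b))" by (intro fl_mono) simp
  then show ?thesis by (auto simp: hp_def intro: diff_le_mono2)
qed

lemma hp_hop: 
  assumes "b \<le> th" "T0 \<le> th" "(max T0 b)\<^sup>2 < b'"
  shows "Suc (hp th b') \<le> hp th b"
proof (cases "th < b'")
  case False
  have "2 \<le> max T0 b" using T0(1) by simp
  then have "Suc (fl (fl (max T0 b))) \<le> fl (fl b')" using assms(3) by (intro fl_sq) (simp_all add: power2_eq_square)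
  moreover have "fl (fl b') \<le> fl (fl (max T0 b'))" by (intro fl_mono) simp
  moreover have "fl (fl (max T0 b')) \<le> fl (fl th)" using assms(2) False by (intro fl_mono) simp
  ultimately show ?thesis using False assms(1) by (simp add: hp_def)
qed (use assms in \<open>simp add: hp_def\<close>)

lemma glim_le: "bv d X \<le> th \<Longrightarrow> T0 \<le> th \<Longrightarrow> glim T0 d X \<le> th * th"
  unfolding glim_def power2_eq_square by (intro mult_le_mono) simp_all

text \<open>The nodes skipped by a pointer have \<open>bv\<close> at most the square of a value that
  does not exceed \<open>th\<close>. So although they are never inspected, \<open>th * th\<close>
  bounds them all.\<close>

lemma dHop_wpb:
  assumes "okM M" "d \<le> 1" "A \<in> subs t" "T0 \<le> th"
    and R: "R rCur = ad A" "R rBv = bv d A" "R rG = gp d A" "R rTt = th" "R rD = d"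
  shows "wpb w dHop (30 * hp th (bv d A) + 20) (\<lambda>s'. \<exists>kc\<le>hD d A. fst s' rCur = ad (hn d kc A) \<and> fst s' rBv = bv d (hn d kc A) \<and>
     (th < bv d (hn d kc A) \<and> (\<forall>k<kc. bv d (hn d k A) \<le> th * th) \<or> \<not> th < bv d (hn d kc A) \<and> (\<forall>k\<le>hD d A. bv d (hn d k A) \<le> th * th))) (R, M)"
  unfolding wpb_def dHop_def
proof (rule wp_While[where x = 0 and pot = "\<lambda>kc. 30 * hp th (bv d (hn d kc A))" and
    I = "\<lambda>kc (R', M'). M' = M \<and> R' rTt = th \<and> R' rD = d \<and> kc \<le> hD d A \<and> R' rCur = ad (hn d kc A) \<and> R' rBv = bv d (hn d kc A) \<and>
      R' rG = gp d (hn d kc A) \<and> (\<forall>k<kc. bv d (hn d k A) \<le> th * th)"], goal_cases)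
  case 1 show ?case using R by simp
next
  case (2 x R' M') show ?case using lenw bs35 by simp
next
  case (3 kc R' M')
  define X where "X = hn d kc A"
  have T: "M' = M" "R' rTt = th" "R' rD = d" "kc \<le> hD d A" "R' rCur = ad X" "R' rBv = bv d X" "R' rG = gp d X" "\<forall>k<kc. bv d (hn d k A) \<le> th * th"
    and b: "bv d X \<le> th" and g0: "gp d X \<noteq> 0" using 3 by (auto simp: X_def split: if_splits)
  define m where "m = Min (gset T0 d X)"
  have ne: "gset T0 d X \<noteq> {}" using g0 by (auto simp: gp_def)
  have fin: "finite (gset T0 d X)" by (rule finite_subset[of _ "{..hD d X}"]) (auto simp: gset_def)
  have m: "0 < m" "m \<le> hD d X" "glim T0 d X < bv d (hn d m X)" using Min_in[OF fin ne] by (auto simp: m_def gset_def)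
  have lo: "j \<notin> gset T0 d X" if "j < m" for j using that fin ne by (auto simp: m_def)
  have Y: "hn d m X = hn d (m + kc) A" unfolding X_def by (rule hn_add)
  have hX: "hD d X = hD d A - kc" using hD_hn[OF T(4)] by (simp add: X_def)
  have kc': "m + kc \<le> hD d A" using m hX T(4) by linarith
  have Ys: "hn d m X \<in> subs t" using hn_sub[OF assms(3)] Y by simp
  have g: "gp d X = ad (hn d m X)" using ne by (simp add: gp_def m_def)
  have al: "bv d (hn d k A) \<le> th * th" if "k < m + kc" for k
  proof (cases "k < kc")
    case False
    define j where "j = k - kc"
    have j: "hn d k A = hn d j X" "j < m" using False that unfolding X_def hn_add j_def by auto
    have "bv d (hn d j X) \<le> glim T0 d X"
    proof (cases "j = 0")
      case True then show ?thesis by (simp add: glim_def power2_eq_square) (metis le_square max.cobounded2 mult_le_mono order_trans)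
    next
      case False then show ?thesis using lo[OF j(2)] m j by (auto simp: gset_def not_less)
    qed
    then show ?thesis using j glim_le[OF b assms(4)] by simp
  qed (use T in simp)
  have h: "Suc (hp th (bv d (hn d m X))) \<le> hp th (bv d X)" using hp_hop[OF b assms(4)] m(3) by (simp add: glim_def)
  note rr = recs(4,5)[OF assms(1) Ys assms(2), folded gp_def]
  have p: "ad (hn d m X) + 13 + d < 2 ^ w" "ad (hn d m X) + 13 + d < bs + 3 * cap" using ad[OF Ys] lenw bs35 assms(2) by linarith+
  show ?case unfolding T(1) dHBody_def using p okM_len[OF assms(1)] h
    by (simp add: T(2-7) g rr X_def[symmetric])
      (rule exI[of _ "m + kc"], simp add: kc' al Y[symmetric])
next
  case (4 q kc R' M')
  define X where "X = hn d kc A"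
  have T: "M' = M" "R' rTt = th" "R' rD = d" "kc \<le> hD d A" "R' rCur = ad X" "R' rBv = bv d X" "R' rG = gp d X" "\<forall>k<kc. bv d (hn d k A) \<le> th * th"
    using 4(1) by (auto simp: X_def)
  have q: "q \<le> 30 * hp th (bv d A) + 20" using 4(3) by simp
  have hX: "hD d X = hD d A - kc" using hD_hn[OF T(4)] by (simp add: X_def)
  have "\<forall>k\<le>hD d A. bv d (hn d k A) \<le> th * th" if nb: "\<not> th < bv d X"
  proof (intro allI impI)
    fix k assume k: "k \<le> hD d A"
    have "gp d X = 0" using 4(2) T nb by (auto split: if_splits)
    have e: "gset T0 d X = {}"
    proof (rule ccontr)
      assume "gset T0 d X \<noteq> {}"
      then have "gp d X = ad (hn d (Min (gset T0 d X)) X)" by (simp add: gp_def)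
      moreover have "hn d (Min (gset T0 d X)) X \<in> subs t" using hn_sub[OF hn_sub[OF assms(3)]] by (simp add: X_def)
      ultimately show False using ad[of "hn d (Min (gset T0 d X)) X"] \<open>gp d X = 0\<close> by simp
    qed
    show "bv d (hn d k A) \<le> th * th"
    proof (cases "k < kc")
      case False
      define j where "j = k - kc"
      have j: "hn d k A = hn d j X" "j \<le> hD d X" using False k hX unfolding X_def hn_add j_def by auto
      have "bv d (hn d j X) \<le> glim T0 d X"
      proof (cases "j = 0")
        case True then show ?thesis by (simp add: glim_def power2_eq_square) (metis le_square max.cobounded2 mult_le_mono order_trans)
      next
        case False then show ?thesis using e j by (auto simp: gset_def not_less)
      qed
      then show ?thesis using j glim_le[of d X th] nb assms(4) by simp
    qed (use T in simp)
  qed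
  then show ?case using T q by (auto simp: X_def)
qed

lemma dB0_wpb:
  assumes "fI0 rt wb i th d M1 (A, s, es) (R, M)" "d \<le> 1"
  shows "wpb w dB0 40 (\<lambda>s'. s' = (R(rZ := s + Off d A, rCur := ad A, rBv := bv d A, rG := gp d A), M)) (R, M)"
proof -
  note D = fI0D[OF assms(1)]
  have p: "ad A + 13 + d < 2 ^ w" "ad A + 13 + d < bs + 3 * cap" "s + Off d A < 2 ^ w" "ad A + 11 + d < 2 ^ w" "ad A + 5 + d < 2 ^ w" "ad A + 11 + d < bs + 3 * cap" "ad A + 5 + d < bs + 3 * cap"
    using ad[OF D(15)] lenw bs35 assms(2) Off_less[of d A] D(16) szw by linarith+
  show ?thesis unfolding wpb_def dB0_def using p okM_len[OF D(1)]
    by (simp add: D(5,6,9) recs(1,4,5)[OF D(1,15) assms(2)] gp_def)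
qed

lemma dB3_wpb:
  assumes I: "fI0 rt wb i th d M1 (A, s, es) (R, M)" and wb: "bs \<le> wb" "wb + cap \<le> bs + 3 * cap" and d: "d \<le> 1"
    and k: "k \<le> hD d A" and R: "R rX = ad (hn d k A)" "R rZ = s + Off d A" and h: "holds d (s + Off d A) i (hn d k A)"
  shows "wpb w dB3 70 (fI0 rt wb i th d M1 (hn d k A, s + Off d A - Off d (hn d k A), if k = 0 then es else es @ [(A, s, d)])) (R, M)"
proof -
  note D = fI0D[OF I]
  define X where "X = hn d k A"
  define z where "z = s + Off d A"
  define sX where "sX = z - Off d X"
  have X: "X \<in> subs t" using hn_sub[OF D(15)] by (simp add: X_def)
  have o: "occ X sX" "Off d X \<le> z" using occ_hn[OF D(2), of k d] by (auto simp: X_def z_def sX_def)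
  have oh: "sX \<le> i" "i < sX + sz X" using h by (auto simp: holds_def X_def[symmetric] z_def[symmetric] sX_def)
  define q where "q = wb + 3 * length es"
  note m = push_mem[OF I wb q_def]
  have p: "ad X + 5 + d < 2 ^ w" "ad X + 5 + d < bs + 3 * cap" "z < 2 ^ w" "ad A < bs + 3 * cap"
    using ad[OF X] ad[OF D(15)] lenw bs35 d Off_less[of d A] D(16) szw unfolding z_def by linarith+
  \<comment> \<open>Sizes decrease strictly along a path, so comparing them tells whether the path
    was followed at all and an entry for \<open>A\<close> is due.\<close>
  have sz: "sz X < sz A \<longleftrightarrow> 0 < k" using hn_sz[OF _ k] by (cases "k = 0") (auto simp: X_def)
  have lk: "0 < k \<Longrightarrow> okp rt (es @ [(A, s, d)]) X sX"
    using d k by (intro okp_append[OF D(12)]) (auto simp: X_def sX_def z_def)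
  have dp: "dep X + k \<le> dep A" using hn_dep[OF k] by (simp add: X_def)
  note recsX = recs(1)[OF D(1) X d] rec_sz[OF D(1) X] rec_sz[OF D(1,15)]
  show ?thesis
  proof (cases "k = 0")
    case True
    then have "X = A" "sX = s" by (auto simp: X_def sX_def z_def)
    then show ?thesis unfolding wpb_def dB3_def dPush_def X_def[symmetric] z_def[symmetric] sX_def[symmetric] using p okM_len[OF D(1)] I o
      by (simp add: R[folded X_def z_def] D(5-10) recsX True sX_def[symmetric]) (simp add: fI0_def recs(1)[OF D(1,15) d] z_def)
  next
    case False
    have "sX < 2 ^ w" "Suc (length es + dep X) \<le> dep t" "wb + (3 + 3 * length es) = 3 + q" "3 + q < 2 ^ w" using p dp False D(13) m(5) by (auto simp: sX_def q_def)
    then show ?thesis unfolding wpb_def dB3_def dPush_def X_def[symmetric] z_def[symmetric] sX_def[symmetric] using p okM_len[OF D(1)] o m(4,5) oh False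
      by (simp add: R[folded X_def z_def] D(5-10) recsX sz sX_def[symmetric] q_def[symmetric])
        (simp add: fI0_def m(1-3) lk D q_def[symmetric])
  qed
qed

definition "dBig = (dB0 ;; dHop ;; dB2 ;; dB3)"

text \<open>There are two outcomes. The cheap one stops at a near child larger than
  \<open>th\<close>, which shrinks the size to its square root. The other pays \<open>KS\<close> for
  a search, but its exit leads to a subtree of size at most \<open>th * th\<close>, so it occurs
  only once in a descent.\<close>

lemma dBig_wpb:
  assumes I: "fI0 rt wb i th d M1 (A, s, es) (R, M)" and wb: "bs \<le> wb" "wb + cap \<le> bs + 3 * cap" and d: "d \<le> 1" and th: "T0 \<le> th"
  shows "\<exists>k\<le>hD d A. \<exists>es' B. holds d (s + Off d A) i (hn d k A) \<and>
    wpb w dBig B (fI0 rt wb i th d M1 (hn d k A, s + Off d A - Off d (hn d k A), es')) (R, M) \<and>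
    (B \<le> 30 * (fl (fl th) - fl (fl T0)) + 250 \<and> th < bv d (hn d k A) \<or>
     B \<le> 30 * (fl (fl th) - fl (fl T0)) + 250 + KS \<and> bv d (hn d k A) \<le> th * th \<and> (k < hD d A \<longrightarrow> \<not> holds d (s + Off d A) i (hn d (Suc k) A)))"
proof -
  note D = fI0D[OF I]
  define z where "z = s + Off d A"
  define H where "H = 30 * hp th (bv d A) + 20"
  define F where "F = fI0 rt wb i th d M1"
  have Hle: "H \<le> 30 * (fl (fl th) - fl (fl T0)) + 50" unfolding H_def using hp_le[of th "bv d A"] by linarith
  have i: "i < sz t" using D(4,16) by simp
  have hA: "holds d z i A" using D(3,4) by (simp add: holds_def z_def)
  define R1 where "R1 = R(rZ := z, rCur := ad A, rBv := bv d A, rG := gp d A)"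
  have W0: "wpb w dB0 40 (\<lambda>s'. s' = (R1, M)) (R, M)" using dB0_wpb[OF I d] by (simp add: R1_def z_def)
  have I1: "F (A, s, es) (R1, M)" unfolding F_def by (rule fI0_frame[OF I]) (auto simp: R1_def)
  have W1: "wpb w dHop H (\<lambda>s'. (\<exists>kc\<le>hD d A. fst s' rCur = ad (hn d kc A) \<and> fst s' rBv = bv d (hn d kc A) \<and>
     (th < bv d (hn d kc A) \<and> (\<forall>k<kc. bv d (hn d k A) \<le> th * th) \<or> \<not> th < bv d (hn d kc A) \<and> (\<forall>k\<le>hD d A. bv d (hn d k A) \<le> th * th))) \<and>
     (\<forall>r. r \<notin> {20, 21, 22} \<longrightarrow> fst s' r = R1 r) \<and> snd s' = M) (R1, M)"
  proof -
    have "wpb w dHop H (\<lambda>s'. \<exists>kc\<le>hD d A. fst s' rCur = ad (hn d kc A) \<and> fst s' rBv = bv d (hn d kc A) \<and>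
     (th < bv d (hn d kc A) \<and> (\<forall>k<kc. bv d (hn d k A) \<le> th * th) \<or> \<not> th < bv d (hn d kc A) \<and> (\<forall>k\<le>hD d A. bv d (hn d k A) \<le> th * th))) (R1, M)"
      unfolding H_def using D(8,9) by (intro dHop_wpb[OF D(1) d D(15) th]) (auto simp: R1_def)
    from wpb_frame[OF this] show ?thesis by (rule wpb_mono) (auto simp: dHop_def dHBody_def)
  qed
  have "\<exists>kc. wpb w dHop H (\<lambda>s'. (kc \<le> hD d A \<and>
     (th < bv d (hn d kc A) \<and> (\<forall>k<kc. bv d (hn d k A) \<le> th * th) \<or> \<not> th < bv d (hn d kc A) \<and> (\<forall>k\<le>hD d A. bv d (hn d k A) \<le> th * th))) \<and>
     fst s' rCur = ad (hn d kc A) \<and> fst s' rBv = bv d (hn d kc A) \<and> (\<forall>r. r \<notin> {20, 21, 22} \<longrightarrow> fst s' r = R1 r) \<and> snd s' = M) (R1, M)"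
    by (rule wpb_ex, rule wpb_mono[OF W1 order_refl]) blast
  then obtain kc where kc: "wpb w dHop H (\<lambda>s'. (kc \<le> hD d A \<and>
     (th < bv d (hn d kc A) \<and> (\<forall>k<kc. bv d (hn d k A) \<le> th * th) \<or> \<not> th < bv d (hn d kc A) \<and> (\<forall>k\<le>hD d A. bv d (hn d k A) \<le> th * th))) \<and>
     fst s' rCur = ad (hn d kc A) \<and> fst s' rBv = bv d (hn d kc A) \<and> (\<forall>r. r \<notin> {20, 21, 22} \<longrightarrow> fst s' r = R1 r) \<and> snd s' = M) (R1, M)" by blast
  note kc1 = wpb_pure[OF kc]
  have kcD: "kc \<le> hD d A" and al: "th < bv d (hn d kc A) \<and> (\<forall>k<kc. bv d (hn d k A) \<le> th * th) \<or> \<not> th < bv d (hn d kc A) \<and> (\<forall>k\<le>hD d A. bv d (hn d k A) \<le> th * th)"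
    using kc1 by blast+
  have W1': "wpb w dHop H (\<lambda>s'. \<exists>R'. s' = (R', M) \<and> R' rCur = ad (hn d kc A) \<and> R' rBv = bv d (hn d kc A) \<and> (\<forall>r. r \<notin> {20, 21, 22} \<longrightarrow> R' r = R1 r)) (R1, M)"
    by (rule wpb_mono[OF conjunct2[OF kc1] order_refl]) (auto simp: prod_eq_iff)
  define K where "K = hn d kc A"
  have Ks: "K \<in> subs t" using hn_sub[OF D(15)] by (simp add: K_def)
  have oK: "occ K (z - Off d K)" "Off d K \<le> z" using occ_hn[OF D(2), of kc d] by (auto simp: K_def z_def)
  have p: "ad K + 5 + d < 2 ^ w" "ad K + 5 + d < bs + 3 * cap" "z < 2 ^ w" "z - Off d K + sz K < 2 ^ w" "(1::nat) < 2 ^ w"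
    using ad[OF Ks] lenw bs35 d Off_less[of d A] D(16) szw oK unfolding z_def occ_def by linarith+
  have I2: "F (A, s, es) (R', M)" if "\<forall>r. r \<notin> {20, 21, 22} \<longrightarrow> R' r = R1 r" for R'
    unfolding F_def by (rule fI0_frame[OF I1[unfolded F_def]]) (use that in auto)
  have I3: "F (A, s, es) (R', M)" if "\<forall>r. r \<notin> {20, 21, 22} \<union> {rX, rJ, rSs, rFl} \<longrightarrow> R' r = R1 r" for R'
    unfolding F_def by (rule fI0_frame[OF I1[unfolded F_def]]) (use that in auto)
  have asm: "wpb w dBig (40 + (H + (B2 + 70))) P (R, M)"
    if B: "\<And>R'. R' rCur = ad K \<Longrightarrow> R' rBv = bv d K \<Longrightarrow> \<forall>r. r \<notin> {20, 21, 22} \<longrightarrow> R' r = R1 r \<Longrightarrow> wpb w dB2 B2 (wpb w dB3 70 P) (R', M)" for B2 P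
  proof -
    have 2: "wpb w (dB2 ;; dB3) (B2 + 70) P (R', M)" if "R' rCur = ad K" "R' rBv = bv d K" "\<forall>r. r \<notin> {20, 21, 22} \<longrightarrow> R' r = R1 r" for R'
      by (rule wpb_Sq) (rule B[OF that])
    have 1: "wpb w (dHop ;; dB2 ;; dB3) (H + (B2 + 70)) P (R1, M)"
      by (rule wpb_Sq, rule wpb_mono[OF W1' order_refl]) (auto intro: 2 simp: K_def)
    show ?thesis unfolding dBig_def by (rule wpb_Sq, rule wpb_mono[OF W0 order_refl], simp only: 1)
  qed
  note RR = D(7-9)
  define sK where "sK = z - Off d K"
  show ?thesis
  proof (cases "th < bv d K \<and> holds d z i K")
    case True
    define es' where "es' = (if kc = 0 then es else es @ [(A, s, d)])"
    have ii: "sK \<le> i" "i < sK + sz K" using True by (auto simp: holds_def sK_def)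
    have "wpb w dBig (40 + (H + (60 + 70))) (F (K, sK, es')) (R, M)"
    proof (rule asm)
      fix R' assume a: "R' rCur = ad K" "R' rBv = bv d K" "\<forall>r. r \<notin> {20, 21, 22} \<longrightarrow> R' r = R1 r"
      have r: "R' rZ = z" "R' rD = d" "R' rI = i" "R' rTt = th" using a(3) RR by (auto simp: R1_def)
      have "wpb w dB2 60 (\<lambda>s'. s' = (R'(rSs := sK, rX := ad K), M)) (R', M)"
        unfolding wpb_def dB2_def eIn_def using p okM_len[OF D(1)] oK(2) ii True
        by (simp add: a(1,2) r recs(1)[OF D(1) Ks d] rec_sz[OF D(1) Ks] sK_def[symmetric])
      then show "wpb w dB2 60 (wpb w dB3 70 (F (K, sK, es'))) (R', M)"
      proof (rule wpb_mono[OF _ order_refl], simp only:)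
        fix s' :: ram_state
        have "F (A, s, es) (R'(rSs := sK, rX := ad K), M)" using a(3) by (intro I3) auto
        from dB3_wpb[OF this[unfolded F_def] wb d kcD] r True
        show "wpb w dB3 70 (F (K, sK, es')) (R'(rSs := sK, rX := ad K), M)"
          by (simp add: F_def K_def sK_def z_def es'_def)
      qed
    qed
    then show ?thesis using kcD True Hle unfolding K_def sK_def F_def z_def
      by (intro exI[of _ kc] conjI exI[of _ es'] exI[of _ "40 + (H + (60 + 70))"]) auto
  next
    case False
    have "wpb w dBig (40 + (H + ((60 + KS) + 70))) (\<lambda>s'. \<exists>k. (k \<le> hD d A \<and> holds d z i (hn d k A) \<and> (k < hD d A \<longrightarrow> \<not> holds d z i (hn d (Suc k) A))) \<and>
        F (hn d k A, z - Off d (hn d k A), if k = 0 then es else es @ [(A, s, d)]) s') (R, M)" (is "wpb _ _ _ ?P _")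
    proof (rule asm)
      fix R' assume a: "R' rCur = ad K" "R' rBv = bv d K" "\<forall>r. r \<notin> {20, 21, 22} \<longrightarrow> R' r = R1 r"
      have r: "R' rZ = z" "R' rD = d" "R' rI = i" "R' rTt = th" "R' rA = ad A" using a(3) RR D(5) by (auto simp: R1_def)
      define R2 where "R2 = R'(rSs := sK, rX := ad A)"
      have S: "wpb w dSearch KS (\<lambda>s'. (\<exists>k\<le>hD d A. fst s' rX = ad (hn d k A) \<and> holds d z i (hn d k A) \<and> (k < hD d A \<longrightarrow> \<not> holds d z i (hn d (Suc k) A))) \<and>
        (\<forall>r. r \<notin> {rX, rJ, rSs, rFl} \<longrightarrow> fst s' r = R2 r) \<and> snd s' = M) (R2, M)"
        by (rule dSearch_wpb[OF D(1) d D(15) z_def D(16) i hA]) (auto simp: R2_def r)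
      have "wpb w dSearch KS (wpb w dB3 70 ?P) (R2, M)"
      proof (rule wpb_mono[OF S order_refl])
        fix s' assume s': "(\<exists>k\<le>hD d A. fst s' rX = ad (hn d k A) \<and> holds d z i (hn d k A) \<and> (k < hD d A \<longrightarrow> \<not> holds d z i (hn d (Suc k) A))) \<and>
          (\<forall>r. r \<notin> {rX, rJ, rSs, rFl} \<longrightarrow> fst s' r = R2 r) \<and> snd s' = M"
        obtain R3 where R3: "s' = (R3, M)" using s' by (cases s') auto
        obtain k where k: "k \<le> hD d A" "R3 rX = ad (hn d k A)" "holds d z i (hn d k A)" "k < hD d A \<longrightarrow> \<not> holds d z i (hn d (Suc k) A)"
          using s' by (auto simp: R3)
        have fr: "\<forall>r. r \<notin> {20, 21, 22} \<union> {rX, rJ, rSs, rFl} \<longrightarrow> R3 r = R1 r" using s' a(3) by (auto simp: R3 R2_def)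
        then have z3: "R3 rZ = z" by (auto simp: R1_def)
        show "wpb w dB3 70 ?P s'" unfolding R3
          by (rule wpb_mono[OF dB3_wpb[OF I3[OF fr, unfolded F_def] wb d k(1,2) z3[unfolded z_def] k(3)[unfolded z_def]] order_refl])
            (rule exI[of _ k], use k in \<open>simp add: F_def z_def\<close>)
      qed
      moreover have "wpb w (rSs ::= V rZ \<^bold>- Ld (V rCur \<^bold>+ C 5 \<^bold>+ V rD) ;; IfC ((V rTt \<^bold>< V rBv) \<^bold>* eIn rSs (V rCur)) (rX ::= V rCur) (rX ::= V rA ;; dSearch)) (60 + KS) P (R', M)"
        if "wpb w dSearch KS P (R2, M)" for P
      proof -
        have c: "\<not> (th < bv d K \<and> i < sK + sz K \<and> \<not> i < sK)" using False by (auto simp: holds_def sK_def)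
        have sK: "sK < 2 ^ w" "sK + sz K < 2 ^ w" using p by (auto simp: sK_def)
        show ?thesis using that unfolding wpb_def eIn_def using p okM_len[OF D(1)] oK(2) c sK
          by (simp add: a(1,2) r recs(1)[OF D(1) Ks d] rec_sz[OF D(1) Ks] sK_def[symmetric] R2_def)
            (elim wp_mono, simp)
      qed
      ultimately show "wpb w dB2 (60 + KS) (wpb w dB3 70 ?P) (R', M)" unfolding dB2_def by blast
    qed
    from wpb_ex[OF this] obtain k where k: "wpb w dBig (40 + (H + ((60 + KS) + 70))) (\<lambda>s'. (k \<le> hD d A \<and> holds d z i (hn d k A) \<and> (k < hD d A \<longrightarrow> \<not> holds d z i (hn d (Suc k) A))) \<and>
        F (hn d k A, z - Off d (hn d k A), if k = 0 then es else es @ [(A, s, d)]) s') (R, M)" by blast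
    note k1 = conjunct1[OF wpb_pure[OF k]] and k2 = conjunct2[OF wpb_pure[OF k]]
    \<comment> \<open>If the pointers found a node that does not contain \<open>i\<close>, the path
      is left before that node, where all values are at most \<open>th * th\<close>.\<close>
    have "bv d (hn d k A) \<le> th * th"
    proof (cases "th < bv d K")
      case True
      then have nh: "\<not> holds d z i K" using False by blast
      have "k < kc"
      proof (rule ccontr)
        assume "\<not> k < kc"
        then have "holds d z i K" unfolding K_def using k1 holds_mono[of d A z kc k i] by (auto simp: z_def)
        then show False using nh by blast
      qed
      then show ?thesis using al True by (auto simp: K_def)
    next
      case False then show ?thesis using al k1 by (auto simp: K_def)
    qed
    then show ?thesis using k1 k2 Hle unfolding F_def z_def
      by (intro exI[of _ k] conjI exI[of _ "if k = 0 then es else es @ [(A, s, d)]"] exI[of _ "40 + (H + ((60 + KS) + 70))"]) auto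
  qed
qed

definition "Uc th = 30 * (fl (fl th) - fl (fl T0)) + 400"
definition "Dc th = 50 * (2 * fl th + 2)"
text \<open>Potential of the descent. A small tree pays per level. A large one pays for a cheap
  round per square root that can still be taken, for one search, and for the descent in the small
  tree that remains.\<close>

definition "ppot th A = (if sz A div th \<le> th then 150 * dep A else Uc th * (fl (fl (sz A)) + 1) + KS + 150 * Dc th)"

lemma small_dep: "Y \<in> subs t \<Longrightarrow> T0 \<le> th \<Longrightarrow> sz Y div th \<le> th \<Longrightarrow> dep Y \<le> Dc th"
proof -
  assume a: "Y \<in> subs t" "T0 \<le> th" "sz Y div th \<le> th"
  have th: "2 \<le> th" using a(2) T0(1) by linarith
  have "sz Y < th * (sz Y div th) + th" using th by (metis add_strict_left_mono mod_less_divisor mult_div_mod_eq not_gr0 not_numeral_le_zero)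
  also have "\<dots> \<le> th * th + th * th" using a(3) th by (intro add_mono) auto
  finally have "sz Y \<le> th * (2 * th)" by simp
  then have "fl (sz Y) \<le> fl (th * (2 * th))" by (rule fl_mono)
  also have "\<dots> \<le> fl th + fl (2 * th) + 1" by (rule fl_mult_le)
  also have "fl (2 * th) = Suc (fl th)" using th by (intro floor_log_twice) simp
  finally show ?thesis using dep_le[OF a(1)] by (simp add: Dc_def)
qed

lemma dFBody_split: "dFBody = (IfC (V rTt \<^bold>< Ld (V rA) \<^bold>/ V rTt) dBig Skip ;; dStep')"
  by (simp add: dFBody_def dBig_def)

lemma dFBody_wpb:
  assumes I: "fI0 rt wb i th d M1 (A, s, es) (R, M)" and wb: "bs \<le> wb" "wb + cap \<le> bs + 3 * cap" and d: "d \<le> 1" and th: "T0 \<le> th" "th < 2 ^ w"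
    and A: "A = Nd l r" and n: "sz A div th \<le> th \<or> noffs d i s A \<le> th"
  shows "\<exists>Y sY es' B. wpb w dFBody B (fI0 rt wb i th d M1 (Y, sY, es')) (R, M) \<and> (sz Y div th \<le> th \<or> noffs d i sY Y \<le> th) \<and> B + 10 + ppot th Y \<le> ppot th A"
proof -
  note D = fI0D[OF I]
  let ?e = "V rTt \<^bold>< Ld (V rA) \<^bold>/ V rTt"
  have th0: "0 < th" using th T0(1) by linarith
  have e: "dfd w ?e (R, M)" "val ?e (R, M) = (if th < sz A div th then 1 else 0)" "cost ?e = 6"
    using ad[OF D(15)] lenw okM_len[OF D(1)] th0 by (simp_all add: D(5,8) rec_sz[OF D(1,15)])
  have sq: "sz Y div th \<le> th" if "sz Y \<le> th * th" for Y using div_le_mono[OF that, of th] th0 by simp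
  show ?thesis
  proof (cases "sz A div th \<le> th")
    case True
    obtain Y sY es' where Y: "chd i (A, s, es) = (Y, sY, es')" by (rule prod_cases3)
    have sub: "sz Y \<le> sz A" "dep Y < dep A" using Y by (auto simp: chd_def A split: if_splits)
    have "sz Y div th \<le> th" using div_le_mono[OF sub(1), of th] True by linarith
    moreover have "wpb w dFBody 100 (fI0 rt wb i th d M1 (Y, sY, es')) (R, M)"
      using dStep'_wpb[OF I wb] e True unfolding dFBody_split wpb_def Y[symmetric] by simp (elim wp_mono, simp)
    ultimately show ?thesis using True sub by (intro exI[of _ Y] exI[of _ sY] exI[of _ es'] exI[of _ 100]) (simp add: ppot_def)
  next
    case False
    then have n: "noffs d i s A \<le> th" using n by blast
    obtain k es1 B where k: "k \<le> hD d A" "holds d (s + Off d A) i (hn d k A)"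
      "wpb w dBig B (fI0 rt wb i th d M1 (hn d k A, s + Off d A - Off d (hn d k A), es1)) (R, M)"
      "B \<le> 30 * (fl (fl th) - fl (fl T0)) + 250 \<and> th < bv d (hn d k A) \<or>
       B \<le> 30 * (fl (fl th) - fl (fl T0)) + 250 + KS \<and> bv d (hn d k A) \<le> th * th \<and> (k < hD d A \<longrightarrow> \<not> holds d (s + Off d A) i (hn d (Suc k) A))"
      using dBig_wpb[OF I wb d th(1)] by blast
    define X where "X = hn d k A"
    define sX where "sX = s + Off d A - Off d X"
    have Xs: "X \<in> subs t" using hn_sub[OF D(15)] by (simp add: X_def)
    have oX: "Off d X \<le> s + Off d A" using occ_hn[OF D(2), of k d] by (simp add: X_def)
    have nX: "noffs d i sX X \<le> th" using noffs_hn[OF k(2) D(3)] n by (simp add: X_def sX_def)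
    obtain Y sY es' where Y: "chd i (X, sX, es1) = (Y, sY, es')" by (rule prod_cases3)
    have Ys: "Y \<in> subs t" "sz Y \<le> sz X" proof -
      have "Y \<in> subs t \<and> sz Y \<le> sz X"
      proof (cases X)
        case (Lf a) then show ?thesis using Y Xs by (simp add: chd_def)
      next
        case (Nd l' r')
        have "l' \<in> subs t \<and> r' \<in> subs t" using sub_Nd Xs Nd by blast
        then show ?thesis using Y Nd by (auto simp: chd_def split: if_splits)
      qed
      then show "Y \<in> subs t" "sz Y \<le> sz X" by auto
    qed
    have W: "wpb w dFBody (B + 100) (fI0 rt wb i th d M1 (Y, sY, es')) (R, M)"
    proof -
      have "wpb w (IfC ?e dBig Skip) (B + 8) (fI0 rt wb i th d M1 (X, sX, es1)) (R, M)"
        using k(3) e False unfolding wpb_def X_def sX_def by simp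
      then have "wpb w dFBody ((B + 8) + 90) (fI0 rt wb i th d M1 (Y, sY, es')) (R, M)" unfolding dFBody_split
      proof (intro wpb_Sq, elim wpb_mono[OF _ order_refl])
        fix s' assume "fI0 rt wb i th d M1 (X, sX, es1) s'"
        then show "wpb w dStep' 90 (fI0 rt wb i th d M1 (Y, sY, es')) s'" unfolding Y[symmetric] by (cases s') (auto intro: dStep'_wpb[OF _ wb])
      qed
      then show ?thesis by (rule wpb_mono) simp_all
    qed
    have small: "ppot th Y \<le> 150 * Dc th" if "sz Y div th \<le> th" using small_dep[OF Ys(1) th(1) that] that by (simp add: ppot_def)
    have pA: "ppot th A = Uc th * (fl (fl (sz A)) + 1) + KS + 150 * Dc th" using False by (simp add: ppot_def)
    have U1: "Uc th \<le> Uc th * (fl (fl (sz A)) + 1)" by simp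
    have res: ?thesis if "sz Y div th \<le> th \<or> noffs d i sY Y \<le> th" "B + 110 + ppot th Y \<le> ppot th A"
      using W that by (intro exI[of _ Y] exI[of _ sY] exI[of _ es'] exI[of _ "B + 100"]) simp
    from k(4) show ?thesis
    proof
      assume b: "B \<le> 30 * (fl (fl th) - fl (fl T0)) + 250 \<and> th < bv d (hn d k A)"
      then obtain l' r' where X': "X = Nd l' r'" by (cases X) (auto simp: X_def[symmetric])
      have BU: "B + 110 \<le> Uc th" using b by (simp add: Uc_def)
      have c: "sz Y = bv d X \<and> noffs d i sY Y \<le> th"
        using child_cases(1)[OF X' oX sX_def k(2)[folded X_def] nX Y] b by (simp add: X_def)
      \<comment> \<open>The near child is smaller than the square root of the path node; the
        iterated logarithm drops and releases \<open>Uc th\<close> for this round.\<close>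
      have "bv d X * bv d X < sz X" using bv_cases[OF X', of d] b by (auto simp: X_def[symmetric])
      moreover have "sz X \<le> sz A" using hn_subs sz_subs unfolding X_def by blast
      ultimately have "sz Y * sz Y < sz A" using c by simp
      moreover have "2 \<le> sz Y" using c b th T0(1) by (simp add: X_def[symmetric])
      ultimately have f: "Suc (fl (fl (sz Y))) \<le> fl (fl (sz A))" by (intro fl_sq)
      have "B + 110 + ppot th Y \<le> ppot th A"
      proof (cases "sz Y div th \<le> th")
        case True then show ?thesis using small BU pA U1 by linarith
      next
        case False
        then have "ppot th Y = Uc th * (fl (fl (sz Y)) + 1) + KS + 150 * Dc th" by (simp add: ppot_def)
        moreover have "Uc th * (fl (fl (sz Y)) + 1 + 1) \<le> Uc th * (fl (fl (sz A)) + 1)" using f by (intro mult_le_mono2) simp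
        ultimately show ?thesis using BU pA by (simp add: add_mult_distrib2)
      qed
      then show ?thesis using c res by blast
    next
      assume b: "B \<le> 30 * (fl (fl th) - fl (fl T0)) + 250 + KS \<and> bv d (hn d k A) \<le> th * th \<and> (k < hD d A \<longrightarrow> \<not> holds d (s + Off d A) i (hn d (Suc k) A))"
      then have BU: "B + 110 \<le> Uc th + KS" by (simp add: Uc_def)
      have "sz Y \<le> th * th"
      proof (cases "k < hD d A")
        case True
        have "hD d X \<noteq> 0" using hD_hn[OF k(1)] True by (simp add: X_def)
        then obtain l' r' where X': "X = Nd l' r'" by (cases X) auto
        show ?thesis using child_cases(2)[OF X' oX sX_def k(2)[folded X_def] nX Y] b True by (simp add: X_def)
      next
        case False
        have "hD d X = 0" using hD_hn[OF k(1)] False by (simp add: X_def)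
        then have "sz X = 1" by (cases X) auto
        moreover have "1 \<le> th * th" using th0 by (simp add: Suc_le_eq)
        ultimately show ?thesis using Ys(2) by linarith
      qed
      from sq[OF this] show ?thesis using small BU pA U1 by (intro res) linarith+
    qed
  qed
qed

lemma dFringe_wpb:
  assumes I: "fI0 rt wb i th d M1 (A, s, es) (R, M)" and wb: "bs \<le> wb" "wb + cap \<le> bs + 3 * cap" and d: "d \<le> 1" and th: "T0 \<le> th" "th < 2 ^ w"
    and n: "sz A div th \<le> th \<or> noffs d i s A \<le> th"
  shows "wpb w dFringe (ppot th A + 20) (\<lambda>s'. \<exists>a es'. fI0 rt wb i th d M1 (Lf a, i, es') s') (R, M)"
  unfolding wpb_def dFringe_def
proof (rule wp_While[where x = "(A, s, es)" and pot = "\<lambda>(A, s, es). ppot th A" and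
    I = "\<lambda>(A, s, es) S. fI0 rt wb i th d M1 (A, s, es) S \<and> (sz A div th \<le> th \<or> noffs d i s A \<le> th)"], goal_cases)
  case 1 show ?case using I n by simp
next
  case (2 x R M)
  obtain A s es where x: "x = (A, s, es)" by (rule prod_cases3)
  have I: "fI0 rt wb i th d M1 (A, s, es) (R, M)" using 2 x by simp
  note D = fI0D[OF I]
  show ?case using ad[OF D(15)] lenw okM_len[OF D(1)] by (simp add: D(5))
next
  case (3 x R M)
  obtain A s es where x: "x = (A, s, es)" by (rule prod_cases3)
  have I: "fI0 rt wb i th d M1 (A, s, es) (R, M)" and n: "sz A div th \<le> th \<or> noffs d i s A \<le> th" using 3 x by auto
  note D = fI0D[OF I]
  have "M ! Suc (ad A) \<noteq> 0" using 3(2) D(5) by (auto split: if_splits)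
  then obtain l r where A: "A = Nd l r" using leaf_test[OF D(1,15)] by (cases A) auto
  obtain Y sY es' B where Y: "wpb w dFBody B (fI0 rt wb i th d M1 (Y, sY, es')) (R, M)" "sz Y div th \<le> th \<or> noffs d i sY Y \<le> th" "B + 10 + ppot th Y \<le> ppot th A"
    using dFBody_wpb[OF I wb d th A n] by blast
  show ?case by (rule wp_mono[OF Y(1)[unfolded wpb_def]], rule exI[of _ "(Y, sY, es')"]) (use Y(2,3) x in auto)
next
  case (4 q x R M)
  obtain A' s' es' where x: "x = (A', s', es')" by (rule prod_cases3)
  have I: "fI0 rt wb i th d M1 (A', s', es') (R, M)" using 4 x by simp
  note D = fI0D[OF I]
  have "M ! Suc (ad A') = 0" using 4(2) D(5) by (auto split: if_splits)
  then obtain a where a: "A' = Lf a" using leaf_test[OF D(1,15)] by blast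
  then have "s' = i" using D(3,4) by simp
  then show ?case using I 4(3) a x by auto
qed

end

section \<open>Locating the lowest common ancestor\<close>

definition "dFBin = Wh (V rLo \<^bold>+ C 1 \<^bold>< V rHi)
  (rMid ::= (V rLo \<^bold>+ V rHi) \<^bold>/ C 2 ;; rJ ::= V rBase \<^bold>+ C 3 \<^bold>* V rMid ;; rSs ::= Ld (V rJ \<^bold>+ C 1) ;;
   IfC (eIn rSs (Ld (V rJ))) (rLo ::= V rMid) (rHi ::= V rMid))"
definition "dF2 = (rJ ::= V rBase \<^bold>+ C 3 \<^bold>* V rLo ;; rA ::= Ld (V rJ) ;; rS ::= Ld (V rJ \<^bold>+ C 1) ;; rD ::= Ld (V rJ \<^bold>+ C 2))"
definition "dF4 = (rN ::= V rZ \<^bold>- Ld (V rX \<^bold>+ C 5 \<^bold>+ V rD) ;; IfC (Ld (V rX) \<^bold>< Ld (V rA)) (rLo ::= V rLo \<^bold>+ C 1) Skip ;;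
  rA ::= V rX ;; rS ::= V rN)"
definition "dF3 = (rZ ::= V rS \<^bold>+ Ld (V rA \<^bold>+ C 5 \<^bold>+ V rD) ;; rX ::= V rA ;; dSearch ;; dF4)"
definition "dFind = (rLo ::= C 0 ;; rHi ::= V rSp ;; dFBin ;; dF2 ;; IfC (V rD \<^bold>< C 2) dF3 Skip)"
definition "dDir = (IfC (V rI \<^bold>< V rF) (rD ::= C 1 ;; rTt ::= V rF \<^bold>- V rI) (rD ::= C 0 ;; rTt ::= V rI \<^bold>- V rF) ;;
  IfC (V rTt \<^bold>< Ld (C 16)) (rTt ::= Ld (C 16)) Skip)"
definition "dMid = (dDir ;; dStep' ;; dFringe)"
definition "dFin = (dPush (C 2) ;; rSp ::= (V rWp \<^bold>- V rBase) \<^bold>/ C 3 ;; rF ::= V rI)"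
definition "dInit = (rI ::= V 0 ;; rBase ::= Ld (C 17))"
definition "dMove = (dInit ;; dFind ;; rWp ::= V rBase \<^bold>+ C 3 \<^bold>* V rLo ;; dMid ;; dFin)"
definition "dAcc = (dInit ;; dFind ;; rWp ::= Ld (C 18) ;; dMid ;; 0 ::= Ld (V rA \<^bold>+ C 3))"
definition "dSet0 = (rA ::= Ld (C 15) ;; rS ::= C 0 ;; rTt ::= Ld (V rA) ;; rD ::= C 0 ;; rWp ::= V rBase)"
definition "dSet = (dInit ;; dSet0 ;; dFringe ;; dFin)"

definition inv_at :: "nat \<Rightarrow> tree \<Rightarrow> nat \<Rightarrow> bool" where
  "inv_at i T s \<longleftrightarrow> s \<le> i \<and> i < s + sz T"

text \<open>Together with \<open>inv_at i X sX\<close> this makes \<open>X\<close> the lowest common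
  ancestor of the two positions; the leaf case is that of equal positions.\<close>

definition sep :: "nat \<Rightarrow> nat \<Rightarrow> tree \<Rightarrow> nat \<Rightarrow> bool" where
  "sep f i X sX \<longleftrightarrow> (\<exists>a. X = Lf a) \<and> i = f \<or>
     (\<exists>l r c sc. X = Nd l r \<and> (c = l \<and> sc = sX \<or> c = r \<and> sc = sX + sz l) \<and> inv_at f c sc \<and> \<not> inv_at i c sc)"

context dmem begin

lemma lnk_occ:
  assumes "lnk (T, s, \<tau>) X sX" "occ T s"
  shows "occ X sX \<and> s \<le> sX \<and> sX + sz X \<le> s + sz T \<and> dep X < dep T"
proof -
  consider k where "0 < k" "k \<le> hD \<tau> T" "X = hn \<tau> k T" "sX = s + Off \<tau> T - Off \<tau> X"
    | l r where "T = Nd l r" "X = l \<and> sX = s \<or> X = r \<and> sX = s + sz l" using assms(1) by auto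
  then show ?thesis
  proof cases
    case 1
    have "dep X + k \<le> dep T" using hn_dep[OF 1(2)] 1(3) by simp
    moreover have "occ X sX" using occ_hn[OF assms(2), of k \<tau>] 1 by simp
    ultimately have c: "occ X sX \<and> dep X < dep T" using 1(1) by simp
    note h = hn_range[of \<tau> T "s + Off \<tau> T" 0 k, OF le_add2 le0, unfolded funpow_0]
    have "s \<le> sX" "sX + sz X \<le> s + sz T" unfolding 1(4) unfolding 1(3) using h by (elim conjE, linarith)+
    then show ?thesis using c by blast
  next
    case 2 then show ?thesis using occ_Nd[of l r s] assms(2) by auto
  qed
qed

text \<open>The leaf of the finger is the last entry. Its type 2 is a dummy, as no entry follows; it
  keeps \<open>dFind\<close> from searching a path there.\<close>

definition fst_ok :: "nat \<Rightarrow> (tree \<times> nat \<times> nat) list \<Rightarrow> bool" where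
  "fst_ok f es \<longleftrightarrow> (\<exists>es' a. es = es' @ [(Lf a, f, 2)] \<and> okp True es' (Lf a) f \<and> length es' \<le> dep t)"

lemma fst_okD:
  assumes "fst_ok f es"
  shows "es \<noteq> []" "length es \<le> dep t + 1" "fst (es ! 0) = t" "fst (snd (es ! 0)) = 0"
    "\<And>k. Suc k < length es \<Longrightarrow> lnk (es ! k) (fst (es ! Suc k)) (fst (snd (es ! Suc k)))"
    "\<exists>a. last es = (Lf a, f, 2)"
    "\<And>k. k < length es \<Longrightarrow> occ (fst (es ! k)) (fst (snd (es ! k))) \<and> k + dep (fst (es ! k)) \<le> dep t"
    "\<And>k. k < length es \<Longrightarrow> okp True (take k es) (fst (es ! k)) (fst (snd (es ! k)))"
proof -
  obtain es' a where e: "es = es' @ [(Lf a, f, 2)]" "okp True es' (Lf a) f" "length es' \<le> dep t" using assms by (auto simp: fst_ok_def)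
  show "es \<noteq> []" "length es \<le> dep t + 1" "\<exists>a. last es = (Lf a, f, 2)" using e by auto
  show 0: "fst (es ! 0) = t" "fst (snd (es ! 0)) = 0" using e by (auto simp: okp_def nth_append split: if_splits)
  show L: "lnk (es ! k) (fst (es ! Suc k)) (fst (snd (es ! Suc k)))" if k: "Suc k < length es" for k
  proof (cases "Suc k = length es'")
    case True
    then have "es' \<noteq> []" and "k = length es' - 1" by auto
    then have "last es' = es' ! k" by (simp add: last_conv_nth)
    then show ?thesis using e True \<open>es' \<noteq> []\<close> by (simp add: okp_def nth_append del: lnk.simps)
  next
    case False
    then show ?thesis using e k by (simp add: okp_def nth_append del: lnk.simps)
  qed
  have ot: "occ t 0" by (simp add: occ_def length_yl[symmetric])
  show "occ (fst (es ! k)) (fst (snd (es ! k))) \<and> k + dep (fst (es ! k)) \<le> dep t" if "k < length es" for k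
    using that
  proof (induction k)
    case 0 then show ?case using \<open>fst (es ! 0) = t\<close> \<open>fst (snd (es ! 0)) = 0\<close> ot by simp
  next
    case (Suc k)
    obtain T s \<tau> where q: "es ! k = (T, s, \<tau>)" by (rule prod_cases3)
    have l: "lnk (T, s, \<tau>) (fst (es ! Suc k)) (fst (snd (es ! Suc k)))" using L[OF Suc.prems] unfolding q .
    have "occ T s" "k + dep T \<le> dep t" using Suc q by auto
    then show ?case using lnk_occ[OF l] by auto
  qed
  show "okp True (take k es) (fst (es ! k)) (fst (snd (es ! k)))" if k: "k < length es" for k
  proof (cases "k = 0")
    case False
    then obtain j where j: "k = Suc j" by (cases k) auto
    have "last (take k es) = es ! j" using j k by (simp add: take_Suc_conv_app_nth)
    then show ?thesis using L k j 0 False \<open>es \<noteq> []\<close> by (auto simp: okp_def simp del: lnk.simps)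
  qed (use 0 in \<open>simp add: okp_def\<close>)
qed

text \<open>Stored nodes are nested, so those that contain \<open>x\<close> form a prefix of the
  path and can be found by binary search.\<close>

lemma fst_ok_nest:
  assumes "fst_ok f es" "j \<le> k" "k < length es" "inv_at x (fst (es ! k)) (fst (snd (es ! k)))"
  shows "inv_at x (fst (es ! j)) (fst (snd (es ! j)))"
  using assms(2-4)
proof (induction k rule: dec_induct)
  case (step k)
  obtain T s \<tau> where q: "es ! k = (T, s, \<tau>)" by (rule prod_cases3)
  have "occ T s" using fst_okD(7)[OF assms(1), of k] step.prems q by simp
  moreover have l: "lnk (T, s, \<tau>) (fst (es ! Suc k)) (fst (snd (es ! Suc k)))" using fst_okD(5)[OF assms(1) step.prems(1)] unfolding q .
  ultimately have "inv_at x (fst (es ! k)) (fst (snd (es ! k)))"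
    using lnk_occ[OF l] step.prems(2) by (auto simp: q inv_at_def)
  then show ?case using step by simp
qed

lemma fst_ok_finger: "fst_ok f es \<Longrightarrow> k < length es \<Longrightarrow> inv_at f (fst (es ! k)) (fst (snd (es ! k)))"
proof -
  assume a: "fst_ok f es" "k < length es"
  obtain b where "last es = (Lf b, f, 2)" using fst_okD(6)[OF a(1)] by blast
  then have "es ! (length es - 1) = (Lf b, f, 2)" using fst_okD(1)[OF a(1)] by (simp add: last_conv_nth)
  then show ?thesis using fst_ok_nest[OF a(1), of k "length es - 1" f] a(2) by (simp add: inv_at_def)
qed

text \<open>The finger lies in the sibling, hence the near end of the child towards \<open>i\<close>
  lies between the finger and \<open>i\<close>.\<close>

lemma sep_noffs:
  assumes "sep f i X sX" "inv_at i X sX" "chd i (X, sX, es) = (Y, sY, es')"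
  shows "noffs (if i < f then 1 else 0) i sY Y \<le> finger_dist (Some f) i"
  using assms unfolding sep_def
proof (elim disjE exE conjE)
  fix a assume "X = Lf a" then show ?thesis using assms by (auto simp: chd_def noffs_def inv_at_def)
next
  fix l r c sc assume a: "X = Nd l r" "c = l" "sc = sX" "inv_at f c sc" "\<not> inv_at i c sc"
  then have "Y = r" "sY = sX + sz l" "f < i" using assms(2,3) by (auto simp: chd_def inv_at_def split: if_splits)
  then show ?thesis using a by (auto simp: noffs_def inv_at_def)
next
  fix l r c sc assume a: "X = Nd l r" "c = r" "sc = sX + sz l" "inv_at f c sc" "\<not> inv_at i c sc"
  then have "Y = l" "sY = sX" "i < f" using assms(2,3) by (auto simp: chd_def inv_at_def split: if_splits)
  then show ?thesis using a by (auto simp: noffs_def inv_at_def)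
qed

lemma dFBin_wpb:
  assumes ok: "okM M" and es: "fst_ok f es" "pst bs es M" and i: "i < sz t"
    and R: "R rLo = 0" "R rHi = length es" "R rBase = bs" "R rI = i"
  shows "wpb w dFBin (60 * fl (dep t + 1) + 100) (\<lambda>(R', M'). \<exists>lo<length es. R' rLo = lo \<and> inv_at i (fst (es ! lo)) (fst (snd (es ! lo))) \<and>
     (Suc lo < length es \<longrightarrow> \<not> inv_at i (fst (es ! Suc lo)) (fst (snd (es ! Suc lo))))) (R, M)"
  unfolding wpb_def dFBin_def
proof (rule wp_While[where x = "(0, length es)" and pot = "\<lambda>(lo, hi). 60 * its (hi - lo)" and
    I = "\<lambda>(lo, hi) (R', M'). M' = M \<and> R' rLo = lo \<and> R' rHi = hi \<and> lo < hi \<and> hi \<le> length es \<and> R' rBase = bs \<and> R' rI = i \<and>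
      inv_at i (fst (es ! lo)) (fst (snd (es ! lo))) \<and> (hi < length es \<longrightarrow> \<not> inv_at i (fst (es ! hi)) (fst (snd (es ! hi))))"], goal_cases)
  case 1 show ?case using R fst_okD(1,3,4)[OF es(1)] i by (simp add: inv_at_def)
next
  case (2 x R M') then show ?case using lenw bs35 cap fst_okD(2)[OF es(1)] by (cases x) auto
next
  case (3 x R M')
  obtain lo hi where x: "x = (lo, hi)" by fastforce
  have T: "M' = M" "R rLo = lo" "R rHi = hi" "hi \<le> length es" "R rBase = bs" "R rI = i"
      "inv_at i (fst (es ! lo)) (fst (snd (es ! lo)))" "hi < length es \<longrightarrow> \<not> inv_at i (fst (es ! hi)) (fst (snd (es ! hi)))" "Suc lo < hi"
    using 3 by (auto simp: x split: if_splits)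
  define mid where "mid = (lo + hi) div 2"
  have mid: "lo < mid" "mid < hi" "hi - mid \<le> (hi - lo + 1) div 2" "mid - lo \<le> (hi - lo + 1) div 2" using T(9) unfolding mid_def by linarith+
  obtain Tm sm \<tau> where em: "es ! mid = (Tm, sm, \<tau>)" by (rule prod_cases3)
  have m: "M ! (bs + 3 * mid) = ad Tm" "M ! Suc (bs + 3 * mid) = sm" using es(2) mid T(4) em by (auto simp: pst_def)
  have om: "Tm \<in> subs t" "sm + sz Tm \<le> sz t" using fst_okD(7)[OF es(1), of mid] mid T(4) em by (auto simp: occ_def)
  have p: "Suc (its (hi - mid)) \<le> its (hi - lo)" "Suc (its (mid - lo)) \<le> its (hi - lo)" using mid T(9) by (auto intro!: its_half)
  have b: "bs + 3 * mid + 3 < bs + cap" "lo + hi < cap" using mid T(4,9) fst_okD(2)[OF es(1)] cap by linarith+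
  have b2: "bs + 3 * mid + 3 < 2 ^ w" "lo + hi < 2 ^ w" "bs + 3 * mid + 3 < bs + 3 * cap" "sm + sz Tm < 2 ^ w" "3 * mid < 2 ^ w"
    using b lenw om(2) szw by linarith+
  show ?case
  proof (cases "inv_at i Tm sm")
    case True
    then have c: "i < sm + sz Tm" "\<not> i < sm" by (auto simp: inv_at_def)
    show ?thesis unfolding T(1) eIn_def using b2 okM_len[OF ok] ad[OF om(1)] c bs35 lenw
      by (simp add: T(2,3,5,6) mid_def[symmetric] m rec_sz[OF ok om(1)] x)
        (use p mid T(4,8) em True in simp)
  next
    case False
    then have c: "\<not> (i < sm + sz Tm \<and> \<not> i < sm)" by (auto simp: inv_at_def)
    have e: "(case (lo, mid) of (lo, hi) \<Rightarrow> mid - lo < cap \<and> lo < mid \<and> hi \<le> length es \<and> inv_at i (fst (es ! lo)) (fst (snd (es ! lo))) \<and> (hi < length es \<longrightarrow> \<not> inv_at i (fst (es ! hi)) (fst (snd (es ! hi)))))"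
      using mid T(4,7) em False b by simp
    show ?thesis unfolding T(1) eIn_def using b2 okM_len[OF ok] ad[OF om(1)] c bs35 lenw
      by (simp add: T(2,3,5,6) mid_def[symmetric] m rec_sz[OF ok om(1)] x)
        (use p mid e in simp)
  qed
next
  case (4 q y R M')
  obtain lo hi where y: "y = (lo, hi)" by fastforce
  have "its (length es) \<le> its (dep t + 1)" using fst_okD(2)[OF es(1)] by (auto simp: its_def intro: fl_mono)
  then have "its (length es) \<le> Suc (fl (dep t + 1))" using its_le[of "dep t + 1"] by linarith
  moreover have "hi = Suc lo" using 4 by (auto simp: y split: if_splits)
  ultimately show ?case using 4 by (auto simp: y)
qed

definition fres :: "nat \<Rightarrow> nat \<Rightarrow> (tree \<times> nat \<times> nat) list \<Rightarrow> (nat \<Rightarrow> nat) \<Rightarrow> bool" where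
  "fres f i es R \<longleftrightarrow> (\<exists>X sX lo. lo \<le> length es \<and> R rA = ad X \<and> R rS = sX \<and> R rLo = lo \<and> okp True (take lo es) X sX \<and>
     lo + dep X \<le> dep t \<and> occ X sX \<and> inv_at i X sX \<and> sep f i X sX)"

lemma dFind_wpb:
  assumes ok: "okM M" and es: "fst_ok f es" "pst bs es M" and i: "i < sz t"
    and R: "R rSp = length es" "R rBase = bs" "R rI = i"
  shows "wpb w dFind (60 * fl (dep t + 1) + KS + 250) (\<lambda>s'. fres f i es (fst s') \<and>
     (\<forall>r. r \<in> {rF, rBase, rI, rSp} \<longrightarrow> fst s' r = R r) \<and> snd s' = M) (R, M)"
proof -
  define R1 where "R1 = R(rLo := 0, rHi := length es)"
  define P where "P = (\<lambda>s'::ram_state. fres f i es (fst s'))"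
  have B: "wpb w dFBin (60 * fl (dep t + 1) + 100) (\<lambda>s'. \<exists>lo<length es. fst s' rLo = lo \<and> inv_at i (fst (es ! lo)) (fst (snd (es ! lo))) \<and>
     (Suc lo < length es \<longrightarrow> \<not> inv_at i (fst (es ! Suc lo)) (fst (snd (es ! Suc lo)))) \<and> fst s' rBase = bs \<and> fst s' rI = i \<and> snd s' = M) (R1, M)"
  proof -
    have "wpb w dFBin (60 * fl (dep t + 1) + 100) (\<lambda>(R', M'). \<exists>lo<length es. R' rLo = lo \<and> inv_at i (fst (es ! lo)) (fst (snd (es ! lo))) \<and>
     (Suc lo < length es \<longrightarrow> \<not> inv_at i (fst (es ! Suc lo)) (fst (snd (es ! Suc lo))))) (R1, M)"
      by (rule dFBin_wpb[OF ok es i]) (auto simp: R1_def R)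
    from wpb_frame[OF this] show ?thesis by (rule wpb_mono) (auto simp: dFBin_def R1_def R)
  qed
  have rest: "wpb w (dF2 ;; IfC (V rD \<^bold>< C 2) dF3 Skip) (40 + (10 + (40 + (KS + 40)))) P (R', M)"
    if lo: "lo < length es" "R' rLo = lo" "inv_at i (fst (es ! lo)) (fst (snd (es ! lo)))"
      "Suc lo < length es \<longrightarrow> \<not> inv_at i (fst (es ! Suc lo)) (fst (snd (es ! Suc lo)))" "R' rBase = bs" "R' rI = i" for R' lo
  proof (rule wpb_Sq)
    obtain A s \<tau> where e: "es ! lo = (A, s, \<tau>)" by (rule prod_cases3)
    have oA: "occ A s" "lo + dep A \<le> dep t" "okp True (take lo es) A s" using fst_okD(7,8)[OF es(1) lo(1)] e by auto
    have As: "A \<in> subs t" "s + sz A \<le> sz t" using oA by (auto simp: occ_def)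
    have iA: "inv_at i A s" "inv_at f A s" using lo(3) fst_ok_finger[OF es(1) lo(1)] e by auto
    have m: "M ! (bs + 3 * lo) = ad A" "M ! Suc (bs + 3 * lo) = s" "M ! Suc (Suc (bs + 3 * lo)) = \<tau>" using es(2) lo(1) e by (auto simp: pst_def)
    have "3 * lo + 20 \<le> cap" using lo(1) fst_okD(2)[OF es(1)] cap by linarith
    then have b: "bs + 3 * lo + 3 < 2 ^ w" "bs + 3 * lo + 3 < bs + 3 * cap" "3 * lo < 2 ^ w" using lenw by linarith+
    define R2 where "R2 = R'(rJ := bs + 3 * lo, rA := ad A, rS := s, rD := \<tau>)"
    have "wpb w dF2 40 (\<lambda>s'. s' = (R2, M)) (R', M)" unfolding wpb_def dF2_def using b okM_len[OF ok]
      by (simp add: lo(2,5) m R2_def)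
    moreover have "wpb w (IfC (V rD \<^bold>< C 2) dF3 Skip) (10 + (40 + (KS + 40))) P (R2, M)"
    proof (cases "\<tau> < 2")
      case False
      have "sep f i A s"
      proof (cases "Suc lo < length es")
        case True
        have "lnk (A, s, \<tau>) (fst (es ! Suc lo)) (fst (snd (es ! Suc lo)))" using fst_okD(5)[OF es(1) True] e by simp
        then obtain l r where "A = Nd l r" "fst (es ! Suc lo) = l \<and> fst (snd (es ! Suc lo)) = s \<or> fst (es ! Suc lo) = r \<and> fst (snd (es ! Suc lo)) = s + sz l"
          using False by auto
        then show ?thesis using lo(4) True fst_ok_finger[OF es(1) True] unfolding sep_def by blast
      next
        case F: False
        then have "lo = length es - 1" using lo(1) by simp
        then have "es ! lo = last es" using fst_okD(1)[OF es(1)] by (simp add: last_conv_nth)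
        then show ?thesis using fst_okD(6)[OF es(1)] e iA by (auto simp: sep_def inv_at_def)
      qed
      then have "P (R2, M)" unfolding P_def fres_def using lo oA iA
        by (intro exI[of _ A] exI[of _ s] exI[of _ lo]) (auto simp: R2_def)
      then show ?thesis unfolding wpb_def using lenw bs35 False by (simp add: R2_def)
    next
      case True
      have \<tau>1: "\<tau> \<le> 1" using True by simp
      have sl: "Suc lo < length es"
      proof (rule ccontr)
        assume "\<not> Suc lo < length es"
        then have "lo = length es - 1" using lo(1) by simp
        then have "es ! lo = last es" using fst_okD(1)[OF es(1)] by (simp add: last_conv_nth)
        then show False using fst_okD(6)[OF es(1)] e True by auto
      qed
      define z where "z = s + Off \<tau> A"
      have "lnk (A, s, \<tau>) (fst (es ! Suc lo)) (fst (snd (es ! Suc lo)))" using fst_okD(5)[OF es(1) sl] e by simp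
      then obtain k0 where k0: "0 < k0" "k0 \<le> hD \<tau> A" "fst (es ! Suc lo) = hn \<tau> k0 A" "fst (snd (es ! Suc lo)) = z - Off \<tau> (hn \<tau> k0 A)"
        using True by (auto simp: z_def)
      \<comment> \<open>The next stored node lies on the path of \<open>A\<close> and contains the
        finger but not \<open>i\<close>; the two positions part somewhere on the stretch that this
        single entry stands for.\<close>
      have h0: "\<not> holds \<tau> z i (hn \<tau> k0 A)" "holds \<tau> z f (hn \<tau> k0 A)"
        using lo(4) sl fst_ok_finger[OF es(1) sl] k0 by (auto simp: inv_at_def holds_def)
      have hA: "holds \<tau> z i A" using iA by (simp add: holds_def inv_at_def z_def)
      define R3 where "R3 = R2(rZ := z, rX := ad A)"
      have p: "ad A + 5 + \<tau> < 2 ^ w" "ad A + 5 + \<tau> < bs + 3 * cap" "z < 2 ^ w" "Suc lo < 2 ^ w"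
        using ad[OF As(1)] lenw bs35 \<tau>1 Off_less[of \<tau> A] As(2) szw b unfolding z_def by linarith+
      have S: "wpb w dSearch KS (\<lambda>s'. (\<exists>k\<le>hD \<tau> A. fst s' rX = ad (hn \<tau> k A) \<and> holds \<tau> z i (hn \<tau> k A) \<and> (k < hD \<tau> A \<longrightarrow> \<not> holds \<tau> z i (hn \<tau> (Suc k) A))) \<and>
        (\<forall>r. r \<notin> {rX, rJ, rSs, rFl} \<longrightarrow> fst s' r = R3 r) \<and> snd s' = M) (R3, M)"
        by (rule dSearch_wpb[OF ok \<tau>1 As(1) z_def As(2) i hA]) (auto simp: R3_def R2_def lo)
      have 4: "wpb w dF4 40 P (R4, M)" if k: "k \<le> hD \<tau> A" "R4 rX = ad (hn \<tau> k A)" "holds \<tau> z i (hn \<tau> k A)"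
        "k < hD \<tau> A \<longrightarrow> \<not> holds \<tau> z i (hn \<tau> (Suc k) A)" "\<forall>r. r \<notin> {rX, rJ, rSs, rFl} \<longrightarrow> R4 r = R3 r" for R4 k
      proof -
        define X where "X = hn \<tau> k A"
        define sX where "sX = z - Off \<tau> X"
        have r: "R4 rZ = z" "R4 rA = ad A" "R4 rD = \<tau>" "R4 rLo = lo" using k(5) lo(2) by (auto simp: R3_def R2_def)
        have oX: "occ X sX" "Off \<tau> X \<le> z" using occ_hn[OF oA(1), of k \<tau>] by (auto simp: X_def z_def sX_def)
        have Xs: "X \<in> subs t" using oX by (simp add: occ_def)
        have kk: "k < k0" using k(3) h0(1) holds_mono[of \<tau> A z k0 k i] by (cases "k < k0") (auto simp: z_def)
        have kh: "k < hD \<tau> A" using kk k0 by simp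
        have "hD \<tau> X \<noteq> 0" using hD_hn[OF k(1)] kh by (simp add: X_def)
        then obtain l r where X: "X = Nd l r" by (cases X) auto
        have H: "hn \<tau> (Suc k) A = hc \<tau> X" by (simp add: X_def)
        \<comment> \<open>As \<open>k < k0\<close>, the successor of \<open>X\<close> on the path
          still contains the finger, whereas by the choice of \<open>k\<close> it does not contain
          \<open>i\<close>. So the positions part exactly at \<open>X\<close>.\<close>
        have hf: "holds \<tau> z f (hc \<tau> X)" using h0(2) holds_mono[of \<tau> A z "Suc k" k0 f] kk unfolding H[symmetric] by (auto simp: z_def simp del: funpow.simps)
        have hi: "\<not> holds \<tau> z i (hc \<tau> X)" using k(4) kh H by simp
        have hs: "(hc \<tau> X = l \<and> z - Off \<tau> (hc \<tau> X) = sX) \<or> (hc \<tau> X = r \<and> z - Off \<tau> (hc \<tau> X) = sX + sz l)"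
          using oX(2) unfolding sX_def X by (auto split: if_splits)
        have sp: "sep f i X sX" unfolding sep_def
          by (intro disjI2 exI[of _ l] exI[of _ r] exI[of _ "hc \<tau> X"] exI[of _ "z - Off \<tau> (hc \<tau> X)"])
            (use X hs hf hi in \<open>simp add: holds_def inv_at_def\<close>)
        have ii: "inv_at i X sX" using k(3) by (simp add: holds_def inv_at_def X_def sX_def)
        have szk: "sz X < sz A \<longleftrightarrow> 0 < k" using hn_sz[OF _ k(1)] by (cases "k = 0") (auto simp: X_def)
        have dp: "dep X + k \<le> dep A" using hn_dep[OF k(1)] by (simp add: X_def)
        \<comment> \<open>If \<open>X\<close> lies strictly below \<open>A\<close>, the entry of
          \<open>A\<close> stays as the one that leads to \<open>X\<close>; otherwise
          \<open>X\<close> is \<open>A\<close> and takes over its slot.\<close>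
        define lo' where "lo' = (if 0 < k then Suc lo else lo)"
        have ob: "okp True (take lo' es) X sX"
        proof (cases "0 < k")
          case True
          have "lnk (A, s, \<tau>) X sX" using True k(1) \<tau>1 by (auto simp: X_def sX_def z_def)
          from okp_append[OF oA(3) this] show ?thesis using True lo(1) e by (simp add: lo'_def take_Suc_conv_app_nth)
        next
          case False then show ?thesis using oA(3) by (simp add: lo'_def X_def sX_def z_def)
        qed
        have fr: "P (R4(rN := sX, rLo := lo', rA := ad X, rS := sX), M)" unfolding P_def fres_def
          by (rule exI[of _ X], rule exI[of _ sX], rule exI[of _ lo']) (use ob dp oA(2) oX ii sp lo(1) in \<open>auto simp: lo'_def\<close>)
        have q: "ad X + 5 + \<tau> < 2 ^ w" "ad X + 5 + \<tau> < bs + 3 * cap" "ad A < bs + 3 * cap" using ad[OF Xs] ad[OF As(1)] lenw bs35 \<tau>1 by linarith+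
        have eq: "R4(rN := sX, rLo := lo, rA := ad X, rS := sX) = R4(rN := sX, rA := ad X, rS := sX)" using r by (auto simp: fun_eq_iff)
        show ?thesis
        proof (cases "0 < k")
          case True
          then show ?thesis unfolding wpb_def dF4_def using q p okM_len[OF ok] oX(2) fr
            by (simp add: r k(2)[folded X_def] recs(1)[OF ok Xs \<tau>1] rec_sz[OF ok Xs] rec_sz[OF ok As(1)] szk sX_def[symmetric] lo'_def)
        next
          case False
          then show ?thesis unfolding wpb_def dF4_def using q p okM_len[OF ok] oX(2) fr[unfolded lo'_def]
            by (simp add: r k(2)[folded X_def] recs(1)[OF ok Xs \<tau>1] rec_sz[OF ok Xs] rec_sz[OF ok As(1)] szk sX_def[symmetric] eq)
        qed
      qed
      have S4: "wpb w (dSearch ;; dF4) (KS + 40) P (R3, M)"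
      proof (rule wpb_Sq, rule wpb_mono[OF S order_refl])
        fix s' assume s': "(\<exists>k\<le>hD \<tau> A. fst s' rX = ad (hn \<tau> k A) \<and> holds \<tau> z i (hn \<tau> k A) \<and> (k < hD \<tau> A \<longrightarrow> \<not> holds \<tau> z i (hn \<tau> (Suc k) A))) \<and>
          (\<forall>r. r \<notin> {rX, rJ, rSs, rFl} \<longrightarrow> fst s' r = R3 r) \<and> snd s' = M"
        obtain R4 where R4: "s' = (R4, M)" using s' by (cases s') auto
        show "wpb w dF4 40 P s'" using s' 4 unfolding R4 by auto
      qed
      have "wpb w dF3 (40 + (KS + 40)) P (R2, M)"
        unfolding dF3_def using S4 p okM_len[OF ok] unfolding wpb_def
        by (simp add: R2_def[THEN fun_cong] R3_def recs(1)[OF ok As(1) \<tau>1] z_def[symmetric] del: wp_Sq add: wp_Sq[of w "Asg _ _"])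
          (elim wp_mono, simp)
      then show ?thesis unfolding wpb_def using lenw bs35 True by (simp add: R2_def[THEN fun_cong]) (elim wp_mono, simp)
    qed
    ultimately show "wpb w dF2 40 (wpb w (IfC (V rD \<^bold>< C 2) dF3 Skip) (10 + (40 + (KS + 40))) P) (R', M)"
      by (elim wpb_mono[OF _ order_refl]) (simp only:)
  qed
  have "wpb w (dFBin ;; dF2 ;; IfC (V rD \<^bold>< C 2) dF3 Skip) (60 * fl (dep t + 1) + 100 + (40 + (10 + (40 + (KS + 40))))) P (R1, M)"
  proof (rule wpb_Sq, rule wpb_mono[OF B order_refl], elim exE conjE)
    fix s' lo assume "lo < length es" "fst s' rLo = lo" "inv_at i (fst (es ! lo)) (fst (snd (es ! lo)))"
     "Suc lo < length es \<longrightarrow> \<not> inv_at i (fst (es ! Suc lo)) (fst (snd (es ! Suc lo)))" "fst s' rBase = bs" "fst s' rI = i" "snd s' = M"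
    then show "wpb w (dF2 ;; IfC (V rD \<^bold>< C 2) dF3 Skip) (40 + (10 + (40 + (KS + 40)))) P s'" using rest[of lo "fst s'"] by (cases s') simp
  qed
  then have "wpb w dFind (60 * fl (dep t + 1) + KS + 250) P (R, M)"
    unfolding dFind_def wpb_def wp_Sq[of w "Asg _ _"] using lenw bs35 by (simp add: R1_def R del: wp_Sq) (elim wp_mono, simp)
  from wpb_frame[OF this] show ?thesis
    by (rule wpb_mono) (auto simp: P_def dFind_def dFBin_def dF2_def dF3_def dF4_def dSearch_def dSBody_def)
qed

end

context dmem begin

section \<open>The operations of the dynamic structure\<close>

definition "PB th = Uc th * (fl (fl (sz t)) + 1) + KS + 150 * Dc th"
definition "Tm th = PB th + 60 * fl (dep t + 1) + KS + 700"

lemma ppot_le: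
  assumes "Y \<in> subs t" "T0 \<le> th"
  shows "ppot th Y \<le> PB th"
proof (cases "sz Y div th \<le> th")
  case True then show ?thesis using small_dep[OF assms True] by (simp add: ppot_def PB_def)
next
  case False
  have "fl (fl (sz Y)) \<le> fl (fl (sz t))" using sz_subs[OF assms(1)] by (intro fl_mono)
  then have "Uc th * (fl (fl (sz Y)) + 1) \<le> Uc th * (fl (fl (sz t)) + 1)" by (intro mult_le_mono2) simp
  then show ?thesis using False by (simp add: ppot_def PB_def)
qed

lemma dMid_wpb:
  assumes ok: "okM M" and wb: "bs \<le> wb" "wb + cap \<le> bs + 3 * cap" and X: "occ X sX" "inv_at i X sX" "sep f i X sX" and f: "f < sz t"
    and R: "R rA = ad X" "R rS = sX" "R rWp = wb + 3 * length es" "R rI = i" "R rF = f"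
    and es: "pst wb es M" "okp rt es X sX" "length es + dep X \<le> dep t"
  shows "wpb w dMid (PB (max T0 (finger_dist (Some f) i)) + 200)
    (\<lambda>s'. \<exists>a es'. fI0 rt wb i (max T0 (finger_dist (Some f) i)) (if i < f then 1 else 0) M (Lf a, i, es') s') (R, M)"
proof -
  define th where "th = max T0 (finger_dist (Some f) i)"
  define d :: nat where "d = (if i < f then 1 else 0)"
  have i: "i < sz t" using X(1,2) by (auto simp: occ_def inv_at_def)
  have "finger_dist (Some f) i < sz t" using i f by auto
  then have th: "T0 \<le> th" "th < 2 ^ w" using T0(2) szw unfolding th_def by linarith+
  have d1: "d \<le> 1" by (simp add: d_def)
  define R1 where "R1 = R(rD := d, rTt := th)"
  have W1: "wpb w dDir 50 (\<lambda>s'. s' = (R1, M)) (R, M)"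
  proof -
    have m: "M ! 16 = T0" using recs(8)[OF ok, of X 0] X(1) by (simp add: occ_def)
    have D: "finger_dist (Some f) i = (if i < f then f - i else i - f)" by auto
    have D': "f < 2 ^ w" "i < 2 ^ w" using f i szw by linarith+
    show ?thesis unfolding wpb_def dDir_def using D' lenw bs35 okM_len[OF ok]
      by (cases "i < f") (auto simp: R(4,5) m R1_def d_def th_def D fun_eq_iff simp del: finger_dist.simps)
  qed
  have I1: "fI0 rt wb i th d M (X, sX, es) (R1, M)"
    using ok X es R by (simp add: fI0_def R1_def inv_at_def outs_def)
  obtain Y sY es' where Y: "chd i (X, sX, es) = (Y, sY, es')" by (rule prod_cases3)
  have W2: "wpb w dStep' 90 (fI0 rt wb i th d M (Y, sY, es')) (R1, M)" using dStep'_wpb[OF I1 wb] Y by simp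
  have n: "noffs d i sY Y \<le> th" using sep_noffs[OF X(3,2) Y] by (simp add: d_def th_def)
  have W3: "wpb w dFringe (PB th + 20) (\<lambda>s'. \<exists>a es'. fI0 rt wb i th d M (Lf a, i, es') s') s2" if "fI0 rt wb i th d M (Y, sY, es') s2" for s2
  proof -
    obtain R2 M2 where s2: "s2 = (R2, M2)" by fastforce
    note I2 = that[unfolded s2]
    show ?thesis unfolding s2 by (rule wpb_mono[OF dFringe_wpb[OF I2 wb d1 th disjI2[OF n]]]) (use ppot_le[OF fI0D(15)[OF I2] th(1)] in auto)
  qed
  have "wpb w (dStep' ;; dFringe) (90 + (PB th + 20)) (\<lambda>s'. \<exists>a es'. fI0 rt wb i th d M (Lf a, i, es') s') (R1, M)"
    by (rule wpb_Sq, rule wpb_mono[OF W2 order_refl W3])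
  then have "wpb w dMid (50 + (90 + (PB th + 20))) (\<lambda>s'. \<exists>a es'. fI0 rt wb i th d M (Lf a, i, es') s') (R, M)"
    unfolding dMid_def by (intro wpb_Sq[of w dDir] wpb_mono[OF W1 order_refl]) (simp only:)
  then show ?thesis unfolding th_def[symmetric] d_def[symmetric] by (rule wpb_mono) auto
qed

definition dI :: "nat option \<Rightarrow> ram_state \<Rightarrow> bool" where
  "dI p s \<longleftrightarrow> okM (snd s) \<and> (case p of None \<Rightarrow> True | Some f \<Rightarrow> f < sz t \<and> fst s rF = f \<and>
     (\<exists>es. fst_ok f es \<and> pst bs es (snd s) \<and> fst s rSp = length es))"

lemma dFin_wpb:
  assumes I: "fI0 True bs i th d M1 (Lf a, i, es) (R, M)" and R: "R rBase = bs"
  shows "wpb w dFin 50 (dI (Some i)) (R, M)"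
proof -
  note D = fI0D[OF I]
  define q where "q = bs + 3 * length es"
  have wb: "bs \<le> bs" "bs + cap \<le> bs + 3 * cap" by auto
  note m = push_mem[OF I wb q_def]
  have f: "fst_ok i (es @ [(Lf a, i, 2)])" using D(12,13) by (auto simp: fst_ok_def)
  have i: "i < sz t" using D(4,16) by simp
  have b: "q < bs + 3 * cap" "Suc q < bs + 3 * cap" "Suc (Suc q) < bs + 3 * cap" "3 + q < 2 ^ w" "(3 + q - bs) div 3 = Suc (length es)" "bs \<le> 3 + q"
    using m(4,5) by (auto simp: q_def)
  show ?thesis unfolding wpb_def dFin_def dPush_def using b okM_len[OF D(1)] lenw
    by (simp add: D(5,6,7,10) R q_def[symmetric]) (use m(1,3) f i in \<open>auto simp: dI_def intro!: exI[of _ "es @ [(Lf a, i, 2)]"]\<close>)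
qed

lemma dFin_wpb': "fI0 True bs i th d M1 (Lf a, i, es) s \<Longrightarrow> fst s rBase = bs \<Longrightarrow> wpb w dFin 50 (dI (Some i)) s"
  using dFin_wpb by (cases s) simp

lemma dInit_wpb: "okM M \<Longrightarrow> wpb w dInit 10 (\<lambda>s'. s' = (R(rI := R 0, rBase := bs), M)) (R, M)"
  unfolding wpb_def dInit_def using lenw bs35 rec_hdr[of M] okM_len[of M] by simp

text \<open>With the threshold \<open>sz t\<close> no subtree counts as large, so the descent simply
  goes from child to child.\<close>

theorem dyn_set:
  assumes "dI p (R, M)" "i < sz t"
  shows "wpb w dSet (150 * dep t + 300) (dI (Some i)) (R(0 := i), M)"
proof -
  have ok: "okM M" using assms by (simp add: dI_def)
  have tt: "t \<in> subs t" by (cases t) auto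
  define R1 where "R1 = R(0 := i, rI := i, rBase := bs)"
  define R2 where "R2 = R1(rA := ad t, rS := 0, rTt := sz t, rD := 0, rWp := bs)"
  have W1: "wpb w dInit 10 (\<lambda>s'. s' = (R1, M)) (R(0 := i), M)" using dInit_wpb[OF ok, of "R(0 := i)"] by (simp add: R1_def)
  have W2: "wpb w dSet0 40 (\<lambda>s'. s' = (R2, M)) (R1, M)"
    unfolding wpb_def dSet0_def using lenw bs35 rec_hdr[OF ok] okM_len[OF ok] ad[OF tt] by (simp add: R1_def R2_def rec_sz[OF ok tt])
  have I: "fI0 True bs i (sz t) 0 M (t, 0, []) (R2, M)"
    using ok assms(2) tt by (simp add: fI0_def R2_def R1_def occ_def pst_def okp_def outs_def length_yl)
  have sm: "sz t div sz t \<le> sz t" using assms(2) by simp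
  have W3: "wpb w dFringe (150 * dep t + 20) (\<lambda>s'. (\<exists>a es. fI0 True bs i (sz t) 0 M (Lf a, i, es) s') \<and> fst s' rBase = bs) (R2, M)"
  proof -
    have "wpb w dFringe (ppot (sz t) t + 20) (\<lambda>s'. \<exists>a es. fI0 True bs i (sz t) 0 M (Lf a, i, es) s') (R2, M)"
      by (rule dFringe_wpb[OF I]) (use T0 szw sm in auto)
    from wpb_frame[OF this] show ?thesis
      by (rule wpb_mono) (use sm in \<open>auto simp: ppot_def dFringe_def dFBody_def dB0_def dHop_def dHBody_def dB2_def dSearch_def dSBody_def dB3_def dStep'_def dStep_def dPush_def R2_def R1_def\<close>)
  qed
  have "wpb w (dFringe ;; dFin) ((150 * dep t + 20) + 50) (dI (Some i)) (R2, M)"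
    by (rule wpb_Sq, rule wpb_mono[OF W3 order_refl]) (elim exE conjE, rule dFin_wpb')
  then have "wpb w (dSet0 ;; dFringe ;; dFin) (40 + ((150 * dep t + 20) + 50)) (dI (Some i)) (R1, M)"
    by (intro wpb_Sq[of w dSet0] wpb_mono[OF W2 order_refl]) (simp only:)
  then have "wpb w dSet (10 + (40 + ((150 * dep t + 20) + 50))) (dI (Some i)) (R(0 := i), M)"
    unfolding dSet_def by (intro wpb_Sq[of w dInit] wpb_mono[OF W1 order_refl]) (simp only:)
  then show ?thesis by (rule wpb_mono) auto
qed

lemma dSearch_phase:
  assumes "dI (Some f) (R, M)" "i < sz t"
  shows "\<exists>es. f < sz t \<and> okM M \<and> fst_ok f es \<and> pst bs es M \<and> R rSp = length es \<and>
   wpb w (dInit ;; dFind) (10 + (60 * fl (dep t + 1) + KS + 250)) (\<lambda>s'. \<exists>R'. s' = (R', M) \<and> fres f i es R' \<and> R' rF = f \<and> R' rBase = bs \<and> R' rI = i \<and> R' rSp = length es) (R(0 := i), M)"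
proof -
  have ok: "okM M" "f < sz t" "R rF = f" using assms by (auto simp: dI_def)
  obtain es where es: "fst_ok f es" "pst bs es M" "R rSp = length es" using assms by (auto simp: dI_def)
  define R1 where "R1 = R(0 := i, rI := i, rBase := bs)"
  have W1: "wpb w dInit 10 (\<lambda>s'. s' = (R1, M)) (R(0 := i), M)" using dInit_wpb[OF ok(1), of "R(0 := i)"] by (simp add: R1_def)
  have "wpb w dFind (60 * fl (dep t + 1) + KS + 250) (\<lambda>s'. fres f i es (fst s') \<and> (\<forall>r. r \<in> {rF, rBase, rI, rSp} \<longrightarrow> fst s' r = R1 r) \<and> snd s' = M) (R1, M)"
    by (rule dFind_wpb[OF ok(1) es(1,2) assms(2)]) (use es in \<open>auto simp: R1_def\<close>)
  then have W2: "wpb w dFind (60 * fl (dep t + 1) + KS + 250) (\<lambda>s'. \<exists>R'. s' = (R', M) \<and> fres f i es R' \<and> R' rF = f \<and> R' rBase = bs \<and> R' rI = i \<and> R' rSp = length es) (R1, M)"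
    by (rule wpb_mono) (use ok es in \<open>auto simp: R1_def prod_eq_iff\<close>)
  then have "wpb w (dInit ;; dFind) (10 + (60 * fl (dep t + 1) + KS + 250)) (\<lambda>s'. \<exists>R'. s' = (R', M) \<and> fres f i es R' \<and> R' rF = f \<and> R' rBase = bs \<and> R' rI = i \<and> R' rSp = length es) (R(0 := i), M)"
    by (intro wpb_Sq[of w dInit] wpb_mono[OF W1 order_refl]) (simp only:)
  then show ?thesis using ok es by blast
qed

lemma Sq_assoc: "wpb w ((a ;; b) ;; c) B P s \<Longrightarrow> wpb w (a ;; b ;; c) B P s" by (simp add: wpb_def add.assoc)

lemma mods_dMid: "5 \<notin> mods dMid" "17 \<notin> mods dMid" "24 \<notin> mods dMid"
  by (simp_all add: dMid_def dDir_def dFringe_def dFBody_def dB0_def dHop_def dHBody_def dB2_def dSearch_def dSBody_def dB3_def dStep'_def dStep_def dPush_def)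

text \<open>The first \<open>lo\<close> entries lead to the common ancestor and remain valid. The
  new part overwrites the others in place, so the cost does not depend on the length of the
  path.\<close>

theorem dyn_move:
  assumes "dI (Some f) (R, M)" "i < sz t"
  shows "wpb w dMove (Tm (max T0 (finger_dist (Some f) i))) (dI (Some i)) (R(0 := i), M)"
proof -
  obtain es where es: "f < sz t" "okM M" "fst_ok f es" "pst bs es M"
   "wpb w (dInit ;; dFind) (10 + (60 * fl (dep t + 1) + KS + 250)) (\<lambda>s'. \<exists>R'. s' = (R', M) \<and> fres f i es R' \<and> R' rF = f \<and> R' rBase = bs \<and> R' rI = i \<and> R' rSp = length es) (R(0 := i), M)"
    using dSearch_phase[OF assms] by blast
  define th where "th = max T0 (finger_dist (Some f) i)"
  have "wpb w (rWp ::= V rBase \<^bold>+ C 3 \<^bold>* V rLo ;; dMid ;; dFin) (20 + ((PB th + 200) + 50)) (dI (Some i)) (R', M)"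
    if R': "fres f i es R'" "R' rF = f" "R' rBase = bs" "R' rI = i" for R'
  proof (rule wpb_Sq)
    obtain X sX lo where X: "lo \<le> length es" "R' rA = ad X" "R' rS = sX" "R' rLo = lo" "okp True (take lo es) X sX"
      "lo + dep X \<le> dep t" "occ X sX" "inv_at i X sX" "sep f i X sX" using R'(1) by (auto simp: fres_def)
    define R2 where "R2 = R'(rWp := bs + 3 * lo)"
    have "3 * lo + 20 \<le> cap" using X(6) cap by linarith
    then have b: "bs + 3 * lo < 2 ^ w" "3 * lo < 2 ^ w" "lo < 2 ^ w" "(3::nat) < 2 ^ w" using lenw bs35 by linarith+
    have ps: "pst bs (take lo es) M" using es(4) by (auto simp: pst_def)
    have "wpb w dMid (PB th + 200) (\<lambda>s'. \<exists>a es'. fI0 True bs i th (if i < f then 1 else 0) M (Lf a, i, es') s') (R2, M)"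
      unfolding th_def by (rule dMid_wpb[OF es(2) _ _ X(7-9) es(1), of bs R2 "take lo es" True]) (use X R' ps in \<open>auto simp: R2_def\<close>)
    from wpb_frame[OF this] have W: "wpb w dMid (PB th + 200) (\<lambda>s'. \<exists>a es'. fI0 True bs i th (if i < f then 1 else 0) M (Lf a, i, es') s' \<and> fst s' rBase = bs) (R2, M)"
      by (rule wpb_mono) (use mods_dMid R'(3) in \<open>simp_all add: R2_def\<close>)
    have "wpb w (dMid ;; dFin) ((PB th + 200) + 50) (dI (Some i)) (R2, M)"
      by (rule wpb_Sq, rule wpb_mono[OF W order_refl]) (elim exE conjE, rule dFin_wpb')
    then show "wpb w (rWp ::= V rBase \<^bold>+ C 3 \<^bold>* V rLo) 20 (wpb w (dMid ;; dFin) ((PB th + 200) + 50) (dI (Some i))) (R', M)"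
      using b by (simp add: R2_def R' X)
  qed
  then have "wpb w ((dInit ;; dFind) ;; (rWp ::= V rBase \<^bold>+ C 3 \<^bold>* V rLo ;; dMid ;; dFin)) ((10 + (60 * fl (dep t + 1) + KS + 250)) + (20 + ((PB th + 200) + 50))) (dI (Some i)) (R(0 := i), M)"
    by (intro wpb_Sq[of w "dInit ;; dFind"] wpb_mono[OF es(5) order_refl]) blast
  from Sq_assoc[OF this] show ?thesis unfolding dMove_def th_def[symmetric] by (rule wpb_mono) (auto simp: Tm_def)
qed

theorem dyn_access:
  assumes "dI (Some f) (R, M)" "i < sz t"
  shows "wpb w dAcc (Tm (max T0 (finger_dist (Some f) i))) (\<lambda>s'. dI (Some f) s' \<and> fst s' 0 = yl t ! i) (R(0 := i), M)"
proof -
  obtain es where es: "f < sz t" "okM M" "fst_ok f es" "pst bs es M"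
   "wpb w (dInit ;; dFind) (10 + (60 * fl (dep t + 1) + KS + 250)) (\<lambda>s'. \<exists>R'. s' = (R', M) \<and> fres f i es R' \<and> R' rF = f \<and> R' rBase = bs \<and> R' rI = i \<and> R' rSp = length es) (R(0 := i), M)"
    using dSearch_phase[OF assms] by blast
  define th where "th = max T0 (finger_dist (Some f) i)"
  let ?P = "\<lambda>s'. dI (Some f) s' \<and> fst s' 0 = yl t ! i"
  have "wpb w (rWp ::= Ld (C 18) ;; dMid ;; 0 ::= Ld (V rA \<^bold>+ C 3)) (20 + ((PB th + 200) + 50)) ?P (R', M)"
    if R': "fres f i es R'" "R' rF = f" "R' rBase = bs" "R' rI = i" "R' rSp = length es" for R'
  proof (rule wpb_Sq)
    obtain X sX lo where X: "lo \<le> length es" "R' rA = ad X" "R' rS = sX" "R' rLo = lo" "okp True (take lo es) X sX"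
      "lo + dep X \<le> dep t" "occ X sX" "inv_at i X sX" "sep f i X sX" using R'(1) by (auto simp: fres_def)
    define R2 where "R2 = R'(rWp := bs + cap)"
    have "wpb w dMid (PB th + 200) (\<lambda>s'. \<exists>a es'. fI0 False (bs + cap) i th (if i < f then 1 else 0) M (Lf a, i, es') s') (R2, M)"
      unfolding th_def by (rule dMid_wpb[OF es(2) _ _ X(7-9) es(1), of "bs + cap" R2 "[]" False]) (use X R' in \<open>auto simp: R2_def pst_def okp_def\<close>)
    from wpb_frame[OF this] have W: "wpb w dMid (PB th + 200) (\<lambda>s'. \<exists>a es'. fI0 False (bs + cap) i th (if i < f then 1 else 0) M (Lf a, i, es') s' \<and> fst s' rF = f \<and> fst s' rSp = length es) (R2, M)"
      by (rule wpb_mono) (use mods_dMid R' in \<open>simp_all add: R2_def\<close>)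
    have "wpb w (dMid ;; 0 ::= Ld (V rA \<^bold>+ C 3)) ((PB th + 200) + 50) ?P (R2, M)"
    proof (rule wpb_Sq, rule wpb_mono[OF W order_refl], elim exE conjE)
      fix s' a es' assume a: "fI0 False (bs + cap) i th (if i < f then 1 else 0) M (Lf a, i, es') s'" "fst s' rF = f" "fst s' rSp = length es"
      obtain R3 M3 where s': "s' = (R3, M3)" by fastforce
      note D = fI0D[OF a(1)[unfolded s']]
      have "take (Suc 0) (drop i (yl t)) = [a]" using D(2) by (simp add: occ_def)
      then have ch: "a = yl t ! i" using D(4,16) by (simp add: take_Suc_conv_app_nth length_yl)
      have "M3 ! a = M ! a" if "a < bs + cap" for a using D(14) that by (auto simp: outs_def)
      moreover have "3 * length es + 3 \<le> cap" using fst_okD(2)[OF es(3)] cap by linarith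
      ultimately have "pst bs es M3" using es(4) by (auto simp: pst_def)
      then have "dI (Some f) (R3(0 := v), M3)" for v using D(1) es(1,3) a(2,3) by (auto simp: dI_def s')
      then show "wpb w (0 ::= Ld (V rA \<^bold>+ C 3)) 50 ?P s'" unfolding s' using lenw bs35 ad[OF D(15)] okM_len[OF D(1)]
        by (simp add: D(5) rec_ch[OF D(1) D(15)[unfolded ch]] ch)
    qed
    then show "wpb w (rWp ::= Ld (C 18)) 20 (wpb w (dMid ;; 0 ::= Ld (V rA \<^bold>+ C 3)) ((PB th + 200) + 50) ?P) (R', M)"
      using lenw bs35 rec_hdr[OF es(2)] okM_len[OF es(2)] by (simp add: R2_def)
  qed
  then have "wpb w ((dInit ;; dFind) ;; (rWp ::= Ld (C 18) ;; dMid ;; 0 ::= Ld (V rA \<^bold>+ C 3))) ((10 + (60 * fl (dep t + 1) + KS + 250)) + (20 + ((PB th + 200) + 50))) ?P (R(0 := i), M)"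
    by (intro wpb_Sq[of w "dInit ;; dFind"] wpb_mono[OF es(5) order_refl]) blast
  from Sq_assoc[OF this] show ?thesis unfolding dAcc_def th_def[symmetric] by (rule wpb_mono) (auto simp: Tm_def)
qed

end

section \<open>Building the memory\<close>

lemma leaf_char: "Lf a \<in> subs t \<Longrightarrow> a \<in> set (yl t)"
  by (induction t) auto

lemma bv_le: "bv d T \<le> sz T" by (cases T) (auto simp: near_def)

lemma thr_le: "dep T \<le> 50 * fl (sz T) \<Longrightarrow> thr T \<le> sz T"
proof -
  assume "dep T \<le> 50 * fl (sz T)"
  then have "(dep T + 49) div 50 \<le> fl (sz T)" by linarith
  then have "thr T \<le> 2 ^ fl (sz T)" unfolding thr_def by (intro power_increasing) auto
  also have "\<dots> \<le> sz T" using sz_ge1[of T] by (intro floor_log_exp2_le) simp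
  finally show ?thesis .
qed

definition node_rec :: "(tree \<Rightarrow> nat) \<Rightarrow> nat \<Rightarrow> tree \<Rightarrow> nat list" where
  "node_rec ad T0 T = 
    (let h = (\<lambda>d. if hD d T = 0 then 0 else ad (hc d T));
         j = (\<lambda>d. if hD d T = 0 then 0 else ad (hn d (hD d T - jm (hD d T)) T));
         g = (\<lambda>d. if gset T0 d T = {} then 0 else ad (hn d (Min (gset T0 d T)) T))
     in [sz T, case T of Lf a \<Rightarrow> 0 | Nd l r \<Rightarrow> ad l, case T of Lf a \<Rightarrow> 0 | Nd l r \<Rightarrow> ad r,
         case T of Lf a \<Rightarrow> a | Nd l r \<Rightarrow> 0, thr T, Off 0 T, Off 1 T, h 0, h 1, j 0, j 1, g 0, g 1, bv 0 T, bv 1 T])"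

lemma length_node_rec: "length (node_rec ad T0 T) = 15" by (simp add: node_rec_def Let_def)

text \<open>An arbitrary numbering \<open>h\<close> of the distinct subtrees determines the
  addresses of the records. All stored numbers are sizes, offsets, characters, addresses or
  thresholds, and each of these is bounded by the string, its characters or the memory.\<close>

lemma layout:
  assumes dp: "\<And>T. T \<in> subs t \<Longrightarrow> dep T \<le> 50 * fl (sz T)" and szw: "sz t < 2 ^ w" and ch: "\<And>a. a \<in> set (yl t) \<Longrightarrow> a < 2 ^ w"
    and bs: "bs = 20 + 15 * card (subs t)" and cap: "cap = 10 * dep t + 20" and w: "bs + 3 * cap < 2 ^ w"
    and T0: "T0 = fl (sz t) + 2" "T0 < sz t"
  shows "\<exists>ad M. dmem w t ad M bs cap T0 \<and> (\<forall>x\<in>set M. x < 2 ^ w)"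
proof -
  obtain h where h: "bij_betw h (subs t) {0..<card (subs t)}" using ex_bij_betw_finite_nat[OF finite_subs] by blast
  define ad where "ad T = 20 + 15 * h T" for T
  define hdr where "hdr x = (if x = 15 then ad t else if x = 16 then T0 else if x = 17 then bs else if x = 18 then bs + cap else if x = 19 then bs + 2 * cap else 0)" for x :: nat
  define g where "g x = (if x < 20 then hdr x else if x < bs then node_rec ad T0 (inv_into (subs t) h ((x - 20) div 15)) ! ((x - 20) mod 15) else 0)" for x
  define M where "M = map g [0..<bs + 3 * cap]"
  have tt: "t \<in> subs t" by (cases t) auto
  have hlt: "h T < card (subs t)" if "T \<in> subs t" for T using h that by (auto simp: bij_betw_def)
  have adb: "20 \<le> ad T \<and> ad T + 15 \<le> bs" if "T \<in> subs t" for T using hlt[OF that] by (simp add: ad_def bs)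
  have hinv: "inv_into (subs t) h (h T) = T" if "T \<in> subs t" for T using h that by (simp add: bij_betw_def inv_into_f_f)
  have nd: "M ! (ad T + j) = node_rec ad T0 T ! j" if "T \<in> subs t" "j < 15" for T j
  proof -
    have "ad T + j < bs" using adb[OF that(1)] that(2) by simp
    moreover have "(ad T + j - 20) div 15 = h T" "(ad T + j - 20) mod 15 = j" using that(2) by (simp_all add: ad_def)
    ultimately show ?thesis using hinv[OF that(1)] by (simp add: M_def g_def ad_def)
  qed
  have nd0: "M ! ad T = sz T" if "T \<in> subs t" for T using nd[OF that, of 0] by (simp add: node_rec_def Let_def)
  have hd: "M ! x = hdr x" if "x < 20" for x using that bs by (simp add: M_def g_def)
  have c1: "1 \<le> card (subs t)" using dep_card[of t] by linarith
  have d01: "d = 0 \<or> d = 1" if "d \<le> 1" for d :: nat using that by linarith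
  have D: "dmem w t ad M bs cap T0"
  proof (unfold_locales, goal_cases)
    case 1 show ?case by (simp add: M_def)
  next
    case 2 show ?case by (rule w)
  next
    case 3 show ?case using c1 bs by simp
  next
    case (4 T) then show ?case by (rule adb)
  next
    case (5 T) then show ?case by (rule nd0)
  next
    case (6 l r) then show ?case using nd[of "Nd l r" 1] by (simp add: node_rec_def Let_def)
  next
    case (7 l r) then show ?case using nd[of "Nd l r" 2] by (simp add: node_rec_def Let_def)
  next
    case (8 a) then show ?case using nd[of "Lf a" 1] by (simp add: node_rec_def Let_def)
  next
    case (9 a) then show ?case using nd[of "Lf a" 3] by (simp add: node_rec_def Let_def)
  next
    case (10 T) then show ?case using nd[of T 4] by (simp add: node_rec_def Let_def)
  next
    case 11 show ?case using hd[of 0] by (simp add: hdr_def)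
  next
    case 12 show ?case using hd[of 15] by (simp add: hdr_def)
  next
    case 13 show ?case using hd[of 17] by (simp add: hdr_def)
  next
    case 14 show ?case using hd[of 18] by (simp add: hdr_def)
  next
    case 15 show ?case using hd[of 19] by (simp add: hdr_def)
  next
    case 16 show ?case by (rule szw)
  next
    case (17 T) then show ?case by (rule dp)
  next
    case 18 show ?case by (simp add: cap)
  next
    case 19 show ?case by (rule T0)
  next
    case 20 show ?case by (rule T0)
  next
    case 21 show ?case using hd[of 16] by (simp add: hdr_def)
  next
    case (22 T d) then show ?case using d01[of d] nd[of T "5 + d"] by (auto simp: node_rec_def Let_def add.commute)
  next
    case (23 T d) then show ?case using d01[of d] nd[of T "7 + d"] by (auto simp: node_rec_def Let_def add.commute)
  next
    case (24 T d) then show ?case using d01[of d] nd[of T "9 + d"] by (auto simp: node_rec_def Let_def add.commute)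
  next
    case (25 T d) then show ?case using d01[of d] nd[of T "11 + d"] by (auto simp: node_rec_def Let_def add.commute split: if_splits)
  next
    case (26 T d) then show ?case using d01[of d] nd[of T "13 + d"] by (auto simp: node_rec_def Let_def add.commute)
  next
    case 27 show ?case using hd[of 5] by (simp add: hdr_def)
  next
    case 28 show ?case using hd[of 6] by (simp add: hdr_def)
  qed
  have adw: "ad T < 2 ^ w" if "T \<in> subs t" for T using adb[OF that] w by linarith
  have rw: "x < 2 ^ w" if T: "T \<in> subs t" and x: "x \<in> set (node_rec ad T0 T)" for T x
  proof -
    have z: "sz T < 2 ^ w" using sz_subs[OF T] szw by linarith
    have hs: "hn d k T \<in> subs t" for d k using hn_subs T subs_trans by blast
    then have hw: "ad (hn d k T) < 2 ^ w" for d k by (rule adw)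
    have "hc d T \<in> subs t" for d using hs[of 1 d] by simp
    then have hcw: "ad (hc d T) < 2 ^ w" for d by (rule adw)
    have cw: "T = Nd l r \<Longrightarrow> ad l < 2 ^ w \<and> ad r < 2 ^ w" for l r using T subs_trans[of "Nd l r" t] by (auto intro!: adw)
    have aw: "T = Lf a \<Longrightarrow> a < 2 ^ w" for a using leaf_char T ch by blast
    have o: "Off d T < 2 ^ w" "bv d T < 2 ^ w" "thr T < 2 ^ w" for d using Off_less[of d T] bv_le[of d T] thr_le[OF dp[OF T]] z by linarith+
    have c: "(case T of Lf a \<Rightarrow> 0 | Nd l r \<Rightarrow> ad l) < 2 ^ w" "(case T of Lf a \<Rightarrow> 0 | Nd l r \<Rightarrow> ad r) < 2 ^ w"
      "(case T of Lf a \<Rightarrow> a | Nd l r \<Rightarrow> 0) < 2 ^ w" using cw aw by (simp_all split: tree.split)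
    have "\<forall>x\<in>set (node_rec ad T0 T). x < 2 ^ w" by (simp add: node_rec_def Let_def c z hw hcw o)
    then show ?thesis using x by blast
  qed
  have hw: "hdr x < 2 ^ w" for x using adw[OF tt] T0(2) szw w by (auto simp: hdr_def)
  have "g x < 2 ^ w" for x
  proof -
    have "inv_into (subs t) h ((x - 20) div 15) \<in> subs t" if "20 \<le> x" "x < bs"
    proof (rule inv_into_into)
      have "(x - 20) div 15 < card (subs t)" using that bs by linarith
      then show "(x - 20) div 15 \<in> h ` subs t" using h by (auto simp: bij_betw_def)
    qed
    moreover have "node_rec ad T0 T ! ((x - 20) mod 15) \<in> set (node_rec ad T0 T)" for T by (rule nth_mem) (simp add: length_node_rec)
    ultimately show ?thesis using hw rw by (auto simp: g_def)
  qed
  then have "\<forall>x\<in>set M. x < 2 ^ w" by (auto simp: M_def)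
  then show ?thesis using D by blast
qed

lemma fl_le_log: "1 \<le> x \<Longrightarrow> real (fl x) \<le> log 2 (real x)"
proof -
  assume x: "1 \<le> x"
  then have "2 ^ fl x \<le> x" by (intro floor_log_exp2_le) simp
  then have "real (2 ^ fl x) \<le> real x" by (simp only: of_nat_le_iff)
  then have "2 powr real (fl x) \<le> real x" by (simp add: powr_realpow)
  then show ?thesis using x by (subst le_log_iff) auto
qed

lemma fl_lt: "8 \<le> n \<Longrightarrow> fl n + 2 < n"
proof -
  assume n: "8 \<le> n"
  have *: "k + 3 \<le> 2 ^ k" if "3 \<le> k" for k :: nat using that by (induction k rule: nat_induct_at_least) auto
  have "3 \<le> fl n" using n by (intro fl_ge) simp
  from *[OF this] have "fl n + 3 \<le> 2 ^ fl n" .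
  also have "\<dots> \<le> n" using n by (intro floor_log_exp2_le) simp
  finally show ?thesis by simp
qed

text \<open>A long string guarantees that all addresses fit into a word. With n rules the records
  take 15 * 17 n cells and the work areas, three times ten cells per level of depth at most 50 n,
  take 1500 n; 80 cells are additive. The sum stays below 2000 n.\<close>

lemma compressed_memory:
  assumes "represents G S" "length S < 2 ^ w" "\<forall>a\<in>set S. a < 2 ^ w" "2000 * slp_size G \<le> length S"
  shows "\<exists>t ad M bs cap T0. dmem w t ad M bs cap T0 \<and> yl t = S \<and> length M \<le> 2000 * slp_size G \<and> (\<forall>x\<in>set M. x < 2 ^ w)"
proof -
  define n where "n = slp_size G"
  obtain t0 where t0: "yl t0 = S" "card (subs t0) \<le> n" using parse_tree[OF assms(1)] by (auto simp: n_def)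
  obtain t where t: "yl t = S" "card (subs t) \<le> 17 * card (subs t0)" "\<And>u. u \<in> subs t \<Longrightarrow> real (dep u) \<le> 25 * lg2 (sz u)"
    using balanced_tree[of t0] t0 by auto
  have N: "sz t = length S" "sz t0 = length S" using length_yl[of t] length_yl[of t0] t(1) t0(1) by auto
  have dp: "dep T \<le> 50 * fl (sz T)" if "T \<in> subs t" for T
  proof (cases "sz T = 1")
    case True
    show ?thesis
    proof (cases T)
      case (Nd l r) then show ?thesis using True sz_ge1[of l] sz_ge1[of r] by simp
    qed simp
  next
    case False
    then have s2: "2 \<le> sz T" using sz_ge1[of T] by linarith
    have "sz T < 2 * 2 ^ fl (sz T)" by (rule floor_log_exp2_gt)
    then have "real (sz T) < real (2 ^ Suc (fl (sz T)))" by (simp only: of_nat_less_iff power_Suc)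
    then have "log 2 (real (sz T)) < real (Suc (fl (sz T)))" using s2 by (subst log_less_iff) (auto simp: powr_realpow powr_add)
    moreover have "1 \<le> fl (sz T)" using s2 by (rule fl_pos)
    \<comment> \<open>Rounding loses less than 1, so the constant 25 doubles once the rounded
      logarithm is positive; a single leaf has depth 0.\<close>
    ultimately have "lg2 (sz T) \<le> 2 * real (fl (sz T))" by linarith
    then show ?thesis using t(3)[OF that] by linarith
  qed
  have n1: "1 \<le> n" using dep_card[of t0] t0(2) by linarith
  \<comment> \<open>A DAG with \<open>n\<close> nodes derives at most 2^n characters. So log N, and
    with it the depth and the work areas, are linear in \<open>n\<close>.\<close>
  have fln: "fl (sz t) \<le> n"
  proof -
    have "sz t0 \<le> 2 ^ dep t0" by (rule sz_le_dep)
    also have "\<dots> \<le> 2 ^ n" using dep_card[of t0] t0(2) by (intro power_increasing) auto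
    finally show ?thesis using fl_mono[of "sz t0" "2 ^ n"] N by simp
  qed
  have tt: "t \<in> subs t" by (cases t) auto
  define bs where "bs = 20 + 15 * card (subs t)"
  define cap where "cap = 10 * dep t + 20"
  have "card (subs t) \<le> 17 * n" "dep t \<le> 50 * n" using t(2) t0(2) dp[OF tt] fln by linarith+
  moreover have "bs + 3 * cap = 80 + 15 * card (subs t) + 30 * dep t" by (simp add: bs_def cap_def)
  ultimately have len: "bs + 3 * cap < 2000 * n" using n1 by linarith
  have "8 \<le> sz t" using assms(4) n1 N unfolding n_def by linarith
  then have T0: "fl (sz t) + 2 < sz t" by (rule fl_lt)
  have lw: "bs + 3 * cap < 2 ^ w" using len assms(2,4) unfolding n_def by linarith
  obtain ad M where M: "dmem w t ad M bs cap (fl (sz t) + 2)" "\<forall>x\<in>set M. x < 2 ^ w"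
    using layout[OF dp _ _ bs_def cap_def lw refl T0] assms(2,3) t(1) N by auto
  have "length M = bs + 3 * cap" using M(1) by (simp add: dmem_def mem_def)
  then show ?thesis using M t(1) len unfolding n_def by (intro exI[of _ t] exI[of _ ad] exI[of _ M] exI[of _ bs] exI[of _ cap] exI[of _ "fl (sz t) + 2"]) simp
qed

section \<open>Time bounds\<close>

text \<open>Cell 0 is the flag that selects the representation, hence the shift by one.\<close>

fun direct_prog :: "finger_op \<Rightarrow> cmd" where
  "direct_prog Access = (0 ::= Ld (V 0 \<^bold>+ C 1))" | "direct_prog Setfinger = Skip" | "direct_prog Movefinger = Skip"

text \<open>The programs must not depend on the grammar, so the choice between the plain string and
  the compressed structure is made at run time by testing cell 0. For a string shorter than
  \<open>2000 * slp_size G\<close> the plain copy is within linear space.\<close>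

lemma solution_by_trees:
  assumes ok: "\<And>op. op \<in> Ops \<Longrightarrow> okC (cp op)" and T1: "\<And>op N D. op \<in> Ops \<Longrightarrow> 1 \<le> T op N D"
    and comp: "\<And>w t ad M0 bs cap T0. dmem w t ad M0 bs cap T0 \<Longrightarrow>
      \<exists>I. I None (\<lambda>_. 0, M0) \<and> (\<forall>p s. I p s \<longrightarrow> snd s \<noteq> [] \<and> snd s ! 0 = 0) \<and>
        (\<forall>R M p op i. I p (R, M) \<longrightarrow> op \<in> Ops \<longrightarrow> enabled op p \<longrightarrow> i < sz t \<longrightarrow>
          wp w (cp op) (\<lambda>k s'. real k \<le> real c * T op (sz t) (finger_dist p i) \<and> (op = Access \<longrightarrow> fst s' 0 = yl t ! i) \<and>
            I (new_finger op i p) s') (R(0 := i), M))"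
  shows "linear_space_solution Ops T"
  unfolding linear_space_solution_def
proof (rule exI, rule exI, intro allI impI, elim conjE)
  let ?Pc = "\<lambda>op. IfC (C 0 \<^bold>< Ld (C 0)) (direct_prog op) (cp op)"
  let ?c = "c + 2000"
  fix G S w assume a: "represents G S" "length S < 2 ^ w" "\<forall>a\<in>set S. a < 2 ^ w"
  have okd: "okC (?Pc op)" if "op \<in> Ops" for op using ok[OF that] by (cases op) auto
  show "\<exists>M. length M \<le> ?c * slp_size G \<and> (\<forall>x\<in>set M. x < 2 ^ w) \<and>
    supports w Ops (\<lambda>op. compC (?Pc op) 0) S M (\<lambda>op D. real ?c * T op (length S) D)"
  proof (cases "2000 * slp_size G \<le> length S")
    case True
    obtain t ad M bs cap T0 where t: "dmem w t ad M bs cap T0" "yl t = S" "length M \<le> 2000 * slp_size G" "\<forall>x\<in>set M. x < 2 ^ w"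
      using compressed_memory[OF a True] by blast
    have N: "sz t = length S" using length_yl[of t] t(2) by simp
    obtain I where I: "I None (\<lambda>_. 0, M)" "\<And>p s. I p s \<Longrightarrow> snd s \<noteq> [] \<and> snd s ! 0 = 0"
      "\<And>R M p op i. I p (R, M) \<Longrightarrow> op \<in> Ops \<Longrightarrow> enabled op p \<Longrightarrow> i < sz t \<Longrightarrow>
          wp w (cp op) (\<lambda>k s'. real k \<le> real c * T op (sz t) (finger_dist p i) \<and> (op = Access \<longrightarrow> fst s' 0 = yl t ! i) \<and>
            I (new_finger op i p) s') (R(0 := i), M)" using comp[OF t(1)] by blast
    have "supports w Ops (\<lambda>op. compC (?Pc op) 0) S M (\<lambda>op D. real ?c * T op (length S) D)"
    proof (rule supports_by_invariant[where I = I])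
      show "I None (\<lambda>_. 0, M)" by (rule I)
      show "okC (?Pc op)" if "op \<in> Ops" for op using okd[OF that] .
      fix R M' p op i assume b: "I p (R, M')" "op \<in> Ops" "enabled op p" "i < length S"
      have m: "M' \<noteq> []" "M' ! 0 = 0" using I(2)[OF b(1)] by auto
      have le: "real c * x + 10 \<le> real ?c * x" if "1 \<le> x" for x using that by (simp add: algebra_simps)
      have "wp w (cp op) (\<lambda>k s'. real (k + 5) \<le> real ?c * T op (length S) (finger_dist p i) \<and> (op = Access \<longrightarrow> fst s' 0 = S ! i) \<and>
            I (new_finger op i p) s') (R(0 := i), M')"
        by (rule wp_mono[OF I(3)[OF b(1-3) b(4)[folded N]]]) (use le[OF T1[OF b(2), of "length S" "finger_dist p i"]] t(2) N in auto)
      then show "wp w (?Pc op) (\<lambda>k s'. real k \<le> real ?c * T op (length S) (finger_dist p i) \<and> (op = Access \<longrightarrow> fst s' 0 = S ! i) \<and>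
            I (new_finger op i p) s') (R(0 := i), M')" using m by (simp add: numeral_eq_Suc)
    qed
    moreover have "2000 * slp_size G \<le> ?c * slp_size G" by (intro mult_le_mono1) simp
    then have "length M \<le> ?c * slp_size G" using t(3) by linarith
    ultimately show ?thesis using t(4) by (intro exI[of _ M] conjI)
  next
    case False
    have S1: "1 \<le> length S"
    proof -
      obtain t0 where "yl t0 = S" using parse_tree[OF a(1)] by blast
      then show ?thesis using length_yl[of t0] sz_ge1[of t0] by simp
    qed
    have w1: "(1::nat) < 2 ^ w" using S1 a(2) by linarith
    have "supports w Ops (\<lambda>op. compC (?Pc op) 0) S (1 # S) (\<lambda>op D. real ?c * T op (length S) D)"
    proof (rule supports_by_invariant[where I = "\<lambda>p s. snd s = 1 # S"])
      show "okC (?Pc op)" if "op \<in> Ops" for op using okd[OF that] .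
      fix R :: "nat \<Rightarrow> nat" and M' p op i assume b: "snd (R, M') = 1 # S" "op \<in> Ops" "enabled op p" "i < length S"
      have "20 * 1 \<le> real ?c * T op (length S) (finger_dist p i)" using T1[OF b(2), of "length S" "finger_dist p i"] by (intro mult_mono) auto
      then show "wp w (?Pc op) (\<lambda>k s'. real k \<le> real ?c * T op (length S) (finger_dist p i) \<and> (op = Access \<longrightarrow> fst s' 0 = S ! i) \<and>
            snd s' = 1 # S) (R(0 := i), M')" using b a(2) w1 by (cases op) auto
    qed simp
    moreover have "length (1 # S) \<le> ?c * slp_size G" using False by (simp add: add_mult_distrib)
    ultimately show ?thesis using a(3) w1 by (intro exI[of _ "1 # S"]) auto
  qed
qed

lemma lg_ge1: "1 \<le> lg x"
proof -
  have "log 2 2 \<le> log 2 (real x + 2)" by (subst log_le_cancel_iff) auto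
  then show ?thesis by (simp add: lg_def)
qed

lemma fl_lg: "x \<le> y + 2 \<Longrightarrow> real (fl x) \<le> lg y"
proof (cases "x = 0")
  case False
  assume "x \<le> y + 2"
  then have "log 2 (real x) \<le> log 2 (real y + 2)" using False by (subst log_le_cancel_iff) auto
  moreover have "real (fl x) \<le> log 2 (real x)" using False by (intro fl_le_log) simp
  ultimately show ?thesis unfolding lg_def by linarith
qed (use lg_ge1[of y] in simp)

lemma lglg_ge0: "0 \<le> lglg x" using lg_ge1[of x] by (simp add: lglg_def)

lemma fl_fl_lglg: "real (fl (fl x)) \<le> lglg x"
proof (cases "fl x = 0")
  case False
  then have "real (fl (fl x)) \<le> log 2 (real (fl x))" by (intro fl_le_log) simp
  also have "\<dots> \<le> log 2 (lg x)" using False fl_lg[of x x] lg_ge1[of x] by (subst log_le_cancel_iff) auto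
  finally show ?thesis by (simp add: lglg_def)
qed (use lglg_ge0[of x] in simp)

text \<open>Kept apart as linear arithmetic: the only product, that of rounds and pointer steps, is
  abstracted to \<open>W\<close>.\<close>

lemma Tm_arith:
  fixes W q l e D X :: nat
  assumes "W \<le> 120 * q + 400 * (l + 1)" "X = W + (300 * e + 400) + 150 * (50 * (2 * q + 2)) + 60 * e + (300 * e + 400) + 700"
    "q \<le> D + l + 3" "e \<le> l + 7"
  shows "X \<le> 20000 * (D + l) + 70000"
proof -
  have "X \<le> 15120 * q + 400 * l + 660 * e + 17300" using assms(1,2) by simp
  also have "\<dots> \<le> 15120 * (D + l + 3) + 400 * l + 660 * (l + 7) + 17300" using assms(3,4) by (intro add_mono mult_le_mono) auto
  also have "\<dots> \<le> 20000 * (D + l) + 70000" by simp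
  finally show ?thesis .
qed

context dmem begin

lemma Tm_bound: "Tm (max T0 D) \<le> 20000 * (fl D + fl (fl (sz t))) + 70000"
proof -
  define N where "N = sz t"
  define L where "L = fl N"
  define l where "l = fl L"
  define q where "q = fl (max T0 D)"
  define p where "p = fl T0"
  define e where "e = fl (dep t + 1)"
  have T0L: "T0 = L + 2" using T0 by (simp add: L_def N_def)
  have "2 \<le> N" using T0 by (simp add: N_def)
  then have L1: "1 \<le> L" unfolding L_def by (rule fl_pos)
  \<comment> \<open>Replacing \<open>D\<close> by \<open>max T0 D\<close> adds at most log
    \<open>T0\<close> to the logarithm, that is log log N up to a constant.\<close>
  have p: "p \<le> l + 3"
  proof -
    have "p \<le> fl (4 * L)" unfolding p_def T0L using L1 by (intro fl_mono) simp
    also have "\<dots> \<le> fl 4 + fl L + 1" by (rule fl_mult_le)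
    also have "fl 4 = 2" using fl_eqI[of 2 4] by simp
    finally show ?thesis by (simp add: l_def)
  qed
  have q: "q \<le> fl D + l + 3"
  proof -
    have "q \<le> fl D \<or> q \<le> p" unfolding q_def p_def by (auto simp: max_def)
    then show ?thesis using p by linarith
  qed
  have e: "e \<le> l + 7"
  proof -
    have "t \<in> subs t" by (cases t) auto
    then have "dep t \<le> 50 * L" using dep_le by (simp add: L_def N_def)
    then have "e \<le> fl (64 * L)" unfolding e_def using L1 by (intro fl_mono) simp
    also have "\<dots> \<le> fl 64 + fl L + 1" by (rule fl_mult_le)
    also have "fl 64 = 6" using fl_eqI[of 6 64] by simp
    finally show ?thesis by (simp add: l_def)
  qed
  have p1: "1 \<le> p" unfolding p_def using T0L by (intro fl_pos) simp
  have pl: "l \<le> p" unfolding l_def p_def T0L by (intro fl_mono) simp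
  have pq: "p \<le> q" unfolding p_def q_def by (intro fl_mono) simp
  \<comment> \<open>Rounds times pointer steps per round. Because \<open>T0\<close> exceeds log N,
    the number of rounds is at most \<open>2 * p\<close>, and \<open>fl_diff\<close> bounds the
    product by a multiple of the logarithm of the threshold.\<close>
  have U: "(fl q - fl p) * (l + 1) \<le> 4 * q"
  proof -
    have "(fl q - fl p) * (l + 1) \<le> (fl q - fl p) * (2 * p)" using p1 pl by (intro mult_le_mono2) linarith
    also have "\<dots> = 2 * (p * (fl q - fl p))" by simp
    also have "\<dots> \<le> 2 * (2 * q)" using fl_diff[OF p1 pq] by (intro mult_le_mono2)
    finally show ?thesis by simp
  qed
  define W where "W = Uc (max T0 D) * (l + 1)"
  have "W = 30 * ((fl q - fl p) * (l + 1)) + 400 * (l + 1)"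
    by (simp add: W_def Uc_def q_def p_def add_mult_distrib)
  then have "W \<le> 120 * q + 400 * (l + 1)" using U by linarith
  moreover have "Tm (max T0 D) = W + (300 * e + 400) + 150 * (50 * (2 * q + 2)) + 60 * e + (300 * e + 400) + 700"
    by (simp add: W_def Tm_def PB_def KS_def Dc_def q_def e_def l_def L_def N_def)
  ultimately have "Tm (max T0 D) \<le> 20000 * (fl D + l) + 70000" using q e by (rule Tm_arith)
  then show ?thesis by (simp add: l_def L_def N_def)
qed

lemma Tm_lg: "k \<le> Tm (max T0 D) \<Longrightarrow> real k \<le> 90000 * (lg D + lglg (sz t))"
proof -
  assume "k \<le> Tm (max T0 D)"
  then have "k \<le> 20000 * (fl D + fl (fl (sz t))) + 70000" using Tm_bound[of D] by linarith
  then have "real k \<le> real (20000 * (fl D + fl (fl (sz t))) + 70000)" by (simp only: of_nat_le_iff)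
  then have "real k \<le> 20000 * (real (fl D) + real (fl (fl (sz t)))) + 70000" by simp
  then show ?thesis using fl_lg[of D D, OF le_add1] fl_fl_lglg[of "sz t"] lg_ge1[of D] lglg_ge0[of "sz t"] unfolding distrib_left by linarith
qed

lemma dep_lg: "real (dep t) \<le> 50 * lg (sz t)"
proof -
  have "t \<in> subs t" by (cases t) auto
  then show ?thesis using dep_le[of t] fl_lg[of "sz t" "sz t"] by linarith
qed

lemma okM_nonempty: "okM M \<Longrightarrow> M \<noteq> [] \<and> M ! 0 = 0" using rec_hdr[of M] okM_len[of M] bs35 by auto

end

fun static_prog :: "finger_op \<Rightarrow> cmd" where
  "static_prog Setfinger = sSet" | "static_prog Access = sAcc" | "static_prog Movefinger = Skip"

fun dynamic_prog :: "finger_op \<Rightarrow> cmd" where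
  "dynamic_prog Setfinger = dSet" | "dynamic_prog Access = dAcc" | "dynamic_prog Movefinger = dMove"

lemma static_solution: "linear_space_solution {Setfinger, Access} static_time"
proof (rule solution_by_trees[where cp = static_prog and c = 51000])
  fix w t ad M0 bs cap T0 assume "dmem w t ad M0 bs cap T0"
  then interpret dmem w t ad M0 bs cap T0 .
  show "\<exists>I. I None (\<lambda>_. 0, M0) \<and> (\<forall>p s. I p s \<longrightarrow> snd s \<noteq> [] \<and> snd s ! 0 = 0) \<and>
        (\<forall>R M p op i. I p (R, M) \<longrightarrow> op \<in> {Setfinger, Access} \<longrightarrow> enabled op p \<longrightarrow> i < sz t \<longrightarrow>
          wp w (static_prog op) (\<lambda>k s'. real k \<le> real 51000 * static_time op (sz t) (finger_dist p i) \<and> (op = Access \<longrightarrow> fst s' 0 = yl t ! i) \<and>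
            I (new_finger op i p) s') (R(0 := i), M))"
  proof (intro exI[of _ sI] conjI allI impI)
    show "sI None (\<lambda>_. 0, M0)" using okM_M0 by (simp add: sI_def)
    show "snd s \<noteq> []" "snd s ! 0 = 0" if "sI p s" for p s using okM_nonempty[of "snd s"] that by (auto simp: sI_def)
    fix R :: "nat \<Rightarrow> nat" and M p op i assume b: "sI p (R, M)" "op \<in> {Setfinger, Access}" "enabled op p" "i < sz t"
    show "wp w (static_prog op) (\<lambda>k s'. real k \<le> real 51000 * static_time op (sz t) (finger_dist p i) \<and> (op = Access \<longrightarrow> fst s' 0 = yl t ! i) \<and>
            sI (new_finger op i p) s') (R(0 := i), M)"
    proof (cases op)
      case Setfinger
      show ?thesis unfolding Setfinger static_prog.simps
        by (rule wp_mono[OF static_set[OF b(1,4), unfolded wpb_def]]) (use dep_lg lg_ge1[of "sz t"] in auto)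
    next
      case Access
      then obtain f where f: "p = Some f" using b(3) by auto
      have l: "real (fl (finger_dist p i + 1)) \<le> lg (finger_dist p i)" by (rule fl_lg) simp
      show ?thesis unfolding Access static_prog.simps
        by (rule wp_mono[OF static_access[OF b(1)[unfolded f] b(4), unfolded wpb_def]])
          (use l lg_ge1[of "finger_dist p i"] f in \<open>auto simp del: finger_dist.simps\<close>)
    qed (use b in auto)
  qed
next
  fix op assume "op \<in> {Setfinger, Access}"
  then show "okC (static_prog op)" by (auto simp: sDesc_def sGBody_def sGreedy_def sPre_def sMid_def sHalf_def sSet_def sBin_def sWalk_def sAcc1_def sAcc2_def sAcc_def )
qed (use lg_ge1 in auto)

lemma dynamic_solution: "linear_space_solution {Setfinger, Movefinger, Access} dynamic_time"
proof (rule solution_by_trees[where cp = dynamic_prog and c = 90000])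
  fix w t ad M0 bs cap T0 assume "dmem w t ad M0 bs cap T0"
  then interpret dmem w t ad M0 bs cap T0 .
  show "\<exists>I. I None (\<lambda>_. 0, M0) \<and> (\<forall>p s. I p s \<longrightarrow> snd s \<noteq> [] \<and> snd s ! 0 = 0) \<and>
        (\<forall>R M p op i. I p (R, M) \<longrightarrow> op \<in> {Setfinger, Movefinger, Access} \<longrightarrow> enabled op p \<longrightarrow> i < sz t \<longrightarrow>
          wp w (dynamic_prog op) (\<lambda>k s'. real k \<le> real 90000 * dynamic_time op (sz t) (finger_dist p i) \<and> (op = Access \<longrightarrow> fst s' 0 = yl t ! i) \<and>
            I (new_finger op i p) s') (R(0 := i), M))"
  proof (intro exI[of _ dI] conjI allI impI)
    show "dI None (\<lambda>_. 0, M0)" using okM_M0 by (simp add: dI_def)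
    show "snd s \<noteq> []" "snd s ! 0 = 0" if "dI p s" for p s using okM_nonempty[of "snd s"] that by (auto simp: dI_def)
    fix R :: "nat \<Rightarrow> nat" and M p op i assume b: "dI p (R, M)" "op \<in> {Setfinger, Movefinger, Access}" "enabled op p" "i < sz t"
    show "wp w (dynamic_prog op) (\<lambda>k s'. real k \<le> real 90000 * dynamic_time op (sz t) (finger_dist p i) \<and> (op = Access \<longrightarrow> fst s' 0 = yl t ! i) \<and>
            dI (new_finger op i p) s') (R(0 := i), M)"
    proof (cases op)
      case Setfinger
      show ?thesis unfolding Setfinger dynamic_prog.simps
        by (rule wp_mono[OF dyn_set[OF b(1,4), unfolded wpb_def]]) (use dep_lg lg_ge1[of "sz t"] in auto)
    next
      case Movefinger
      then obtain f where f: "p = Some f" using b(3) by auto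
      show ?thesis unfolding Movefinger dynamic_prog.simps
        by (rule wp_mono[OF dyn_move[OF b(1)[unfolded f] b(4), unfolded wpb_def]])
          (use Tm_lg f in \<open>auto simp del: finger_dist.simps\<close>)
    next
      case Access
      then obtain f where f: "p = Some f" using b(3) by auto
      show ?thesis unfolding Access dynamic_prog.simps
        by (rule wp_mono[OF dyn_access[OF b(1)[unfolded f] b(4), unfolded wpb_def]])
          (use Tm_lg f in \<open>auto simp del: finger_dist.simps\<close>)
    qed
  qed
next
  fix op assume "op \<in> {Setfinger, Movefinger, Access}"
  then show "okC (dynamic_prog op)"
    by (auto simp: dSet_def dMove_def dAcc_def dInit_def dSet0_def dFin_def dFind_def dFBin_def dF2_def dF3_def dF4_def dMid_def dDir_def dFringe_def dFBody_def
      dB0_def dHop_def dHBody_def dB2_def dSearch_def dSBody_def dB3_def dStep'_def dStep_def dPush_def eIn_def)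
next
  fix op N D assume "op \<in> {Setfinger, Movefinger, Access}"
  then show "1 \<le> dynamic_time op N D" using lg_ge1[of N] lg_ge1[of D] lglg_ge0[of N] by auto
qed

theorem theorem1:
  "linear_space_solution {Setfinger, Access} static_time \<and>
   linear_space_solution {Setfinger, Movefinger, Access} dynamic_time"
  using static_solution dynamic_solution ..

end
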